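(* Let $\Gamma$, $(\mu_\alpha)$, $(\gamma_{i\alpha})$ and $H$ be as in the context, and let $v_T\in V$. If $f\in L^2(\Gamma\times(0,T))$, then the Hamilton-Jacobi boundary value problem $$\begin{cases}-\partial_tv-\mu_\alpha\partial^2v+H(x,\partial v)=f&\text{in }(\Gamma_\alpha\setminus\mathcal V)\times(0,T),\ \alpha\in\mathcal A,\\ v|_{\Gamma_\alpha}(\nu_i,t)=v|_{\Gamma_\beta}(\nu_i,t)& t\in(0,T),\ \alpha,\beta\in\mathcal A_i,\ \nu_i\in\mathcal V,\\ \sum_{\alpha\in\mathcal A_i}\gamma_{i\alpha}\mu_\alpha\partial_\alpha v(\nu_i,t)=0& t\in(0,T),\ \nu_i\in\mathcal V,\\ v(x,T)=v_T(x)& x\in\Gamma,\end{cases}$$ has a unique weak solution.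
   Context: **Network.** $\Gamma\subset\mathbb R^n$ is a bounded network: a connected set that is a finite union of bounded closed straight segments (edges) $\Gamma_\alpha$, $\alpha\in\mathcal A$, of length $\ell_\alpha$, which meet only at endpoints (vertices) $\nu_i$, $i\in I$ ($I,\mathcal A\subset\mathbb N$ finite); for $\alpha\ne\beta$, $\Gamma_\alpha\cap\Gamma_\beta$ is empty or a single vertex. $\mathcal V=\{\nu_i\}_{i\in I}$, $\mathcal A_i=\{\alpha\in\mathcal A:\nu_i\in\Gamma_\alpha\}$. An edge joining $\nu_i$ and $\nu_j$, $i<j$, is parametrized by arc length by $\pi_\alpha:[0,\ell_\alpha]\to\Gamma_\alpha$, $\pi_\alpha(y)=\ell_\alpha^{-1}((\ell_\alpha-y)\nu_i+y\nu_j)$. For $v:\Gamma\to\mathbb R$, $v_\alpha=v\circ\pi_\alpha$ on $(0,\ell_\alpha)$, extended by continuity to $[0,\ell_\alpha]$ when possible; $v|_{\Gamma_\alpha}$ is the corresponding function on $\Gamma_\alpha$ (endpoint values are limits from inside $\Gamma_\alpha$). $\partial^kv(x)=\partial^kv_\alpha(\pi_\alpha^{-1}(x))$ for $x\in\Gamma_\alpha\setminus\mathcal V$. $n_{i\alpha}=1$ if $\nu_i=\pi_\alpha(\ell_\alpha)$, $n_{i\alpha}=-1$ if $\nu_i=\pi_\alpha(0)$; $\partial_\alpha v(\nu_i)=n_{i\alpha}\,\partial v|_{\Gamma_\alpha}(\nu_i)$ (outward derivative). $\int_\Gamma v\,dx=\sum_\alpha\int_0^{\ell_\alpha}v_\alpha\,dy$.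 **Spaces.** $L^2(\Gamma)$ is defined edgewise; $H^s_b(\Gamma)=\{v: v_\alpha\in H^s(0,\ell_\alpha)\ \forall\alpha\}$ with the natural norm; $H^s(\Gamma)=C(\Gamma)\cap H^s_b(\Gamma)$; $V=H^1(\Gamma)$; $W=\{w\in H^1_b(\Gamma): w|_{\Gamma_\alpha}(\nu_i)/\gamma_{i\alpha}=w|_{\Gamma_\beta}(\nu_i)/\gamma_{i\beta}\ \forall i\in I,\ \alpha,\beta\in\mathcal A_i\}$. **Assumptions.** $T>0$; $\mu_\alpha>0$; $\gamma_{i\alpha}>0$ with $\sum_{\alpha\in\mathcal A_i}\gamma_{i\alpha}\mu_\alpha=1$ for all $i\in I$; $\mu$ denotes the function equal to $\mu_\alpha$ on $\Gamma_\alpha$. $H$ is given by the collection $H^\alpha=H|_{\Gamma_\alpha\times\mathbb R}$ with $H^\alpha\in C^1(\Gamma_\alpha\times\mathbb R)$, $H^\alpha(x,\cdot)$ convex, and, for a constant $C_0$ independent of $\alpha$ and all $(x,p)\in\Gamma_\alpha\times\mathbb R$: $H^\alpha(x,p)\le C_0(|p|+1)$, $|\partial_pH^\alpha(x,p)|\le C_0$, $|\partial_xH^\alpha(x,p)|\le C_0(|p|+1)$. **Weak solution.** A function $v\in L^2(0,T;H^2(\Gamma))\cap C([0,T];V)$ with $\partial_tv\in L^2(\Gamma\times(0,T))$, $v(\cdot,T)=v_T$, and $\int_\Gamma(-\partial_tv\,w+\mu\,\partial v\,\partial w+H(x,\partial v)w)dx=\int_\Gamma fw\,dx$ for all $w\in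 W$ and a.e. $t\in(0,T)$. *)

theory Defs
  imports "HOL-Analysis.Analysis"
begin

section \<open>Networks\<close>

record 'a network =
  verts :: "nat set"
  edges :: "nat set"
  pos   :: "nat \<Rightarrow> 'a"
  tail  :: "nat \<Rightarrow> nat"
  head  :: "nat \<Rightarrow> nat"

definition edge :: "'a::euclidean_space network \<Rightarrow> nat \<Rightarrow> 'a set" where
  "edge G \<alpha> = closed_segment (pos G (tail G \<alpha>)) (pos G (head G \<alpha>))"

definition len :: "'a::euclidean_space network \<Rightarrow> nat \<Rightarrow> real" where
  "len G \<alpha> = dist (pos G (tail G \<alpha>)) (pos G (head G \<alpha>))"

definition points :: "'a::euclidean_space network \<Rightarrow> 'a set" where
  "points G = (\<Union>\<alpha>\<in>edges G. edge G \<alpha>)"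

text \<open>Two distinct edges that intersect do so in one vertex which is an endpoint of both, so no
  vertex lies in the relative interior of an edge.\<close>

definition is_network :: "'a::euclidean_space network \<Rightarrow> bool" where
  "is_network G \<longleftrightarrow>
     finite (verts G) \<and> finite (edges G) \<and> inj_on (pos G) (verts G) \<and>
     verts G = tail G ` edges G \<union> head G ` edges G \<and>
     (\<forall>\<alpha>\<in>edges G. tail G \<alpha> < head G \<alpha>) \<and>
     (\<forall>\<alpha>\<in>edges G. \<forall>\<beta>\<in>edges G. \<alpha> \<noteq> \<beta> \<longrightarrow>
        edge G \<alpha> \<inter> edge G \<beta> = {} \<or>
        (\<exists>i \<in> {tail G \<alpha>, head G \<alpha>} \<inter> {tail G \<beta>, head G \<beta>}.
           edge G \<alpha> \<inter> edge G \<beta> = {pos G i})) \<and>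
     connected (points G)"

definition edges_at :: "'a::euclidean_space network \<Rightarrow> nat \<Rightarrow> nat set" where
  "edges_at G i = {\<alpha> \<in> edges G. pos G i \<in> edge G \<alpha>}"

definition arc :: "'a::euclidean_space network \<Rightarrow> nat \<Rightarrow> real \<Rightarrow> 'a" where
  "arc G \<alpha> y = (1 / len G \<alpha>) *\<^sub>R
     ((len G \<alpha> - y) *\<^sub>R pos G (tail G \<alpha>) + y *\<^sub>R pos G (head G \<alpha>))"

definition on_edge :: "'a::euclidean_space network \<Rightarrow> nat \<Rightarrow> ('a \<Rightarrow> real) \<Rightarrow> real \<Rightarrow> real" where
  "on_edge G \<alpha> v = (\<lambda>y. v (arc G \<alpha> y))"

text \<open>Integrands on the network are given edgewise in arc length, as families indexed by edges.\<close>

definition net_integral :: "'a::euclidean_space network \<Rightarrow> (nat \<Rightarrow> real \<Rightarrow> real) \<Rightarrow> real" where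
  "net_integral G F = (\<Sum>\<alpha>\<in>edges G. LINT y|lebesgue_on {0<..<len G \<alpha>}. F \<alpha> y)"


section \<open>Square integrable functions and weak derivatives\<close>

definition L2_on :: "'b::euclidean_space set \<Rightarrow> ('b \<Rightarrow> real) \<Rightarrow> bool" where
  "L2_on S u \<longleftrightarrow> u \<in> borel_measurable (lebesgue_on S) \<and>
     integrable (lebesgue_on S) (\<lambda>z. (u z)\<^sup>2)"

primrec Ck_fun :: "nat \<Rightarrow> ('b::euclidean_space \<Rightarrow> real) \<Rightarrow> bool" where
  "Ck_fun 0 \<phi> \<longleftrightarrow> continuous_on UNIV \<phi>"
| "Ck_fun (Suc k) \<phi> \<longleftrightarrow> (\<forall>z. \<phi> differentiable at z) \<and>
     (\<forall>b\<in>Basis. Ck_fun k (\<lambda>z. frechet_derivative \<phi> (at z) b))"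

definition test_fun :: "'b::euclidean_space set \<Rightarrow> ('b \<Rightarrow> real) \<Rightarrow> bool" where
  "test_fun S \<phi> \<longleftrightarrow> (\<forall>k. Ck_fun k \<phi>) \<and> (\<exists>K. compact K \<and> K \<subseteq> S \<and> (\<forall>z. z \<notin> K \<longrightarrow> \<phi> z = 0))"

text \<open>\<open>g\<close> is the distributional derivative of \<open>u\<close> on the open set \<open>S\<close> in the
  direction \<open>b\<close>, both being square integrable.\<close>

definition has_weak_deriv ::
  "'b::euclidean_space set \<Rightarrow> 'b \<Rightarrow> ('b \<Rightarrow> real) \<Rightarrow> ('b \<Rightarrow> real) \<Rightarrow> bool" where
  "has_weak_deriv S b u g \<longleftrightarrow> L2_on S u \<and> L2_on S g \<and>
     (\<forall>\<phi>. test_fun S \<phi> \<longrightarrow>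
        (LINT z|lebesgue_on S. u z * frechet_derivative \<phi> (at z) b) =
        - (LINT z|lebesgue_on S. g z * \<phi> z))"


section \<open>Sobolev spaces\<close>

text \<open>\<open>sobolev s l\<close> is \<open>H\<^sup>s(0,l)\<close>; its elements are functions considered up to null sets.\<close>

primrec sobolev :: "nat \<Rightarrow> real \<Rightarrow> (real \<Rightarrow> real) \<Rightarrow> bool" where
  "sobolev 0 l u \<longleftrightarrow> L2_on {0<..<l} u"
| "sobolev (Suc s) l u \<longleftrightarrow> (\<exists>g. has_weak_deriv {0<..<l} 1 u g \<and> sobolev s l g)"

text \<open>A representative of the weak derivative on \<open>(0,l)\<close>, which is unique up to null sets.\<close>

definition weak_deriv :: "real \<Rightarrow> (real \<Rightarrow> real) \<Rightarrow> real \<Rightarrow> real" where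
  "weak_deriv l u = (SOME g. has_weak_deriv {0<..<l} 1 u g)"

definition edge_deriv :: "'a::euclidean_space network \<Rightarrow> nat \<Rightarrow> ('a \<Rightarrow> real) \<Rightarrow> real \<Rightarrow> real" where
  "edge_deriv G \<alpha> v = weak_deriv (len G \<alpha>) (on_edge G \<alpha> v)"

definition Hb :: "'a::euclidean_space network \<Rightarrow> nat \<Rightarrow> ('a \<Rightarrow> real) set" where
  "Hb G s = {v. \<forall>\<alpha>\<in>edges G. sobolev s (len G \<alpha>) (on_edge G \<alpha> v)}"

definition Hb_norm :: "'a::euclidean_space network \<Rightarrow> nat \<Rightarrow> ('a \<Rightarrow> real) \<Rightarrow> real" where
  "Hb_norm G s v = sqrt (\<Sum>k\<le>s. net_integral G
     (\<lambda>\<alpha> y. ((weak_deriv (len G \<alpha>) ^^ k) (on_edge G \<alpha> v) y)\<^sup>2))"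

definition Hs :: "'a::euclidean_space network \<Rightarrow> nat \<Rightarrow> ('a \<Rightarrow> real) set" where
  "Hs G s = {v. continuous_on (points G) v} \<inter> Hb G s"

abbreviation V_space :: "'a::euclidean_space network \<Rightarrow> ('a \<Rightarrow> real) set" where
  "V_space G \<equiv> Hs G 1"

text \<open>The value at the vertex \<open>i\<close> of the restriction of \<open>v\<close> to the edge \<open>\<alpha>\<close>,
  i.e. the limit from inside the edge.  As \<open>v\<close> is only determined up to null sets, it is read
  off the continuous representative on \<open>[0, len G \<alpha>]\<close>, which exists for \<open>v \<in> Hb G 1\<close>.\<close>

definition vertex_val :: "'a::euclidean_space network \<Rightarrow> nat \<Rightarrow> ('a \<Rightarrow> real) \<Rightarrow> nat \<Rightarrow> real" where
  "vertex_val G \<alpha> v i = (THE c. \<exists>u. continuous_on {0..len G \<alpha>} u \<and>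
     (AE y in lebesgue_on {0<..<len G \<alpha>}. on_edge G \<alpha> v y = u y) \<and>
     c = u (if i = tail G \<alpha> then 0 else len G \<alpha>))"

definition W_space ::
  "'a::euclidean_space network \<Rightarrow> (nat \<Rightarrow> nat \<Rightarrow> real) \<Rightarrow> ('a \<Rightarrow> real) set" where
  "W_space G \<gamma> = {w \<in> Hb G 1. \<forall>i\<in>verts G. \<forall>\<alpha>\<in>edges_at G i. \<forall>\<beta>\<in>edges_at G i.
     vertex_val G \<alpha> w i / \<gamma> i \<alpha> = vertex_val G \<beta> w i / \<gamma> i \<beta>}"


section \<open>Spaces of time-dependent functions\<close>

text \<open>Time-dependent functions take the time as first argument: \<open>v t x\<close> is \<open>v(x,t)\<close>.
  The spaces \<open>L\<^sup>2(0,T;X)\<close> and \<open>C([0,T];X)\<close> are taken for a linear space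
  \<open>X\<close> of functions with norm \<open>N\<close>.\<close>

definition strongly_measurable ::
  "real \<Rightarrow> ('a \<Rightarrow> real) set \<Rightarrow> (('a \<Rightarrow> real) \<Rightarrow> real) \<Rightarrow> (real \<Rightarrow> 'a \<Rightarrow> real) \<Rightarrow> bool" where
  "strongly_measurable T X N v \<longleftrightarrow>
     (\<exists>s :: nat \<Rightarrow> real \<Rightarrow> 'a \<Rightarrow> real.
        (\<forall>n. finite (s n ` {0<..<T}) \<and> s n ` {0<..<T} \<subseteq> X \<and>
             (\<forall>z. {t \<in> {0<..<T}. s n t = z} \<in> sets lebesgue)) \<and>
        (AE t in lebesgue_on {0<..<T}. (\<lambda>n. N (\<lambda>x. s n t x - v t x)) \<longlonglongrightarrow> 0))"

definition L2_time ::
  "real \<Rightarrow> ('a \<Rightarrow> real) set \<Rightarrow> (('a \<Rightarrow> real) \<Rightarrow> real) \<Rightarrow> (real \<Rightarrow> 'a \<Rightarrow> real) \<Rightarrow> bool" where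
  "L2_time T X N v \<longleftrightarrow>
     (AE t in lebesgue_on {0<..<T}. v t \<in> X) \<and> strongly_measurable T X N v \<and>
     integrable (lebesgue_on {0<..<T}) (\<lambda>t. (N (v t))\<^sup>2)"

definition C_time ::
  "real \<Rightarrow> ('a \<Rightarrow> real) set \<Rightarrow> (('a \<Rightarrow> real) \<Rightarrow> real) \<Rightarrow> (real \<Rightarrow> 'a \<Rightarrow> real) \<Rightarrow> bool" where
  "C_time T X N v \<longleftrightarrow> (\<forall>t\<in>{0..T}. v t \<in> X \<and>
     ((\<lambda>\<tau>. N (\<lambda>x. v \<tau> x - v t x)) \<longlongrightarrow> 0) (at t within {0..T}))"

definition cylinder :: "'a::euclidean_space network \<Rightarrow> real \<Rightarrow> nat \<Rightarrow> (real \<times> real) set" where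
  "cylinder G T \<alpha> = {0<..<len G \<alpha>} \<times> {0<..<T}"

definition L2_cyl :: "'a::euclidean_space network \<Rightarrow> real \<Rightarrow> (real \<Rightarrow> 'a \<Rightarrow> real) \<Rightarrow> bool" where
  "L2_cyl G T f \<longleftrightarrow>
     (\<forall>\<alpha>\<in>edges G. L2_on (cylinder G T \<alpha>) (\<lambda>(y,t). on_edge G \<alpha> (f t) y))"

definition has_time_deriv :: "'a::euclidean_space network \<Rightarrow> real \<Rightarrow>
    (real \<Rightarrow> 'a \<Rightarrow> real) \<Rightarrow> (real \<Rightarrow> 'a \<Rightarrow> real) \<Rightarrow> bool" where
  "has_time_deriv G T v v' \<longleftrightarrow>
     (\<forall>\<alpha>\<in>edges G. has_weak_deriv (cylinder G T \<alpha>) (0, 1)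
        (\<lambda>(y,t). on_edge G \<alpha> (v t) y) (\<lambda>(y,t). on_edge G \<alpha> (v' t) y))"


section \<open>The Hamiltonian and weak solutions\<close>

text \<open>\<open>H \<alpha> x p\<close> is \<open>H\<^sup>\<alpha>(x,p)\<close>.  Regularity in \<open>x\<close> is expressed in the arc
  length parameter, up to the endpoints; \<open>Hx\<close> and \<open>Hp\<close> are the partial derivatives.\<close>

definition hamiltonian ::
  "'a::euclidean_space network \<Rightarrow> (nat \<Rightarrow> 'a \<Rightarrow> real \<Rightarrow> real) \<Rightarrow> bool" where
  "hamiltonian G H \<longleftrightarrow> (\<exists>C\<^sub>0. \<forall>\<alpha>\<in>edges G.
     (\<forall>x\<in>edge G \<alpha>. convex_on UNIV (H \<alpha> x)) \<and>
     (\<forall>x\<in>edge G \<alpha>. \<forall>p. H \<alpha> x p \<le> C\<^sub>0 * (\<bar>p\<bar> + 1)) \<and>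
     (\<exists>Hx Hp :: real \<times> real \<Rightarrow> real.
        continuous_on ({0..len G \<alpha>} \<times> UNIV) Hx \<and> continuous_on ({0..len G \<alpha>} \<times> UNIV) Hp \<and>
        (\<forall>y\<in>{0..len G \<alpha>}. \<forall>p.
           ((\<lambda>(y,p). H \<alpha> (arc G \<alpha> y) p) has_derivative
              (\<lambda>(dy,dp). Hx (y,p) * dy + Hp (y,p) * dp)) (at (y,p) within {0..len G \<alpha>} \<times> UNIV) \<and>
           \<bar>Hp (y,p)\<bar> \<le> C\<^sub>0 \<and> \<bar>Hx (y,p)\<bar> \<le> C\<^sub>0 * (\<bar>p\<bar> + 1))))"

text \<open>The space \<open>C([0,T];V)\<close> fixes \<open>v t x\<close> for every \<open>t \<in> [0,T]\<close> and every point \<open>x\<close>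
  of the network.  The transmission conditions of the boundary value problem are encoded in
  the continuity of \<open>v t\<close> and in the choice of the test space \<open>W\<close>.\<close>

definition weak_solution :: "'a::euclidean_space network \<Rightarrow> (nat \<Rightarrow> real) \<Rightarrow>
    (nat \<Rightarrow> nat \<Rightarrow> real) \<Rightarrow> (nat \<Rightarrow> 'a \<Rightarrow> real \<Rightarrow> real) \<Rightarrow> real \<Rightarrow> (real \<Rightarrow> 'a \<Rightarrow> real) \<Rightarrow>
    ('a \<Rightarrow> real) \<Rightarrow> (real \<Rightarrow> 'a \<Rightarrow> real) \<Rightarrow> bool" where
  "weak_solution G \<mu> \<gamma> H T f vT v \<longleftrightarrow>
     L2_time T (Hs G 2) (Hb_norm G 2) v \<and>
     C_time T (V_space G) (Hb_norm G 1) v \<and>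
     (\<forall>x\<in>points G. v T x = vT x) \<and>
     (\<exists>v'. has_time_deriv G T v v' \<and>
        (\<forall>w\<in>W_space G \<gamma>. AE t in lebesgue_on {0<..<T}.
           net_integral G (\<lambda>\<alpha> y.
               - on_edge G \<alpha> (v' t) y * on_edge G \<alpha> w y
               + \<mu> \<alpha> * edge_deriv G \<alpha> (v t) y * edge_deriv G \<alpha> w y
               + H \<alpha> (arc G \<alpha> y) (edge_deriv G \<alpha> (v t) y) * on_edge G \<alpha> w y)
           = net_integral G (\<lambda>\<alpha> y. on_edge G \<alpha> (f t) y * on_edge G \<alpha> w y)))"

end

theory Submission
 imports Defs "HOL-Complex_Analysis.Great_Picard"
begin

text \<open>On each edge let \<open>\<psi>\<close> be the affine function with the values \<open>\<gamma>\<close> at the ends. Writing test functions as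
 \<open>w = \<psi> \<phi>\<close> identifies \<open>W\<close> with \<open>V\<close> and turns the problem into \<open>- v\<^sub>t + A v = f - F(x, v, v\<^sub>x)\<close>, where \<open>A\<close> belongs to the
 symmetric form \<open>Q(v, \<phi>) = \<integral> (v \<phi> + \<mu> v\<^sub>x \<phi>\<^sub>x) \<psi> dx\<close> and \<open>F\<close> is Lipschitz in \<open>(v, v\<^sub>x)\<close> because \<open>H\<close> has bounded slope.
 The form has compact resolvent, so in an eigenbasis the equation with right-hand side \<open>g\<close> decouples into
 \<open>c' = \<lambda> c - h\<close>, and the energy identity
 \<open>\<lambda> c(t)\<^sup>2 + \<integral>\<^sub>t\<^sup>T (c'\<^sup>2 + \<lambda>\<^sup>2 c\<^sup>2) = \<lambda> c(T)\<^sup>2 + \<integral>\<^sub>t\<^sup>T h\<^sup>2\<close> gives every estimate: the Picard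
 iteration for \<open>g\<close> converges in \<open>L\<^sup>2\<close> of space-time, elliptic regularity puts the solution into \<open>H\<^sup>2\<close>, and the
 difference \<open>z\<close> of two solutions satisfies \<open>Q(z(t), z(t)) \<le> K \<integral>\<^sub>t\<^sup>T Q(z, z)\<close>, hence vanishes.\<close>

text \<open>Test functions in \<open>W\<close> jump at the vertices while the solution is
  continuous, so the form of the equation is not symmetric as it stands. The jumps have prescribed
  ratios \<gamma>, and dividing by \<psi> removes them; the price is a drift
  \<open>\<mu> * \<psi>' * v_x * \<phi>\<close>, which is of first order and joins \<open>F\<close>,
  as does the \<open>- v\<close> that pays for the zeroth order term making the form coercive. The
  solution spaces are demanding pointwise: \<open>v t x\<close> is fixed at every time and point,
  derivatives are arbitrary representatives, and strong measurability asks for finitely valued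
  approximations. Fourier series answer all of this: they give an element of \<open>V\<close> for
  every \<open>t\<close>, and truncations with rounded coefficients take finitely many values. The
  Lipschitz estimate at time \<open>t\<close> sees only \<open>[t,T]\<close>, so a weight exp(4 K (T
  - t)) makes the iteration contract for any \<open>T\<close>. For uniqueness, a given solution only
  has a weak time derivative on each cylinder; its continuity in \<open>V\<close> is what identifies
  its Fourier coefficients with absolutely continuous functions that obey the mode
  equations.\<close>

abbreviation (input) pm (infixr "><" 80) where "M >< N \<equiv> pair_measure M N"

abbreviation (input) lims (infixr "~~>" 60) where "X ~~> L \<equiv> LIMSEQ X L"

abbreviation BM :: "('a::topological_space => 'b::topological_space) set" where "BM \<equiv> borel_measurable borel"

text \<open>Evaluate at the minimum \<open>t = - B / C\<close>; for \<open>C = 0\<close>, which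
  seminorms can produce, a nonconstant affine function would become negative. Besides
  Cauchy-Schwarz, the case \<open>A = 0\<close> serves as the first variation of a minimisation
  problem.\<close>

lemma discriminant_bound:
 fixes A B C :: real
 assumes "\<And>t. 0 <= A + 2 * t * B + t^2 * C" "0 <= C"
 shows "B^2 <= A * C"
proof (cases "C = 0")
 case True
 have "B = 0"
 proof (rule ccontr)
  assume "B \<noteq> 0"
  have "0 <= A + 2 * (- (A + 1) / (2 * B)) * B"
   using assms(1)[of "- (A + 1) / (2 * B)"] True by simp
  also have "... = -1" using \<open>B \<noteq> 0\<close> by (simp add: field_simps)
  finally show False by simp
 qed
 then show ?thesis using True by simp
next
 case False
 then have "C > 0" using assms(2) by simp
 have "0 <= A + 2 * (- B / C) * B + (- B / C)^2 * C" by (rule assms(1))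
 also have "... = A - B^2 / C" using \<open>C > 0\<close> by (simp add: field_simps power2_eq_square)
 finally show ?thesis using \<open>C > 0\<close> by (simp add: field_simps)
qed

section \<open>Square integrable functions\<close>

definition L2 :: "'x measure => ('x => real) => bool" where
 "L2 M f \<longleftrightarrow> f \<in> borel_measurable M & integrable M (%x. (f x)^2)"

lemma L2_measurable[measurable_dest]: "L2 M f ==> f \<in> borel_measurable M"
 by (simp add: L2_def)

lemma L2_square: "L2 M f ==> integrable M (%x. (f x)^2)"
 by (simp add: L2_def)

lemma abs_mult_le_squares: "\<bar>a * b\<bar> <= a^2 + (b::real)^2"
proof -
 have "0 <= (\<bar>a\<bar> - \<bar>b\<bar>)^2" by simp
 then have "2 * (\<bar>a\<bar> * \<bar>b\<bar>) <= a^2 + b^2" by (simp add: power2_diff)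
 moreover have "0 <= \<bar>a\<bar> * \<bar>b\<bar>" by simp
 ultimately show ?thesis unfolding abs_mult by linarith
qed

lemma square_sum_le: "(a + b)^2 <= 2 * a^2 + 2 * (b::real)^2"
 using sum_squares_ge_zero[of "a - b" 0] by (simp add: power2_eq_square algebra_simps)

lemma square_diff_le: "(a - b)^2 <= 2 * a^2 + 2 * (b::real)^2"
 using square_sum_le[of a "-b"] by simp

lemma L2_mult: assumes "L2 M f" "L2 M g" shows "integrable M (%x. f x * g x)"
proof (rule Bochner_Integration.integrable_bound)
 show "integrable M (%x. (f x)^2 + (g x)^2)" using assms by (simp add: L2_def)
 show "(%x. f x * g x) \<in> borel_measurable M" using assms by (auto simp: L2_def)
 show "AE x in M. norm (f x * g x) <= norm ((f x)^2 + (g x)^2)"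
 proof (rule AE_I2)
  fix x show "norm (f x * g x) <= norm ((f x)^2 + (g x)^2)"
   using abs_mult_le_squares[of "f x" "g x"] by simp
 qed
qed

lemma L2_add: assumes "L2 M f" "L2 M g" shows "L2 M (%x. f x + g x)"
 using assms L2_mult[OF assms] unfolding L2_def
 by (auto simp: power2_sum mult.assoc)

lemma L2_cmult: "L2 M f ==> L2 M (%x. c * f x)"
 by (auto simp: L2_def power_mult_distrib)

lemma L2_diff: assumes "L2 M f" "L2 M g" shows "L2 M (%x. f x - g x)"
 using L2_add[OF assms(1) L2_cmult[OF assms(2), of "-1"]] by simp

lemma L2_zero: "L2 M (%x. 0)" by (simp add: L2_def)

lemma L2_sum: "(\<And>i. i \<in> I ==> L2 M (f i)) ==> L2 M (%x. \<Sum>i\<in>I. f i x)"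
 by (induction I rule: infinite_finite_induct) (auto simp: L2_zero L2_add)

lemma L2_bound:
 assumes "L2 M g" "f \<in> borel_measurable M" "AE x in M. \<bar>f x\<bar> <= C * \<bar>g x\<bar>"
 shows "L2 M f"
 unfolding L2_def
proof (intro conjI)
 show "integrable M (%x. (f x)^2)"
 proof (rule Bochner_Integration.integrable_bound)
  show "integrable M (%x. C^2 * (g x)^2)" using assms(1) by (simp add: L2_def)
  show "AE x in M. norm ((f x)^2) <= norm (C^2 * (g x)^2)"
   using assms(3)
  proof eventually_elim
   case (elim x)
   then have "\<bar>f x\<bar>^2 <= (C * \<bar>g x\<bar>)^2" by (intro power_mono) auto
   then show ?case by (simp add: power_mult_distrib)
  qed
 qed (use assms(2) in measurable)
qed (rule assms(2))

lemma L2_integral_square_add: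
 assumes "L2 M f" "L2 M g"
 shows "(LINT x|M. (f x + g x)^2) <= 2 * (LINT x|M. (f x)^2) + 2 * (LINT x|M. (g x)^2)"
proof -
 have "(LINT x|M. (f x + g x)^2) <= (LINT x|M. 2 * (f x)^2 + 2 * (g x)^2)"
  using L2_add[OF assms] assms by (intro integral_mono) (auto simp: L2_def square_sum_le)
 then show ?thesis using assms by (simp add: L2_def)
qed

lemma L2_integral_square_diff:
 assumes "L2 M f" "L2 M g"
 shows "(LINT x|M. (f x - g x)^2) <= 2 * (LINT x|M. (f x)^2) + 2 * (LINT x|M. (g x)^2)"
 using L2_integral_square_add[OF assms(1) L2_cmult[OF assms(2), of "-1"]] by simp

lemma L2_expand:
 assumes "L2 M f" "L2 M g"
 shows "(LINT x|M. (f x + c * g x)^2) =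
  (LINT x|M. (f x)^2) + 2 * c * (LINT x|M. f x * g x) + c^2 * (LINT x|M. (g x)^2)"
proof -
 have "(LINT x|M. (f x + c * g x)^2) = (LINT x|M. (f x)^2 + 2 * c * (f x * g x) + c^2 * (g x)^2)"
  by (rule Bochner_Integration.integral_cong) (auto simp: power2_eq_square algebra_simps)
 then show ?thesis using assms L2_mult[OF assms] by (simp add: L2_def)
qed

lemma L2_Cauchy_Schwarz:
 assumes "L2 M f" "L2 M g"
 shows "(LINT x|M. f x * g x)^2 <= (LINT x|M. (f x)^2) * (LINT x|M. (g x)^2)"
proof (rule discriminant_bound)
 show "0 <= (LINT x|M. (f x)^2) + 2 * t * (LINT x|M. f x * g x) + t^2 * (LINT x|M. (g x)^2)" for t
  unfolding L2_expand[OF assms, of t, symmetric] by (rule integral_nonneg_AE) simp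
qed simp

lemma L2_tendsto_mult:
 assumes "\<And>n. L2 M (f n)" "L2 M f'" "L2 M g"
  and "(%n. (LINT x|M. (f' x - f n x)^2)) ~~> 0"
 shows "(%n. (LINT x|M. f n x * g x)) ~~> (LINT x|M. f' x * g x)"
proof -
 have "(%n. (LINT x|M. f' x * g x) - (LINT x|M. f n x * g x)) ~~> 0"
 proof (rule Lim_null_comparison)
  show "\<forall>\<^sub>F n in sequentially. norm ((LINT x|M. f' x * g x) - (LINT x|M. f n x * g x))
    <= sqrt ((LINT x|M. (f' x - f n x)^2) * (LINT x|M. (g x)^2))"
  proof (rule always_eventually, rule allI)
   fix n
   have "(LINT x|M. f' x * g x) - (LINT x|M. f n x * g x) = (LINT x|M. (f' x - f n x) * g x)"
    using L2_mult[OF assms(2,3)] L2_mult[OF assms(1,3)] by (simp add: left_diff_distrib)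
   then show "norm ((LINT x|M. f' x * g x) - (LINT x|M. f n x * g x))
    <= sqrt ((LINT x|M. (f' x - f n x)^2) * (LINT x|M. (g x)^2))"
    using L2_Cauchy_Schwarz[OF L2_diff[OF assms(2) assms(1)] assms(3)]
    by (auto intro!: real_le_rsqrt)
  qed
  show "(%n. sqrt ((LINT x|M. (f' x - f n x)^2) * (LINT x|M. (g x)^2))) ~~> 0"
   using tendsto_real_sqrt[OF tendsto_mult_left_zero[OF assms(4)]] by simp
 qed
 from tendsto_diff[OF tendsto_const[of "(LINT x|M. f' x * g x)"] this] show ?thesis by simp
qed

text \<open>Expanding the square of the difference reduces the claim to convergence of the inner
  products with the limit itself.\<close>

lemma L2_tendsto_square:
 assumes "\<And>n. L2 M (f n)" "L2 M f'"
  and "(%n. (LINT x|M. (f' x - f n x)^2)) ~~> 0"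
 shows "(%n. (LINT x|M. (f n x)^2)) ~~> (LINT x|M. (f' x)^2)"
proof -
 have eq: "(LINT x|M. (f n x)^2) = (LINT x|M. (f' x - f n x)^2) + 2 * (LINT x|M. f n x * f' x) - (LINT x|M. (f' x)^2)" for n
  using L2_expand[OF assms(2) assms(1), of "-1" n] by (simp add: mult.commute)
 have "(%n. (LINT x|M. (f' x - f n x)^2) + 2 * (LINT x|M. f n x * f' x) - (LINT x|M. (f' x)^2))
   ~~> 0 + 2 * (LINT x|M. f' x * f' x) - (LINT x|M. (f' x)^2)"
  by (intro tendsto_intros assms L2_tendsto_mult)
 then show ?thesis unfolding eq by (simp add: power2_eq_square)
qed

text \<open>Riesz--Fischer, for sequences with geometrically decreasing increments: the weighted sum
 of the squared increments is integrable, hence finite almost everywhere, and controls the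
 increments and the tails pointwise.\<close>

lemma L2_complete_rapid:
 assumes f: "\<And>n. L2 M (f n)" and C: "\<And>n. (LINT x|M. (f (Suc n) x - f n x)^2) <= C * (1/4)^n"
 shows "\<exists>g. L2 M g & (%n. (LINT x|M. (g x - f n x)^2)) ~~> 0"
proof -
 define h where "h n x = 2^n * (f (Suc n) x - f n x)^2" for n x
 define Z where "Z x = (\<Sum>n. h n x)" for x
 have h0: "h n x >= 0" for n x by (simp add: h_def)
 have fm[measurable]: "f n \<in> borel_measurable M" for n using f by (simp add: L2_def)
 have hint: "integrable M (h n)" for n
  unfolding h_def using L2_square[OF L2_diff[OF f f]] by auto
 have hI: "(LINT x|M. h n x) <= C * (1/2)^n" for n
 proof -
  have "(LINT x|M. h n x) = 2^n * (LINT x|M. (f (Suc n) x - f n x)^2)" by (simp add: h_def)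
  also have "... <= 2^n * (C * (1/4)^n)" using C by (intro mult_left_mono) auto
  also have "... = C * (2 * (1/4))^n" by (simp only: power_mult_distrib) simp
  finally show ?thesis by simp
 qed
 have "(\<Sum>n. \<integral>\<^sup>+x. ennreal (h n x) \<partial>M) < \<infinity>"
 proof -
  have "(\<integral>\<^sup>+x. ennreal (h n x) \<partial>M) = ennreal (LINT x|M. h n x)" for n
   using hint h0 by (intro nn_integral_eq_integral) auto
  moreover have "summable (%n. (LINT x|M. h n x))"
  proof (rule summable_comparison_test')
   show "summable (%n. C * (1/2)^n)" by (intro summable_mult summable_geometric) simp
   show "norm (LINT x|M. h n x) <= C * (1/2)^n" if "n >= 0" for n
    using hI[of n] integral_nonneg_AE[of "h n" M] h0 by simp
  qed
  ultimately show ?thesis using h0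
   by (simp add: suminf_ennreal2 integral_nonneg_AE)
 qed
 then have "(\<integral>\<^sup>+x. (\<Sum>n. ennreal (h n x)) \<partial>M) < \<infinity>"
  using hint by (subst nn_integral_suminf) auto
 moreover have "(%x. \<Sum>n. ennreal (h n x)) \<in> borel_measurable M" using hint by measurable
 ultimately have "AE x in M. (\<Sum>n. ennreal (h n x)) \<noteq> \<infinity>" by (intro nn_integral_PInf_AE) auto
 then have sm: "AE x in M. summable (%n. h n x)"
  by eventually_elim (use h0 summable_suminf_not_top in auto)
 have Zm[measurable]: "Z \<in> borel_measurable M" unfolding Z_def using hint by measurable
 have Zint: "integrable M Z"
 proof (rule integrableI_bounded)
  have "(\<integral>\<^sup>+ x. ennreal (norm (Z x)) \<partial>M) = (\<integral>\<^sup>+x. (\<Sum>n. ennreal (h n x)) \<partial>M)"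
  proof (rule nn_integral_cong_AE, use sm in eventually_elim)
   case (elim x) then show ?case
    using suminf_nonneg[of "%n. h n x"] h0 by (simp add: Z_def suminf_ennreal2)
  qed
  then show "(\<integral>\<^sup>+ x. ennreal (norm (Z x)) \<partial>M) < \<infinity>"
   using \<open>(\<integral>\<^sup>+x. (\<Sum>n. ennreal (h n x)) \<partial>M) < \<infinity>\<close> by simp
 qed simp
 \<comment> \<open>\<open>lim\<close> is defined everywhere and measurable; it is the true limit
   wherever the weighted series converges, and its value on the remaining null set does not
   matter.\<close>
 define g where "g x = lim (%n. f n x)" for x
 have gm[measurable]: "g \<in> borel_measurable M" unfolding g_def by measurable
 have key: "AE x in M. (\<forall>n. (g x - f n x)^2 <= 2 * (1/2)^n * Z x)"
  using sm
 proof eventually_elim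
  case (elim x)
  have Z0: "Z x >= 0" unfolding Z_def using elim h0 by (intro suminf_nonneg) auto
  have diff: "(f (n + k) x - f n x)^2 <= 2 * (1/2)^n * Z x" for n k
  proof -
   have "f (n + k) x - f n x = (\<Sum>j=n..<n+k. f (Suc j) x - f j x)"
    by (subst sum_Suc_diff') auto
   \<comment> \<open>The factors \<open>sqrt ((1/2)^j)\<close> and \<open>sqrt (2^j)\<close> cancel;
     Cauchy-Schwarz then splits the block into a geometric tail and a partial sum of the series
     \<open>Z\<close>.\<close>
   also have "...^2 = (\<Sum>j=n..<n+k. sqrt ((1/2)^j) * (sqrt (2^j) * (f (Suc j) x - f j x)))^2"
   proof -
    have "sqrt ((1/2)^j) * (sqrt (2^j)) = (1::real)" for j
     by (simp add: real_sqrt_mult[symmetric] power_mult_distrib[symmetric])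
    then show ?thesis by (simp add: mult.assoc[symmetric])
   qed
   also have "... <= (\<Sum>j=n..<n+k. (sqrt ((1/2)^j))^2) * (\<Sum>j=n..<n+k. (sqrt (2^j) * (f (Suc j) x - f j x))^2)"
    by (rule Cauchy_Schwarz_ineq_sum)
   also have "... = (\<Sum>j=n..<n+k. (1/2)^j) * (\<Sum>j=n..<n+k. h j x)"
    by (simp add: h_def power_mult_distrib)
   also have "... <= (2 * (1/2)^n) * Z x"
   proof (rule mult_mono)
    have "(\<Sum>j=n..<n+k. (1/2)^j) <= 2 * (1/2::real)^n"
    proof (induction k arbitrary: n)
     case (Suc k)
     have "(\<Sum>j=n..<n+Suc k. (1/2)^j) = (1/2)^n + (\<Sum>j=Suc n..<Suc n+k. (1/2::real)^j)"
      by (simp add: sum.atLeast_Suc_lessThan)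
     also have "... <= (1/2)^n + 2 * (1/2)^Suc n" using Suc.IH[of "Suc n"] by linarith
     finally show ?case by simp
    qed simp
    then show "(\<Sum>j=n..<n+k. (1/2)^j) <= 2 * (1/2::real)^n" .
    show "(\<Sum>j=n..<n+k. h j x) <= Z x"
     unfolding Z_def using elim h0 by (intro sum_le_suminf) auto
   qed (auto intro: sum_nonneg h0)
   finally show ?thesis .
  qed
  have "Cauchy (%n. f n x)"
  proof (rule CauchyI')
   fix r :: real assume "r > 0"
   have "(%n. 2 * (1/2)^n * Z x) ~~> 2 * 0 * Z x"
    by (intro tendsto_intros LIMSEQ_realpow_zero) auto
   then have "\<forall>\<^sub>F n in sequentially. 2 * (1/2)^n * Z x < r^2"
    using \<open>r > 0\<close> by (intro order_tendstoD(2)[where y = "2 * 0 * Z x"]) auto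
   then obtain N where N: "\<And>n. n >= N ==> 2 * (1/2)^n * Z x < r^2"
    by (auto simp: eventually_sequentially)
   show "\<exists>N. \<forall>m\<ge>N. \<forall>n>m. dist (f m x) (f n x) < r"
   proof (intro exI allI impI)
    fix m n assume "m >= N" "m < n"
    then have "(f n x - f m x)^2 < r^2"
     using diff[of m "n - m"] N[of m] by simp
    then have "\<bar>f n x - f m x\<bar> < r" using \<open>r > 0\<close>
     by (metis abs_of_pos abs_square_less_1 power2_abs power_less_imp_less_base less_imp_le)
    then show "dist (f m x) (f n x) < r" by (simp add: dist_real_def abs_minus_commute)
   qed
  qed
  then have lim: "(%n. f n x) ~~> g x"
   unfolding g_def by (simp add: Cauchy_convergent_iff convergent_LIMSEQ_iff)
  show ?case
  proof
   fix n
   have "(%k. (f (k + n) x - f n x)^2) ~~> (g x - f n x)^2"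
    by (intro tendsto_intros LIMSEQ_ignore_initial_segment lim)
   then show "(g x - f n x)^2 <= 2 * (1/2)^n * Z x"
    by (rule Lim_bounded) (use diff[of n] in "auto simp: add.commute")
  qed
 qed
 have gL: "L2 M (%x. g x - f n x)" for n
  unfolding L2_def
 proof
  show "integrable M (%x. (g x - f n x)^2)"
  proof (rule Bochner_Integration.integrable_bound)
   show "integrable M (%x. 2 * (1/2)^n * Z x)" using Zint by simp
   show "AE x in M. norm ((g x - f n x)^2) <= norm (2 * (1/2)^n * Z x)"
    using key by eventually_elim (metis abs_ge_self abs_power2 order_trans real_norm_def)
  qed simp
 qed simp
 have "L2 M (%x. (g x - f 0 x) + f 0 x)" by (rule L2_add[OF gL f])
 then have "L2 M g" by simp
 moreover have "(%n. (LINT x|M. (g x - f n x)^2)) ~~> 0"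
 proof (rule tendsto_sandwich[OF _ _ tendsto_const])
  show "\<forall>\<^sub>F n in sequentially. (LINT x|M. (g x - f n x)^2) <= 2 * (1/2)^n * (LINT x|M. Z x)"
  proof (rule always_eventually, rule allI)
   fix n
   have "(LINT x|M. (g x - f n x)^2) <= (LINT x|M. 2 * (1/2)^n * Z x)"
    using key Zint gL[of n] by (intro integral_mono_AE) (auto simp: L2_def)
   then show "(LINT x|M. (g x - f n x)^2) <= 2 * (1/2)^n * (LINT x|M. Z x)" by simp
  qed
  have "(%n. 2 * (1/2)^n * (LINT x|M. Z x)) ~~> 2 * 0 * (LINT x|M. Z x)"
   by (intro tendsto_intros LIMSEQ_realpow_zero) auto
  then show "(%n. 2 * (1/2)^n * (LINT x|M. Z x)) ~~> 0" by simp
 qed (simp add: integral_nonneg_AE)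
 ultimately show ?thesis by blast
qed

text \<open>A subsequence with increments below \<open>(1/4)^k\<close> falls under the geometric
  case, and the Cauchy property carries its limit over to the whole sequence.\<close>

lemma L2_complete:
 assumes f: "\<And>n. L2 M (f n)"
  and Cy: "\<And>ep. ep > 0 ==> \<exists>N. \<forall>m\<ge>N. \<forall>n\<ge>N. (LINT x|M. (f m x - f n x)^2) < ep"
 shows "\<exists>g. L2 M g & (%n. (LINT x|M. (g x - f n x)^2)) ~~> 0"
proof -
 have "\<forall>k. \<exists>N. \<forall>m\<ge>N. \<forall>n\<ge>N. (LINT x|M. (f m x - f n x)^2) < (1/4)^k"
  using Cy by simp
 then obtain N where N: "\<And>k m n. m >= N k ==> n >= N k ==> (LINT x|M. (f m x - f n x)^2) < (1/4)^k"
  by metis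
 \<comment> \<open>Summing all thresholds up to \<open>k\<close> makes \<open>r\<close> monotone and
   at least \<open>N k\<close>; the summand \<open>k\<close> forces it to infinity.\<close>
 define r where "r k = k + (\<Sum>j\<le>k. N j)" for k
 have rN: "r k >= N k" "r k >= k" "r (Suc k) >= r k" for k
  by (auto simp: r_def intro: trans_le_add2 member_le_sum)
 obtain g where g: "L2 M g" "(%k. (LINT x|M. (g x - f (r k) x)^2)) ~~> 0"
 proof -
  have "(LINT x|M. (f (r (Suc k)) x - f (r k) x)^2) <= 1 * (1/4)^k" for k
   using N[of k "r (Suc k)" "r k"] rN[of k] by simp
  from L2_complete_rapid[of M "%k. f (r k)" 1, OF f this] show ?thesis using that by blast
 qed
 have "(%n. (LINT x|M. (g x - f n x)^2)) ~~> 0"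
 proof (rule LIMSEQ_I)
  fix ep :: real assume "ep > 0"
  obtain k0 where k0: "\<And>k. k >= k0 ==> norm ((LINT x|M. (g x - f (r k) x)^2) - 0) < ep/4"
   using LIMSEQ_D[OF g(2), of "ep/4"] \<open>ep > 0\<close> by auto
  obtain n0 where n0: "\<And>m n. m >= n0 ==> n >= n0 ==> (LINT x|M. (f m x - f n x)^2) < ep/4"
   using Cy[of "ep/4"] \<open>ep > 0\<close> by auto
  define k where "k = max k0 n0"
  show "\<exists>no. \<forall>n\<ge>no. norm ((LINT x|M. (g x - f n x)^2) - 0) < ep"
  proof (intro exI allI impI)
   fix n assume "n >= n0"
   have "(LINT x|M. (g x - f n x)^2) = (LINT x|M. ((g x - f (r k) x) + (f (r k) x - f n x))^2)" by simp
   also have "... <= 2 * (LINT x|M. (g x - f (r k) x)^2) + 2 * (LINT x|M. (f (r k) x - f n x)^2)"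
    by (intro L2_integral_square_add L2_diff f g)
   also have "... < ep"
    using k0[of k] n0[of "r k" n] \<open>n >= n0\<close> rN(2)[of k] by (auto simp: k_def)
   finally show "norm ((LINT x|M. (g x - f n x)^2) - 0) < ep"
    by (simp add: integral_nonneg_AE)
  qed
 qed
 then show ?thesis using g(1) by blast
qed

lemma L2_limit_unique:
 assumes "L2 M g" "L2 M h" "\<And>n. L2 M (f n)"
  and "(%n. (LINT x|M. (g x - f n x)^2)) ~~> 0" "(%n. (LINT x|M. (h x - f n x)^2)) ~~> 0"
 shows "AE x in M. g x = h x"
proof -
 have "(LINT x|M. (g x - h x)^2) <= 2 * (LINT x|M. (g x - f n x)^2) + 2 * (LINT x|M. (h x - f n x)^2)" for n
  using L2_integral_square_diff[OF L2_diff[OF assms(1,3)] L2_diff[OF assms(2,3)], of n n] by simp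
 moreover have "(%n. 2 * (LINT x|M. (g x - f n x)^2) + 2 * (LINT x|M. (h x - f n x)^2)) ~~> 2 * 0 + 2 * 0"
  by (intro tendsto_intros assms)
 ultimately have "(LINT x|M. (g x - h x)^2) <= 2 * 0 + 2 * 0"
  by (intro LIMSEQ_le_const) auto
 then have "(LINT x|M. (g x - h x)^2) = 0" by (simp add: integral_nonneg_AE antisym)
 then have "AE x in M. (g x - h x)^2 = 0"
  using L2_square[OF L2_diff[OF assms(1,2)]] by (subst (asm) integral_nonneg_eq_0_iff_AE) auto
 then show ?thesis by simp
qed

section \<open>Absolutely continuous functions on \<open>[0,l]\<close>\<close>

text \<open>Absolute continuity in the form used throughout: \<open>u\<close> is an indefinite
  integral, with the derivative \<open>d\<close> carried along as explicit data. \<open>d\<close> is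
  Borel on the whole line, but only its values on \<open>[0,l]\<close> enter, and these only up to
  null sets; \<open>u\<close> is unrestricted outside \<open>[0,l]\<close>.\<close>

definition ac :: "real => (real => real) => (real => real) => bool" where
 "ac l u d \<longleftrightarrow> d \<in> BM & integrable lborel (%s. indicator {0..l} s * d s) \<and>
  (\<forall>y\<in>{0..l}. u y = u 0 + (LINT s|lborel. indicator {0..y} s * d s))"

lemma acI:
 assumes "d \<in> BM" "integrable lborel (%s. indicator {0..l} s * d s)"
  "\<And>y. y \<in> {0..l} ==> u y = u 0 + (LINT s|lborel. indicator {0..y} s * d s)"
 shows "ac l u d"
 unfolding ac_def using assms by blast

lemma ac_borel[measurable_dest]: "ac l u d ==> d \<in> BM"
 and ac_integrable: "ac l u d ==> integrable lborel (%s. indicator {0..l} s * d s)"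
 and ac_eq: "ac l u d ==> y \<in> {0..l} ==> u y = u 0 + (LINT s|lborel. indicator {0..y} s * d s)"
 unfolding ac_def by blast+

lemma ac_integrable_sub:
 assumes "ac l u d" "A \<subseteq> {0..l}" "A \<in> sets borel"
 shows "integrable lborel (%s. indicator A s * d s)"
proof -
 have "integrable lborel (%s. indicator A s *\<^sub>R (indicator {0..l} s * d s))"
  using assms ac_integrable by (intro integrable_mult_indicator) auto
 moreover have "(%s. indicator A s *\<^sub>R (indicator {0..l} s * d s)) = (%s. indicator A s * d s)"
  using assms(2) by (intro ext) (auto simp: indicator_def)
 ultimately show ?thesis by simp
qed

lemma ac_diff:
 assumes "ac l u d" "0 <= s" "s <= t" "t <= l"
 shows "u t - u s = (LINT r|lborel. indicator {s..t} r * d r)"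
proof -
 note [measurable] = ac_borel[OF assms(1)]
 have "(LINT r|lborel. indicator {0..t} r * d r) =
  (LINT r|lborel. indicator {0..s} r * d r + indicator {s..t} r * d r)"
 proof (rule integral_cong_AE)
  show "AE r in lborel. indicator {0..t} r * d r = indicator {0..s} r * d r + indicator {s..t} r * d r"
   using AE_lborel_singleton[of s] by eventually_elim (use assms in "auto simp: indicator_def")
 qed auto
 also have "... = (LINT r|lborel. indicator {0..s} r * d r) + (LINT r|lborel. indicator {s..t} r * d r)"
  using assms by (intro Bochner_Integration.integral_add ac_integrable_sub[OF assms(1)]) auto
 moreover have "u t = u 0 + (LINT r|lborel. indicator {0..t} r * d r)" "u s = u 0 + (LINT r|lborel. indicator {0..s} r * d r)"
  using assms by (auto intro!: ac_eq[OF assms(1)])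
 ultimately show ?thesis by linarith
qed

lemma ac_continuous: assumes "ac l u d" shows "continuous_on {0..l} u"
proof -
 have si: "set_integrable lborel {0..l} d"
  using ac_integrable[OF assms] by (simp add: set_integrable_def)
 have "continuous_on {0..l} (%y. u 0 + integral {0..y} d)"
  by (intro continuous_intros indefinite_integral_continuous_1 set_borel_integral_eq_integral(1)[OF si])
 moreover have "u y = u 0 + integral {0..y} d" if "y \<in> {0..l}" for y
 proof -
  have "set_integrable lborel {0..y} d"
   using that by (intro set_integrable_subset[OF si]) auto
  from set_borel_integral_eq_integral(2)[OF this] show ?thesis
   using ac_eq[OF assms that] by (simp add: set_lebesgue_integral_def)
 qed
 ultimately show ?thesis by (metis (no_types, lifting) continuous_on_eq)
qed

lemma ac_comb:
 assumes "ac l u a" "ac l v b"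
 shows "ac l (%y. c * u y + k * v y) (%y. c * a y + k * b y)"
proof -
 have eq: "(LINT s|lborel. indicator {0..y} s * (c * a s + k * b s)) =
  c * (LINT s|lborel. indicator {0..y} s * a s) + k * (LINT s|lborel. indicator {0..y} s * b s)"
  if "y \<in> {0..l}" for y
 proof -
  have "(LINT s|lborel. indicator {0..y} s * (c * a s + k * b s)) =
   (LINT s|lborel. c * (indicator {0..y} s * a s) + k * (indicator {0..y} s * b s))"
   by (simp add: algebra_simps)
  then show ?thesis
   using ac_integrable_sub[OF assms(1), of "{0..y}"] ac_integrable_sub[OF assms(2), of "{0..y}"] that by simp
 qed
 have "integrable lborel (%s. c * (indicator {0..l} s * a s) + k * (indicator {0..l} s * b s))"
  using ac_integrable[OF assms(1)] ac_integrable[OF assms(2)] by auto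
 then have "integrable lborel (%s. indicator {0..l} s * (c * a s + k * b s))"
  by (simp add: algebra_simps)
 moreover have "u y = u 0 + (LINT s|lborel. indicator {0..y} s * a s)"
   "v y = v 0 + (LINT s|lborel. indicator {0..y} s * b s)" if "y \<in> {0..l}" for y
  using that by (auto intro!: ac_eq[OF assms(1)] ac_eq[OF assms(2)])
 ultimately show ?thesis
 proof (intro acI)
  fix y assume y: "y \<in> {0..l}"
  show "c * u y + k * v y = c * u 0 + k * v 0 + (LINT s|lborel. indicator {0..y} s * (c * a s + k * b s))"
   unfolding ac_eq[OF assms(1) y] ac_eq[OF assms(2) y]
   using eq[OF y]
   by (simp add: algebra_simps)
 qed (use ac_borel[OF assms(1)] ac_borel[OF assms(2)] in auto)
qed

lemma ac_cong_AE:
 assumes "ac l u d" "d' \<in> BM" "AE s in lborel. 0 < s & s < l --> d s = d' s"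
  and uu: "\<And>y. y \<in> {0..l} ==> u y = u' y"
 shows "ac l u' d'"
proof -
 note [measurable] = ac_borel[OF assms(1)] assms(2)
 have ae: "AE s in lborel. indicator {0..y} s * d s = indicator {0..y} s * d' s" if "y <= l" for y
  using assms(3) AE_lborel_singleton[of 0] AE_lborel_singleton[of l]
  by eventually_elim (use that in "auto simp: indicator_def")
 have "integrable lborel (%s. indicator {0..l} s * d' s)"
  using ac_integrable[OF assms(1)] ae[of l] by (subst integrable_cong_AE[symmetric, where f="%s. indicator {0..l} s * d s"]) auto
 moreover have "u' y = u' 0 + (LINT s|lborel. indicator {0..y} s * d' s)" if "y \<in> {0..l}" for y
 proof -
  have "(LINT s|lborel. indicator {0..y} s * d' s) = (LINT s|lborel. indicator {0..y} s * d s)"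
   using ae[of y] that by (intro integral_cong_AE) auto
  moreover have "u y = u 0 + (LINT s|lborel. indicator {0..y} s * d s)"
   by (rule ac_eq[OF assms(1) that])
  ultimately show ?thesis using uu[of y] uu[of 0] that by simp
 qed
 ultimately show ?thesis using assms(2) by (intro acI)
qed

text \<open>The fundamental theorem of calculus; the cut-off by the indicator makes the derivative,
  known to be continuous only on \<open>[0,l]\<close>, Borel on the whole line.\<close>

lemma ac_deriv:
 assumes "\<And>y. y \<in> {0..l} ==> (u has_real_derivative d y) (at y within {0..l})"
  and "continuous_on {0..l} d"
 shows "ac l u (%y. indicator {0..l} y * d y)"
proof -
 have m: "(%y. indicator {0..l} y *\<^sub>R d y) \<in> BM"
  using assms(2) by (intro borel_measurable_continuous_on_indicator) auto
 have "set_integrable lborel {0..l} d"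
  by (rule borel_integrable_atLeastAtMost') (rule assms)
 then have "integrable lborel (%y. indicator {0..l} y * (indicator {0..l} y * d y))"
  unfolding set_integrable_def
  by (rule Bochner_Integration.integrable_cong[THEN iffD1, rotated 2]) (auto simp: indicator_def)
 moreover have "u y = u 0 + (LINT s|lborel. indicator {0..y} s * (indicator {0..l} s * d s))"
  if "y \<in> {0..l}" for y
 proof -
  have "(LINT s|lborel. indicator {0..y} s *\<^sub>R d s) = u y - u 0"
  proof (rule integral_FTC_atLeastAtMost)
   show "(u has_vector_derivative d x) (at x within {0..y})" if "0 <= x" "x <= y" for x
    using assms(1)[of x] that \<open>y \<in> {0..l}\<close>
    by (auto simp: has_real_derivative_iff_has_vector_derivative intro: has_vector_derivative_within_subset)
   show "continuous_on {0..y} d" using that by (intro continuous_on_subset[OF assms(2)]) auto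
  qed (use that in auto)
  moreover have "(%s. indicator {0..y} s * (indicator {0..l} s * d s)) = (%s. indicator {0..y} s *\<^sub>R d s)"
   using that by (auto simp: indicator_def)
  ultimately show ?thesis by simp
 qed
 moreover have "(%y. indicator {0..l} y * d y) \<in> BM" using m by simp
 ultimately show ?thesis by (intro acI)
qed

lemma ac_const: "ac l (%y. c) (%y. 0)"
 by (simp add: ac_def)

text \<open>Product rule by Fubini: \<open>(u y - u 0) * (v y - v 0)\<close> is the integral of
  \<open>a s * b r\<close> over the square \<open>[0,y]^2\<close>, which the diagonal cuts into the
  triangles \<open>r <= s\<close> and \<open>s < r\<close>; the inner integrals over them are
  increments of \<open>v\<close> and of \<open>u\<close>.\<close>

lemma ac_mult:
 assumes u: "ac l u a" and v: "ac l v b"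
 shows "ac l (%y. u y * v y) (%y. indicator {0..l} y * (a y * v y + u y * b y))"
proof -
 note [measurable] = ac_borel[OF u] ac_borel[OF v]
 \<comment> \<open>Extensions by zero are Borel and bounded on the whole line.\<close>
 define iu where "iu y = indicator {0..l} y * u y" for y
 define iv where "iv y = indicator {0..l} y * v y" for y
 have mu[measurable]: "iu \<in> BM" "iv \<in> BM"
  unfolding iu_def iv_def
  using borel_measurable_continuous_on_indicator[OF _ ac_continuous[OF u]]
   borel_measurable_continuous_on_indicator[OF _ ac_continuous[OF v]] by auto
 have eqd: "indicator {0..l} y * (a y * v y + u y * b y) = a y * iv y + iu y * b y" for y
  by (auto simp: iu_def iv_def indicator_def)
 obtain K where K: "\<And>y. \<bar>iu y\<bar> <= K" "\<And>y. \<bar>iv y\<bar> <= K"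
 proof -
  have "bounded (u ` {0..l})" "bounded (v ` {0..l})"
   by (auto intro!: compact_imp_bounded compact_continuous_image ac_continuous[OF u] ac_continuous[OF v])
  then obtain K1 K2 where "\<And>y. y \<in> {0..l} ==> \<bar>u y\<bar> <= K1" "\<And>y. y \<in> {0..l} ==> \<bar>v y\<bar> <= K2"
   unfolding bounded_iff by (metis imageI real_norm_def)
  then have "\<bar>iu y\<bar> <= max 0 (max K1 K2)" "\<bar>iv y\<bar> <= max 0 (max K1 K2)" for y
   by (cases "y \<in> {0..l}"; simp add: iu_def iv_def le_max_iff_disj)+
  then show ?thesis using that by blast
 qed
 have intm: "integrable lborel (%s. indicator {0..l} s * p s * q s)"
  if "integrable lborel (%s. indicator {0..l} s * p s)" "q \<in> BM" "\<And>s. \<bar>q s\<bar> <= K"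
   "p \<in> BM" for p q
 proof (rule Bochner_Integration.integrable_bound)
  show "integrable lborel (%s. K * (indicator {0..l} s * p s))" using that by simp
  show "(%s. indicator {0..l} s * p s * q s) \<in> borel_measurable lborel" using that by measurable
  show "AE s in lborel. norm (indicator {0..l} s * p s * q s) <= norm (K * (indicator {0..l} s * p s))"
  proof (rule AE_I2)
   fix s
   have "\<bar>indicator {0..l} s * p s\<bar> * \<bar>q s\<bar> <= \<bar>indicator {0..l} s * p s\<bar> * \<bar>K\<bar>"
    using that(3)[of s] by (intro mult_left_mono) auto
   then show "norm (indicator {0..l} s * p s * q s) <= norm (K * (indicator {0..l} s * p s))"
    by (simp add: abs_mult mult.commute)
  qed
 qed
 have i1: "integrable lborel (%s. indicator {0..l} s * a s * iv s)"
  by (rule intm) (use ac_integrable[OF u] K in auto)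
 have i2: "integrable lborel (%s. indicator {0..l} s * b s * iu s)"
  by (rule intm) (use ac_integrable[OF v] K in auto)
 have main: "u y * v y = u 0 * v 0 + (LINT s|lborel. indicator {0..y} s * (a s * iv s + iu s * b s))"
  if y: "y \<in> {0..l}" for y
 proof -
  define A where "A s = indicator {0..y} s * a s" for s
  define B where "B s = indicator {0..y} s * b s" for s
  have [measurable]: "A \<in> BM" "B \<in> BM"
   unfolding A_def B_def by measurable
  have Ai: "integrable lborel A" and Bi: "integrable lborel B"
   unfolding A_def B_def using y
   by (auto intro!: ac_integrable_sub[OF u] ac_integrable_sub[OF v])
  have ABi: "integrable (lborel >< lborel) (%(s,r). A s * B r)"
  proof (rule lborel_pair.Fubini_integrable)
   show "integrable lborel (%x. (LINT y|lborel. norm (case (x, y) of (s, r) => A s * B r)))"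
    using Ai by (simp add: abs_mult)
   show "AE x in lborel. integrable lborel (%y. case (x, y) of (s, r) => A s * B r)"
    using Bi by simp
  qed measurable
  have AB2: "integrable (lborel >< lborel) (%(s,r). (if s < r then A s * B r else 0))"
   by (rule Bochner_Integration.integrable_bound[OF ABi]) auto
  have ints: "integrable lborel (%r. if r <= s then B r else 0)" "integrable lborel (%r. if s < r then B r else 0)" for s
   by (auto intro: Bochner_Integration.integrable_bound[OF Bi])
  have Bs: "(LINT r|lborel. (if r <= s then B r else 0)) = v s - v 0" if "s \<in> {0..y}" for s
  proof -
   have "v s - v 0 = (LINT r|lborel. indicator {0..s} r * b r)"
    using ac_diff[OF v, of 0 s] that y by auto
   also have "... = (LINT r|lborel. (if r <= s then B r else 0))"
    using that by (intro Bochner_Integration.integral_cong) (auto simp: B_def indicator_def)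
   finally show ?thesis by simp
  qed
  have As: "(LINT s|lborel. (if s < r then A s else 0)) = u r - u 0" if "r \<in> {0..y}" for r
  proof -
   have "u r - u 0 = (LINT s|lborel. indicator {0..r} s * a s)"
    using ac_diff[OF u, of 0 r] that y by auto
   also have "... = (LINT s|lborel. (if s < r then A s else 0))"
   proof (rule integral_cong_AE)
    show "AE s in lborel. indicator {0..r} s * a s = (if s < r then A s else 0)"
     using AE_lborel_singleton[of r] by eventually_elim (use that in "auto simp: A_def indicator_def")
   qed auto
   finally show ?thesis by simp
  qed
  have uy: "u y - u 0 = (LINT s|lborel. A s)" "v y - v 0 = (LINT s|lborel. B s)"
   using ac_diff[OF u, of 0 y] ac_diff[OF v, of 0 y] y by (auto simp: A_def B_def)
  have AV: "integrable lborel (%s. A s * iv s)" "integrable lborel (%s. B s * iu s)"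
  proof -
   have "integrable lborel (%s. indicator {0..y} s *\<^sub>R (indicator {0..l} s * a s * iv s))"
    "integrable lborel (%s. indicator {0..y} s *\<^sub>R (indicator {0..l} s * b s * iu s))"
    by (rule integrable_mult_indicator[OF _ i1] integrable_mult_indicator[OF _ i2], simp)+
   moreover have "(%s. indicator {0..y} s *\<^sub>R (indicator {0..l} s * a s * iv s)) = (%s. A s * iv s)"
    "(%s. indicator {0..y} s *\<^sub>R (indicator {0..l} s * b s * iu s)) = (%s. B s * iu s)"
    using y by (intro ext, simp add: A_def B_def split: split_indicator)+
   ultimately show "integrable lborel (%s. A s * iv s)" "integrable lborel (%s. B s * iu s)" by auto
  qed
  have 1: "(LINT s|lborel. A s * (LINT r|lborel. (if r <= s then B r else 0))) = (LINT s|lborel. A s * iv s - v 0 * A s)"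
  proof (rule Bochner_Integration.integral_cong[OF refl])
   show "A s * (LINT r|lborel. (if r <= s then B r else 0)) = A s * iv s - v 0 * A s" for s
    using y by (cases "s \<in> {0..y}") (simp_all add: A_def iv_def Bs right_diff_distrib)
  qed
  have 2: "(LINT s|lborel. B s * (LINT r|lborel. (if r < s then A r else 0))) = (LINT s|lborel. B s * iu s - u 0 * B s)"
  proof (rule Bochner_Integration.integral_cong[OF refl])
   show "B s * (LINT r|lborel. (if r < s then A r else 0)) = B s * iu s - u 0 * B s" for s
    using y by (cases "s \<in> {0..y}") (simp_all add: B_def iu_def As right_diff_distrib)
  qed
  have "(u y - u 0) * (v y - v 0) = (LINT s|lborel. A s * (LINT r|lborel. B r))"
   using uy Ai by simp
  also have "... = (LINT s|lborel. A s * (LINT r|lborel. (if r <= s then B r else 0)) + (LINT r|lborel. (if s < r then A s * B r else 0)))"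
  proof (rule Bochner_Integration.integral_cong[OF refl])
   fix s
   have "(LINT r|lborel. B r) = (LINT r|lborel. (if r <= s then B r else 0) + (if s < r then B r else 0))"
    by (rule Bochner_Integration.integral_cong) auto
   also have "... = (LINT r|lborel. (if r <= s then B r else 0)) + (LINT r|lborel. (if s < r then B r else 0))"
    using ints[of s] by simp
   finally have "A s * (LINT r|lborel. B r) = A s * (LINT r|lborel. (if r <= s then B r else 0)) + A s * (LINT r|lborel. (if s < r then B r else 0))"
    by (simp add: algebra_simps)
   moreover have "A s * (LINT r|lborel. (if s < r then B r else 0)) = (LINT r|lborel. A s * (if s < r then B r else 0))"
    by simp
   moreover have "(%r. A s * (if s < r then B r else 0)) = (%r. (if s < r then A s * B r else 0))" by auto
   ultimately show "A s * (LINT r|lborel. B r) = A s * (LINT r|lborel. (if r <= s then B r else 0)) + (LINT r|lborel. (if s < r then A s * B r else 0))"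
    by simp
  qed
  also have "... = (LINT s|lborel. A s * (LINT r|lborel. (if r <= s then B r else 0))) + (LINT s|lborel. (LINT r|lborel. (if s < r then A s * B r else 0)))"
  proof (rule Bochner_Integration.integral_add)
   show "integrable lborel (%s. LINT r|lborel. (if s < r then A s * B r else 0))"
    using lborel_pair.integrable_fst[OF AB2] by simp
   have "integrable lborel (%s. A s * iv s - v 0 * A s)" using AV Ai by simp
   moreover have "(%s. A s * iv s - v 0 * A s) = (%s. A s * (LINT r|lborel. (if r <= s then B r else 0)))"
   proof
    show "A s * iv s - v 0 * A s = A s * (LINT r|lborel. (if r <= s then B r else 0))" for s
     using y by (cases "s \<in> {0..y}") (simp_all add: A_def iv_def Bs right_diff_distrib)
   qed
   ultimately show "integrable lborel (%s. A s * (LINT r|lborel. (if r <= s then B r else 0)))" by simp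
  qed
  also have "(LINT s|lborel. (LINT r|lborel. (if s < r then A s * B r else 0))) = (LINT r|lborel. (LINT s|lborel. (if s < r then A s * B r else 0)))"
   using lborel_pair.Fubini_integral[of "%s r. if s < r then A s * B r else 0"] AB2 by simp
  also have "... = (LINT r|lborel. B r * (LINT s|lborel. (if s < r then A s else 0)))"
  proof (rule Bochner_Integration.integral_cong[OF refl])
   fix r
   have "(%s. if s < r then A s * B r else 0) = (%s. B r * (if s < r then A s else 0))" by auto
   then show "(LINT s|lborel. (if s < r then A s * B r else 0)) = B r * (LINT s|lborel. (if s < r then A s else 0))"
    by simp
  qed
  finally have "(u y - u 0) * (v y - v 0) = (LINT s|lborel. A s * iv s - v 0 * A s) + (LINT s|lborel. B s * iu s - u 0 * B s)"
   unfolding 1 2 .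
  also have "... = (LINT s|lborel. A s * iv s) + (LINT s|lborel. B s * iu s) - v 0 * (u y - u 0) - u 0 * (v y - v 0)"
   using AV Ai Bi uy by simp
  also have "(LINT s|lborel. A s * iv s) + (LINT s|lborel. B s * iu s) = (LINT s|lborel. indicator {0..y} s * (a s * iv s + iu s * b s))"
   using AV by (subst Bochner_Integration.integral_add[symmetric]) (auto simp: A_def B_def algebra_simps)
  finally show ?thesis by (simp add: algebra_simps)
 qed
 have "integrable lborel (%s. indicator {0..l} s * a s * iv s + indicator {0..l} s * b s * iu s)"
  using i1 i2 by simp
 then have "integrable lborel (%s. indicator {0..l} s * (a s * iv s + iu s * b s))"
  by (simp add: algebra_simps)
 moreover have "(%y. a y * iv y + iu y * b y) \<in> BM" by measurable
 ultimately show ?thesis using main unfolding eqd by (intro acI)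
qed

text \<open>Cauchy-Schwarz against the indicator of \<open>[s,t]\<close>. The resulting Hoelder
  exponent 1/2 is the source of compactness of the energy space.\<close>

lemma ac_holder:
 assumes "ac l u d" "integrable lborel (%s. indicator {0..l} s * (d s)^2)" "0 <= s" "s <= t" "t <= l"
 shows "(u t - u s)^2 <= (t - s) * (LINT r|lborel. indicator {0..l} r * (d r)^2)"
proof -
 note [measurable] = ac_borel[OF assms(1)]
 have eq: "(indicator {0..l} r * d r)^2 = indicator {0..l} r * (d r)^2" for r
  by (auto simp: indicator_def)
 have eq2: "(indicator {s..t} r)^2 = (indicator {s..t} r :: real)" for r
  by (auto simp: indicator_def)
 have "u t - u s = (LINT r|lborel. indicator {s..t} r * d r)" by (rule ac_diff[OF assms(1)]) (use assms in auto)
 also have "... = (LINT r|lborel. indicator {s..t} r * (indicator {0..l} r * d r))"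
  using assms by (intro Bochner_Integration.integral_cong) (auto simp: indicator_def)
 also have "...^2 <= (LINT r|lborel. (indicator {s..t} r)^2) * (LINT r|lborel. (indicator {0..l} r * d r)^2)"
  using assms(2,4) by (intro L2_Cauchy_Schwarz) (auto simp: L2_def eq eq2 intro!: integrable_real_indicator)
 also have "... = (t - s) * (LINT r|lborel. indicator {0..l} r * (d r)^2)"
  using assms by (simp add: eq eq2)
 finally show ?thesis .
qed

section \<open>Borel representatives\<close>

lemma AE_lebesgue_on:
 "S \<in> sets borel ==> (AE x in lebesgue_on S. P x) \<longleftrightarrow> (AE x in lborel. x \<in> S --> P x)"
 by (subst AE_restrict_space_iff) (auto simp: AE_completion_iff)

text \<open>Preimages under \<open>f\<close> and \<open>g\<close> differ by subsets of null sets,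
  which the completion contains.\<close>

lemma measurable_completion_cong_AE:
 fixes f g :: "'a => real"
 assumes g: "g \<in> borel_measurable M" and ae: "AE x in M. f x = g x"
 shows "f \<in> borel_measurable (completion M)"
proof (rule measurableI)
 fix A :: "real set" assume A: "A \<in> sets borel"
 show "f -` A \<inter> space (completion M) \<in> sets (completion M)"
 proof (rule completion.in_sets_AE)
  show "AE x in completion M. (x \<in> g -` A \<inter> space (completion M)) = (x \<in> f -` A \<inter> space (completion M))"
   using AE_completion[OF ae] by eventually_elim auto
  show "g -` A \<inter> space (completion M) \<in> sets (completion M)"
   using measurable_completion[OF g] A by (rule measurable_sets)
 qed auto
qed simp

context
 fixes S :: "'b::euclidean_space set"
 assumes S: "S \<in> sets borel"
begin

lemma measurable_lebesgue_on_AE: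
 assumes g: "g \<in> BM" and ae: "AE x in lborel. x \<in> S --> f x = (g x :: real)"
 shows "f \<in> borel_measurable (lebesgue_on S)"
proof -
 have "(%x. indicator S x *\<^sub>R f x) \<in> borel_measurable lebesgue"
 proof (rule measurable_completion_cong_AE)
  show "(%x. indicator S x *\<^sub>R g x) \<in> borel_measurable lborel" using g S by measurable
  show "AE x in lborel. indicator S x *\<^sub>R f x = indicator S x *\<^sub>R g x"
   using ae by eventually_elim (auto simp: indicator_def)
 qed
 then show ?thesis using S by (subst borel_measurable_restrict_space_iff) auto
qed

text \<open>The definitions integrate over Lebesgue measure restricted to open sets, the proof over
  \<open>lborel\<close> with indicators; replacing the integrand by a Borel representative is the
  passage between the two.\<close>

lemma integrable_lebesgue_on_AE:
 assumes g: "g \<in> BM" and ae: "AE x in lborel. x \<in> S --> f x = (g x :: real)"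
 shows "integrable (lebesgue_on S) f \<longleftrightarrow> integrable lborel (%x. indicator S x * g x)"
  and "integral\<^sup>L (lebesgue_on S) f = (LINT x|lborel. indicator S x * g x)"
proof -
 have gm: "g \<in> borel_measurable (lebesgue_on S)" by (rule measurable_lebesgue_on_AE[OF g]) simp
 note fm = measurable_lebesgue_on_AE[OF g ae]
 have ae': "AE x in lebesgue_on S. f x = g x" using ae by (simp add: AE_lebesgue_on[OF S])
 have im: "(%x. indicator S x *\<^sub>R g x) \<in> borel_measurable lborel" using g S by measurable
 show "integrable (lebesgue_on S) f \<longleftrightarrow> integrable lborel (%x. indicator S x * g x)"
  using integrable_cong_AE[OF fm gm ae'] integrable_restrict_space[of S lebesgue g] S
   integrable_completion[OF im] by simp
 show "integral\<^sup>L (lebesgue_on S) f = (LINT x|lborel. indicator S x * g x)"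
  using integral_cong_AE[OF fm gm ae'] integral_restrict_space[of S lebesgue g] S
   integral_completion[OF im] by simp
qed

lemma borel_version:
 assumes "f \<in> borel_measurable (lebesgue_on S)"
 shows "\<exists>g \<in> BM. AE x in lborel. x \<in> S --> f x = (g x :: real)"
proof -
 have "(%x. indicator S x *\<^sub>R f x) \<in> borel_measurable lebesgue"
  using assms S by (subst (asm) borel_measurable_restrict_space_iff) auto
 from completion_ex_borel_measurable_real[OF this] obtain g
  where g: "g \<in> borel_measurable lborel" "AE x in lborel. indicator S x *\<^sub>R f x = g x" by auto
 from g(2) have "AE x in lborel. x \<in> S --> f x = g x" by eventually_elim auto
 then show ?thesis using g(1) by auto
qed

lemma L2_on_AE:
 assumes g: "g \<in> BM" and ae: "AE x in lborel. x \<in> S --> f x = (g x :: real)"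
 shows "L2_on S f \<longleftrightarrow> integrable lborel (%x. indicator S x * (g x)^2)"
proof -
 have "(%x. (g x)^2) \<in> BM" using g by measurable
 moreover have "AE x in lborel. x \<in> S --> (f x)^2 = (g x)^2" using ae by eventually_elim auto
 ultimately show ?thesis
  unfolding L2_on_def using measurable_lebesgue_on_AE[OF g ae] integrable_lebesgue_on_AE(1)[of "%x. (g x)^2" "%x. (f x)^2"] by simp
qed

end

section \<open>Smooth functions\<close>

lemma frechet_derivative_real:
 "(f has_real_derivative d) (at x) ==> frechet_derivative f (at x) = (%h. d * h)"
 using frechet_derivative_at[of f "%h. d * h" x] by (simp add: has_field_derivative_def)

lemma Ck_fun_SucI:
 fixes ph :: "real => real"
 assumes "\<And>z. (ph has_real_derivative ph' z) (at z)" "Ck_fun k ph'"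
 shows "Ck_fun (Suc k) ph"
 using assms by (auto simp: frechet_derivative_real[OF assms(1)])
  (metis assms(1) differentiable_def has_field_derivative_def)

lemma Ck_fun_SucD:
 fixes ph :: "real => real"
 assumes "Ck_fun (Suc k) ph"
 shows "\<exists>ph'. (\<forall>z. (ph has_real_derivative ph' z) (at z)) & Ck_fun k ph'"
proof -
 have "(ph has_real_derivative frechet_derivative ph (at z) 1) (at z)" for z
 proof -
  have "(ph has_derivative frechet_derivative ph (at z)) (at z)"
   using assms frechet_derivative_works[of ph "at z"] by simp
  moreover have "frechet_derivative ph (at z) h = frechet_derivative ph (at z) 1 * h" for h
   using linear_cmul[OF has_derivative_linear[OF calculation], of h 1] by simp
  ultimately show ?thesis unfolding has_field_derivative_def by (metis (no_types, lifting) ext)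
 qed
 then show ?thesis using assms by (intro exI[of _ "%z. frechet_derivative ph (at z) 1"]) simp
qed

lemma Ck_fun_continuous: "Ck_fun k (ph :: real => real) ==> continuous_on UNIV ph"
proof (cases k)
 case (Suc j)
 assume "Ck_fun k ph"
 then obtain ph' where "\<And>z. (ph has_real_derivative ph' z) (at z)" using Ck_fun_SucD Suc by metis
 then show ?thesis by (intro continuous_at_imp_continuous_on ballI DERIV_isCont)
qed simp

lemma Ck_fun_Suc_imp: "Ck_fun (Suc k) (ph :: real => real) ==> Ck_fun k ph"
proof (induction k arbitrary: ph)
 case 0 then show ?case using Ck_fun_continuous[OF 0] by simp
next
 case (Suc k)
 obtain ph' where "\<And>z. (ph has_real_derivative ph' z) (at z)" "Ck_fun (Suc k) ph'" using Ck_fun_SucD[OF Suc.prems] by blast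
 then show ?case using Suc.IH by (intro Ck_fun_SucI[of ph ph'])
qed

lemma Ck_fun_const: "Ck_fun k (%z::real. c::real)"
 by (induction k arbitrary: c) (auto intro!: Ck_fun_SucI[where ph' = "%z. 0"] derivative_eq_intros simp del: Ck_fun.simps(2))

lemma Ck_fun_comb:
 "Ck_fun k f ==> Ck_fun k g ==> Ck_fun k (%z::real. a * f z + b * g z :: real)"
proof (induction k arbitrary: f g)
 case 0 then show ?case by (auto intro!: continuous_intros)
next
 case (Suc k)
 obtain f' where f': "\<And>z. (f has_real_derivative f' z) (at z)" "Ck_fun k f'" using Ck_fun_SucD[OF Suc.prems(1)] by blast
 obtain g' where g': "\<And>z. (g has_real_derivative g' z) (at z)" "Ck_fun k g'" using Ck_fun_SucD[OF Suc.prems(2)] by blast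
 show ?case
  by (rule Ck_fun_SucI[where ph' = "%z. a * f' z + b * g' z"])
   (auto intro!: derivative_eq_intros f' g' Suc.IH)
qed

lemma Ck_fun_mult:
 "Ck_fun k f ==> Ck_fun k g ==> Ck_fun k (%z::real. f z * g z :: real)"
proof (induction k arbitrary: f g)
 case 0 then show ?case by (auto intro!: continuous_intros)
next
 case (Suc k)
 obtain f' where f': "\<And>z. (f has_real_derivative f' z) (at z)" "Ck_fun k f'" using Ck_fun_SucD[OF Suc.prems(1)] by blast
 obtain g' where g': "\<And>z. (g has_real_derivative g' z) (at z)" "Ck_fun k g'" using Ck_fun_SucD[OF Suc.prems(2)] by blast
 have "Ck_fun k (%z. 1 * (f' z * g z) + 1 * (f z * g' z))"
  by (intro Ck_fun_comb Suc.IH f'(2) g'(2) Ck_fun_Suc_imp[OF Suc.prems(1)] Ck_fun_Suc_imp[OF Suc.prems(2)])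
 then show ?case
  by (intro Ck_fun_SucI[where ph' = "%z. f' z * g z + f z * g' z"])
   (auto intro!: derivative_eq_intros f' g' simp: algebra_simps)
qed

lemma Ck_fun_affine: "Ck_fun k f ==> Ck_fun k (%z::real. f (a * z + b) :: real)"
proof (induction k arbitrary: f)
 case 0 then show ?case by (auto intro!: continuous_intros continuous_on_compose2[of UNIV f])
next
 case (Suc k)
 obtain f' where f': "\<And>z. (f has_real_derivative f' z) (at z)" "Ck_fun k f'" using Ck_fun_SucD[OF Suc.prems(1)] by blast
 have "Ck_fun k (%z. a * f' (a * z + b) + 0 * 0)" by (intro Ck_fun_comb Ck_fun_const Suc.IH f')
 moreover have "((%z. f (a * z + b)) has_real_derivative f' (a * z + b) * a) (at z)" for z
  by (rule DERIV_chain2[OF f'(1)]) (auto intro!: derivative_eq_intros)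
 ultimately show ?case by (intro Ck_fun_SucI[where ph' = "%z. a * f' (a * z + b)"]) (simp_all add: mult.commute)
qed

text \<open>The classical exp(-1/x) continued by zero, with its multiples by powers of
  \<open>1/x\<close>: the derivative of a member is a combination of members, so smoothness of all
  of them follows by one induction.\<close>

definition flat :: "nat => real => real" where
 "flat k x = (if x > 0 then (1 / x) ^ k * exp (- (1 / x)) else 0)"

text \<open>Substituting \<open>1/x\<close> for \<open>x\<close> turns the limit from the right into
  the decay of \<open>x^k / exp x\<close> at infinity.\<close>

lemma flat_tendsto_0: "(flat k \<longlongrightarrow> 0) (at 0)"
 unfolding filterlim_at_split
proof
 show "(flat k \<longlongrightarrow> 0) (at_left 0)"
  by (rule tendsto_eventually) (auto simp: flat_def eventually_at intro!: exI[of _ 1])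
 have "((%x. x ^ k / exp x) \<longlongrightarrow> (0::real)) at_top" by (rule tendsto_power_div_exp_0)
 moreover have "\<forall>\<^sub>F x in at_top. x ^ k / exp x = flat k (inverse x)"
  using eventually_gt_at_top[of "0::real"] by eventually_elim (simp add: flat_def exp_minus field_simps)
 ultimately show "(flat k \<longlongrightarrow> 0) (at_right 0)"
  unfolding filterlim_at_right_to_top by (rule Lim_transform_eventually)
qed

text \<open>At the origin the difference quotient of \<open>flat k\<close> is
  \<open>flat (k + 1)\<close>, which tends to zero; elsewhere a single branch is valid in a
  neighbourhood.\<close>

lemma flat_deriv: "(flat k has_real_derivative (flat (k + 2) x - real k * flat (k + 1) x)) (at x)"
proof (cases "x = 0")
 case True
 have "((%y. (flat k y - flat k 0) / (y - 0)) \<longlongrightarrow> 0) (at 0)"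
 proof (rule Lim_transform_eventually[OF flat_tendsto_0[of "k + 1"]])
  show "\<forall>\<^sub>F y in at 0. flat (k + 1) y = (flat k y - flat k 0) / (y - 0)"
   by (auto simp: flat_def eventually_at intro!: exI[of _ 1])
 qed
 then show ?thesis using True by (simp add: has_field_derivative_iff flat_def)
next
 case False
 show ?thesis
 proof (cases "x > 0")
  case True
  have "((%x. (1 / x) ^ k * exp (- (1 / x))) has_real_derivative
   (flat (k + 2) x - real k * flat (k + 1) x)) (at x)"
  proof -
   have 1: "((%x. 1 / x) has_real_derivative - (1 / x^2)) (at x)"
    using True by (auto intro!: derivative_eq_intros simp: power2_eq_square)
   have 2: "((%x. exp (- (1 / x))) has_real_derivative exp (- (1 / x)) * (1 / x^2)) (at x)"
    using DERIV_chain2[OF DERIV_exp DERIV_minus[OF 1]] by simp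
   show ?thesis
    by (rule DERIV_cong[OF DERIV_mult[OF DERIV_power[OF 1, of k] 2]], cases k)
     (use True in "simp_all add: flat_def field_simps power2_eq_square")
  qed
  moreover have "\<forall>\<^sub>F y in nhds x. (1 / y) ^ k * exp (- (1 / y)) = flat k y"
   using eventually_nhds_in_open[of "{0<..}" x] True
   by (auto elim!: eventually_mono simp: flat_def)
  ultimately show ?thesis using True
   by (subst DERIV_cong_ev[OF refl _ refl, of "flat k" "%x. (1 / x) ^ k * exp (- (1 / x))"])
    (auto elim!: eventually_mono)
 next
  case neg: False
  have "((%x. 0) has_real_derivative 0) (at x)" by simp
  moreover have "\<forall>\<^sub>F y in nhds x. 0 = flat k y"
   using eventually_nhds_in_open[of "{..<0}" x] neg False
   by (auto elim!: eventually_mono simp: flat_def)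
  ultimately show ?thesis using neg
   by (subst DERIV_cong_ev[OF refl _ refl, of "flat k" "%x. 0"]) (auto elim!: eventually_mono simp: flat_def)
 qed
qed

lemma flat_Ck: "Ck_fun n (flat k)"
proof (induction n arbitrary: k)
 case 0 show ?case
  using flat_deriv by (auto intro!: continuous_at_imp_continuous_on DERIV_isCont)
next
 case (Suc n)
 have "Ck_fun n (%x. 1 * flat (k + 2) x + (- real k) * flat (k + 1) x)"
  by (intro Ck_fun_comb Suc.IH)
 then show ?case by (intro Ck_fun_SucI[OF flat_deriv]) simp
qed

text \<open>Dilation by \<open>n\<close> sends both factors to 1 inside the interval, since
  exp(-1/x) tends to 1 at infinity; these smooth functions supported in \<open>[a,b]\<close> thus
  approximate the indicator of the open interval boundedly.\<close>

definition plateau :: "real => real => nat => real => real" where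
 "plateau a b n x = flat 0 (real n * (x - a)) * flat 0 (real n * (b - x))"

lemma plateau_bounds: "0 <= plateau a b n x" "plateau a b n x <= 1"
proof -
 have *: "0 <= flat 0 y" "flat 0 y <= 1" for y by (auto simp: flat_def)
 show "0 <= plateau a b n x" "plateau a b n x <= 1"
  unfolding plateau_def using * by (auto intro: mult_le_one)
qed

lemma plateau_zero: "x \<notin> {a<..<b} ==> plateau a b n x = 0"
 by (auto simp: plateau_def flat_def zero_less_mult_iff)

lemma plateau_Ck: "Ck_fun k (plateau a b n)"
proof -
 have "Ck_fun k (%x. flat 0 (real n * x + (- real n * a)) * flat 0 ((- real n) * x + real n * b))"
  by (intro Ck_fun_mult Ck_fun_affine flat_Ck)
 then show ?thesis by (simp add: plateau_def[abs_def] algebra_simps)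
qed

lemma plateau_test: "{a..b} \<subseteq> S ==> test_fun S (plateau a b n)"
 unfolding test_fun_def
 by (intro conjI allI plateau_Ck exI[of _ "{a..b}"]) (auto intro: plateau_zero)

lemma plateau_tendsto: "(%n. plateau a b n x) ~~> indicator {a<..<b} x"
proof (cases "x \<in> {a<..<b}")
 case True
 have *: "(%n. flat 0 (real n * y)) ~~> 1" if "y > 0" for y
 proof (rule Lim_transform_eventually)
  have "(%n. exp (- (1 / y * (1 / real n)))) ~~> exp (- (1 / y * 0))"
   by (intro tendsto_intros lim_1_over_n)
  then show "(%n. exp (- (1 / y * (1 / real n)))) ~~> 1" by simp
  show "\<forall>\<^sub>F n in sequentially. exp (- (1 / y * (1 / real n))) = flat 0 (real n * y)"
   using eventually_gt_at_top[of 0] by eventually_elim (use that in "simp add: flat_def field_simps")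
 qed
 have "(%n. plateau a b n x) ~~> 1 * 1"
  unfolding plateau_def using True by (intro tendsto_mult *) auto
 then show ?thesis using True by simp
qed (simp add: plateau_zero)

lemma test_fun_continuous:
 assumes "test_fun S (ph :: real => real)"
 obtains ph' where "\<And>z. (ph has_real_derivative ph' z) (at z)" "continuous_on UNIV ph'" "continuous_on UNIV ph"
  "\<And>z. frechet_derivative ph (at z) 1 = ph' z" "\<And>k. Ck_fun k ph'"
proof -
 have C: "Ck_fun k ph" for k using assms by (simp add: test_fun_def)
 obtain ph' where d: "\<And>z. (ph has_real_derivative ph' z) (at z)" "Ck_fun 0 ph'"
  using Ck_fun_SucD[OF C[of "Suc 0"]] by blast
 have "Ck_fun k ph'" for k
 proof -
  obtain \<psi> where "\<And>z. (ph has_real_derivative \<psi> z) (at z)" "Ck_fun k \<psi>"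
   using Ck_fun_SucD[OF C[of "Suc k"]] by blast
  moreover have "ph' = \<psi>" using DERIV_unique[OF d(1) calculation(1)] by auto
  ultimately show ?thesis by simp
 qed
 moreover have "frechet_derivative ph (at z) 1 = ph' z" for z
  using frechet_derivative_real[OF d(1)] by simp
 ultimately show thesis
  by (intro that[OF d(1)] Ck_fun_continuous[OF C] Ck_fun_continuous)
qed

lemma Ck_fun_prod:
 "Ck_fun k f ==> Ck_fun k g ==> Ck_fun k (%(y::real, t::real). f y * g t :: real)"
proof (induction k arbitrary: f g)
 case 0 then show ?case
  by (auto simp: split_beta intro!: continuous_intros continuous_on_compose2[of UNIV f] continuous_on_compose2[of UNIV g])
next
 case (Suc k)
 obtain f' where f': "\<And>z. (f has_real_derivative f' z) (at z)" "Ck_fun k f'" using Ck_fun_SucD[OF Suc.prems(1)] by blast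
 obtain g' where g': "\<And>z. (g has_real_derivative g' z) (at z)" "Ck_fun k g'" using Ck_fun_SucD[OF Suc.prems(2)] by blast
 have D: "((%z. f (fst z) * g (snd z)) has_derivative (%h. f' (fst z) * fst h * g (snd z) + f (fst z) * (g' (snd z) * snd h))) (at z)" for z
 proof -
  have 1: "((%z. f (fst z)) has_derivative (%h. f' (fst z) * fst h)) (at z)"
   using f'(1)[of "fst z"] unfolding has_field_derivative_def
   by (rule has_derivative_compose[OF has_derivative_fst[OF has_derivative_ident]])
  have 2: "((%z. g (snd z)) has_derivative (%h. g' (snd z) * snd h)) (at z)"
   using g'(1)[of "snd z"] unfolding has_field_derivative_def
   by (rule has_derivative_compose[OF has_derivative_snd[OF has_derivative_ident]])
  show ?thesis using has_derivative_mult[OF 1 2] by (simp add: add.commute)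
 qed
 have F: "frechet_derivative (%z. f (fst z) * g (snd z)) (at z) = (%h. f' (fst z) * fst h * g (snd z) + f (fst z) * (g' (snd z) * snd h))" for z
  using frechet_derivative_at[OF D[of z]] by simp
 have "Ck_fun k (%(y, t). f' y * g t)" "Ck_fun k (%(y, t). f y * g' t)"
  by (intro Suc.IH f'(2) g'(2) Ck_fun_Suc_imp[OF Suc.prems(1)] Ck_fun_Suc_imp[OF Suc.prems(2)])+
 then show ?case using D unfolding split_beta' by (auto simp: F Basis_prod_def differentiable_def)
qed

lemma test_fun_prod:
 assumes "test_fun A f" "test_fun B g"
 shows "test_fun (A \<times> B) (%(y::real, t::real). f y * g t)"
proof -
 obtain K L where "compact K" "K \<subseteq> A" "\<And>z. z \<notin> K ==> f z = 0" "compact L" "L \<subseteq> B" "\<And>z. z \<notin> L ==> g z = 0"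
  using assms by (auto simp: test_fun_def)
 then show ?thesis using assms unfolding test_fun_def
  by (intro conjI allI Ck_fun_prod exI[of _ "K \<times> L"]) (auto intro: compact_Times)
qed

section \<open>The fundamental lemma of the calculus of variations\<close>

text \<open>The positive and the negative part of \<open>g\<close> are densities of finite measures
  that agree on all half-lines and therefore coincide, so the densities agree almost
  everywhere.\<close>

lemma zero_integrals_imp_zero:
 fixes g :: "real => real"
 assumes g[measurable]: "g \<in> BM" and gi: "integrable lborel (%y. indicator {0..l} y * g y)"
  and z: "\<And>a b. 0 < a ==> a < b ==> b < l ==> (LINT y|lborel. indicator {a..b} y * g y) = 0"
 shows "AE y in lborel. 0 < y & y < l --> g y = (0::real)"
proof (cases "l > 0")
 case l: True
 define G where "G y = (LINT s|lborel. indicator {0..y} s * g s)" for y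
 have ac: "ac l G g"
 proof (rule acI[OF g gi])
  fix y assume "y \<in> {0..l}"
  have "(LINT s|lborel. indicator {0..0} s * g s) = 0"
  proof (rule integral_eq_zero_AE)
   show "AE s in lborel. indicator {0..0} s * g s = 0"
    using AE_lborel_singleton[of "0::real"] by eventually_elim (simp add: indicator_def)
  qed
  then have "G 0 = 0" by (simp add: G_def)
  then show "G y = G 0 + (LINT s|lborel. indicator {0..y} s * g s)" by (simp add: G_def)
 qed
 have inner: "G y = G (l/2)" if "y \<in> {0<..<l}" for y
 proof (cases "y = l/2")
  case False
  then consider "y < l/2" | "l/2 < y" by linarith
  then show ?thesis
  proof cases
   case 1 then show ?thesis using ac_diff[OF ac, of y "l/2"] z[of y "l/2"] that by simp
  next
   case 2 then show ?thesis using ac_diff[OF ac, of "l/2" y] z[of "l/2" y] that by simp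
  qed
 next
  case True show ?thesis unfolding True ..
 qed
 \<comment> \<open>The hypothesis concerns intervals strictly inside \<open>(0,l)\<close>;
   continuity of the primitive extends it to intervals that reach the ends.\<close>
 have cl: "closure {0<..<l} = {0..l}" using l by simp
 have Gc: "G y = G (l/2)" if "y \<in> {0..l}" for y
  using ac_continuous[OF ac] inner that unfolding cl[symmetric] by (rule continuous_constant_on_closure)
 have zero: "(LINT y|lborel. indicator {a..l} y * g y) = 0" if "0 <= a" "a <= l" for a
  using ac_diff[OF ac that] Gc[of a] Gc[of l] that by simp
 define P where "P y = ennreal (indicator {0..l} y * max 0 (g y))" for y
 define N where "N y = ennreal (indicator {0..l} y * max 0 (- g y))" for y
 have [measurable]: "P \<in> BM" "N \<in> BM"
  unfolding P_def N_def by measurable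
 have fin: "integrable lborel (%y. indicator {x<..} y * (indicator {0..l} y * max 0 (g y)))"
   "integrable lborel (%y. indicator {x<..} y * (indicator {0..l} y * max 0 (- g y)))" for x
  by (rule Bochner_Integration.integrable_bound[OF gi]; auto simp: indicator_def)+
 have em: "emeasure (density lborel P) {x<..} = ennreal (LINT y|lborel. indicator {x<..} y * (indicator {0..l} y * max 0 (g y)))"
   "emeasure (density lborel N) {x<..} = ennreal (LINT y|lborel. indicator {x<..} y * (indicator {0..l} y * max 0 (- g y)))" for x
  unfolding P_def N_def
  by (subst emeasure_density; (simp add: nn_integral_eq_integral[symmetric] fin)?;
    rule nn_integral_cong; simp add: indicator_def)+
 have eq: "(LINT y|lborel. indicator {x<..} y * (indicator {0..l} y * max 0 (g y)))
   = (LINT y|lborel. indicator {x<..} y * (indicator {0..l} y * max 0 (- g y)))" for x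
 proof -
  have "(LINT y|lborel. indicator {x<..} y * (indicator {0..l} y * max 0 (g y)))
   - (LINT y|lborel. indicator {x<..} y * (indicator {0..l} y * max 0 (- g y)))
   = (LINT y|lborel. indicator {x<..} y * (indicator {0..l} y * g y))"
   by (subst Bochner_Integration.integral_diff[symmetric, OF fin]) (auto intro!: Bochner_Integration.integral_cong simp: indicator_def max_def)
  also have "... = 0"
  proof (cases "x <= l")
   case True
   have "(LINT y|lborel. indicator {x<..} y * (indicator {0..l} y * g y)) = (LINT y|lborel. indicator {max 0 x..l} y * g y)"
    by (rule integral_cong_AE) (use AE_lborel_singleton[of x] in "auto simp: indicator_def elim!: eventually_mono")
   then show ?thesis using zero[of "max 0 x"] True l by simp
  next
   case False
   then have "(%y. indicator {x<..} y * (indicator {0..l} y * g y)) = (%y. 0)" by (auto simp: indicator_def)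
   then show ?thesis by simp
  qed
  finally show ?thesis by simp
 qed
 have "density lborel P = density lborel N"
 proof (rule measure_eqI_lessThan)
  show "emeasure (density lborel P) {x<..} < \<infinity>" for x unfolding em by simp
  show "emeasure (density lborel P) {x<..} = emeasure (density lborel N) {x<..}" for x unfolding em eq ..
 qed auto
 then have "AE y in lborel. P y = N y" by (intro sigma_finite_measure.density_unique[OF lborel.sigma_finite_measure_axioms]) auto
 then show ?thesis
  by eventually_elim (auto simp: P_def N_def max_def split: if_splits)
qed auto

text \<open>Plateau functions are test functions and converge boundedly to indicators; dominated
  convergence reduces the claim to vanishing integrals over intervals.\<close>

lemma fundamental_lemma:
 fixes g :: "real => real"
 assumes g[measurable]: "g \<in> BM" and gi: "integrable lborel (%y. indicator {0..l} y * g y)"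
  and t: "\<And>ph. test_fun {0<..<l} ph ==> (LINT y|lborel. indicator {0..l} y * g y * ph y) = 0"
 shows "AE y in lborel. 0 < y & y < l --> g y = (0::real)"
proof (rule zero_integrals_imp_zero[OF g gi])
 fix a b assume ab: "0 < a" "a < b" "b < l"
 have pm: "plateau a b n \<in> BM" for n
  using Ck_fun_continuous[OF plateau_Ck] by (rule borel_measurable_continuous_onI)
 have "(%n. LINT y|lborel. indicator {0..l} y * g y * plateau a b n y) ~~> (LINT y|lborel. indicator {0..l} y * g y * indicator {a<..<b} y)"
 proof (rule integral_dominated_convergence[where w = "%y. norm (indicator {0..l} y * g y)"])
  show "AE y in lborel. (%n. indicator {0..l} y * g y * plateau a b n y) ~~> indicator {0..l} y * g y * indicator {a<..<b} y"
   by (intro AE_I2 tendsto_intros plateau_tendsto)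
  show "AE y in lborel. norm (indicator {0..l} y * g y * plateau a b n y) <= norm (indicator {0..l} y * g y)" for n
  proof (rule AE_I2)
   fix y
   have "\<bar>indicator {0..l} y * g y\<bar> * plateau a b n y <= \<bar>indicator {0..l} y * g y\<bar> * 1"
    using plateau_bounds by (intro mult_left_mono) auto
   then show "norm (indicator {0..l} y * g y * plateau a b n y) <= norm (indicator {0..l} y * g y)"
    using plateau_bounds(1)[of a b n y] by (simp add: abs_mult)
  qed
 qed (use gi pm in auto)
 moreover have "(LINT y|lborel. indicator {0..l} y * g y * plateau a b n y) = 0" for n
  using ab by (intro t plateau_test) auto
 ultimately have "(LINT y|lborel. indicator {0..l} y * g y * indicator {a<..<b} y) = 0"
  by (simp add: LIMSEQ_const_iff)
 moreover have "(LINT y|lborel. indicator {0..l} y * g y * indicator {a<..<b} y) = (LINT y|lborel. indicator {a..b} y * g y)"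
 proof (rule integral_cong_AE)
  show "AE y in lborel. indicator {0..l} y * g y * indicator {a<..<b} y = indicator {a..b} y * g y"
   using AE_lborel_singleton[of a] AE_lborel_singleton[of b]
   by eventually_elim (use ab in "auto simp: indicator_def")
 qed auto
 ultimately show "(LINT y|lborel. indicator {a..b} y * g y) = 0" by simp
qed

lemma integrable_mult_continuous:
 fixes l :: real
 assumes a: "a \<in> BM" "integrable lborel (%s. indicator {0..l} s * a s)"
  and v: "continuous_on {0..l} v"
 shows "integrable lborel (%s. indicator {0..l} s * (a s * v s :: real))"
proof -
 have "bounded (v ` {0..l})" by (intro compact_imp_bounded compact_continuous_image v) simp
 then obtain K where K: "\<And>y. y \<in> {0..l} ==> \<bar>v y\<bar> <= K" unfolding bounded_iff by (metis imageI real_norm_def)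
 have vm: "(%s. indicator {0..l} s *\<^sub>R v s) \<in> BM"
  using v by (intro borel_measurable_continuous_on_indicator) auto
 have eq: "(%s. indicator {0..l} s * (a s * v s)) = (%s. a s * (indicator {0..l} s *\<^sub>R v s))"
  by (auto simp: indicator_def)
 show ?thesis
 proof (rule Bochner_Integration.integrable_bound)
  show "integrable lborel (%s. K * (indicator {0..l} s * a s))" using a by simp
  show "(%s. indicator {0..l} s * (a s * v s)) \<in> borel_measurable lborel"
   unfolding eq using a(1) vm by simp
  show "AE s in lborel. norm (indicator {0..l} s * (a s * v s)) <= norm (K * (indicator {0..l} s * a s))"
  proof (rule AE_I2)
   fix s show "norm (indicator {0..l} s * (a s * v s)) <= norm (K * (indicator {0..l} s * a s))"
   proof (cases "s \<in> {0..l}")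
    case True
    then have "\<bar>a s\<bar> * \<bar>v s\<bar> <= \<bar>a s\<bar> * \<bar>K\<bar>" using K[of s] by (intro mult_left_mono) auto
    then show ?thesis using True by (simp add: abs_mult mult.commute)
   qed simp
  qed
 qed
qed

lemma ac_by_parts:
 assumes u: "ac l u a" and v: "ac l v b" and l: "0 <= l"
 shows "(LINT s|lborel. indicator {0..l} s * (u s * b s)) = u l * v l - u 0 * v 0 - (LINT s|lborel. indicator {0..l} s * (a s * v s))"
proof -
 have i: "integrable lborel (%s. indicator {0..l} s * (a s * v s))" "integrable lborel (%s. indicator {0..l} s * (b s * u s))"
  by (intro integrable_mult_continuous ac_borel[OF u] ac_borel[OF v] ac_integrable[OF u] ac_integrable[OF v]
    ac_continuous[OF u] ac_continuous[OF v])+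
 have "u l * v l - u 0 * v 0 = (LINT s|lborel. indicator {0..l} s * (indicator {0..l} s * (a s * v s + u s * b s)))"
  using ac_diff[OF ac_mult[OF u v], of 0 l] l by simp
 also have "... = (LINT s|lborel. indicator {0..l} s * (a s * v s) + indicator {0..l} s * (b s * u s))"
  by (intro Bochner_Integration.integral_cong) (auto simp: indicator_def)
 also have "... = (LINT s|lborel. indicator {0..l} s * (a s * v s)) + (LINT s|lborel. indicator {0..l} s * (b s * u s))"
  by (rule Bochner_Integration.integral_add[OF i])
 finally show ?thesis by (simp add: mult.commute)
qed

lemma integral_open_closed:
 fixes l :: real
 shows "f \<in> BM ==> (LINT y|lborel. indicator {0<..<l} y * f y) = (LINT y|lborel. indicator {0..l} y * (f y :: real))"
proof (rule integral_cong_AE)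
 show "AE y in lborel. indicator {0<..<l} y * f y = indicator {0..l} y * f y"
  using AE_lborel_singleton[of 0] AE_lborel_singleton[of l] by eventually_elim (auto simp: indicator_def)
qed auto

lemma integrable_open_closed:
 fixes l :: real
 shows "f \<in> BM ==> integrable lborel (%y. indicator {0<..<l} y * f y) \<longleftrightarrow> integrable lborel (%y. indicator {0..l} y * (f y :: real))"
proof (rule integrable_cong_AE)
 show "AE y in lborel. indicator {0<..<l} y * f y = indicator {0..l} y * f y"
  using AE_lborel_singleton[of 0] AE_lborel_singleton[of l] by eventually_elim (auto simp: indicator_def)
qed auto

text \<open>A primitive is constant on either side of the support of \<eta>; normalised to vanish on
  the left, it vanishes on the right because \<eta> has mean zero.\<close>

lemma test_fun_antiderivative:
 assumes \<eta>: "test_fun {0<..<l} \<eta>" and z: "(LINT y|lborel. indicator {0..l} y * \<eta> y) = 0"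
 shows "\<exists>ph. test_fun {0<..<l} ph & (\<forall>y. (ph has_real_derivative \<eta> y) (at y))"
proof -
 obtain K where K: "compact K" "K \<subseteq> {0<..<l}" "\<And>z. z \<notin> K ==> \<eta> z = 0" and C: "\<And>k. Ck_fun k \<eta>"
  using \<eta> by (auto simp: test_fun_def)
 show ?thesis
 proof (cases "K = {}")
  case True
  then have "\<eta> = (%y. 0)" using K(3) by auto
  then show ?thesis using \<eta> by (intro exI[of _ "%y. 0"]) simp
 next
  case False
  obtain a where a: "a \<in> K" "\<And>t. t \<in> K ==> a <= t" using compact_attains_inf[OF K(1) False] by blast
  obtain b where b: "b \<in> K" "\<And>t. t \<in> K ==> t <= b" using compact_attains_sup[OF K(1) False] by blast
  have cont: "continuous_on UNIV \<eta>" by (rule Ck_fun_continuous[OF C])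
  then have "\<exists>F. \<forall>x::real. -\<infinity> < ereal x --> ereal x < \<infinity> --> (F has_vector_derivative \<eta> x) (at x)"
   by (intro einterval_antiderivative) (auto simp: continuous_on_eq_continuous_at)
  then obtain F where F: "\<And>x. (F has_real_derivative \<eta> x) (at x)"
   by (auto simp: has_real_derivative_iff_has_vector_derivative)
  have left: "F x = F a" if "x <= a" for x
  proof (cases "x = a")
   case False
   then have "x < a" using that by simp
   from MVT2[OF this F] obtain z where "x < z" "z < a" "F a - F x = (a - x) * \<eta> z" by auto
   then show ?thesis using K(3)[of z] a(2)[of z] by force
  qed simp
  have right: "F x = F b" if "b <= x" for x
  proof (cases "x = b")
   case False
   then have "b < x" using that by simp
   from MVT2[OF this F] obtain z where "b < z" "z < x" "F x - F b = (x - b) * \<eta> z" by auto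
   then show ?thesis using K(3)[of z] b(2)[of z] by force
  qed simp
  have ab: "0 < a" "a <= b" "b < l" using a b K(2) by auto
  have "F l - F 0 = (LINT y|lborel. indicator {0..l} y *\<^sub>R \<eta> y)"
   using ab F by (intro integral_FTC_atLeastAtMost[symmetric])
    (auto simp: has_real_derivative_iff_has_vector_derivative intro: continuous_on_subset[OF cont] has_vector_derivative_at_within)
  then have Fab: "F a = F b" using z left[of 0] right[of l] ab by simp
  define ph where "ph x = F x - F a" for x
  have D: "(ph has_real_derivative \<eta> y) (at y)" for y
   unfolding ph_def by (auto intro!: derivative_eq_intros F)
  have "Ck_fun k ph" for k
  proof (cases k)
   case 0 then show ?thesis using D by (auto intro!: continuous_at_imp_continuous_on DERIV_isCont)
  next
   case (Suc j) then show ?thesis using Ck_fun_SucI[OF D C] by simp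
  qed
  moreover have "ph z = 0" if "z \<notin> {a..b}" for z using that left[of z] right[of z] Fab by (auto simp: ph_def)
  ultimately have "test_fun {0<..<l} ph" unfolding test_fun_def using ab by (auto intro!: exI[of _ "{a..b}"])
  then show ?thesis using D by blast
 qed
qed

lemma test_fun_ac:
 assumes "test_fun {0<..<l} ph" "\<And>y. (ph has_real_derivative ph' y) (at y)" "continuous_on UNIV ph'"
 shows "ac l ph ph'" "ph 0 = 0" "ph l = 0"
proof -
 have "ac l ph (%y. indicator {0..l} y * ph' y)"
  by (rule ac_deriv) (auto intro: DERIV_subset[OF assms(2)] continuous_on_subset[OF assms(3)])
 then show "ac l ph ph'"
  by (rule ac_cong_AE) (auto intro: borel_measurable_continuous_onI assms)
 show "ph 0 = 0" "ph l = 0" using assms(1) by (auto simp: test_fun_def)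
qed

lemma ac_test:
 assumes u: "ac l u d" and l: "0 <= l" and ph: "test_fun {0<..<l} ph" "\<And>y. (ph has_real_derivative ph' y) (at y)" "continuous_on UNIV ph'"
 shows "(LINT s|lborel. indicator {0..l} s * (u s * ph' s)) = - (LINT s|lborel. indicator {0..l} s * (d s * ph s))"
 using ac_by_parts[OF u test_fun_ac(1)[OF ph] l] test_fun_ac(2,3)[OF ph] by simp

lemma integrable_of_square:
 assumes "d \<in> BM" "integrable lborel (%s. indicator {0..l} s * (d s)^2)"
 shows "integrable lborel (%s. indicator {0..l::real} s * (d s :: real))"
proof (rule Bochner_Integration.integrable_bound)
 show "integrable lborel (%s. indicator {0..l} s + indicator {0..l} s * (d s)^2)"
  using assms(2) by (cases "0 <= l") (auto intro!: Bochner_Integration.integrable_add integrable_real_indicator)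
 show "AE s in lborel. norm (indicator {0..l} s * d s) <= norm (indicator {0..l} s + indicator {0..l} s * (d s)^2)"
 proof (rule AE_I2)
  fix s
  have "\<bar>1 * d s\<bar> <= 1^2 + (d s)^2" by (rule abs_mult_le_squares)
  then show "norm (indicator {0..l} s * d s) <= norm (indicator {0..l} s + indicator {0..l} s * (d s)^2)"
   by (simp add: indicator_def)
 qed
qed (use assms in simp)

text \<open>The points of disagreement inside the interval form an open null set, which is empty;
  the ends follow by continuity. This is how values at vertices are recovered from statements that
  hold almost everywhere.\<close>

lemma continuous_AE_eq:
 fixes u v :: "real => real"
 assumes "continuous_on {0..l} u" "continuous_on {0..l} v" "AE y in lborel. 0 < y & y < l --> u y = v y" "0 < l" "y \<in> {0..l}"
 shows "u y = v y"
proof -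
 have inner: "u y - v y = 0" if "y \<in> {0<..<l}" for y
 proof (rule ccontr)
  assume ne: "u y - v y \<noteq> 0"
  define U where "U = (%y. u y - v y) -` (- {0}) \<inter> {0<..<l}"
  have "continuous_on {0<..<l} (%y. u y - v y)"
   by (intro continuous_intros continuous_on_subset[OF assms(1)] continuous_on_subset[OF assms(2)]) auto
  then have "open U" unfolding U_def
   by (subst (asm) continuous_on_open_vimage) (auto simp: open_Compl)
  moreover have "y \<in> U" using ne that by (simp add: U_def)
  moreover have "negligible U"
  proof -
   have "AE y in lebesgue. y \<notin> U"
    using AE_completion[OF assms(3)] by eventually_elim (auto simp: U_def)
   moreover have "U \<in> sets lebesgue" using \<open>open U\<close> by auto
   ultimately show ?thesis by (simp add: negligible_iff_null_sets AE_iff_null_sets)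
  qed
  ultimately show False using open_not_negligible by blast
 qed
 show ?thesis
  using continuous_constant_on_closure[of "{0<..<l}" "%y. u y - v y" 0 y] inner assms
  by (auto intro!: continuous_intros)
qed

lemma ac_unique:
 assumes "ac l u a" "ac l u b"
 shows "AE y in lborel. 0 < y & y < l --> a y = b y"
proof -
 have c: "ac l (%y. 1 * u y + (-1) * u y) (%y. 1 * a y + (-1) * b y)" by (rule ac_comb[OF assms])
 have "AE y in lborel. 0 < y & y < l --> 1 * a y + (-1) * b y = 0"
  by (rule zero_integrals_imp_zero[OF ac_borel[OF c] ac_integrable[OF c]])
   (use ac_diff[OF c] in "simp add: less_imp_le")
 then show ?thesis by eventually_elim auto
qed

section \<open>Weak derivatives on an interval\<close>

text \<open>An element of \<open>H^1(0,l)\<close> with chosen representatives: \<open>v\<close> is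
  any member of the class, \<open>u\<close> its absolutely continuous version and \<open>d\<close> a
  Borel version of the derivative.\<close>

definition H1_rep :: "real => (real => real) => (real => real) => (real => real) => bool" where
 "H1_rep l v u d \<longleftrightarrow> ac l u d & integrable lborel (%s. indicator {0..l} s * (d s)^2) \<and>
  (AE y in lborel. 0 < y & y < l --> v y = u y)"

lemma H1_rep_weak_deriv:
 assumes r: "H1_rep l v u d" and l: "0 <= l" and g: "AE y in lborel. 0 < y & y < l --> g y = d y"
 shows "has_weak_deriv {0<..<l} 1 v g"
proof -
 have ac: "ac l u d" and d2: "integrable lborel (%s. indicator {0..l} s * (d s)^2)"
  and vu: "AE y in lborel. 0 < y & y < l --> v y = u y" using r by (auto simp: H1_rep_def)
 define U where "U y = indicator {0..l} y *\<^sub>R u y" for y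
 have Um[measurable]: "U \<in> BM"
  unfolding U_def using ac_continuous[OF ac] by (intro borel_measurable_continuous_on_indicator) auto
 have dm[measurable]: "d \<in> BM" by (rule ac_borel[OF ac])
 have vU: "AE y in lborel. y \<in> {0<..<l} --> v y = U y" using vu by eventually_elim (auto simp: U_def)
 have gd: "AE y in lborel. y \<in> {0<..<l} --> g y = d y" using g by eventually_elim auto
 have S: "{0<..<l} \<in> sets borel" by simp
 have "set_integrable lborel {0..l} (%y. (u y)^2)"
  by (intro borel_integrable_atLeastAtMost' continuous_intros ac_continuous[OF ac])
 moreover have "(%y. indicator {0..l} y *\<^sub>R (u y)^2) = (%y. indicator {0..l} y * (U y)^2)"
  by (auto simp: U_def indicator_def)
 ultimately have U2: "integrable lborel (%y. indicator {0..l} y * (U y)^2)"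
  by (simp add: set_integrable_def)
 have 1: "L2_on {0<..<l} v" using U2 by (subst L2_on_AE[OF S Um vU], subst integrable_open_closed) auto
 have 2: "L2_on {0<..<l} g" using d2 by (subst L2_on_AE[OF S dm gd], subst integrable_open_closed) auto
 have 3: "(LINT z|lebesgue_on {0<..<l}. v z * frechet_derivative ph (at z) 1) = - (LINT z|lebesgue_on {0<..<l}. g z * ph z)"
  if ph: "test_fun {0<..<l} ph" for ph
 proof -
  obtain ph' where D: "\<And>z. (ph has_real_derivative ph' z) (at z)" "continuous_on UNIV ph'" "continuous_on UNIV ph"
   "\<And>z. frechet_derivative ph (at z) 1 = ph' z" using test_fun_continuous[OF ph] by metis
  have [measurable]: "ph' \<in> BM" "ph \<in> BM"
   using D by (auto intro: borel_measurable_continuous_onI)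
  have "(LINT z|lebesgue_on {0<..<l}. v z * frechet_derivative ph (at z) 1) = (LINT z|lborel. indicator {0<..<l} z * (U z * ph' z))"
   by (rule integrable_lebesgue_on_AE(2)[OF S]) (use vU in "auto simp: D(4)")
  also have "... = (LINT z|lborel. indicator {0..l} z * (U z * ph' z))" by (rule integral_open_closed) measurable
  also have "... = (LINT z|lborel. indicator {0..l} z * (u z * ph' z))"
   by (intro Bochner_Integration.integral_cong) (auto simp: U_def indicator_def)
  also have "... = - (LINT z|lborel. indicator {0..l} z * (d z * ph z))" by (rule ac_test[OF ac l ph D(1,2)])
  also have "(LINT z|lborel. indicator {0..l} z * (d z * ph z)) = (LINT z|lborel. indicator {0<..<l} z * (d z * ph z))"
   by (rule integral_open_closed[symmetric]) measurable
  also have "... = (LINT z|lebesgue_on {0<..<l}. g z * ph z)"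
   by (rule integrable_lebesgue_on_AE(2)[OF S, symmetric]) (use gd in auto)
  finally show ?thesis .
 qed
 show ?thesis unfolding has_weak_deriv_def using 1 2 3 by blast
qed

text \<open>The lemma of du Bois-Reymond: \<open>v\<close> minus a primitive of \<open>g\<close>
  annihilates all derivatives of test functions, and every test function is such a derivative up to
  a multiple of one fixed bump; hence the difference is constant.\<close>

lemma weak_deriv_H1_rep:
 assumes w: "has_weak_deriv {0<..<l} 1 v g" and l: "0 < l"
 shows "\<exists>u d. H1_rep l v u d & (AE y in lborel. 0 < y & y < l --> g y = d y)"
proof -
 have S: "{0<..<l} \<in> sets borel" by simp
 have L: "L2_on {0<..<l} v" "L2_on {0<..<l} g" using w by (auto simp: has_weak_deriv_def)
 obtain v0 where v0[measurable]: "v0 \<in> BM" and v0e: "AE y in lborel. y \<in> {0<..<l} --> v y = v0 y"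
  using borel_version[OF S] L by (auto simp: L2_on_def)
 obtain d where d[measurable]: "d \<in> BM" and de: "AE y in lborel. y \<in> {0<..<l} --> g y = d y"
  using borel_version[OF S] L by (auto simp: L2_on_def)
 have v2: "integrable lborel (%y. indicator {0..l} y * (v0 y)^2)"
  using L(1) by (subst (asm) L2_on_AE[OF S v0 v0e], subst (asm) integrable_open_closed) auto
 have d2: "integrable lborel (%y. indicator {0..l} y * (d y)^2)"
  using L(2) by (subst (asm) L2_on_AE[OF S d de], subst (asm) integrable_open_closed) auto
 define P where "P y = (LINT s|lborel. indicator {0..y} s * d s)" for y
 have acP: "ac l P d"
 proof (rule acI[OF d integrable_of_square[OF d d2]])
  fix y assume "y \<in> {0..l}"
  have "(LINT s|lborel. indicator {0..0} s * d s) = 0"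
  proof (rule integral_eq_zero_AE)
   show "AE s in lborel. indicator {0..0} s * d s = 0"
    using AE_lborel_singleton[of "0::real"] by eventually_elim (simp add: indicator_def)
  qed
  then show "P y = P 0 + (LINT s|lborel. indicator {0..y} s * d s)" by (simp add: P_def)
 qed
 define Q where "Q y = indicator {0..l} y *\<^sub>R P y" for y
 have Qm[measurable]: "Q \<in> BM"
  unfolding Q_def using ac_continuous[OF acP] by (intro borel_measurable_continuous_on_indicator) auto
 define r where "r y = v0 y - Q y" for y
 have rm[measurable]: "r \<in> BM" unfolding r_def by measurable
 have Qi: "integrable lborel (%y. indicator {0..l} y * Q y)"
 proof -
  have "set_integrable lborel {0..l} P" by (intro borel_integrable_atLeastAtMost' ac_continuous[OF acP])
  moreover have "(%y. indicator {0..l} y *\<^sub>R P y) = (%y. indicator {0..l} y * Q y)"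
   by (auto simp: Q_def indicator_def)
  ultimately show ?thesis by (simp add: set_integrable_def)
 qed
 have ri: "integrable lborel (%y. indicator {0..l} y * r y)"
  using Bochner_Integration.integrable_diff[OF integrable_of_square[OF v0 v2] Qi] by (simp add: r_def right_diff_distrib)
 have rint: "integrable lborel (%y. indicator {0..l} y * (r y * \<psi> y))" if "continuous_on UNIV \<psi>" for \<psi>
  by (rule integrable_mult_continuous[OF rm ri]) (rule continuous_on_subset[OF that], simp)
 have orth: "(LINT y|lborel. indicator {0..l} y * (r y * ph' y)) = 0"
  if ph: "test_fun {0<..<l} ph" and D: "\<And>y. (ph has_real_derivative ph' y) (at y)" for ph ph'
 proof -
  obtain \<psi> where D': "\<And>z. (ph has_real_derivative \<psi> z) (at z)" "continuous_on UNIV \<psi>" "continuous_on UNIV ph"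
   "\<And>z. frechet_derivative ph (at z) 1 = \<psi> z" using test_fun_continuous[OF ph] by metis
  have [simp]: "\<psi> = ph'" using DERIV_unique[OF D D'(1)] by auto
  note D2 = D'(2)[simplified] D'(4)[simplified]
  have [measurable]: "ph' \<in> BM" "ph \<in> BM"
   using D2 D'(3) by (auto intro: borel_measurable_continuous_onI)
  have "(LINT z|lborel. indicator {0..l} z * (v0 z * ph' z)) = (LINT z|lborel. indicator {0<..<l} z * (v0 z * ph' z))"
   by (rule integral_open_closed[symmetric]) measurable
  also have "... = (LINT z|lebesgue_on {0<..<l}. v z * frechet_derivative ph (at z) 1)"
   by (rule integrable_lebesgue_on_AE(2)[OF S, symmetric]) (use v0e in "auto simp: D2")
  also have "... = - (LINT z|lebesgue_on {0<..<l}. g z * ph z)" using w ph by (auto simp: has_weak_deriv_def)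
  also have "(LINT z|lebesgue_on {0<..<l}. g z * ph z) = (LINT z|lborel. indicator {0<..<l} z * (d z * ph z))"
   by (rule integrable_lebesgue_on_AE(2)[OF S]) (use de in auto)
  also have "... = (LINT z|lborel. indicator {0..l} z * (d z * ph z))" by (rule integral_open_closed) measurable
  also have "- ... = (LINT z|lborel. indicator {0..l} z * (P z * ph' z))"
   using ac_test[OF acP _ ph D D2(1)] l by simp
  also have "... = (LINT z|lborel. indicator {0..l} z * (Q z * ph' z))"
   by (intro Bochner_Integration.integral_cong) (auto simp: Q_def indicator_def)
  finally have e: "(LINT z|lborel. indicator {0..l} z * (v0 z * ph' z)) = (LINT z|lborel. indicator {0..l} z * (Q z * ph' z))" .
  have c: "continuous_on {0..l} ph'" by (rule continuous_on_subset[OF D2(1)]) simp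
  have "(LINT y|lborel. indicator {0..l} y * (r y * ph' y)) = (LINT z|lborel. indicator {0..l} z * (v0 z * ph' z)) - (LINT z|lborel. indicator {0..l} z * (Q z * ph' z))"
   using integrable_mult_continuous[OF v0 integrable_of_square[OF v0 v2] c] integrable_mult_continuous[OF Qm Qi c]
   by (subst Bochner_Integration.integral_diff[symmetric]) (auto simp: r_def algebra_simps)
  then show ?thesis using e by simp
 qed
 \<comment> \<open>A bump of nonzero mean: subtracting a suitable multiple of it from a test
   function leaves one of mean zero, which has a compactly supported primitive.\<close>
 define \<kappa> where "\<kappa> = plateau (l/3) (2*l/3) 1"
 have \<kappa>: "test_fun {0<..<l} \<kappa>" unfolding \<kappa>_def using l by (intro plateau_test) auto
 have ti: "integrable lborel (%y. indicator {0..l} y * \<psi> y)" "continuous_on UNIV \<psi>" "\<psi> \<in> BM"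
  if "test_fun {0<..<l} \<psi>" for \<psi> :: "real => real"
 proof -
  have c: "continuous_on UNIV \<psi>" using that Ck_fun_continuous unfolding test_fun_def by blast
  have "set_integrable lborel {0..l} \<psi>" by (intro borel_integrable_atLeastAtMost' continuous_on_subset[OF c]) simp
  then show "integrable lborel (%y. indicator {0..l} y * \<psi> y)" by (simp add: set_integrable_def)
  show "continuous_on UNIV \<psi>" by (rule c)
  then show "\<psi> \<in> BM" by (rule borel_measurable_continuous_onI)
 qed
 define c where "c = (LINT y|lborel. indicator {0..l} y * \<kappa> y)"
 have c: "c > 0"
 proof -
  have "c \<noteq> 0"
  proof
   assume "c = 0"
   then have "AE y in lborel. indicator {0..l} y * \<kappa> y = 0"
    unfolding c_def using ti(1)[OF \<kappa>] plateau_bounds(1)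
    by (subst (asm) integral_nonneg_eq_0_iff_AE) (auto simp: \<kappa>_def)
   then have "AE y in lborel. 0 < y & y < l --> \<kappa> y = 0" by eventually_elim auto
   then have "\<kappa> (l/2) = 0"
    using l by (intro continuous_AE_eq[of l \<kappa> "%y. 0"]) (auto intro: continuous_on_subset[OF ti(2)[OF \<kappa>]])
   then show False using l by (simp add: \<kappa>_def plateau_def flat_def)
  qed
  moreover have "c >= 0" unfolding c_def \<kappa>_def by (rule integral_nonneg_AE) (simp add: plateau_bounds)
  ultimately show ?thesis by simp
 qed
 \<comment> \<open>If \<open>r\<close> is constant, this average against \<kappa> is its
   value.\<close>
 define C where "C = (LINT y|lborel. indicator {0..l} y * (r y * \<kappa> y)) / c"
 have "AE y in lborel. 0 < y & y < l --> r y - C = 0"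
 proof (rule fundamental_lemma)
  show "(%y. r y - C) \<in> BM" by measurable
  show Ci: "integrable lborel (%y. indicator {0..l} y * (r y - C))"
   using Bochner_Integration.integrable_diff[OF ri, of "%y. indicator {0..l} y * C"] l
   by (simp add: right_diff_distrib integrable_real_indicator)
  fix ph assume ph: "test_fun {0<..<l} ph"
  define m where "m = (LINT y|lborel. indicator {0..l} y * ph y)"
  define \<eta> where "\<eta> y = 1 * ph y + (- (m / c)) * \<kappa> y" for y
  have \<eta>: "test_fun {0<..<l} \<eta>"
  proof -
   obtain K L where "compact K" "K \<subseteq> {0<..<l}" "\<And>z. z \<notin> K ==> ph z = 0" "compact L" "L \<subseteq> {0<..<l}" "\<And>z. z \<notin> L ==> \<kappa> z = 0"
    using ph \<kappa> by (auto simp: test_fun_def)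
   moreover have "Ck_fun k \<eta>" for k using ph \<kappa> unfolding \<eta>_def[abs_def] test_fun_def by (intro Ck_fun_comb) auto
   ultimately show ?thesis unfolding test_fun_def by (intro conjI allI exI[of _ "K \<union> L"]) (auto simp: \<eta>_def)
  qed
  have "(LINT y|lborel. indicator {0..l} y * \<eta> y) = (LINT y|lborel. indicator {0..l} y * ph y - (m / c) * (indicator {0..l} y * \<kappa> y))"
   by (intro Bochner_Integration.integral_cong) (auto simp: \<eta>_def algebra_simps)
  also have "... = m - (m / c) * c" using ti(1)[OF ph] ti(1)[OF \<kappa>] by (simp add: m_def c_def)
  finally have "(LINT y|lborel. indicator {0..l} y * \<eta> y) = 0" using c by simp
  from test_fun_antiderivative[OF \<eta> this] orth
  have "0 = (LINT y|lborel. indicator {0..l} y * (r y * \<eta> y))" by metis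
  also have "... = (LINT y|lborel. indicator {0..l} y * (r y * ph y) - (m / c) * (indicator {0..l} y * (r y * \<kappa> y)))"
   by (intro Bochner_Integration.integral_cong) (auto simp: \<eta>_def algebra_simps)
  also have "... = (LINT y|lborel. indicator {0..l} y * (r y * ph y)) - m * C"
   using rint[OF ti(2)[OF ph]] rint[OF ti(2)[OF \<kappa>]] by (simp add: C_def)
  also have "... = (LINT y|lborel. indicator {0..l} y * (r y * ph y) - C * (indicator {0..l} y * ph y))"
   using rint[OF ti(2)[OF ph]] ti(1)[OF ph] by (simp add: m_def)
  also have "... = (LINT y|lborel. indicator {0..l} y * (r y - C) * ph y)"
   by (intro Bochner_Integration.integral_cong) (auto simp: algebra_simps)
  finally show "(LINT y|lborel. indicator {0..l} y * (r y - C) * ph y) = 0" by simp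
 qed
 then have rC: "AE y in lborel. 0 < y & y < l --> v y = P y + C"
  using v0e by eventually_elim (auto simp: r_def Q_def)
 have "ac l (%y. 1 * P y + C * 1) (%y. 1 * d y + C * 0)" by (rule ac_comb[OF acP ac_const])
 then have "ac l (%y. P y + C) d" by simp
 then have "H1_rep l v (%y. P y + C) d" using rC d2 by (auto simp: H1_rep_def)
 moreover have "AE y in lborel. 0 < y & y < l --> g y = d y" using de by eventually_elim auto
 ultimately show ?thesis by blast
qed

lemma H1_rep_unique:
 assumes "H1_rep l v u d" "H1_rep l v u' d'" "0 < l"
 shows "y \<in> {0..l} ==> u y = u' y" "AE y in lborel. 0 < y & y < l --> d y = d' y"
proof -
 have "AE y in lborel. 0 < y & y < l --> v y = u y" "AE y in lborel. 0 < y & y < l --> v y = u' y"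
  using assms by (auto simp: H1_rep_def)
 then have "AE y in lborel. 0 < y & y < l --> u y = u' y" by eventually_elim auto
 then show eq: "u y = u' y" if "y \<in> {0..l}" for y
  using assms that by (intro continuous_AE_eq[of l u u']) (auto simp: H1_rep_def intro: ac_continuous)
 have a: "ac l u d" "ac l u' d'" using assms by (auto simp: H1_rep_def)
 have "ac l u d'"
 proof (rule ac_cong_AE[OF a(2) ac_borel[OF a(2)]])
  show "u' y = u y" if "y \<in> {0..l}" for y by (rule eq[OF that, symmetric])
 qed simp
 with a show "AE y in lborel. 0 < y & y < l --> d y = d' y" by (intro ac_unique)
qed

text \<open>Whatever representative \<open>SOME\<close> picks is itself a weak derivative, hence
  equal almost everywhere to any other one.\<close>

lemma weak_deriv_AE:
 assumes r: "H1_rep l v u d" and l: "0 < l"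
 shows "AE y in lborel. 0 < y & y < l --> weak_deriv l v y = d y"
proof -
 have "has_weak_deriv {0<..<l} 1 v d" using H1_rep_weak_deriv[OF r] l by simp
 then have "has_weak_deriv {0<..<l} 1 v (weak_deriv l v)" unfolding weak_deriv_def by (rule someI[of "has_weak_deriv {0<..<l} 1 v"])
 from weak_deriv_H1_rep[OF this l] obtain u' d' where r': "H1_rep l v u' d'"
  and e: "AE y in lborel. 0 < y & y < l --> weak_deriv l v y = d' y" by blast
 show ?thesis using H1_rep_unique(2)[OF r r' l] e by eventually_elim auto
qed

lemma sobolev_1: 
 assumes "0 < l" shows "sobolev 1 l v \<longleftrightarrow> (\<exists>u d. H1_rep l v u d)"
proof
 assume "sobolev 1 l v"
 then obtain g where "has_weak_deriv {0<..<l} 1 v g" by auto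
 then show "\<exists>u d. H1_rep l v u d" using weak_deriv_H1_rep[OF _ assms] by blast
next
 assume "\<exists>u d. H1_rep l v u d"
 then obtain u d where "H1_rep l v u d" by blast
 then have "has_weak_deriv {0<..<l} 1 v d" using H1_rep_weak_deriv assms by simp
 then show "sobolev 1 l v" by (auto simp: has_weak_deriv_def)
qed

lemma sobolev_2:
 assumes "0 < l" "H1_rep l v u d" "H1_rep l d d' d''"
 shows "sobolev 2 l v" "AE y in lborel. 0 < y & y < l --> weak_deriv l (weak_deriv l v) y = d'' y"
proof -
 have w: "AE y in lborel. 0 < y & y < l --> weak_deriv l v y = d y" by (rule weak_deriv_AE[OF assms(2,1)])
 have 2: "has_weak_deriv {0<..<l} 1 d d''" using H1_rep_weak_deriv[OF assms(3)] assms(1) by simp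
 then have "sobolev (Suc 0) l d" by (auto simp: has_weak_deriv_def)
 moreover have "has_weak_deriv {0<..<l} 1 v d" using H1_rep_weak_deriv[OF assms(2)] assms(1) by simp
 ultimately show "sobolev 2 l v" by (auto simp: numeral_2_eq_2)
 have "AE y in lborel. 0 < y & y < l --> d y = d' y" using assms(3) by (simp add: H1_rep_def)
 with w have "AE y in lborel. 0 < y & y < l --> weak_deriv l v y = d' y" by eventually_elim auto
 then have "H1_rep l (weak_deriv l v) d' d''"
  using assms(3) unfolding H1_rep_def by blast
 then show "AE y in lborel. 0 < y & y < l --> weak_deriv l (weak_deriv l v) y = d'' y"
  by (rule weak_deriv_AE[OF _ assms(1)])
qed

section \<open>Eigenfunction expansions for a form with compact resolvent\<close>

text \<open>The space consists of functions and not of classes, so the form is only semidefinite and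
  no quotient is taken. Special coefficients in \<open>comb\<close> and \<open>comb_left\<close>
  give sums, differences and multiples.\<close>

locale psd_form =
 fixes S :: "('x => real) set" and B :: "('x => real) => ('x => real) => real"
 assumes zero: "(%x. 0) \<in> S"
  and comb: "u \<in> S ==> v \<in> S ==> (%x. a * u x + c * v x) \<in> S"
  and sym: "u \<in> S ==> v \<in> S ==> B u v = B v u"
  and comb_left: "u \<in> S ==> v \<in> S ==> w \<in> S ==> B (%x. a * u x + c * v x) w = a * B u w + c * B v w"
  and nonneg: "u \<in> S ==> 0 <= B u u"
begin

lemma add_in: "u \<in> S ==> v \<in> S ==> (%x. u x + v x) \<in> S" using comb[of u v 1 1] by simp
lemma diff_in: "u \<in> S ==> v \<in> S ==> (%x. u x - v x) \<in> S" using comb[of u v 1 "-1"] by simp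
lemma scale_in: "u \<in> S ==> (%x. a * u x) \<in> S" using comb[of u u a 0] by simp

lemma scale_left: "u \<in> S ==> w \<in> S ==> B (%x. a * u x) w = a * B u w"
 using comb_left[of u u w a 0] by simp
lemma add_left: "u \<in> S ==> v \<in> S ==> w \<in> S ==> B (%x. u x + v x) w = B u w + B v w"
 using comb_left[of u v w 1 1] by simp
lemma diff_left: "u \<in> S ==> v \<in> S ==> w \<in> S ==> B (%x. u x - v x) w = B u w - B v w"
 using comb_left[of u v w 1 "-1"] by simp
lemma zero_left: "w \<in> S ==> B (%x. 0) w = 0"
 using scale_left[OF zero, of w 0] by simp

lemma sum_in: "(\<And>i. i \<in> I ==> e i \<in> S) ==> (%x. \<Sum>i\<in>I. a i * e i x) \<in> S"
 by (induction I rule: infinite_finite_induct) (auto simp: zero intro!: add_in scale_in)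

lemma sum_left:
 assumes "\<And>i. i \<in> I ==> e i \<in> S" "w \<in> S"
 shows "B (%x. \<Sum>i\<in>I. a i * e i x) w = (\<Sum>i\<in>I. a i * B (e i) w)"
 using assms(1)
proof (induction I rule: infinite_finite_induct)
 case (insert j I)
 then show ?case
  using add_left[OF scale_in[of "e j" "a j"] sum_in[of I e a] assms(2)] by (simp add: scale_left assms)
qed (simp_all add: zero_left assms)

lemma expand:
 assumes "u \<in> S" "v \<in> S"
 shows "B (%x. u x + c * v x) (%x. u x + c * v x) = B u u + 2 * c * B u v + c^2 * B v v"
proof -
 let ?w = "%x. u x + c * v x"
 have w: "?w \<in> S" using comb[OF assms, of 1 c] by simp
 have *: "B ?w z = B u z + c * B v z" if "z \<in> S" for z
  using comb_left[OF assms that, of 1 c] by simp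
 have "B ?w ?w = B u ?w + c * B v ?w" by (rule *[OF w])
 also have "B u ?w = B u u + c * B u v" using sym[OF assms(1) w] *[OF assms(1)] sym assms by simp
 also have "B v ?w = B u v + c * B v v" using sym[OF assms(2) w] *[OF assms(2)] by simp
 finally show ?thesis by (simp add: power2_eq_square algebra_simps)
qed

lemma expand_add: "u \<in> S ==> v \<in> S ==> B (%x. u x + v x) (%x. u x + v x) = B u u + 2 * B u v + B v v"
 using expand[of u v 1] by simp
lemma expand_diff: "u \<in> S ==> v \<in> S ==> B (%x. u x - v x) (%x. u x - v x) = B u u - 2 * B u v + B v v"
 using expand[of u v "-1"] by simp

lemma Cauchy_Schwarz:
 assumes "u \<in> S" "v \<in> S" shows "(B u v)^2 <= B u u * B v v"
proof (rule discriminant_bound)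
 show "0 <= B u u + 2 * t * B u v + t^2 * B v v" for t
  unfolding expand[OF assms, symmetric] using comb[OF assms, of 1 t] by (intro nonneg) simp
qed (rule nonneg[OF assms(2)])

lemma null_left: "u \<in> S ==> v \<in> S ==> B v v = 0 ==> B u v = 0"
 using Cauchy_Schwarz[of u v] by simp

lemma square_add_le:
 assumes "u \<in> S" "v \<in> S"
 shows "B (%x. u x + v x) (%x. u x + v x) <= 2 * B u u + 2 * B v v"
 using expand_add[OF assms] expand_diff[OF assms] nonneg[OF diff_in[OF assms]] by linarith

lemma square_diff_le:
 assumes "u \<in> S" "v \<in> S"
 shows "B (%x. u x - v x) (%x. u x - v x) <= 2 * B u u + 2 * B v v"
 using expand_add[OF assms] expand_diff[OF assms] nonneg[OF add_in[OF assms]] by linarith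

lemma tendsto_left:
 assumes "\<And>n. s n \<in> S" "u \<in> S" "w \<in> S" "(%n. B (%x. u x - s n x) (%x. u x - s n x)) ~~> 0"
 shows "(%n. B (s n) w) ~~> B u w"
proof -
 have "(%n. B u w - B (s n) w) ~~> 0"
 proof (rule Lim_null_comparison)
  show "\<forall>\<^sub>F n in sequentially. norm (B u w - B (s n) w)
    <= sqrt (B (%x. u x - s n x) (%x. u x - s n x) * B w w)"
   using Cauchy_Schwarz[OF diff_in[OF assms(2) assms(1)] assms(3)] diff_left[OF assms(2,1,3)]
   by (auto intro!: always_eventually real_le_rsqrt)
  show "(%n. sqrt (B (%x. u x - s n x) (%x. u x - s n x) * B w w)) ~~> 0"
   using tendsto_real_sqrt[OF tendsto_mult_left_zero[OF assms(4)]] by simp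
 qed
 from tendsto_diff[OF tendsto_const[of "B u w"] this] show ?thesis by simp
qed

lemma tendsto_square:
 assumes "\<And>n. s n \<in> S" "u \<in> S" "(%n. B (%x. u x - s n x) (%x. u x - s n x)) ~~> 0"
 shows "(%n. B (s n) (s n)) ~~> B u u"
proof -
 have "B (s n) (s n) = B (%x. u x - s n x) (%x. u x - s n x) + 2 * B (s n) u - B u u" for n
  using expand_diff[OF assms(2,1), of n] sym[OF assms(2,1), of n] by simp
 moreover have "(%n. B (%x. u x - s n x) (%x. u x - s n x) + 2 * B (s n) u - B u u) ~~> 0 + 2 * B u u - B u u"
  by (intro tendsto_intros assms tendsto_left)
 ultimately show ?thesis by simp
qed

end

text \<open>The setting of the spectral theorem for a form with compact resolvent: \<open>Q\<close>
  is complete, and the embedding of the \<open>Q\<close>-norm into the \<open>B\<close>-norm is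
  compact. Compactness only asks for a \<open>B\<close>-Cauchy subsequence, since limits are
  supplied by completeness of \<open>Q\<close>. With \<open>Q_ge\<close>, \<open>B_null\<close>
  gives both seminorms the same null vectors.\<close>

locale spectral = B: psd_form S B + Q: psd_form S Q
 for S :: "('x => real) set" and B Q +
 assumes Q_ge: "u \<in> S ==> B u u <= Q u u"
  and B_null: "u \<in> S ==> B u u = 0 ==> Q u u = 0"
  and complete: "(\<And>n. s n \<in> S) ==>
   (\<And>ep. ep > 0 ==> \<exists>N. \<forall>m\<ge>N. \<forall>n\<ge>N. Q (%x. s m x - s n x) (%x. s m x - s n x) < ep) ==>
   \<exists>u\<in>S. (%n. Q (%x. u x - s n x) (%x. u x - s n x)) ~~> 0"
  and compact: "(\<And>n. s n \<in> S) ==> (\<And>n. Q (s n) (s n) <= C) ==>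
   \<exists>r. strict_mono (r :: nat => nat) & (\<forall>ep>0. \<exists>N. \<forall>m\<ge>N. \<forall>n\<ge>N.
    B (%x. s (r m) x - s (r n) x) (%x. s (r m) x - s (r n) x) < ep)"
begin

lemma B_tendsto_of_Q:
 assumes "\<And>n. s n \<in> S" "u \<in> S" "(%n. Q (%x. u x - s n x) (%x. u x - s n x)) ~~> 0"
 shows "(%n. B (%x. u x - s n x) (%x. u x - s n x)) ~~> 0"
 by (rule tendsto_sandwich[OF _ _ tendsto_const assms(3)])
  (auto intro!: always_eventually B.nonneg Q_ge B.diff_in assms)

text \<open>Direct method for the Rayleigh quotient on the \<open>B\<close>-orthogonal complement of
  the vectors \<open>e k\<close>: a minimising sequence has a \<open>B\<close>-Cauchy subsequence,
  and near-minimality upgrades it to a \<open>Q\<close>-Cauchy one.\<close>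

lemma minimiser:
 assumes e: "\<And>k. k < n ==> e k \<in> S"
  and u0: "u0 \<in> S" "\<And>k. k < n ==> B u0 (e k) = 0" "B u0 u0 > 0"
 shows "\<exists>w\<in>S. (\<forall>k<n. B w (e k) = 0) & B w w = 1 \<and>
  (\<forall>u\<in>S. (\<forall>k<n. B u (e k) = 0) --> Q w w * B u u <= Q u u)"
proof -
 define S' where "S' = {u \<in> S. \<forall>k<n. B u (e k) = 0}"
 define R where "R = {Q u u |u. u \<in> S' & B u u = 1}"
 have S'S: "u \<in> S" if "u \<in> S'" for u using that by (simp add: S'_def)
 have S'comb: "(%x. a * u x + c * v x) \<in> S'" if "u \<in> S'" "v \<in> S'" for u v a c
  using that e by (auto simp: S'_def B.comb B.comb_left)
 have S'scale: "(%x. a * u x) \<in> S'" if "u \<in> S'" for u a using S'comb[OF that that, of a 0] by simp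
 have scaleB: "B (%x. a * u x) (%x. a * u x) = a^2 * B u u" "Q (%x. a * u x) (%x. a * u x) = a^2 * Q u u"
  if "u \<in> S" for a u
  using B.expand[OF B.zero that, of a] Q.expand[OF B.zero that, of a]
   B.zero_left[OF that] B.zero_left[OF B.zero] Q.zero_left[OF that] Q.zero_left[OF B.zero]
  by simp_all
 have normal: "(%x. (1 / sqrt (B u u)) * u x) \<in> S'" "B (%x. (1 / sqrt (B u u)) * u x) (%x. (1 / sqrt (B u u)) * u x) = 1"
   "Q (%x. (1 / sqrt (B u u)) * u x) (%x. (1 / sqrt (B u u)) * u x) = Q u u / B u u"
  if "u \<in> S'" "B u u > 0" for u
  using S'scale[OF that(1), of "1 / sqrt (B u u)"] scaleB[OF S'S[OF that(1)], of "1 / sqrt (B u u)"] that(2)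
  by (simp_all add: power_divide)
 have Rne: "R \<noteq> {}" using normal[of u0] u0 by (auto simp: R_def S'_def)
 have Rbd: "bdd_below R" using Q.nonneg S'S by (auto simp: R_def bdd_below_def intro!: exI[of _ 0])
 define m where "m = Inf R"
 have m_le: "m * B u u <= Q u u" if "u \<in> S'" for u
 proof (cases "B u u = 0")
  case True then show ?thesis using Q.nonneg[OF S'S[OF that]] by simp
 next
  case False
  then have pos: "B u u > 0" using B.nonneg[OF S'S[OF that]] by simp
  from normal(1,2)[OF that pos] normal(3)[OF that pos, symmetric]
  have "Q u u / B u u \<in> R" unfolding R_def by blast
  then have "m <= Q u u / B u u" unfolding m_def by (intro cInf_lower Rbd)
  then show ?thesis using pos by (simp add: field_simps)
 qed
 have "\<exists>u. u \<in> S' & B u u = 1 & Q u u < m + 1 / real (Suc j)" for j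
 proof -
  have "Inf R < m + 1 / real (Suc j)" by (simp add: m_def)
  then obtain q where "q \<in> R" "q < m + 1 / real (Suc j)" using cInf_less_iff[OF Rne Rbd] by auto
  then show ?thesis by (auto simp: R_def)
 qed
 then obtain s where s: "\<And>j. s j \<in> S'" "\<And>j. B (s j) (s j) = 1" "\<And>j. Q (s j) (s j) < m + 1 / real (Suc j)"
  by metis
 have sS: "s j \<in> S" for j using s S'S by blast
 have m0: "m >= 0" unfolding m_def using Rne by (intro cInf_greatest) (auto simp: R_def intro: Q.nonneg S'S)
 have "Q (s j) (s j) <= m + 1" for j
 proof -
  have "1 / real (Suc j) <= 1" by simp
  then show ?thesis using s(3)[of j] by linarith
 qed
 from compact[of s, OF sS this] obtain r :: "nat => nat" where r: "strict_mono r"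
  and rC: "\<forall>ep>0. \<exists>N. \<forall>j\<ge>N. \<forall>k\<ge>N. B (%x. s (r j) x - s (r k) x) (%x. s (r j) x - s (r k) x) < ep"
  by (elim exE conjE) (rule that; assumption)
 \<comment> \<open>Parallelogram law for both forms: the sum of two normalised vectors again lies in
   \<open>S'\<close>, so its \<open>Q\<close> value is at least \<open>m\<close> times its
   \<open>B\<close> value, which bounds the \<open>Q\<close> value of the difference from
   above.\<close>
 have key: "Q (%x. s j x - s k x) (%x. s j x - s k x) \<le>
  2 / real (Suc j) + 2 / real (Suc k) + m * B (%x. s j x - s k x) (%x. s j x - s k x)" for j k
 proof -
  have "(%x. s j x + s k x) \<in> S'" using S'comb[OF s(1)[of j] s(1)[of k], of 1 1] by simp
  from m_le[OF this] have "m * (4 - B (%x. s j x - s k x) (%x. s j x - s k x)) <= Q (%x. s j x + s k x) (%x. s j x + s k x)"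
   unfolding B.expand_add[OF sS sS] B.expand_diff[OF sS sS] by (simp add: s(2))
  then show ?thesis
   using s(3)[of j] s(3)[of k] unfolding Q.expand_add[OF sS sS] Q.expand_diff[OF sS sS]
   by (simp add: algebra_simps)
 qed
 have "\<exists>N. \<forall>j\<ge>N. \<forall>k\<ge>N. Q (%x. s (r j) x - s (r k) x) (%x. s (r j) x - s (r k) x) < ep" if "ep > 0" for ep
 proof -
  obtain N1 where N1: "\<And>j k. j >= N1 ==> k >= N1 ==> B (%x. s (r j) x - s (r k) x) (%x. s (r j) x - s (r k) x) < ep / (2 * (m + 1))"
   using rC[rule_format, of "ep / (2 * (m + 1))"] \<open>ep > 0\<close> m0 by auto
  obtain N2 where N2: "1 / real (Suc N2) < ep / 8" using nat_approx_posE[of "ep/8"] \<open>ep > 0\<close> by auto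
  show ?thesis
  proof (intro exI allI impI)
   fix j k assume jk: "j >= max N1 N2" "k >= max N1 N2"
   have i: "1 / real (Suc (r i)) < ep / 8" if "i >= N2" for i
   proof -
    have "N2 <= r i" using that seq_suble[OF r, of i] by simp
    then have "1 / real (Suc (r i)) <= 1 / real (Suc N2)" by (intro divide_left_mono) auto
    then show ?thesis using N2 by linarith
   qed
   have "m * B (%x. s (r j) x - s (r k) x) (%x. s (r j) x - s (r k) x) <= m * (ep / (2 * (m + 1)))"
    using N1[of j k] jk m0 by (intro mult_left_mono) auto
   also have "... <= ep / 2" using m0 \<open>ep > 0\<close> by (simp add: field_simps)
   finally show "Q (%x. s (r j) x - s (r k) x) (%x. s (r j) x - s (r k) x) < ep"
    using key[of "r j" "r k"] i[of j] i[of k] jk by simp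
  qed
 qed
 from complete[of "%j. s (r j)", OF sS this] obtain w where w: "w \<in> S"
  and lim: "(%j. Q (%x. w x - s (r j) x) (%x. w x - s (r j) x)) ~~> 0" by blast
 have limB: "(%j. B (%x. w x - s (r j) x) (%x. w x - s (r j) x)) ~~> 0"
  by (rule B_tendsto_of_Q[OF _ w lim]) (rule sS)
 have we: "B w (e k) = 0" if "k < n" for k
 proof -
  have "(%j. B (s (r j)) (e k)) ~~> B w (e k)" by (rule B.tendsto_left[OF _ w e[OF that] limB]) (rule sS)
  moreover have "B (s (r j)) (e k) = 0" for j using s(1)[of "r j"] that by (simp add: S'_def)
  ultimately show ?thesis by (simp add: LIMSEQ_const_iff)
 qed
 have ww: "B w w = 1"
  using B.tendsto_square[OF _ w limB] sS by (simp add: s(2) LIMSEQ_const_iff)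
 have "Q w w <= m"
 proof (rule LIMSEQ_le[OF Q.tendsto_square[OF _ w lim]])
  show "(%j. m + 1 / real (Suc (r j))) ~~> m"
   using tendsto_add[OF tendsto_const[of m] LIMSEQ_subseq_LIMSEQ[OF lim_1_over_n[THEN LIMSEQ_Suc] r]]
   by (simp add: o_def)
  show "\<exists>N. \<forall>j\<ge>N. Q (s (r j)) (s (r j)) <= m + 1 / real (Suc (r j))"
   using s(3) by (auto intro: less_imp_le)
 qed (rule sS)
 show ?thesis
 proof (intro bexI[OF _ w] conjI allI impI ballI we ww)
  fix u assume "u \<in> S" "\<forall>k<n. B u (e k) = 0"
  then have "u \<in> S'" by (simp add: S'_def)
  then have "m * B u u <= Q u u" by (rule m_le)
  moreover have "Q w w * B u u <= m * B u u" using \<open>Q w w <= m\<close> B.nonneg[OF \<open>u \<in> S\<close>] by (rule mult_right_mono)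
  ultimately show "Q w w * B u u <= Q u u" by linarith
 qed
qed

text \<open>When the orthogonal complement of the eigenfunctions found so far is trivial, the sequence is
 continued by zero functions with artificial eigenvalues; so \<open>B (e n) (e n)\<close> may be \<open>0\<close>.\<close>

definition eigen :: "(nat => 'x => real) => nat => ('x => real) => real => bool" where
 "eigen e n w \<mu> \<longleftrightarrow> w \<in> S & 1 <= \<mu> & (\<forall>k<n. B w (e k) = 0) \<and>
  (B w w = 1 \<or> B w w = 0 & \<mu> = real (Suc n)) \<and>
  (\<forall>ph\<in>S. Q w ph = \<mu> * B w ph) \<and>
  (\<forall>u\<in>S. (\<forall>k<n. B u (e k) = 0) --> \<mu> * B u u <= Q u u)"

text \<open>The first variation gives the eigenvalue equation of the minimiser for test vectors in
  the complement. An arbitrary test vector differs from one of these by a combination of earlier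
  eigenvectors, on which both sides vanish.\<close>

lemma eigen_step:
 assumes prev: "\<And>k. k < n ==> eigen e k (e k) (l k)"
 shows "\<exists>w \<mu>. eigen e n w \<mu>"
proof (cases "\<exists>u\<in>S. (\<forall>k<n. B u (e k) = 0) & B u u > 0")
 case False
 have "eigen e n (%x. 0) (real (Suc n))"
  unfolding eigen_def
 proof (intro conjI ballI allI impI)
  fix u assume u: "u \<in> S" "\<forall>k<n. B u (e k) = 0"
  then have "B u u = 0" using False B.nonneg[of u] by force
  then show "real (Suc n) * B u u <= Q u u" using Q.nonneg[of u] u by simp
 qed (use prev in "auto simp: eigen_def B.zero B.zero_left Q.zero_left")
 then show ?thesis by blast
next
 case True
 have e: "e k \<in> S" if "k < n" for k using prev[OF that] by (simp add: eigen_def)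
 have orth: "B (e j) (e k) = 0" if "j < n" "k < n" "j \<noteq> k" for j k
 proof (cases "k < j")
  case True then show ?thesis using prev[of j] that by (simp add: eigen_def)
 next
  case False
  then have "B (e k) (e j) = 0" using prev[of k] that by (simp add: eigen_def)
  then show ?thesis using B.sym[OF e e] that by simp
 qed
 from True minimiser[of n e] e obtain w where w: "w \<in> S" "\<And>k. k < n ==> B w (e k) = 0" "B w w = 1"
  and min: "\<And>u. u \<in> S ==> (\<And>k. k < n ==> B u (e k) = 0) ==> Q w w * B u u <= Q u u" by metis
 have EL0: "Q w ph = Q w w * B w ph" if ph: "ph \<in> S" "\<And>k. k < n ==> B ph (e k) = 0" for ph
 proof -
  \<comment> \<open>A nonnegative quadratic polynomial with constant term 0 has no linear
    term.\<close>
  have "(Q w ph - Q w w * B w ph)^2 <= 0 * (Q ph ph - Q w w * B ph ph)"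
  proof (rule discriminant_bound)
   fix t
   have "(%x. w x + t * ph x) \<in> S" using B.comb[OF w(1) ph(1), of 1 t] by simp
   moreover have "B (%x. w x + t * ph x) (e k) = 0" if "k < n" for k
    using B.comb_left[OF w(1) ph(1) e[OF that], of 1 t] w(2)[OF that] ph(2)[OF that] by simp
   ultimately have "Q w w * B (%x. w x + t * ph x) (%x. w x + t * ph x) <= Q (%x. w x + t * ph x) (%x. w x + t * ph x)"
    by (intro min)
   then show "0 <= 0 + 2 * t * (Q w ph - Q w w * B w ph) + t^2 * (Q ph ph - Q w w * B ph ph)"
    unfolding B.expand[OF w(1) ph(1)] Q.expand[OF w(1) ph(1)] w(3) by (simp add: algebra_simps)
  qed (use min[OF ph] in simp)
  then show ?thesis by simp
 qed
 have EL: "Q w ph = Q w w * B w ph" if ph: "ph \<in> S" for ph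
 proof -
  define p where "p x = (\<Sum>k<n. B ph (e k) * e k x)" for x
  have p: "p \<in> S" unfolding p_def by (rule B.sum_in) (use e in auto)
  have pw: "B p w = 0"
  proof -
   have "B p w = (\<Sum>k<n. B ph (e k) * B (e k) w)"
    unfolding p_def by (rule B.sum_left) (use e w in auto)
   moreover have "B (e k) w = 0" if "k < n" for k using B.sym[OF w(1) e[OF that]] w(2)[OF that] by simp
   ultimately show ?thesis by simp
  qed
  have Qpw: "Q p w = 0"
  proof -
   have "Q p w = (\<Sum>k<n. B ph (e k) * Q (e k) w)"
    unfolding p_def by (rule Q.sum_left) (use e w in auto)
   also have "... = (\<Sum>k<n. 0)"
   proof (rule sum.cong[OF refl])
    fix k assume k: "k \<in> {..<n}"
    then have "Q (e k) w = l k * B (e k) w" using prev[of k] w(1) by (simp add: eigen_def)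
    then show "B ph (e k) * Q (e k) w = 0" using w(2)[of k] B.sym[OF w(1) e[of k]] k by simp
   qed
   finally show ?thesis by simp
  qed
  have pe: "B p (e j) = B ph (e j)" if "j < n" for j
  proof -
   have "B p (e j) = (\<Sum>k<n. B ph (e k) * B (e k) (e j))"
    unfolding p_def by (rule B.sum_left) (use e that in auto)
   also have "... = (\<Sum>k<n. if k = j then B ph (e j) * B (e j) (e j) else 0)"
    using orth that by (intro sum.cong) auto
   also have "... = B ph (e j) * B (e j) (e j)" using that by simp
   \<comment> \<open>If \<open>e j\<close> is one of the padding vectors of norm zero,
     \<open>B ph (e j)\<close> vanishes by Cauchy-Schwarz and the equation still holds.\<close>
   also have "... = B ph (e j)"
    using prev[OF that] B.null_left[OF ph e[OF that]] by (auto simp: eigen_def)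
   finally show ?thesis .
  qed
  have "Q w (%x. ph x - p x) = Q w w * B w (%x. ph x - p x)"
   using pe B.diff_left[OF ph p e] by (intro EL0 B.diff_in ph p) simp
  then show ?thesis
   using B.sym[OF w(1) B.diff_in[OF ph p]] Q.sym[OF w(1) B.diff_in[OF ph p]]
    B.diff_left[OF ph p w(1)] Q.diff_left[OF ph p w(1)] pw Qpw B.sym[OF w(1) ph] Q.sym[OF w(1) ph] by simp
 qed
 have "eigen e n w (Q w w)"
  unfolding eigen_def using w(1,2) Q_ge[OF w(1)] w(3) by (auto intro: min EL)
 then show ?thesis by blast
qed

lemma eigen_cong: "(\<And>k. k < n ==> e k = e' k) ==> eigen e n w \<mu> = eigen e' n w \<mu>"
 by (simp add: eigen_def cong: conj_cong)

lemma eigensystem_exists: "\<exists>e l. \<forall>n. eigen e n (e n) (l n)"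
proof -
 have "\<exists>f. \<forall>n. eigen (fst \<circ> f) n (fst (f n)) (snd (f n))"
 proof (rule dependent_wf_choice[OF wf_less_than])
  fix f g :: "nat => ('x => real) \<times> real" and n r
  assume "\<And>z. (z, n) \<in> less_than ==> f z = g z"
  then show "eigen (fst \<circ> f) n (fst r) (snd r) = eigen (fst \<circ> g) n (fst r) (snd r)"
   by (intro eigen_cong) auto
 next
  fix n and f :: "nat => ('x => real) \<times> real"
  assume "\<And>y. (y, n) \<in> less_than ==> eigen (fst \<circ> f) y (fst (f y)) (snd (f y))"
  then show "\<exists>r. eigen (fst \<circ> f) n (fst r) (snd r)"
   using eigen_step[of n "fst \<circ> f" "snd \<circ> f"] by auto
 qed
 then obtain f where "\<forall>n. eigen (fst \<circ> f) n (fst (f n)) (snd (f n))" by blast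
 then show ?thesis by (intro exI[of _ "fst \<circ> f"] exI[of _ "snd \<circ> f"]) simp
qed

section \<open>The eigensystem and Parseval's identity\<close>

definition ef :: "nat => 'x => real" where
 "ef = (SOME e. \<exists>l. \<forall>n. eigen e n (e n) (l n))"
definition ev :: "nat => real" where
 "ev = (SOME l. \<forall>n. eigen ef n (ef n) (l n))"

lemma eigen_ef: "eigen ef n (ef n) (ev n)"
proof -
 have "\<exists>l. \<forall>n. eigen ef n (ef n) (l n)"
  unfolding ef_def using eigensystem_exists by (rule someI_ex)
 then have "\<forall>n. eigen ef n (ef n) (ev n)" unfolding ev_def by (rule someI_ex)
 then show ?thesis by blast
qed

lemma ef_in: "ef n \<in> S" and ev_ge: "1 <= ev n"
 and ef_Q: "ph \<in> S ==> Q (ef n) ph = ev n * B (ef n) ph"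
 and ef_min: "u \<in> S ==> (\<And>k. k < n ==> B u (ef k) = 0) ==> ev n * B u u <= Q u u"
 and ef_norm: "B (ef n) (ef n) = 1 \<or> B (ef n) (ef n) = 0 & ev n = real (Suc n)"
 using eigen_ef[of n] by (auto simp: eigen_def)

lemma ef_orth: "j \<noteq> k ==> B (ef j) (ef k) = 0"
proof (induction j k rule: linorder_wlog)
 case (le j k)
 then have "B (ef k) (ef j) = 0" using eigen_ef[of k] by (simp add: eigen_def)
 then show ?case using B.sym[OF ef_in ef_in] by simp
next
 case (sym j k) then show ?case using B.sym[OF ef_in ef_in] by metis
qed

text \<open>Trivial for a normalised eigenvector; for a null vector both sides vanish by
  Cauchy-Schwarz. It lets the projections ignore the padding.\<close>

lemma ef_coeff: "u \<in> S ==> B u (ef k) * B (ef k) (ef k) = B u (ef k)"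
 using ef_norm[of k] B.null_left[OF _ ef_in] by auto

text \<open>Infinitely many eigenvalues below a bound would give a \<open>B\<close>-orthonormal
  sequence bounded in \<open>Q\<close>; its members have mutual squared distance 2, so no
  subsequence is \<open>B\<close>-Cauchy.\<close>

lemma ev_tendsto: "filterlim ev at_top sequentially"
proof (rule ccontr)
 assume "\<not> ?thesis"
 then obtain C where "\<not> (\<forall>\<^sub>F n in sequentially. C <= ev n)" by (auto simp: filterlim_at_top)
 then have inf: "\<exists>\<^sub>\<infinity>n. ev n < C" by (simp add: not_eventually not_le cofinite_eq_sequentially)
 \<comment> \<open>The condition \<open>C < real n\<close> excludes the padding, whose eigenvalue at
   index \<open>n\<close> is \<open>real (Suc n)\<close>.\<close>
 define I where "I = {n. ev n < C & C < real n}"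
 obtain N :: nat where N: "C < real N" using reals_Archimedean2 by blast
 have "infinite I"
 proof
  assume "finite I"
  moreover have "{n. ev n < C} \<subseteq> I \<union> {..N}"
  proof
   fix n assume "n \<in> {n. ev n < C}"
   then show "n \<in> I \<union> {..N}" using N by (cases "n <= N") (auto simp: I_def)
  qed
  ultimately show False using inf by (auto simp: INFM_iff_infinite dest: finite_subset)
 qed
 define s where "s j = ef (enumerate I j)" for j
 have en: "enumerate I j \<in> I" for j using enumerate_in_set[OF \<open>infinite I\<close>] .
 have norm1: "B (s j) (s j) = 1" for j
  using ef_norm[of "enumerate I j"] en[of j] by (auto simp: s_def I_def)
 have QC: "Q (s j) (s j) <= C" for j
  using ef_Q[OF ef_in, of "enumerate I j" "enumerate I j"] norm1[of j] en[of j] by (simp add: s_def I_def)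
 have sS: "s j \<in> S" for j by (simp add: s_def ef_in)
 from compact[of s C, OF sS QC] obtain r :: "nat => nat" where r: "strict_mono r"
  and rC: "\<forall>ep>0. \<exists>N. \<forall>m\<ge>N. \<forall>n\<ge>N. B (%x. s (r m) x - s (r n) x) (%x. s (r m) x - s (r n) x) < ep"
  by (elim exE conjE) (rule that; assumption)
 from rC[rule_format, OF zero_less_one]
 obtain M where M: "\<forall>m\<ge>M. \<forall>n\<ge>M. B (%x. s (r m) x - s (r n) x) (%x. s (r m) x - s (r n) x) < 1"
  by (elim exE) (rule that)
 have "enumerate I (r M) \<noteq> enumerate I (r (Suc M))"
  using enumerate_mono[OF strict_monoD[OF r, of M "Suc M"] \<open>infinite I\<close>] by simp
 then have "B (s (r M)) (s (r (Suc M))) = 0" unfolding s_def by (rule ef_orth)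
 then show False
  using M[rule_format, of M "Suc M"] B.expand_diff[OF sS sS, of "r M" "r (Suc M)"] norm1 by simp
qed

lemma ef_sum_B: "B (%x. \<Sum>k\<in>I. a k * ef k x) (ef j) = (if finite I & j \<in> I then a j * B (ef j) (ef j) else 0)"
proof (cases "finite I")
 case True
 have "B (%x. \<Sum>k\<in>I. a k * ef k x) (ef j) = (\<Sum>k\<in>I. a k * B (ef k) (ef j))"
  by (rule B.sum_left) (auto simp: ef_in)
 also have "... = (\<Sum>k\<in>I. if k = j then a j * B (ef j) (ef j) else 0)"
  by (rule sum.cong) (auto simp: ef_orth)
 finally show ?thesis using True by simp
qed (simp add: B.zero_left ef_in)

lemma ef_sum_QB:
 assumes "finite I"
 shows "Q (%x. \<Sum>k\<in>I. a k * ef k x) (%x. \<Sum>k\<in>I. a k * ef k x) = (\<Sum>k\<in>I. ev k * (a k)^2 * B (ef k) (ef k))"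
  and "B (%x. \<Sum>k\<in>I. a k * ef k x) (%x. \<Sum>k\<in>I. a k * ef k x) = (\<Sum>k\<in>I. (a k)^2 * B (ef k) (ef k))"
proof -
 let ?s = "%x. \<Sum>k\<in>I. a k * ef k x"
 have s: "?s \<in> S" by (rule B.sum_in) (rule ef_in)
 have "B (ef k) ?s = a k * B (ef k) (ef k)" if "k \<in> I" for k
  using ef_sum_B[of a I k] assms that B.sym[OF ef_in s] by simp
 moreover have "Q ?s ?s = (\<Sum>k\<in>I. a k * Q (ef k) ?s)" by (rule Q.sum_left) (auto simp: ef_in s)
 moreover have "B ?s ?s = (\<Sum>k\<in>I. a k * B (ef k) ?s)" by (rule B.sum_left) (auto simp: ef_in s)
 ultimately show "Q ?s ?s = (\<Sum>k\<in>I. ev k * (a k)^2 * B (ef k) (ef k))" "B ?s ?s = (\<Sum>k\<in>I. (a k)^2 * B (ef k) (ef k))"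
  using ef_Q[OF s] by (auto intro!: sum.cong simp: power2_eq_square)
qed

text \<open>By orthogonality the \<open>Q\<close> value of a block of the series is at most the
  corresponding block of the numerical series, so the partial sums are
  \<open>Q\<close>-Cauchy.\<close>

lemma ef_series:
 assumes "summable (%k. ev k * (a k)^2)"
 shows "\<exists>v\<in>S. (%n. Q (%x. v x - (\<Sum>k<n. a k * ef k x)) (%x. v x - (\<Sum>k<n. a k * ef k x))) ~~> 0"
proof (rule complete)
 show "(%x. \<Sum>k<n. a k * ef k x) \<in> S" for n by (rule B.sum_in) (rule ef_in)
 fix ep :: real assume "ep > 0"
 have nn: "0 <= ev k * (a k)^2" for k using ev_ge[of k] by simp
 have le: "ev k * (a k)^2 * B (ef k) (ef k) <= ev k * (a k)^2" for k
  using ef_norm[of k] nn[of k] by auto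
 from assms \<open>ep > 0\<close> obtain N where N: "\<And>m n. m >= N ==> norm (\<Sum>k=m..<n. ev k * (a k)^2) < ep"
  unfolding summable_Cauchy by meson
 have half: "Q (%x. (\<Sum>k<m. a k * ef k x) - (\<Sum>k<n. a k * ef k x)) (%x. (\<Sum>k<m. a k * ef k x) - (\<Sum>k<n. a k * ef k x)) < ep"
  if "n >= N" "n <= m" for m n
 proof -
  have "(%x. (\<Sum>k<m. a k * ef k x) - (\<Sum>k<n. a k * ef k x)) = (%x. \<Sum>k=n..<m. a k * ef k x)"
  proof
   fix x show "(\<Sum>k<m. a k * ef k x) - (\<Sum>k<n. a k * ef k x) = (\<Sum>k=n..<m. a k * ef k x)"
    using sum_diff_nat_ivl[of 0 n m "%k. a k * ef k x"] that by (simp add: atLeast0LessThan)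
  qed
  then have "Q (%x. (\<Sum>k<m. a k * ef k x) - (\<Sum>k<n. a k * ef k x)) (%x. (\<Sum>k<m. a k * ef k x) - (\<Sum>k<n. a k * ef k x))
    = (\<Sum>k=n..<m. ev k * (a k)^2 * B (ef k) (ef k))" by (simp add: ef_sum_QB)
  also have "... <= (\<Sum>k=n..<m. ev k * (a k)^2)" by (rule sum_mono) (rule le)
  also have "... < ep" using N[OF that(1), of m] by simp
  finally show ?thesis .
 qed
 have symm: "Q (%x. u x - v x) (%x. u x - v x) = Q (%x. v x - u x) (%x. v x - u x)" if "u \<in> S" "v \<in> S" for u v
  using Q.expand_diff[OF that] Q.expand_diff[OF that(2,1)] Q.sym[OF that] by simp
 show "\<exists>N. \<forall>m\<ge>N. \<forall>n\<ge>N. Q (%x. (\<Sum>k<m. a k * ef k x) - (\<Sum>k<n. a k * ef k x)) (%x. (\<Sum>k<m. a k * ef k x) - (\<Sum>k<n. a k * ef k x)) < ep"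
 proof (intro exI allI impI)
  fix m n assume "m >= N" "n >= N"
  then show "Q (%x. (\<Sum>k<m. a k * ef k x) - (\<Sum>k<n. a k * ef k x)) (%x. (\<Sum>k<m. a k * ef k x) - (\<Sum>k<n. a k * ef k x)) < ep"
   using half[of n m] half[of m n] symm[OF B.sum_in[of "{..<m}" ef a] B.sum_in[of "{..<n}" ef a]] ef_in
   by (cases "n <= m") auto
 qed
qed

text \<open>The remainder after \<open>n\<close> terms is orthogonal to the first \<open>n\<close>
  eigenvectors, so its \<open>B\<close> value is at most \<open>Q u u / ev n\<close> and tends to
  zero. The series converges in \<open>Q\<close> to some \<open>v\<close> by Bessel's inequality;
  \<open>u\<close> and \<open>v\<close> then have \<open>B\<close> distance zero, hence
  \<open>Q\<close> distance zero.\<close>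

lemma parseval:
 assumes u: "u \<in> S"
 shows "(%n. Q (%x. u x - (\<Sum>k<n. B u (ef k) * ef k x)) (%x. u x - (\<Sum>k<n. B u (ef k) * ef k x))) ~~> 0"
  and "(%k. ev k * (B u (ef k))^2) sums Q u u"
proof -
 define p where "p n x = (\<Sum>k<n. B u (ef k) * ef k x)" for n x
 define r where "r n x = u x - p n x" for n x
 have p: "p n \<in> S" for n unfolding p_def by (rule B.sum_in) (rule ef_in)
 have r: "r n \<in> S" for n unfolding r_def by (rule B.diff_in[OF u p])
 have pe: "B (p n) (ef k) = (if k < n then B u (ef k) else 0)" for n k
  unfolding p_def ef_sum_B by (simp add: ef_coeff[OF u])
 have re: "B (r n) (ef k) = 0" if "k < n" for n k
  unfolding r_def using B.diff_left[OF u p ef_in, of n k] pe[of n k] that by simp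
 have Qpp: "Q (p n) (p n) = (\<Sum>k<n. ev k * (B u (ef k))^2)" for n
  unfolding p_def ef_sum_QB(1)[OF finite_lessThan] by (rule sum.cong) (simp_all add: power2_eq_square mult.assoc ef_coeff[OF u])
 have Qpr: "Q (p n) (r n) = 0" for n
 proof -
  have "Q (p n) (r n) = (\<Sum>k<n. B u (ef k) * Q (ef k) (r n))"
   unfolding p_def by (rule Q.sum_left) (auto simp: ef_in r)
  also have "... = 0" using re ef_Q[OF r] B.sym[OF r ef_in] by (intro sum.neutral) auto
  finally show ?thesis .
 qed
 have Qsplit: "Q u u = Q (p n) (p n) + Q (r n) (r n)" for n
  using Q.expand_add[OF p r, of n n] Qpr by (simp add: r_def)
 have sumle: "(\<Sum>k<n. ev k * (B u (ef k))^2) <= Q u u" for n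
  using Qsplit[of n] Qpp[of n] Q.nonneg[OF r[of n]] by simp
 have nn: "0 <= ev k * (B u (ef k))^2" for k using ev_ge[of k] by simp
 have sm: "summable (%k. ev k * (B u (ef k))^2)"
  by (rule summableI_nonneg_bounded[OF nn sumle])
 from ef_series[OF sm] obtain v where v: "v \<in> S" and vl: "(%n. Q (%x. v x - p n x) (%x. v x - p n x)) ~~> 0"
  by (auto simp: p_def)
 have Br: "(%n. B (r n) (r n)) ~~> 0"
 proof (rule tendsto_sandwich[OF _ _ tendsto_const])
  show "\<forall>\<^sub>F n in sequentially. B (r n) (r n) <= Q u u / ev n"
  proof (intro always_eventually allI)
   fix n
   have "ev n * B (r n) (r n) <= Q (r n) (r n)" by (rule ef_min[OF r re])
   also have "... <= Q u u" using Qsplit[of n] Q.nonneg[OF p] by simp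
   finally show "B (r n) (r n) <= Q u u / ev n" using ev_ge[of n] by (simp add: field_simps)
  qed
  show "(%n. Q u u / ev n) ~~> 0"
   by (rule real_tendsto_divide_at_top[OF tendsto_const ev_tendsto])
 qed (intro always_eventually allI B.nonneg r)
 have Bv: "(%n. B (%x. v x - p n x) (%x. v x - p n x)) ~~> 0" by (rule B_tendsto_of_Q[OF p v vl])
 have "B (%x. u x - v x) (%x. u x - v x) <= 0"
 proof (rule LIMSEQ_le_const)
  show "(%n. 2 * B (r n) (r n) + 2 * B (%x. v x - p n x) (%x. v x - p n x)) ~~> 0"
   using tendsto_add[OF tendsto_mult_right_zero[OF Br, of 2] tendsto_mult_right_zero[OF Bv, of 2]] by simp
  have "B (%x. u x - v x) (%x. u x - v x) <= 2 * B (r n) (r n) + 2 * B (%x. v x - p n x) (%x. v x - p n x)" for n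
   using B.square_diff_le[OF r B.diff_in[OF v p], of n n] by (simp add: r_def)
  then show "\<exists>N. \<forall>n\<ge>N. B (%x. u x - v x) (%x. u x - v x) <= 2 * B (r n) (r n) + 2 * B (%x. v x - p n x) (%x. v x - p n x)"
   by blast
 qed
 then have "B (%x. u x - v x) (%x. u x - v x) = 0" using B.nonneg[OF B.diff_in[OF u v]] by simp
 then have Q0: "Q (%x. u x - v x) (%x. u x - v x) = 0" by (rule B_null[OF B.diff_in[OF u v]])
 have lim: "(%n. Q (r n) (r n)) ~~> 0"
 proof (rule tendsto_sandwich[OF _ _ tendsto_const])
  show "\<forall>\<^sub>F n in sequentially. Q (r n) (r n) <= 2 * Q (%x. u x - v x) (%x. u x - v x) + 2 * Q (%x. v x - p n x) (%x. v x - p n x)"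
  proof (intro always_eventually allI)
   fix n show "Q (r n) (r n) <= 2 * Q (%x. u x - v x) (%x. u x - v x) + 2 * Q (%x. v x - p n x) (%x. v x - p n x)"
    using Q.square_add_le[OF B.diff_in[OF u v] B.diff_in[OF v p], of n] by (simp add: r_def[abs_def])
  qed
  show "(%n. 2 * Q (%x. u x - v x) (%x. u x - v x) + 2 * Q (%x. v x - p n x) (%x. v x - p n x)) ~~> 0"
   using tendsto_mult_right_zero[OF vl, of 2] by (simp add: Q0)
 qed (intro always_eventually allI Q.nonneg r)
 then show "(%n. Q (%x. u x - (\<Sum>k<n. B u (ef k) * ef k x)) (%x. u x - (\<Sum>k<n. B u (ef k) * ef k x))) ~~> 0"
  by (simp add: r_def[abs_def] p_def[abs_def])
 have "(%n. Q u u - Q (r n) (r n)) ~~> Q u u - 0" by (intro tendsto_intros lim)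
 moreover have "Q u u - Q (r n) (r n) = (\<Sum>k<n. ev k * (B u (ef k))^2)" for n using Qsplit[of n] Qpp[of n] by simp
 ultimately show "(%k. ev k * (B u (ef k))^2) sums Q u u" by (simp add: sums_def)
qed

end

section \<open>Integrals over a time interval\<close>

text \<open>Lebesgue measure on \<open>[0,T]\<close> as a measure on the whole line: functions stay
  Borel on the line, and products of such measures carry the usual Borel sets of the plane.\<close>

definition tm :: "real => real measure" where
 "tm T = density lborel (%t. ennreal (indicator {0..T} t))"

definition tint :: "real => (real => real) => real => real" where
 "tint T h t = (LINT s|lborel. indicator {t..T} s * h s)"

lemma sets_tm[simp, measurable_cong]: "sets (tm T) = sets borel" by (simp add: tm_def)
lemma space_tm[simp]: "space (tm T) = UNIV" by (simp add: tm_def)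
lemma measurable_tm[simp]: "borel_measurable (tm T) = BM"
 by (rule measurable_cong_sets) auto

lemma AE_tm: "(AE t in tm T. P t) \<longleftrightarrow> (AE t in lborel. 0 <= t & t <= T --> P t)"
 unfolding tm_def by (subst AE_density) (auto simp: indicator_def)

lemma integral_tm: "f \<in> BM ==> integral\<^sup>L (tm T) f = (LINT s|lborel. indicator {0..T} s * (f s :: real))"
 unfolding tm_def by (subst integral_density) auto

lemma integrable_tm: "f \<in> BM ==> integrable (tm T) f \<longleftrightarrow> integrable lborel (%s. indicator {0..T} s * (f s :: real))"
 unfolding tm_def by (subst integrable_density) auto

lemma finite_measure_tm: "finite_measure (tm T)"
 by (rule finite_measureI) (cases "0 <= T"; simp add: tm_def emeasure_density ennreal_indicator)

lemma tint_integrable: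
 fixes h :: "real => real"
 assumes "integrable (tm T) h" "0 <= t" shows "integrable lborel (%s. indicator {t..T} s * h s)"
proof -
 have m: "h \<in> BM" using borel_measurable_integrable[OF assms(1)] by simp
 have "integrable lborel (%s. indicator {t..T} s *\<^sub>R (indicator {0..T} s * h s))"
  using assms m by (intro integrable_mult_indicator) (auto simp: integrable_tm)
 moreover have "(%s. indicator {t..T} s *\<^sub>R (indicator {0..T} s * h s)) = (%s. indicator {t..T} s * h s)"
  using assms(2) by (intro ext) (auto simp: indicator_def)
 ultimately show ?thesis by simp
qed

lemma tint_mono:
 assumes "integrable (tm T) h" "integrable (tm T) g" "AE s in tm T. h s <= g s" "0 <= t"
 shows "tint T h t <= tint T g t"
 unfolding tint_def
proof (rule integral_mono_AE)
 show "AE s in lborel. indicator {t..T} s * h s <= indicator {t..T} s * g s"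
  using assms(3) unfolding AE_tm by eventually_elim (use assms(4) in "auto simp: indicator_def")
qed (intro tint_integrable assms)+

lemma tint_cong_AE:
 assumes "h \<in> BM" "g \<in> BM" "AE s in tm T. h s = g s" "0 <= t"
 shows "tint T h t = tint T g t"
 unfolding tint_def
proof (rule integral_cong_AE)
 show "AE s in lborel. indicator {t..T} s * h s = indicator {t..T} s * g s"
  using assms(3) unfolding AE_tm by eventually_elim (use assms(4) in "auto simp: indicator_def")
qed (use assms in auto)

lemma tint_add:
 assumes "integrable (tm T) h" "integrable (tm T) g" "0 <= t"
 shows "tint T (%s. h s + g s) t = tint T h t + tint T g t"
 unfolding tint_def using tint_integrable[OF assms(1,3)] tint_integrable[OF assms(2,3)]
 by (simp add: distrib_left)

lemma tint_cmult: "tint T (%s. c * h s) t = c * tint T h t"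
proof -
 have "(%s. indicator {t..T} s * (c * h s)) = (%s. c * (indicator {t..T} s * h s))" by auto
 then show ?thesis unfolding tint_def by simp
qed

lemma tint_sum:
 assumes "\<And>k. k \<in> I ==> integrable (tm T) (h k)" "0 <= t"
 shows "tint T (%s. \<Sum>k\<in>I. h k s) t = (\<Sum>k\<in>I. tint T (h k) t)"
 unfolding tint_def using tint_integrable[OF assms(1) assms(2)] by (simp add: sum_distrib_left)

lemma tint_0: "h \<in> BM ==> tint T h 0 = integral\<^sup>L (tm T) h"
 by (simp add: tint_def integral_tm)

lemma tint_nonneg: "AE s in tm T. 0 <= h s ==> 0 <= t ==> 0 <= tint T h t"
 unfolding tint_def AE_tm by (rule integral_nonneg_AE) (auto simp: indicator_def elim!: eventually_mono)

lemma tint_antimono: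
 assumes "integrable (tm T) h" "AE s in tm T. 0 <= h s" "0 <= s" "s <= t"
 shows "tint T h t <= tint T h s"
 unfolding tint_def
proof (rule integral_mono_AE)
 show "AE r in lborel. indicator {t..T} r * h r <= indicator {s..T} r * h r"
  using assms(2) unfolding AE_tm by eventually_elim (use assms(3,4) in "auto simp: indicator_def")
qed (use assms in "auto intro!: tint_integrable")

lemma integrable_tm_continuous:
 fixes u :: "real => real"
 assumes "continuous_on {0..T} u"
 shows "integrable (tm T) (%s. indicator {0..T} s * u s)"
  and "(%s. indicator {0..T} s * u s) \<in> BM"
proof -
 show m: "(%s. indicator {0..T} s * u s) \<in> BM"
  using borel_measurable_continuous_on_indicator[OF _ assms] by simp
 have "set_integrable lborel {0..T} u" by (rule borel_integrable_atLeastAtMost') (rule assms)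
 moreover have "(%s. indicator {0..T} s * (indicator {0..T} s * u s)) = (%s. indicator {0..T} s *\<^sub>R u s)"
  by (auto simp: indicator_def)
 ultimately show "integrable (tm T) (%s. indicator {0..T} s * u s)"
  using m by (simp add: integrable_tm set_integrable_def)
qed

text \<open>Square \<open>h = l * c - p\<close> and integrate over \<open>[t,T]\<close>: the mixed
  term \<open>- 2 * l * c * p\<close> is the derivative of \<open>- l * c^2\<close> and leaves the
  boundary terms.\<close>

lemma mode_energy:
 assumes ac: "ac T c p" and h[measurable]: "h \<in> BM" and hi: "integrable (tm T) (%s. (h s)^2)"
  and p: "AE s in lborel. 0 < s & s < T --> p s = l * c s - h s" and t: "0 <= t" "t <= T"
 shows "integrable (tm T) (%s. (p s)^2)"
  and "l * (c t)^2 + (tint T (%s. (p s)^2) t + l^2 * tint T (%s. indicator {0..T} s * (c s)^2) t) = l * (c T)^2 + tint T (%s. (h s)^2) t"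
proof -
 have [measurable]: "p \<in> BM" by (rule ac_borel[OF ac])
 define cc where "cc s = indicator {0..T} s * c s" for s
 note cont = ac_continuous[OF ac]
 have [measurable]: "cc \<in> BM"
  unfolding cc_def using integrable_tm_continuous(2)[OF cont] by simp
 have cc2: "indicator {0..T} s * (c s)^2 = (cc s)^2" for s by (simp add: cc_def power_mult_distrib indicator_def)
 have ccL: "L2 (tm T) cc" "L2 (tm T) h"
  unfolding L2_def using integrable_tm_continuous(1)[of T "%s. (c s)^2"] cont hi
  by (auto simp: cc2 intro!: continuous_intros)
 have pAE: "AE s in tm T. p s = l * cc s - h s"
  unfolding AE_tm using p AE_lborel_singleton[of 0] AE_lborel_singleton[of T]
  by eventually_elim (auto simp: cc_def)
 have pL: "L2 (tm T) p"
 proof -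
  have "L2 (tm T) (%s. l * cc s - h s)" by (intro L2_diff L2_cmult ccL)
  then have "integrable (tm T) (%s. (l * cc s - h s)^2)" by (simp add: L2_def)
  moreover have "AE s in tm T. (l * cc s - h s)^2 = (p s)^2" using pAE by eventually_elim simp
  ultimately have "integrable (tm T) (%s. (p s)^2)"
   by (subst integrable_cong_AE[of _ _ "%s. (l * cc s - h s)^2"]) auto
  then show ?thesis by (simp add: L2_def)
 qed
 then show "integrable (tm T) (%s. (p s)^2)" by (simp add: L2_def)
 have i: "integrable (tm T) (%s. (p s)^2)" "integrable (tm T) (%s. (cc s)^2)" "integrable (tm T) (%s. cc s * p s)"
  using pL ccL L2_mult[OF ccL(1) pL] by (auto simp: L2_def)
 have "(c T)^2 - (c t)^2 = (LINT s|lborel. indicator {t..T} s * (indicator {0..T} s * (p s * c s + c s * p s)))"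
  using ac_diff[OF ac_mult[OF ac ac], of t T] t by (simp add: power2_eq_square)
 also have "... = tint T (%s. 2 * (cc s * p s)) t"
  unfolding tint_def by (intro Bochner_Integration.integral_cong) (auto simp: cc_def indicator_def)
 finally have e1: "(c T)^2 - (c t)^2 = 2 * tint T (%s. cc s * p s) t" by (simp add: tint_cmult)
 have "tint T (%s. (h s)^2) t = tint T (%s. ((p s)^2 + l^2 * (cc s)^2) + (- (2 * l)) * (cc s * p s)) t"
 proof (rule tint_cong_AE)
  show "AE s in tm T. (h s)^2 = ((p s)^2 + l^2 * (cc s)^2) + (- (2 * l)) * (cc s * p s)"
   using pAE
  proof eventually_elim
   case (elim s)
   then have *: "h s = l * cc s - p s" by simp
   show ?case unfolding * by (simp add: power2_eq_square algebra_simps)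
  qed
 qed (use t in auto)
 also have "... = tint T (%s. (p s)^2) t + l^2 * tint T (%s. (cc s)^2) t + (- (2 * l)) * tint T (%s. cc s * p s) t"
 proof -
  have a: "tint T (%s. ((p s)^2 + l^2 * (cc s)^2) + (- (2 * l)) * (cc s * p s)) t =
    tint T (%s. (p s)^2 + l^2 * (cc s)^2) t + tint T (%s. (- (2 * l)) * (cc s * p s)) t"
   by (rule tint_add) (use i t in auto)
  have b: "tint T (%s. (p s)^2 + l^2 * (cc s)^2) t = tint T (%s. (p s)^2) t + tint T (%s. l^2 * (cc s)^2) t"
   by (rule tint_add) (use i t in auto)
  show ?thesis unfolding a b tint_cmult ..
 qed
 finally show "l * (c t)^2 + (tint T (%s. (p s)^2) t + l^2 * tint T (%s. indicator {0..T} s * (c s)^2) t) = l * (c T)^2 + tint T (%s. (h s)^2) t"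
  using arg_cong[OF e1, of "%x. l * x"] unfolding cc2 by (simp add: algebra_simps)
qed

text \<open>Variation of constants, solved backwards from \<open>T\<close>:
  \<open>c t = exp (l * t) * (exp (- l * T) * \<tau> + K T - K t)\<close>. The size of the
  exponentials is harmless, because estimates uniform in \<open>l\<close> come from the energy
  identity.\<close>

lemma mode_exists:
 assumes h[measurable]: "h \<in> BM" and hi: "integrable (tm T) (%s. (h s)^2)" and T: "0 <= T"
 shows "\<exists>c \<in> BM. ac T c (%t. indicator {0..T} t * (l * c t - h t)) & c T = \<tau>"
proof -
 define E where "E t = exp (l * t)" for t
 define K where "K t = (LINT s|lborel. indicator {0..t} s * (exp (- (l * s)) * h s))" for t
 have hint: "integrable (tm T) h"
 proof (rule Bochner_Integration.integrable_bound)
  interpret finite_measure "tm T" by (rule finite_measure_tm)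
  show "integrable (tm T) (%s. 1 + (h s)^2)" using hi by simp
  show "AE s in tm T. norm (h s) <= norm (1 + (h s)^2)"
  proof (rule AE_I2)
   fix s show "norm (h s) <= norm (1 + (h s)^2)" using abs_mult_le_squares[of 1 "h s"] by simp
  qed
 qed simp
 have acE: "ac T E (%t. indicator {0..T} t * (l * E t))"
  unfolding E_def by (rule ac_deriv) (auto intro!: derivative_eq_intros continuous_intros)
 have acK: "ac T K (%s. exp (- (l * s)) * h s)"
 proof (rule acI)
  obtain B where B: "\<And>s. s \<in> {0..T} ==> norm (exp (- (l * s))) <= B"
  proof -
   have "compact ((%s. exp (- (l * s))) ` {0..T})" by (intro compact_continuous_image continuous_intros) auto
   from compact_imp_bounded[OF this] obtain B where "\<forall>x\<in>(%s. exp (- (l * s))) ` {0..T}. norm x <= B"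
    unfolding bounded_iff by blast
   then show ?thesis by (intro that[of B]) blast
  qed
  show "integrable lborel (%s. indicator {0..T} s * (exp (- (l * s)) * h s))"
  proof (rule Bochner_Integration.integrable_bound)
   show "integrable lborel (%s. B * (indicator {0..T} s * h s))" using hint by (simp add: integrable_tm)
   show "AE s in lborel. norm (indicator {0..T} s * (exp (- (l * s)) * h s)) <= norm (B * (indicator {0..T} s * h s))"
   proof (rule AE_I2)
    fix s show "norm (indicator {0..T} s * (exp (- (l * s)) * h s)) <= norm (B * (indicator {0..T} s * h s))"
     using B[of s] by (auto simp: indicator_def abs_mult intro!: mult_right_mono)
   qed
  qed simp
  fix y assume "y \<in> {0..T}"
  have "K 0 = 0"
   unfolding K_def
  proof (rule integral_eq_zero_AE)
   show "AE s in lborel. indicator {0..0} s * (exp (- (l * s)) * h s) = 0"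
    using AE_lborel_singleton[of "0::real"] by eventually_elim (simp add: indicator_def)
  qed
  then show "K y = K 0 + (LINT s|lborel. indicator {0..y} s * (exp (- (l * s)) * h s))" by (simp add: K_def)
 qed simp
 define A where "A t = 1 * (exp (- (l * T)) * \<tau> + K T) + (-1) * K t" for t
 have acA: "ac T A (%t. 1 * 0 + (-1) * (exp (- (l * t)) * h t))"
  unfolding A_def by (rule ac_comb[OF ac_const acK])
 define c where "c t = indicator {0..T} t * (E t * A t)" for t
 note acEA = ac_mult[OF acE acA]
 have cm[measurable]: "c \<in> BM"
  unfolding c_def by (rule integrable_tm_continuous(2)[OF ac_continuous[OF acEA]])
 have "ac T c (%t. indicator {0..T} t * (l * c t - h t))"
 proof (rule ac_cong_AE[OF acEA])
  show "AE s in lborel. 0 < s & s < T --> indicator {0..T} s * (indicator {0..T} s * (l * E s) * A s + E s * (1 * 0 + - 1 * (exp (- (l * s)) * h s))) = indicator {0..T} s * (l * c s - h s)"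
   by (rule AE_I2) (auto simp: c_def E_def indicator_def exp_minus field_simps)
  show "E y * A y = c y" if "y \<in> {0..T}" for y using that by (simp add: c_def)
 qed simp
 moreover have "c T = \<tau>" using T by (simp add: c_def E_def A_def exp_minus)
 ultimately show ?thesis using cm by blast
qed

lemma AE_summable:
 assumes i: "\<And>k. integrable M (f k)" and nn: "\<And>k x. 0 <= f k x" and s: "summable (%k. (LINT x|M. f k x))"
 shows "AE x in M. summable (%k. f k x :: real)"
proof -
 have "(\<Sum>k. \<integral>\<^sup>+x. ennreal (f k x) \<partial>M) < \<infinity>"
 proof -
  have "(\<integral>\<^sup>+x. ennreal (f k x) \<partial>M) = ennreal (LINT x|M. f k x)" for k
   using i nn by (intro nn_integral_eq_integral) auto
  then show ?thesis using s nn by (simp add: suminf_ennreal2 integral_nonneg_AE)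
 qed
 then have "(\<integral>\<^sup>+x. (\<Sum>k. ennreal (f k x)) \<partial>M) < \<infinity>" using i by (subst nn_integral_suminf) auto
 moreover have "(%x. \<Sum>k. ennreal (f k x)) \<in> borel_measurable M" using i by measurable
 ultimately have "AE x in M. (\<Sum>k. ennreal (f k x)) \<noteq> \<infinity>" by (intro nn_integral_PInf_AE) auto
 then show ?thesis by eventually_elim (use nn summable_suminf_not_top in auto)
qed

section \<open>The semilinear evolution equation in Fourier coordinates\<close>

locale space_time = M: sigma_finite_measure M for M :: "'x measure" +
 fixes T :: real
 assumes T: "0 < T"
begin

sublocale tm: finite_measure "tm T" by (rule finite_measure_tm)
sublocale N: pair_sigma_finite "tm T" M ..

abbreviation N where "N \<equiv> tm T >< M"

lemma slice_L2: assumes "L2 N g" shows "AE t in tm T. L2 M (%x. g (t, x))"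
proof -
 have [measurable]: "g \<in> borel_measurable N" using assms by (simp add: L2_def)
 have "AE t in tm T. integrable M (%x. (g (t, x))^2)" using N.AE_integrable_fst'[OF L2_square[OF assms]] .
 moreover have "(%x. g (t, x)) \<in> borel_measurable M" for t by measurable
 ultimately show ?thesis by (auto simp: L2_def)
qed

definition sq :: "(real \<times> 'x => real) => real => real" where
 "sq g t = (LINT x|M. (g (t, x))^2)"

lemma sq_nonneg: "0 <= sq g t" by (simp add: sq_def)

lemma sq_integrable: assumes "L2 N g" shows "integrable (tm T) (sq g)" and "(LINT t|tm T. sq g t) = (LINT z|N. (g z)^2)"
 using N.integrable_fst'[OF L2_square[OF assms]] N.integral_fst'[OF L2_square[OF assms]] by (simp_all add: sq_def[abs_def])

lemma sq_borel: "L2 N g ==> sq g \<in> BM"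
 using sq_integrable(1)[THEN borel_measurable_integrable] by simp

lemma tensor_L2:
 assumes "L2 M e" "L2 (tm T) c" shows "L2 N (%(t, x). c t * e x)"
proof -
 have [measurable]: "e \<in> borel_measurable M" "c \<in> BM" using assms by (auto simp: L2_def)
 have "integrable N (%(t, x). (c t)^2 * (e x)^2)"
 proof (rule N.Fubini_integrable)
  show "integrable (tm T) (%t. (LINT x|M. norm (case (t, x) of (t, x) => (c t)^2 * (e x)^2)))"
   using assms by (simp add: L2_def)
  show "AE t in tm T. integrable M (%x. case (t, x) of (t, x) => (c t)^2 * (e x)^2)"
   using assms by (simp add: L2_def)
 qed measurable
 moreover have "(%z. (case z of (t, x) => c t * e x)^2) = (%(t, x). (c t)^2 * (e x)^2)"
  by (auto simp: power_mult_distrib)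
 moreover have "(%(t, x). c t * e x) \<in> borel_measurable N" by measurable
 ultimately show ?thesis by (simp add: L2_def)
qed

text \<open>Convergence in space-time gives convergence of time slices only along a subsequence. As
  \<open>\<kappa> k * (c k t)^2\<close> is summable for almost every \<open>t\<close>, the slices
  are also Cauchy, so the whole sequence converges to the slice of the same \<open>P\<close>. The
  weights admit both values (\<kappa> equal to 1) and derivatives (\<kappa> the eigenvalue) of
  eigenfunctions.\<close>

lemma joint_limit:
 fixes e :: "nat => 'x => real" and c :: "nat => real => real"
 assumes e: "\<And>k. L2 M (e k)" and \<kappa>: "\<And>k. 0 <= \<kappa> k" and C: "0 <= C"
  and bd: "\<And>a n m. (LINT x|M. (\<Sum>k=n..<m. a k * e k x)^2) <= C * (\<Sum>k=n..<m. \<kappa> k * (a k)^2)"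
  and c: "\<And>k. L2 (tm T) (c k)" and sm: "summable (%k. (LINT t|tm T. \<kappa> k * (c k t)^2))"
 shows "\<exists>P. L2 N P & (%n. (LINT z|N. (P z - (\<Sum>k<n. case z of (t, x) => c k t * e k x))^2)) ~~> 0 \<and>
  (AE t in tm T. L2 M (%x. P (t, x)) \<and>
  (%n. (LINT x|M. (P (t, x) - (\<Sum>k<n. c k t * e k x))^2)) ~~> 0)"
proof -
 define s where "s n z = (\<Sum>k<n. (case z of (t, x) => c k t * e k x))" for n z
 have sL: "L2 N (s n)" for n unfolding s_def by (intro L2_sum tensor_L2 e c)
 have stx: "s n (t, x) = (\<Sum>k<n. c k t * e k x)" for n t x by (simp add: s_def)
 have ci: "integrable (tm T) (%t. \<kappa> k * (c k t)^2)" for k using c by (simp add: L2_def)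
 have bd1: "(LINT x|M. (s m (t, x) - s n (t, x))^2) <= C * (\<Sum>k=n..<m. \<kappa> k * (c k t)^2)" if "n <= m" for n m t
 proof -
  have "s m (t, x) - s n (t, x) = (\<Sum>k=n..<m. c k t * e k x)" for x
   using sum_diff_nat_ivl[of 0 n m "%k. c k t * e k x"] that by (simp add: stx atLeast0LessThan)
  then show ?thesis using bd by simp
 qed
 have bd2: "(LINT z|N. (s m z - s n z)^2) <= C * (\<Sum>k=n..<m. (LINT t|tm T. \<kappa> k * (c k t)^2))" if "n <= m" for n m
 proof -
  note L = L2_square[OF L2_diff[OF sL[of m] sL[of n]]]
  have "(LINT z|N. (s m z - s n z)^2) = (LINT t|tm T. (LINT x|M. (s m (t, x) - s n (t, x))^2))"
   using N.integral_fst'[OF L] by simp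
  also have "... <= (LINT t|tm T. C * (\<Sum>k=n..<m. \<kappa> k * (c k t)^2))"
   using N.integrable_fst'[OF L] ci bd1[OF that] by (intro integral_mono) auto
  also have "... = C * (\<Sum>k=n..<m. (LINT t|tm T. \<kappa> k * (c k t)^2))" using ci by simp
  finally show ?thesis .
 qed
 have symm: "(LINT z|N. (s m z - s n z)^2) = (LINT z|N. (s n z - s m z)^2)" for m n
  by (simp add: power2_commute)
 obtain P where P: "L2 N P" "(%n. (LINT z|N. (P z - s n z)^2)) ~~> 0"
 proof -
  have "\<exists>K. \<forall>m\<ge>K. \<forall>n\<ge>K. (LINT z|N. (s m z - s n z)^2) < ep" if "ep > 0" for ep
  proof -
   have "0 < ep / (C + 1)" using that C by simp
   then obtain K where K: "\<And>m n. m >= K ==> norm (\<Sum>k=m..<n. (LINT t|tm T. \<kappa> k * (c k t)^2)) < ep / (C + 1)"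
    using sm unfolding summable_Cauchy by meson
   have half: "(LINT z|N. (s m z - s n z)^2) < ep" if "K <= n" "n <= m" for m n
   proof -
    have "(LINT z|N. (s m z - s n z)^2) <= C * (\<Sum>k=n..<m. (LINT t|tm T. \<kappa> k * (c k t)^2))" by (rule bd2[OF that(2)])
    also have "... <= C * (ep / (C + 1))" using K[OF that(1), of m] C by (intro mult_left_mono) auto
    also have "... < ep" using C \<open>ep > 0\<close> by (simp add: field_simps)
    finally show ?thesis .
   qed
   show ?thesis
   proof (intro exI allI impI)
    fix m n assume "K <= m" "K <= n"
    then show "(LINT z|N. (s m z - s n z)^2) < ep"
     using half[of n m] half[of m n] symm[of m n] by (cases "n <= m") auto
   qed
  qed
  from L2_complete[OF sL this] show ?thesis using that by blast
 qed
 define D where "D n t = (LINT x|M. (P (t, x) - s n (t, x))^2)" for n t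
 note LD = L2_square[OF L2_diff[OF P(1) sL]]
 have Di: "integrable (tm T) (D n)" for n using N.integrable_fst'[OF LD] by (simp add: D_def[abs_def])
 have "(LINT t|tm T. norm (D n t)) = (LINT z|N. (P z - s n z)^2)" for n
 proof -
  have "norm (D n t) = D n t" for t by (simp add: D_def)
  then show ?thesis using N.integral_fst'[OF LD, of n] by (simp add: D_def)
 qed
 then have "(%n. (LINT t|tm T. norm (D n t))) ~~> 0" using P(2) by simp
 from tendsto_L1_AE_subseq[OF Di this] obtain r :: "nat => nat" where r: "strict_mono r"
  and Dr: "AE t in tm T. (%n. D (r n) t) ~~> 0" by blast
 have sum: "AE t in tm T. summable (%k. \<kappa> k * (c k t)^2)"
  by (rule AE_summable[OF ci _ sm]) (simp add: \<kappa>)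
 have ssl: "AE t in tm T. \<forall>k. L2 M (%x. s k (t, x))" using slice_L2[OF sL] by (simp add: AE_all_countable)
 have "AE t in tm T. L2 M (%x. P (t, x)) & (%n. D n t) ~~> 0"
  using Dr sum slice_L2[OF P(1)] ssl
 proof eventually_elim
  case (elim t)
  have "(%n. D n t) ~~> 0"
  proof (rule LIMSEQ_I)
   fix ep :: real assume ep: "0 < ep"
   then have "0 < ep / (4 * (C + 1))" using C by simp
   then obtain K where K: "\<And>m n. m >= K ==> norm (\<Sum>k=m..<n. \<kappa> k * (c k t)^2) < ep / (4 * (C + 1))"
    using elim(2) unfolding summable_Cauchy by meson
   obtain J where J: "\<And>j. j >= J ==> norm (D (r j) t - 0) < ep / 4" using LIMSEQ_D[OF elim(1), of "ep/4"] ep by auto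
   show "\<exists>no. \<forall>n\<ge>no. norm (D n t - 0) < ep"
   proof (intro exI allI impI)
    fix n assume n: "K <= n"
    \<comment> \<open>The slice is compared with a member of the good subsequence that is late
      enough for \<open>J\<close> and whose index \<open>r j\<close> is at least
      \<open>n\<close>.\<close>
    define j where "j = max J n"
    have nj: "n <= r j" using seq_suble[OF r, of j] by (simp add: j_def)
    have "D n t = (LINT x|M. ((P (t, x) - s (r j) (t, x)) + (s (r j) (t, x) - s n (t, x)))^2)" by (simp add: D_def)
    also have "... <= 2 * D (r j) t + 2 * (LINT x|M. (s (r j) (t, x) - s n (t, x))^2)"
     unfolding D_def using elim by (intro L2_integral_square_add L2_diff) auto
    also have "... <= 2 * D (r j) t + 2 * (C * (ep / (4 * (C + 1))))"
    proof -
     have "(LINT x|M. (s (r j) (t, x) - s n (t, x))^2) <= C * (\<Sum>k=n..<r j. \<kappa> k * (c k t)^2)" by (rule bd1[OF nj])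
     also have "... <= C * (ep / (4 * (C + 1)))" using K[OF n, of "r j"] C by (intro mult_left_mono) auto
     finally show ?thesis by simp
    qed
    also have "... < ep"
    proof -
     have "C * (ep / (4 * (C + 1))) < ep / 4" using C ep by (simp add: field_simps)
     moreover have "D (r j) t < ep / 4" using J[of j] by (auto simp: j_def)
     ultimately show ?thesis by linarith
    qed
    finally show "norm (D n t - 0) < ep" by (simp add: D_def)
   qed
  qed
  then show ?case using elim by simp
 qed
 then show ?thesis using P unfolding D_def stx unfolding s_def by blast
qed

end

text \<open>Carries estimates for the partial sums of two series over to their limits.\<close>

lemma L2_integral_le_limit:
 assumes f: "\<And>n. L2 M (f n)" "L2 M f'" "(%n. (LINT x|M. (f' x - f n x)^2)) ~~> 0"
  and g: "\<And>n. L2 M (g n)" "L2 M g'" "(%n. (LINT x|M. (g' x - g n x)^2)) ~~> 0"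
  and B: "\<And>n. (LINT x|M. (f n x - g n x)^2) <= B"
 shows "(LINT x|M. (f' x - g' x)^2) <= B"
proof (rule LIMSEQ_le_const2)
 show "(%n. (LINT x|M. (f n x - g n x)^2)) ~~> (LINT x|M. (f' x - g' x)^2)"
 proof (rule L2_tendsto_square)
  show "(%n. (LINT x|M. (f' x - g' x - (f n x - g n x))^2)) ~~> 0"
  proof (rule tendsto_sandwich[OF _ _ tendsto_const])
   show "\<forall>\<^sub>F n in sequentially. (LINT x|M. (f' x - g' x - (f n x - g n x))^2)
     <= 2 * (LINT x|M. (f' x - f n x)^2) + 2 * (LINT x|M. (g' x - g n x)^2)"
   proof (intro always_eventually allI)
    fix n
    have "(%x. (f' x - g' x - (f n x - g n x))^2) = (%x. ((f' x - f n x) - (g' x - g n x))^2)" by (simp add: algebra_simps)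
    then show "(LINT x|M. (f' x - g' x - (f n x - g n x))^2)
     <= 2 * (LINT x|M. (f' x - f n x)^2) + 2 * (LINT x|M. (g' x - g n x)^2)"
     using L2_integral_square_diff[OF L2_diff[OF f(2) f(1)] L2_diff[OF g(2) g(1)], of n n] by simp
   qed
   show "(%n. 2 * (LINT x|M. (f' x - f n x)^2) + 2 * (LINT x|M. (g' x - g n x)^2)) ~~> 0"
    using tendsto_add[OF tendsto_mult_right_zero[OF f(3), of 2] tendsto_mult_right_zero[OF g(3), of 2]] by simp
  qed (simp add: integral_nonneg_AE)
 qed (intro L2_diff f g)+
qed (use B in auto)

text \<open>\<open>e\<close> and \<open>d\<close> stand for values and derivatives of the
  eigenfunctions. Norms of \<open>e k\<close> are only bounded by 1 because of the padding, and the
  \<open>d k\<close> need not be orthogonal, so they enter through the coercivity estimate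
  \<open>d_bound\<close>.\<close>

locale fourier = space_time M T for M :: "'x measure" and T +
 fixes e d :: "nat => 'x => real" and lam :: "nat => real" and C :: real
 assumes e: "L2 M (e k)" and d: "L2 M (d k)"
  and e_orth: "j \<noteq> k ==> (LINT x|M. e j x * e k x) = 0" and e_norm: "(LINT x|M. (e k x)^2) <= 1"
  and lam: "1 <= lam k" and C: "0 <= C"
  and d_bound: "(LINT x|M. (\<Sum>k=n..<m. a k * d k x)^2) <= C * (\<Sum>k=n..<m. lam k * (a k)^2)"
begin

lemma e_sum: "finite I ==> (LINT x|M. (\<Sum>k\<in>I. a k * e k x)^2) <= (\<Sum>k\<in>I. (a k)^2)"
proof -
 assume I: "finite I"
 have i: "integrable M (%x. e j x * e k x)" for j k by (rule L2_mult[OF e e])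
 have "(LINT x|M. (\<Sum>k\<in>I. a k * e k x)^2) = (LINT x|M. (\<Sum>j\<in>I. \<Sum>k\<in>I. a j * a k * (e j x * e k x)))"
  by (intro Bochner_Integration.integral_cong refl) (simp add: power2_eq_square sum_product algebra_simps)
 also have "... = (\<Sum>j\<in>I. \<Sum>k\<in>I. a j * a k * (LINT x|M. e j x * e k x))"
  using i by (simp add: Bochner_Integration.integral_sum)
 also have "... = (\<Sum>j\<in>I. \<Sum>k\<in>I. if k = j then (a j)^2 * (LINT x|M. (e j x)^2) else 0)"
  by (intro sum.cong refl) (auto simp: e_orth power2_eq_square)
 also have "... = (\<Sum>j\<in>I. (a j)^2 * (LINT x|M. (e j x)^2))" using I by simp
 also have "... <= (\<Sum>j\<in>I. (a j)^2 * 1)" by (intro sum_mono mult_left_mono e_norm) simp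
 finally show ?thesis by simp
qed

text \<open>Expand the square of \<open>u\<close> minus its Fourier sum; norms at most 1 are enough,
  by \<open>e_sum\<close>.\<close>

lemma bessel:
 assumes u: "L2 M u" shows "(\<Sum>k<n. (LINT x|M. u x * e k x)^2) <= (LINT x|M. (u x)^2)"
proof -
 define a where "a k = (LINT x|M. u x * e k x)" for k
 define s where "s x = (\<Sum>k<n. a k * e k x)" for x
 have s: "L2 M s" unfolding s_def by (intro L2_sum L2_cmult e)
 have "(LINT x|M. u x * s x) = (LINT x|M. (\<Sum>k<n. a k * (u x * e k x)))"
  by (intro Bochner_Integration.integral_cong refl) (simp add: s_def sum_distrib_left algebra_simps)
 also have "... = (\<Sum>k<n. (a k)^2)"
  using L2_mult[OF u e] by (simp add: a_def power2_eq_square)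
 finally have us: "(LINT x|M. u x * s x) = (\<Sum>k<n. (a k)^2)" .
 have "0 <= (LINT x|M. (u x + (-1) * s x)^2)" by (simp add: integral_nonneg_AE)
 also have "... = (LINT x|M. (u x)^2) - 2 * (\<Sum>k<n. (a k)^2) + (LINT x|M. (s x)^2)"
  unfolding L2_expand[OF u s] us by simp
 also have "... <= (LINT x|M. (u x)^2) - (\<Sum>k<n. (a k)^2)"
  using e_sum[of "{..<n}" a] by (simp add: s_def)
 finally show ?thesis by (simp add: a_def)
qed

definition coef :: "(real \<times> 'x => real) => nat => real => real" where
 "coef g k t = (LINT x|M. g (t, x) * e k x)"

lemma coef_borel: assumes "L2 N g" shows "coef g k \<in> BM"
proof -
 have [measurable]: "g \<in> borel_measurable N" "e k \<in> borel_measurable M" using assms e by (auto simp: L2_def)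
 have "(%t. (LINT x|M. g (t, x) * e k x)) \<in> borel_measurable (tm T)" by measurable
 then show ?thesis by (simp add: coef_def[abs_def])
qed

lemma coef_bessel: "L2 N g ==> AE t in tm T. \<forall>n. (\<Sum>k<n. (coef g k t)^2) <= sq g t"
 using slice_L2[of g] by (auto simp: coef_def sq_def bessel elim!: eventually_mono)

lemma coef_square_integrable:
 assumes g: "L2 N g" shows "integrable (tm T) (%t. (coef g k t)^2)"
proof (rule Bochner_Integration.integrable_bound[OF sq_integrable(1)[OF g]])
 show "(%t. (coef g k t)^2) \<in> borel_measurable (tm T)" using coef_borel[OF g, of k] by simp
 show "AE t in tm T. norm ((coef g k t)^2) <= norm (sq g t)"
  using coef_bessel[OF g]
 proof eventually_elim
  case (elim t)
  have "(coef g k t)^2 <= (\<Sum>k<Suc k. (coef g k t)^2)" by (simp add: sum_nonneg)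
  then show ?case using elim[rule_format, of "Suc k"] by simp
 qed
qed

lemma coef_sum_integral:
 assumes g: "L2 N g" shows "(\<Sum>k<n. (LINT t|tm T. (coef g k t)^2)) <= (LINT t|tm T. sq g t)"
proof -
 have "(\<Sum>k<n. (LINT t|tm T. (coef g k t)^2)) = (LINT t|tm T. (\<Sum>k<n. (coef g k t)^2))"
  using coef_square_integrable[OF g] by simp
 also have "... <= (LINT t|tm T. sq g t)"
  using coef_bessel[OF g] coef_square_integrable[OF g] sq_integrable[OF g]
  by (intro integral_mono_AE) (auto elim!: eventually_mono)
 finally show ?thesis .
qed

lemma coef_diff: 
 assumes "L2 N g" "L2 N g'" shows "AE t in tm T. \<forall>k. coef (%z. g z - g' z) k t = coef g k t - coef g' k t"
 using slice_L2[OF assms(1)] slice_L2[OF assms(2)]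
proof eventually_elim
 case (elim t)
 then show ?case using L2_mult[OF _ e] by (simp add: coef_def left_diff_distrib)
qed

text \<open>The coefficients of a solution of \<open>- v' + A v = g\<close> with terminal
  coefficients \<tau>. Being absolutely continuous, they have a value at every time.\<close>

definition modes :: "(nat => real) => (real \<times> 'x => real) => (nat => real => real) => bool" where
 "modes \<tau> g c \<longleftrightarrow> (\<forall>k. c k \<in> BM \<and>
  ac T (c k) (%t. indicator {0..T} t * (lam k * c k t - coef g k t)) & c k T = \<tau> k)"

lemma modes_exist: "L2 N g ==> \<exists>c. modes \<tau> g c"
proof -
 assume g: "L2 N g"
 have "\<exists>c \<in> BM. ac T c (%t. indicator {0..T} t * (lam k * c t - coef g k t)) & c T = \<tau> k" for k
  by (rule mode_exists[OF coef_borel[OF g] coef_square_integrable[OF g]]) (use T in simp)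
 then show ?thesis unfolding modes_def by metis
qed

lemma modesD:
 assumes "modes \<tau> g c"
 shows "c k \<in> BM" "ac T (c k) (%t. indicator {0..T} t * (lam k * c k t - coef g k t))" "c k T = \<tau> k"
 using assms by (auto simp: modes_def)

lemma continuous_L2_tm:
 assumes "continuous_on {0..T} u" "u \<in> BM" shows "L2 (tm T) u"
 unfolding L2_def
proof
 have "integrable (tm T) (%s. indicator {0..T} s * (u s)^2)"
  by (rule integrable_tm_continuous) (intro continuous_intros assms)
 moreover have "AE s in tm T. indicator {0..T} s * (u s)^2 = (u s)^2" by (simp add: AE_tm)
 ultimately show "integrable (tm T) (%s. (u s)^2)"
  using assms(2) by (subst integrable_cong_AE[of _ _ "%s. indicator {0..T} s * (u s)^2"]) (auto elim!: eventually_mono)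
qed (use assms in simp)

text \<open>The right-hand side of the energy identity on all of \<open>[0,T]\<close>: it dominates
  the mode \<open>k\<close> uniformly in time and is summable in \<open>k\<close>.\<close>

definition bound :: "(nat => real) => (real \<times> 'x => real) => nat => real" where
 "bound \<tau> g k = lam k * (\<tau> k)^2 + (LINT t|tm T. (coef g k t)^2)"

lemma bound_summable:
 assumes g: "L2 N g" and \<tau>: "summable (%k. lam k * (\<tau> k)^2)" shows "summable (bound \<tau> g)"
proof -
 have "summable (%k. (LINT t|tm T. (coef g k t)^2))"
  by (rule summableI_nonneg_bounded[OF _ coef_sum_integral[OF g]]) (simp add: integral_nonneg_AE)
 then show ?thesis unfolding bound_def[abs_def] by (rule summable_add[OF \<tau>])
qed

text \<open>Each inequality keeps one term on the left of the energy identity, where all terms are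
  nonnegative.\<close>

lemma modes_bounds:
 assumes m: "modes \<tau> g c" and g: "L2 N g"
 shows "L2 (tm T) (c k)"
  and "t \<in> {0..T} ==> lam k * (c k t)^2 <= bound \<tau> g k"
  and "(LINT t|tm T. (lam k * c k t)^2) <= bound \<tau> g k"
  and "L2 (tm T) (%t. lam k * c k t - coef g k t)"
  and "(LINT t|tm T. (lam k * c k t - coef g k t)^2) <= bound \<tau> g k"
proof -
 note [measurable] = modesD(1)[OF m] coef_borel[OF g]
 let ?p = "%t. indicator {0..T} t * (lam k * c k t - coef g k t)"
 have T0: "0 <= T" using T by simp
 note hi = coef_square_integrable[OF g, of k]
 have p: "AE s in lborel. 0 < s & s < T --> ?p s = lam k * c k s - coef g k s" by auto
 note en = mode_energy[OF modesD(2)[OF m] coef_borel[OF g] hi p]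
 show cL: "L2 (tm T) (c k)" by (intro continuous_L2_tm ac_continuous[OF modesD(2)[OF m]] modesD(1)[OF m])
 have pe: "AE t in tm T. ?p t = lam k * c k t - coef g k t" by (auto simp: AE_tm)
 have ce: "AE t in tm T. indicator {0..T} t * (c k t)^2 = (c k t)^2" by (auto simp: AE_tm)
 show pL: "L2 (tm T) (%t. lam k * c k t - coef g k t)"
  using cL hi coef_borel[OF g, of k] by (intro L2_diff L2_cmult) (auto simp: L2_def)
 have t1: "0 <= tint T (%s. (?p s)^2) t" "0 <= (lam k)^2 * tint T (%s. indicator {0..T} s * (c k s)^2) t" if "0 <= t" for t
  using that by (auto intro!: tint_nonneg mult_nonneg_nonneg)
 have t2: "tint T (%s. (coef g k s)^2) t <= (LINT s|tm T. (coef g k s)^2)" if "0 <= t" for t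
  using tint_antimono[OF hi _ _ that] tint_0[of "%s. (coef g k s)^2" T] by simp
 show "lam k * (c k t)^2 <= bound \<tau> g k" if "t \<in> {0..T}"
  using en(2)[of t] t1[of t] t2[of t] that by (simp add: bound_def modesD(3)[OF m])
 have l0: "0 <= lam k * (c k 0)^2" using lam[of k] by simp
 have "tint T (%s. (?p s)^2) 0 = (LINT t|tm T. (?p t)^2)" by (rule tint_0) simp
 also have "... = (LINT t|tm T. (lam k * c k t - coef g k t)^2)"
  by (rule integral_cong_AE) (use pe in "auto elim!: eventually_mono")
 finally have P: "tint T (%s. (?p s)^2) 0 = (LINT t|tm T. (lam k * c k t - coef g k t)^2)" .
 have "tint T (%s. indicator {0..T} s * (c k s)^2) 0 = (LINT t|tm T. indicator {0..T} t * (c k t)^2)" by (rule tint_0) simp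
 also have "... = (LINT t|tm T. (c k t)^2)"
  by (rule integral_cong_AE) (use ce in "auto elim!: eventually_mono")
 finally have Cc: "(lam k)^2 * tint T (%s. indicator {0..T} s * (c k s)^2) 0 = (LINT t|tm T. (lam k * c k t)^2)"
  by (simp add: power_mult_distrib)
 have n: "0 <= (LINT t|tm T. (lam k * c k t)^2)" "0 <= (LINT t|tm T. (lam k * c k t - coef g k t)^2)"
  by (intro integral_nonneg_AE AE_I2; simp)+
 show "(LINT t|tm T. (lam k * c k t)^2) <= bound \<tau> g k" "(LINT t|tm T. (lam k * c k t - coef g k t)^2) <= bound \<tau> g k"
  using en(2)[OF order_refl T0, unfolded P Cc modesD(3)[OF m]] t2[OF order_refl] l0 n
  unfolding bound_def by linarith+
qed

text \<open>Both families have the same terminal values, so the energy identity of the difference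
  retains only the source on \<open>[t,T]\<close>; Bessel's inequality sums the modes.\<close>

lemma modes_diff:
 assumes m: "modes \<tau> g c" "modes \<tau> g' c'" and g: "L2 N g" "L2 N g'" and t: "t \<in> {0..T}"
 shows "(\<Sum>k<n. lam k * (c k t - c' k t)^2) <= tint T (sq (%z. g z - g' z)) t"
proof -
 note gg = L2_diff[OF g]
 have 1: "lam k * (c k t - c' k t)^2 <= tint T (%s. (coef g k s - coef g' k s)^2) t" for k
 proof -
  note [measurable] = coef_borel[OF g(1)] coef_borel[OF g(2)]
  have i: "integrable (tm T) (%s. (coef g k s - coef g' k s)^2)"
   using L2_diff[of "tm T" "coef g k" "coef g' k"] coef_square_integrable g by (simp add: L2_def)
  have a: "ac T (%s. 1 * c k s + (-1) * c' k s) (%t. 1 * (indicator {0..T} t * (lam k * c k t - coef g k t)) + (-1) * (indicator {0..T} t * (lam k * c' k t - coef g' k t)))"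
   by (intro ac_comb modesD(2)[OF m(1)] modesD(2)[OF m(2)])
  have "0 <= lam k * (c k t - c' k t)^2" using lam[of k] by simp
  have "0 <= tint T (%s. (1 * (indicator {0..T} s * (lam k * c k s - coef g k s)) + (-1) * (indicator {0..T} s * (lam k * c' k s - coef g' k s)))^2) t
   + (lam k)^2 * tint T (%s. indicator {0..T} s * (1 * c k s + (-1) * c' k s)^2) t"
   using t by (intro add_nonneg_nonneg mult_nonneg_nonneg tint_nonneg) auto
  then show ?thesis
   using mode_energy(2)[OF a _ i, of "lam k" t] t m by (simp add: modesD(3) algebra_simps)
 qed
 have i: "integrable (tm T) (%s. (coef g k s - coef g' k s)^2)" for k
  using L2_diff[of "tm T" "coef g k" "coef g' k"] coef_square_integrable coef_borel g by (simp add: L2_def)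
 have "(\<Sum>k<n. lam k * (c k t - c' k t)^2) <= (\<Sum>k<n. tint T (%s. (coef g k s - coef g' k s)^2) t)"
  by (rule sum_mono) (rule 1)
 also have "... = tint T (%s. \<Sum>k<n. (coef g k s - coef g' k s)^2) t"
  using t by (intro tint_sum[symmetric] i) auto
 also have "... <= tint T (sq (%z. g z - g' z)) t"
 proof (rule tint_mono)
  show "AE s in tm T. (\<Sum>k<n. (coef g k s - coef g' k s)^2) <= sq (%z. g z - g' z) s"
   using coef_bessel[OF gg] coef_diff[OF g]
  proof eventually_elim
   case (elim s) then show ?case using elim(1)[rule_format, of n] by simp
  qed
 qed (use i t sq_integrable(1)[OF gg] in auto)
 finally show ?thesis .
qed

text \<open>Convergence in space-time and in almost every time slice to the same function, as
  supplied by \<open>joint_limit\<close>: the slices serve the equation at a fixed time, the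
  space-time limit serves the weak time derivative.\<close>

definition tends :: "(nat => 'x => real) => (nat => real => real) => (real \<times> 'x => real) => bool" where
 "tends b c v \<longleftrightarrow> L2 N v & (%n. (LINT z|N. (v z - (\<Sum>k<n. case z of (t, x) => c k t * b k x))^2)) ~~> 0 & (AE t in tm T. L2 M (%x. v (t, x)) \<and>
  (%n. (LINT x|M. (v (t, x) - (\<Sum>k<n. c k t * b k x))^2)) ~~> 0)"

lemma tends_e:
 assumes "\<And>k. L2 (tm T) (c k)" "\<And>k. (LINT t|tm T. (c k t)^2) <= b k" "summable b"
 shows "\<exists>v. tends e c v"
 unfolding tends_def
proof (rule joint_limit[where \<kappa> = "%k. 1" and C = 1])
 show "summable (%k. (LINT t|tm T. 1 * (c k t)^2))"
  by (rule summable_comparison_test'[OF assms(3), of 0]) (use assms(2) in "simp add: integral_nonneg_AE")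
qed (use e_sum assms(1) in "auto simp: e")

lemma tends_d:
 assumes "\<And>k. L2 (tm T) (c k)" "\<And>k. (LINT t|tm T. lam k * (c k t)^2) <= b k" "summable b"
 shows "\<exists>v. tends d c v"
 unfolding tends_def
proof (rule joint_limit[where \<kappa> = lam and C = C])
 show l: "0 <= lam k" for k using lam[of k] by simp
 show "summable (%k. (LINT t|tm T. lam k * (c k t)^2))"
  by (rule summable_comparison_test'[OF assms(3), of 0])
   (use assms(2) l in "simp add: integral_nonneg_AE abs_of_nonneg")
qed (use d_bound assms(1) C in "auto simp: d")

lemma modes_tends:
 assumes m: "modes \<tau> g c" and g: "L2 N g" and \<tau>: "summable (%k. lam k * (\<tau> k)^2)"
 shows "\<exists>v. tends e c v" "\<exists>v. tends d c v" "\<exists>v. tends e (%k t. lam k * c k t) v"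
  "\<exists>v. tends e (%k t. lam k * c k t - coef g k t) v"
proof -
 note b = modes_bounds[OF m g]
 note s = bound_summable[OF g \<tau>]
 \<comment> \<open>Since \<open>lam k >= 1\<close>, the bound on \<open>lam k * c k\<close>, the
   strongest one, controls the weaker series.\<close>
 have L: "lam k * (c k t)^2 <= (lam k * c k t)^2" "(c k t)^2 <= (lam k * c k t)^2" for k t
 proof -
  have "1 * 1 <= lam k * lam k" "lam k * 1 <= lam k * lam k" using lam[of k] by (intro mult_mono; simp)+
  then show "lam k * (c k t)^2 <= (lam k * c k t)^2" "(c k t)^2 <= (lam k * c k t)^2"
   using mult_right_mono[of 1 "lam k * lam k" "(c k t)^2"] mult_right_mono[of "lam k" "lam k * lam k" "(c k t)^2"]
   by (auto simp: power_mult_distrib power2_eq_square[of "lam k"])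
 qed
 have lL: "L2 (tm T) (%t. lam k * c k t)" for k by (intro L2_cmult b)
 have le: "(LINT t|tm T. lam k * (c k t)^2) <= bound \<tau> g k" "(LINT t|tm T. (c k t)^2) <= bound \<tau> g k" for k
  using L2_square[OF b(1)[of k]] L2_square[OF lL[of k]] L
  by (intro order_trans[OF integral_mono b(3)[of k]]; simp)+
 show "\<exists>v. tends e c v" by (rule tends_e[OF b(1) le(2) s])
 show "\<exists>v. tends d c v" by (rule tends_d[OF b(1) le(1) s])
 show "\<exists>v. tends e (%k t. lam k * c k t) v" by (rule tends_e[OF lL b(3) s])
 show "\<exists>v. tends e (%k t. lam k * c k t - coef g k t) v" by (rule tends_e[OF b(4) b(5) s])
qed

end

section \<open>Picard iteration for the semilinear equation\<close>

locale evolution = fourier M T e d lam C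
 for M :: "'x measure" and T e d lam C +
 fixes F :: "'x => real => real => real" and L :: real and f :: "real \<times> 'x => real" and \<tau> :: "nat => real"
 assumes F_measurable: "(%(x, a, b). F x a b) \<in> borel_measurable (M >< (borel >< borel))"
  and F_lipschitz: "x \<in> space M ==> \<bar>F x a b - F x a' b'\<bar> <= L * (\<bar>a - a'\<bar> + \<bar>b - b'\<bar>)"
  and L: "0 <= L"
  and F_0: "L2 M (%x. F x 0 0)"
  and f: "L2 N f"
  and \<tau>: "summable (%k. lam k * (\<tau> k)^2)"
begin

lemma F_comp_L2:
 assumes v: "L2 N v" and D: "L2 N D" shows "L2 N (%(t, x). F x (v (t, x)) (D (t, x)))"
proof -
 have [measurable]: "v \<in> borel_measurable N" "D \<in> borel_measurable N" using v D by (auto simp: L2_def)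
 have "(%z. (snd z, v z, D z)) \<in> N \<rightarrow>\<^sub>M M >< (borel >< borel)" by measurable
 from measurable_compose[OF this F_measurable]
 have m: "(%(t, x). F x (v (t, x)) (D (t, x))) \<in> borel_measurable N" by (simp add: split_beta')
 define G where "G z = \<bar>F (snd z) 0 0\<bar> + L * (\<bar>v z\<bar> + \<bar>D z\<bar>)" for z
 have abs: "L2 N (%z. \<bar>u z\<bar>)" if "L2 N u" for u using that by (auto simp: L2_def)
 have "L2 N (%(t, x). 1 * F x 0 0)"
  by (rule tensor_L2[OF F_0]) (simp add: L2_def)
 then have "L2 N (%z. F (snd z) 0 0)" by (simp add: split_beta')
 then have "L2 N G" unfolding G_def by (intro L2_add L2_cmult abs v D)
 then show ?thesis
 proof (rule L2_bound[where C = 1, OF _ m])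
  show "AE z in N. \<bar>case z of (t, x) => F x (v (t, x)) (D (t, x))\<bar> <= 1 * \<bar>G z\<bar>"
  proof (rule AE_I2)
   fix z assume "z \<in> space N"
   then have "snd z \<in> space M" by (auto simp: space_pair_measure)
   from F_lipschitz[OF this, of "v z" "D z" 0 0]
   show "\<bar>case z of (t, x) => F x (v (t, x)) (D (t, x))\<bar> <= 1 * \<bar>G z\<bar>"
    by (simp add: G_def split_beta')
  qed
 qed
qed

definition rhs :: "(real \<times> 'x => real) => (real \<times> 'x => real) => real \<times> 'x => real" where
 "rhs v D = (%(t, x). f (t, x) - F x (v (t, x)) (D (t, x)))"

lemma rhs_L2: assumes "L2 N v" "L2 N D" shows "L2 N (rhs v D)"
 using L2_diff[OF f F_comp_L2[OF assms]] by (simp add: rhs_def split_beta')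

text \<open>A relation and not a map, because the limits \<open>v\<close> and \<open>D\<close> are
  determined only almost everywhere.\<close>

definition picard :: "(real \<times> 'x => real) => (real \<times> 'x => real) => bool" where
 "picard g g' \<longleftrightarrow> (\<exists>c v D. modes \<tau> g c & tends e c v & tends d c D & g' = rhs v D)"

lemma picard_exists: assumes "L2 N g" shows "\<exists>g'. L2 N g' & picard g g'"
proof -
 obtain c where c: "modes \<tau> g c" using modes_exist[OF assms] by blast
 obtain v where v: "tends e c v" using modes_tends(1)[OF c assms \<tau>] by blast
 obtain D where D: "tends d c D" using modes_tends(2)[OF c assms \<tau>] by blast
 have "L2 N (rhs v D)" using v D by (intro rhs_L2) (auto simp: tends_def)
 then show ?thesis using c v D unfolding picard_def by blast
qed

text \<open>From the Lipschitz condition: the factor 2 splits the square of a sum, and 1 and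
  \<open>C\<close> bound the differences of values and of derivatives by the same energy; the last
  \<open>+ 1\<close> makes \<open>K\<close> positive.\<close>

definition K :: real where "K = 2 * L^2 * (1 + C) + 1"

lemma K_pos: "0 < K"
proof -
 have "0 <= 2 * L^2 * (1 + C)" using C by simp
 then show ?thesis unfolding K_def by linarith
qed

text \<open>Bound the differences of values and derivatives at time \<open>t\<close> by
  \<open>modes_diff\<close> and apply the Lipschitz condition. Only the sources on
  \<open>[t,T]\<close> occur, and this Volterra structure makes the iteration converge without any
  smallness of \<open>T\<close> or \<open>L\<close>.\<close>

lemma picard_contracts:
 assumes g: "L2 N g1" "L2 N g2" and p: "picard g1 h1" "picard g2 h2"
 shows "AE t in tm T. sq (%z. h1 z - h2 z) t <= K * tint T (sq (%z. g1 z - g2 z)) t"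
proof -
 obtain c1 v1 D1 where 1: "modes \<tau> g1 c1" "tends e c1 v1" "tends d c1 D1" "h1 = rhs v1 D1" using p(1) by (auto simp: picard_def)
 obtain c2 v2 D2 where 2: "modes \<tau> g2 c2" "tends e c2 v2" "tends d c2 D2" "h2 = rhs v2 D2" using p(2) by (auto simp: picard_def)
 have L: "L2 N v1" "L2 N D1" "L2 N v2" "L2 N D2" using 1 2 by (auto simp: tends_def)
 have lim: "AE t in tm T. L2 M (%x. v (t, x)) & (%n. (LINT x|M. (v (t, x) - (\<Sum>k<n. c k t * b k x))^2)) ~~> 0"
  if "tends b c v" for b c v using that by (auto simp: tends_def)
 have range: "AE t in tm T. t \<in> {0..T}" by (auto simp: AE_tm)
 have hL: "L2 N h1" "L2 N h2" using 1(4) 2(4) L rhs_L2 by auto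
 show ?thesis
  using lim[OF 1(2)] lim[OF 1(3)] lim[OF 2(2)] lim[OF 2(3)] range slice_L2[OF hL(1)] slice_L2[OF hL(2)]
 proof eventually_elim
  case (elim t)
  define E where "E = tint T (sq (%z. g1 z - g2 z)) t"
  have df: "(\<Sum>k<n. lam k * (c1 k t - c2 k t)^2) <= E" for n
   unfolding E_def by (rule modes_diff[OF 1(1) 2(1) g elim(5)])
  have sub: "(%x. ((\<Sum>k<n. c1 k t * b k x) - (\<Sum>k<n. c2 k t * b k x))^2) = (%x. (\<Sum>k=0..<n. (c1 k t - c2 k t) * b k x)^2)" for b n
   by (simp add: sum_subtractf left_diff_distrib atLeast0LessThan)
  have E1: "(LINT x|M. (v1 (t, x) - v2 (t, x))^2) <= E"
  proof (rule L2_integral_le_limit[of M "%n x. \<Sum>k<n. c1 k t * e k x" _ "%n x. \<Sum>k<n. c2 k t * e k x"])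
   fix n
   have "(LINT x|M. ((\<Sum>k<n. c1 k t * e k x) - (\<Sum>k<n. c2 k t * e k x))^2) <= (\<Sum>k=0..<n. (c1 k t - c2 k t)^2)"
    unfolding sub by (rule e_sum) simp
   also have "... <= (\<Sum>k<n. lam k * (c1 k t - c2 k t)^2)"
    unfolding atLeast0LessThan using mult_right_mono[OF lam] by (intro sum_mono) fastforce
   also have "... <= E" by (rule df)
   finally show "(LINT x|M. ((\<Sum>k<n. c1 k t * e k x) - (\<Sum>k<n. c2 k t * e k x))^2) <= E" .
  qed (use elim in "auto intro!: L2_sum L2_cmult e")
  have E2: "(LINT x|M. (D1 (t, x) - D2 (t, x))^2) <= C * E"
  proof (rule L2_integral_le_limit[of M "%n x. \<Sum>k<n. c1 k t * d k x" _ "%n x. \<Sum>k<n. c2 k t * d k x"])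
   fix n
   have "(LINT x|M. ((\<Sum>k<n. c1 k t * d k x) - (\<Sum>k<n. c2 k t * d k x))^2) <= C * (\<Sum>k=0..<n. lam k * (c1 k t - c2 k t)^2)"
    unfolding sub by (rule d_bound)
   also have "... <= C * E" using df[of n] C unfolding atLeast0LessThan by (intro mult_left_mono)
   finally show "(LINT x|M. ((\<Sum>k<n. c1 k t * d k x) - (\<Sum>k<n. c2 k t * d k x))^2) <= C * E" .
  qed (use elim in "auto intro!: L2_sum L2_cmult d")
  have Lv: "L2 M (%x. v1 (t, x) - v2 (t, x))" "L2 M (%x. D1 (t, x) - D2 (t, x))" using elim by (auto intro: L2_diff)
  have E0: "0 <= E" using df[of 0] by simp
  have "sq (%z. h1 z - h2 z) t <= (LINT x|M. 2 * L^2 * ((v1 (t, x) - v2 (t, x))^2 + (D1 (t, x) - D2 (t, x))^2))"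
   unfolding sq_def
  proof (rule integral_mono)
   show "integrable M (%x. (h1 (t, x) - h2 (t, x))^2)" using L2_diff[OF elim(6,7)] by (simp add: L2_def)
   show "integrable M (%x. 2 * L^2 * ((v1 (t, x) - v2 (t, x))^2 + (D1 (t, x) - D2 (t, x))^2))" using Lv by (simp add: L2_def)
   fix x assume x: "x \<in> space M"
   have "\<bar>h1 (t, x) - h2 (t, x)\<bar> <= L * (\<bar>v1 (t, x) - v2 (t, x)\<bar> + \<bar>D1 (t, x) - D2 (t, x)\<bar>)"
    using F_lipschitz[OF x, of "v1 (t, x)" "D1 (t, x)" "v2 (t, x)" "D2 (t, x)"] by (simp add: 1(4) 2(4) rhs_def)
   then have "(h1 (t, x) - h2 (t, x))^2 <= (L * (\<bar>v1 (t, x) - v2 (t, x)\<bar> + \<bar>D1 (t, x) - D2 (t, x)\<bar>))^2"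
    by (metis abs_ge_zero power2_abs power_mono)
   also have "... <= L^2 * (2 * \<bar>v1 (t, x) - v2 (t, x)\<bar>^2 + 2 * \<bar>D1 (t, x) - D2 (t, x)\<bar>^2)"
    unfolding power_mult_distrib by (intro mult_left_mono square_sum_le) simp
   finally show "(h1 (t, x) - h2 (t, x))^2 <= 2 * L^2 * ((v1 (t, x) - v2 (t, x))^2 + (D1 (t, x) - D2 (t, x))^2)"
    by (simp add: algebra_simps)
  qed
  also have "... = 2 * L^2 * ((LINT x|M. (v1 (t, x) - v2 (t, x))^2) + (LINT x|M. (D1 (t, x) - D2 (t, x))^2))"
   using Lv by (simp add: L2_def)
  also have "... <= 2 * L^2 * (E + C * E)" using E1 E2 by (intro mult_left_mono add_mono) auto
  also have "... <= K * E" using E0 by (simp add: K_def algebra_simps)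
  finally show ?case by (simp add: E_def)
 qed
qed

lemma tint_exp_le:
 assumes "0 <= t" "t <= T" "0 < B"
 shows "tint T (%s. exp (B * (T - s))) t <= exp (B * (T - t)) / B"
proof -
 have "(LINT s|lborel. indicator {t..T} s *\<^sub>R exp (B * (T - s))) = (- exp (B * (T - T)) / B) - (- exp (B * (T - t)) / B)"
 proof (rule integral_FTC_atLeastAtMost)
  show "((%s. - exp (B * (T - s)) / B) has_vector_derivative exp (B * (T - x))) (at x within {t..T})" for x
   using assms(3) by (auto intro!: derivative_eq_intros simp: has_real_derivative_iff_has_vector_derivative[symmetric])
 qed (use assms in "auto intro!: continuous_intros")
 then show ?thesis using assms by (simp add: tint_def)
qed

text \<open>Integrating the weight \<open>exp (4 * K * (T - s))\<close> over \<open>[t,T]\<close>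
  gains a factor \<open>1 / (4 * K)\<close>, which beats the \<open>K\<close> of the step and leaves
  \<open>1/4\<close>, the rate that \<open>L2_complete_rapid\<close> asks for.\<close>

lemma iterate_bound:
 assumes E: "\<And>n. L2 N (g n)" and step: "\<And>n. AE t in tm T. sq (g (Suc n)) t <= K * tint T (sq (g n)) t"
  and t: "0 <= t" "t <= T"
 shows "tint T (sq (g n)) t <= tint T (sq (g 0)) 0 * (1/4)^n * exp (4 * K * (T - t))"
 using t
proof (induction n arbitrary: t)
 case 0
 have "tint T (sq (g 0)) t <= tint T (sq (g 0)) 0"
  using 0 by (intro tint_antimono sq_integrable E) (auto simp: sq_nonneg)
 moreover have "0 <= tint T (sq (g 0)) 0" by (intro tint_nonneg) (auto simp: sq_nonneg)
 moreover have "1 <= exp (4 * K * (T - t))" using 0 K_pos by simp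
 ultimately have "tint T (sq (g 0)) t * 1 <= tint T (sq (g 0)) 0 * exp (4 * K * (T - t))"
  by (intro mult_mono) auto
 then show ?case by simp
next
 case (Suc n)
 define A where "A = tint T (sq (g 0)) 0 * (1/4)^n"
 have A: "0 <= A" unfolding A_def by (intro mult_nonneg_nonneg tint_nonneg) (auto simp: sq_nonneg)
 have m: "(%s. exp (4 * K * (T - s))) \<in> BM" by measurable
 have i: "integrable (tm T) (%s. exp (4 * K * (T - s)))"
 proof -
  have "L2 (tm T) (%s. exp (2 * K * (T - s)))"
   by (intro continuous_L2_tm) (auto intro!: continuous_intros)
  moreover have "(%s. (exp (2 * K * (T - s)))^2) = (%s. exp (4 * K * (T - s)))"
   by (auto simp: exp_double[symmetric] mult.assoc)
  ultimately show ?thesis by (simp add: L2_def)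
 qed
 have "tint T (sq (g (Suc n))) t <= tint T (%s. K * A * exp (4 * K * (T - s))) t"
 proof (rule tint_mono[OF sq_integrable(1)[OF E]])
  have "AE t in tm T. t \<in> {0..T}" by (auto simp: AE_tm)
  with step[of n] show "AE s in tm T. sq (g (Suc n)) s <= K * A * exp (4 * K * (T - s))"
  proof eventually_elim
   case (elim s)
   have "K * tint T (sq (g n)) s <= K * (A * exp (4 * K * (T - s)))"
    using Suc.IH[of s] elim K_pos by (intro mult_left_mono) (auto simp: A_def)
   then show ?case using elim by simp
  qed
 qed (use i Suc.prems in auto)
 also have "... = K * A * tint T (%s. exp (4 * K * (T - s))) t" by (rule tint_cmult)
 also have "... <= K * A * (exp (4 * K * (T - t)) / (4 * K))"
  using A K_pos Suc.prems by (intro mult_left_mono tint_exp_le) auto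
 also have "... = A * (1/4) * exp (4 * K * (T - t))" using K_pos by simp
 finally show ?case by (simp add: A_def)
qed

text \<open>The limit \<open>G\<close> of the iterates is compared with a Picard image
  \<open>H\<close> of it: by the contraction estimate the iterates converge to \<open>H\<close> as
  well, so \<open>G = H\<close> almost everywhere.\<close>

theorem fixed_point:
 "\<exists>g c v D. L2 N g & modes \<tau> g c & tends e c v & tends d c D & (AE z in N. g z = rhs v D z)"
proof -
 have "\<exists>g. \<forall>n. (L2 N (g n)) & picard (g n) (g (Suc n))"
  by (rule dependent_nat_choice) (use L2_zero picard_exists in blast)+
 then obtain g where g: "\<And>n. L2 N (g n)" "\<And>n. picard (g n) (g (Suc n))" by blast
 define \<delta> where "\<delta> n z = g (Suc n) z - g n z" for n z
 have \<delta>: "L2 N (\<delta> n)" for n unfolding \<delta>_def by (intro L2_diff g)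
 have "AE t in tm T. sq (\<delta> (Suc n)) t <= K * tint T (sq (\<delta> n)) t" for n
  unfolding \<delta>_def by (rule picard_contracts[OF g(1) g(1) g(2) g(2)])
 note bd = iterate_bound[of \<delta>, OF \<delta> this]
 have sqN: "(LINT z|N. (h z)^2) = tint T (sq h) 0" if "L2 N h" for h
  using sq_integrable(2)[OF that] tint_0[OF sq_borel[OF that], of T] by simp
 have "(LINT z|N. (g (Suc n) z - g n z)^2) <= (tint T (sq (\<delta> 0)) 0 * exp (4 * K * T)) * (1/4)^n" for n
  using bd[of 0 n] sqN[OF \<delta>[of n]] T by (simp add: \<delta>_def mult_ac)
 from L2_complete_rapid[OF g(1) this] obtain G where G: "L2 N G" "(%n. (LINT z|N. (G z - g n z)^2)) ~~> 0" by blast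
 obtain H where H: "L2 N H" "picard G H" using picard_exists[OF G(1)] by blast
 have le: "(LINT z|N. (H z - g (Suc n) z)^2) <= K * T * (LINT z|N. (G z - g n z)^2)" for n
 proof -
  note LG = L2_diff[OF G(1) g(1)[of n]] and LH = L2_diff[OF H(1) g(1)[of "Suc n"]]
  have "(LINT z|N. (H z - g (Suc n) z)^2) = (LINT t|tm T. sq (%z. H z - g (Suc n) z) t)" using sq_integrable(2)[OF LH] by simp
  also have "... <= (LINT t|tm T. K * (LINT z|N. (G z - g n z)^2))"
  proof (rule integral_mono_AE[OF sq_integrable(1)[OF LH]])
   have "AE t in tm T. t \<in> {0..T}" by (auto simp: AE_tm)
   with picard_contracts[OF G(1) g(1)[of n] H(2) g(2)[of n]]
   show "AE t in tm T. sq (%z. H z - g (Suc n) z) t <= K * (LINT z|N. (G z - g n z)^2)"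
   proof eventually_elim
    case (elim t)
    have "tint T (sq (%z. G z - g n z)) t <= tint T (sq (%z. G z - g n z)) 0"
     using elim by (intro tint_antimono sq_integrable LG) (auto simp: sq_nonneg)
    then have "K * tint T (sq (%z. G z - g n z)) t <= K * (LINT z|N. (G z - g n z)^2)"
     unfolding sqN[OF LG] using K_pos by (intro mult_left_mono) auto
    then show ?case using elim by simp
   qed
  qed simp
  also have "... = K * T * (LINT z|N. (G z - g n z)^2)"
  proof -
   have "(LINT t|tm T. K * (LINT z|N. (G z - g n z)^2)) = (LINT s|lborel. indicator {0..T} s * (K * (LINT z|N. (G z - g n z)^2)))"
    by (rule integral_tm) simp
   also have "... = T * (K * (LINT z|N. (G z - g n z)^2))" using T by simp
   finally show ?thesis by (simp only: mult_ac)
  qed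
  finally show ?thesis .
 qed
 have "(%n. (LINT z|N. (H z - g (Suc n) z)^2)) ~~> 0"
 proof (rule tendsto_sandwich[OF _ _ tendsto_const])
  show "(%n. K * T * (LINT z|N. (G z - g n z)^2)) ~~> 0"
   using tendsto_mult_right_zero[OF G(2), of "K * T"] by simp
 qed (use le in "auto intro!: always_eventually integral_nonneg_AE")
 then have eq: "AE z in N. G z = H z"
  by (intro L2_limit_unique[OF G(1) H(1) g(1) LIMSEQ_Suc[OF G(2)]])
 from H(2) obtain c v D where "modes \<tau> G c" "tends e c v" "tends d c D" "H = rhs v D" by (auto simp: picard_def)
 then show ?thesis using G(1) eq by blast
qed

end

section \<open>The weighted network\<close>

locale net_data =
 fixes G :: "'a::euclidean_space network" and \<mu> :: "nat => real" and \<gamma> :: "nat => nat => real"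
 assumes net: "is_network G"
  and \<mu>_pos: "al \<in> edges G ==> \<mu> al > 0"
  and \<gamma>_pos: "i \<in> verts G ==> al \<in> edges_at G i ==> \<gamma> i al > 0"
begin

abbreviation E where "E \<equiv> edges G"
abbreviation l where "l \<equiv> len G"

section \<open>Geometry of edges and vertices\<close>

lemma finite_E: "finite E"
 and inj_pos: "inj_on (pos G) (verts G)"
 and verts_eq: "verts G = tail G ` E \<union> head G ` E"
 and tail_less_head: "\<forall>al\<in>E. tail G al < head G al"
 and edges_meet: "\<forall>al\<in>E. \<forall>be\<in>E. al \<noteq> be -->
    edge G al \<inter> edge G be = {} \<or>
    (\<exists>i \<in> {tail G al, head G al} \<inter> {tail G be, head G be}. edge G al \<inter> edge G be = {pos G i})"
proof -
 note n = net[unfolded is_network_def, THEN conjunct2]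
 show "finite E" by (rule n[THEN conjunct1])
 show "inj_on (pos G) (verts G)" by (rule n[THEN conjunct2, THEN conjunct1])
 show "verts G = tail G ` E \<union> head G ` E" by (rule n[THEN conjunct2, THEN conjunct2, THEN conjunct1])
 show "\<forall>al\<in>E. tail G al < head G al" by (rule n[THEN conjunct2, THEN conjunct2, THEN conjunct2, THEN conjunct1])
 show "\<forall>al\<in>E. \<forall>be\<in>E. al \<noteq> be -->
    edge G al \<inter> edge G be = {} \<or>
    (\<exists>i \<in> {tail G al, head G al} \<inter> {tail G be, head G be}. edge G al \<inter> edge G be = {pos G i})"
  by (rule n[THEN conjunct2, THEN conjunct2, THEN conjunct2, THEN conjunct2, THEN conjunct1])
qed

lemma ends_in_verts: "al \<in> E ==> tail G al \<in> verts G" "al \<in> E ==> head G al \<in> verts G"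
 unfolding verts_eq by auto

lemma tail_neq_head: "al \<in> E ==> tail G al \<noteq> head G al"
 using tail_less_head by (metis less_irrefl)

lemma pos_inj: "i \<in> verts G ==> j \<in> verts G ==> pos G i = pos G j ==> i = j"
 by (rule inj_onD[OF inj_pos])

lemma l_pos: "al \<in> E ==> 0 < l al"
 using pos_inj[OF ends_in_verts(1) ends_in_verts(2), of al al] tail_neq_head[of al] by (auto simp: len_def)

text \<open>A vertex is an end of some edge \<open>be\<close>. If it also lies on another edge, the
  two meet in a single common end, which injectivity of \<open>pos\<close> identifies with the
  vertex; so no vertex lies in the interior of an edge.\<close>

lemma edges_at_iff:
 assumes "i \<in> verts G" shows "al \<in> edges_at G i \<longleftrightarrow> al \<in> E & (i = tail G al \<or> i = head G al)"
proof
 assume "al \<in> edges_at G i"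
 then have al: "al \<in> E" "pos G i \<in> edge G al" by (auto simp: edges_at_def)
 obtain be where be: "be \<in> E" "i = tail G be \<or> i = head G be" using assms verts_eq by blast
 show "al \<in> E & (i = tail G al \<or> i = head G al)"
 proof (cases "al = be")
  case False
  have "pos G i \<in> edge G be" using be by (auto simp: edge_def)
  then have "edge G al \<inter> edge G be \<noteq> {}" using al by blast
  then obtain j where j: "j \<in> {tail G al, head G al} \<inter> {tail G be, head G be}" "edge G al \<inter> edge G be = {pos G j}"
   using edges_meet al(1) be(1) False by blast
  then have "pos G i = pos G j" using al \<open>pos G i \<in> edge G be\<close> by blast
  then have "i = j" using pos_inj[OF assms, of j] j ends_in_verts[OF al(1)] by auto
  then show ?thesis using j(1) al(1) by blast
 qed (use al be in auto)
next
 assume "al \<in> E & (i = tail G al \<or> i = head G al)"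
 then show "al \<in> edges_at G i" by (auto simp: edges_at_def edge_def)
qed

text \<open>The affine weight \<open>\<psi>\<close> takes the value \<open>\<gamma> i al\<close> at the end \<open>i\<close> of \<open>al\<close>, so that the elements of
 \<open>W\<close> are the products of \<open>\<psi>\<close> with elements of \<open>V\<close>; in the space \<open>L^2\<close> with weight \<open>\<psi>\<close> the
 principal part of the equation is symmetric.\<close>

definition \<psi>' :: "nat => real" where
 "\<psi>' al = (\<gamma> (head G al) al - \<gamma> (tail G al) al) / l al"
definition \<psi> :: "nat => real => real" where
 "\<psi> al y = \<gamma> (tail G al) al + \<psi>' al * y"

lemma \<psi>_ends: "\<psi> al 0 = \<gamma> (tail G al) al" "al \<in> E ==> \<psi> al (l al) = \<gamma> (head G al) al"
 using l_pos[of al] by (auto simp: \<psi>_def \<psi>'_def)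

lemma \<gamma>_ends: "al \<in> E ==> 0 < \<gamma> (tail G al) al" "al \<in> E ==> 0 < \<gamma> (head G al) al"
 by (rule \<gamma>_pos; simp add: edges_at_iff ends_in_verts)+

lemma \<psi>_convex: "al \<in> E ==> \<psi> al y = (1 - y / l al) * \<gamma> (tail G al) al + (y / l al) * \<gamma> (head G al) al"
 using l_pos[of al] by (simp add: \<psi>_def \<psi>'_def field_simps)

lemma \<psi>_borel[measurable]: "\<psi> al \<in> BM"
 unfolding \<psi>_def[abs_def] by measurable

text \<open>With \<open>upper\<close>, one pair of constants for all edges, so that estimates need
  not track individual parameters. The inserted 1 keeps the sets nonempty and yields
  \<open>1 <= upper\<close>.\<close>

definition lower :: real where
 "lower = Min (insert 1 ((%al. min (\<gamma> (tail G al) al) (\<gamma> (head G al) al)) ` E \<union> \<mu> ` E))"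
definition upper :: real where
 "upper = Max (insert 1 ((%al. max (\<gamma> (tail G al) al) (\<gamma> (head G al) al)) ` E \<union> \<mu> ` E \<union> l ` E \<union> (%al. \<bar>\<psi>' al\<bar>) ` E))"

lemma lower_pos: "0 < lower"
proof -
 have "\<forall>x \<in> insert 1 ((%al. min (\<gamma> (tail G al) al) (\<gamma> (head G al) al)) ` E \<union> \<mu> ` E). 0 < x"
  using \<mu>_pos \<gamma>_ends by auto
 then show ?thesis unfolding lower_def using finite_E by (subst Min_gr_iff) simp_all
qed

lemma upper_ge_1: "1 <= upper" unfolding upper_def by (rule Max_ge) (simp_all add: finite_E)

lemma \<mu>_bounds: "al \<in> E ==> lower <= \<mu> al" "al \<in> E ==> \<mu> al <= upper"
 unfolding lower_def upper_def by (rule Min_le Max_ge; simp add: finite_E)+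

lemma \<psi>'_upper: "al \<in> E ==> \<bar>\<psi>' al\<bar> <= upper"
 unfolding upper_def by (rule Max_ge; simp add: finite_E)

lemma \<psi>_bounds: assumes "al \<in> E" "y \<in> {0..l al}" shows "lower <= \<psi> al y" "\<psi> al y <= upper"
proof -
 let ?a = "\<gamma> (tail G al) al" and ?b = "\<gamma> (head G al) al" and ?s = "y / l al"
 have "lower <= min ?a ?b" unfolding lower_def by (rule Min_le; simp add: finite_E assms)
 then have a: "lower <= ?a" "lower <= ?b" by auto
 have "max ?a ?b <= upper" unfolding upper_def by (rule Max_ge; simp add: finite_E assms)
 then have b: "?a <= upper" "?b <= upper" by auto
 have s: "0 <= ?s" "0 <= 1 - ?s" using assms l_pos[OF assms(1)] by auto
 have "(1 - ?s) * lower + ?s * lower <= (1 - ?s) * ?a + ?s * ?b" using a s by (intro add_mono mult_left_mono)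
 then show "lower <= \<psi> al y" unfolding \<psi>_convex[OF assms(1)] by (simp add: algebra_simps)
 have "(1 - ?s) * ?a + ?s * ?b <= (1 - ?s) * upper + ?s * upper" using b s by (intro add_mono mult_left_mono)
 then show "\<psi> al y <= upper" unfolding \<psi>_convex[OF assms(1)] by (simp add: algebra_simps)
qed

lemma \<psi>_pos: "al \<in> E ==> y \<in> {0..l al} ==> 0 < \<psi> al y"
 using \<psi>_bounds lower_pos by fastforce

text \<open>All edges form one measure space, a disjoint union. Parameters range over the whole line
  with zero weight outside \<open>[0, l al]\<close>, so measurability amounts to Borel functions of
  the line, one for each edge.\<close>

definition NM :: "(nat \<times> real) measure" where
 "NM = density (count_space E >< lborel) (%(al, y). ennreal (indicator {0..l al} y * \<psi> al y))"

lemma weight_measurable: "(%(al, y). indicator {0..l al} y * \<psi> al y) \<in> borel_measurable (count_space E >< lborel)"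
 by (rule measurable_pair_measure_countable1) (use finite_E in "auto intro: countable_finite")

lemma sets_NM[simp, measurable_cong]: "sets NM = sets (count_space E >< lborel)" by (simp add: NM_def)
lemma space_NM[simp]: "space NM = E \<times> UNIV" by (simp add: NM_def space_pair_measure)

lemma NM_measurable_iff: "h \<in> borel_measurable NM \<longleftrightarrow> (\<forall>al\<in>E. (%y. h (al, y)) \<in> BM)"
proof
 assume h: "h \<in> borel_measurable NM"
 show "\<forall>al\<in>E. (%y. h (al, y)) \<in> BM"
 proof
  fix al assume "al \<in> E"
  then have "Pair al \<in> lborel \<rightarrow>\<^sub>M (count_space E >< lborel)" by (intro measurable_Pair1') simp
  then have "Pair al \<in> lborel \<rightarrow>\<^sub>M NM" unfolding measurable_cong_sets[OF refl sets_NM] .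
  from measurable_compose[OF this h] show "(%y. h (al, y)) \<in> BM" by simp
 qed
next
 assume h: "\<forall>al\<in>E. (%y. h (al, y)) \<in> BM"
 have "h \<in> borel_measurable (count_space E >< lborel)"
  by (rule measurable_pair_measure_countable1) (use finite_E h in "auto intro: countable_finite")
 then show "h \<in> borel_measurable NM" unfolding measurable_cong_sets[OF sets_NM refl] .
qed

lemma NM_slice: "h \<in> borel_measurable NM ==> al \<in> E ==> (%y. h (al, y)) \<in> BM"
 by (simp add: NM_measurable_iff)

lemma NM_pair: "pair_sigma_finite (count_space E) (lborel :: real measure)"
 using sigma_finite_measure_count_space_finite[OF finite_E] lborel.sigma_finite_measure_axioms
 by (simp add: pair_sigma_finite_def)

lemma NM_integrable:
 assumes h: "h \<in> borel_measurable NM"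
 shows "integrable NM h \<longleftrightarrow> (\<forall>al\<in>E. integrable lborel (%y. indicator {0..l al} y * (\<psi> al y * h (al, y))))"
  and "integrable NM h ==> integral\<^sup>L NM h = (\<Sum>al\<in>E. LINT y|lborel. indicator {0..l al} y * (\<psi> al y * h (al, y)))"
proof -
 interpret P: pair_sigma_finite "count_space E" "lborel :: real measure" by (rule NM_pair)
 define k where "k = (%(al, y). (indicator {0..l al} y * \<psi> al y) *\<^sub>R h (al, y))"
 have hm: "h \<in> borel_measurable (count_space E >< lborel)" using h unfolding measurable_cong_sets[OF sets_NM refl] .
 have km: "k \<in> borel_measurable (count_space E >< lborel)"
  using borel_measurable_scaleR[OF weight_measurable hm] by (simp add: k_def split_beta')
 have nn: "AE z in count_space E >< lborel. 0 <= (case z of (al, y) => indicator {0..l al} y * \<psi> al y)"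
 proof (rule AE_I2)
  fix z assume "z \<in> space (count_space E >< (lborel :: real measure))"
  then show "0 <= (case z of (al, y) => indicator {0..l al} y * \<psi> al y)"
   using \<psi>_pos[of "fst z" "snd z"] by (auto simp: space_pair_measure indicator_def less_imp_le split: prod.splits)
 qed
 have dens: "NM = density (count_space E >< lborel) (%z. ennreal (case z of (al, y) => indicator {0..l al} y * \<psi> al y))"
  unfolding NM_def by (simp add: split_beta')
 have kk: "(%z. (case z of (al, y) => indicator {0..l al} y * \<psi> al y) * h z) = k" by (auto simp: k_def)
 have i1: "integrable NM h \<longleftrightarrow> integrable (count_space E >< lborel) k"
  unfolding dens using integrable_density[OF hm weight_measurable nn] by (simp add: kk)
 have i2: "integral\<^sup>L NM h = integral\<^sup>L (count_space E >< lborel) k"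
  unfolding dens using integral_density[OF hm weight_measurable nn] by (simp add: kk)
 have kk2: "k (al, y) = indicator {0..l al} y * (\<psi> al y * h (al, y))" for al y by (simp add: k_def)
 show "integrable NM h \<longleftrightarrow> (\<forall>al\<in>E. integrable lborel (%y. indicator {0..l al} y * (\<psi> al y * h (al, y))))"
  unfolding i1
 proof
  assume "integrable (count_space E >< lborel) k"
  from P.AE_integrable_fst'[OF this] show "\<forall>al\<in>E. integrable lborel (%y. indicator {0..l al} y * (\<psi> al y * h (al, y)))"
   by (simp add: AE_count_space kk2)
 next
  assume a: "\<forall>al\<in>E. integrable lborel (%y. indicator {0..l al} y * (\<psi> al y * h (al, y)))"
  show "integrable (count_space E >< lborel) k"
   by (rule P.Fubini_integrable[OF km]) (use a finite_E in "auto simp: kk2 AE_count_space intro!: integrable_count_space")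
 qed
 show "integral\<^sup>L NM h = (\<Sum>al\<in>E. LINT y|lborel. indicator {0..l al} y * (\<psi> al y * h (al, y)))" if "integrable NM h"
  using P.integral_fst'[of k] that finite_E unfolding i1 i2 by (simp add: lebesgue_integral_count_space_finite kk2)
qed

lemma sigma_finite_NM: "sigma_finite_measure NM" and finite_NM: "finite_measure NM"
proof -
 have m: "(%x. 1::real) \<in> borel_measurable NM" by simp
 have "integrable NM (%x. 1::real)"
  unfolding NM_integrable(1)[OF m]
 proof
  fix al
  have "set_integrable lborel {0..l al} (\<psi> al)"
   unfolding \<psi>_def[abs_def] by (intro borel_integrable_atLeastAtMost' continuous_intros)
  then show "integrable lborel (%y. indicator {0..l al} y * (\<psi> al y * 1))" by (simp add: set_integrable_def)
 qed
 then have "(\<integral>\<^sup>+x. ennreal (norm (1::real)) \<partial>NM) < \<infinity>" unfolding integrable_iff_bounded by blast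
 then have "emeasure NM (space NM) < \<infinity>" by (simp del: space_NM)
 then show "finite_measure NM" by (intro finite_measureI) (simp del: space_NM)
 then show "sigma_finite_measure NM" by (simp add: finite_measure_def)
qed

lemma NM_edge_le:
 assumes h: "integrable NM h" and nn: "\<And>be y. be \<in> E ==> y \<in> {0..l be} ==> 0 <= h (be, y)" and al: "al \<in> E"
 shows "integrable lborel (%y. indicator {0..l al} y * h (al, y))"
  and "lower * (LINT y|lborel. indicator {0..l al} y * h (al, y)) <= (LINT x|NM. h x)"
proof -
 have hm: "h \<in> borel_measurable NM" using h by simp
 note [measurable] = NM_slice[OF hm al]
 note i = NM_integrable(1)[OF hm, THEN iffD1, OF h]
 have pw: "lower * (indicator {0..l al} y * h (al, y)) <= indicator {0..l al} y * (\<psi> al y * h (al, y))" for y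
  using \<psi>_bounds(1)[OF al, of y] nn[OF al, of y] by (auto simp: indicator_def intro!: mult_right_mono)
 have "integrable lborel (%y. lower * (indicator {0..l al} y * h (al, y)))"
 proof (rule Bochner_Integration.integrable_bound[OF i[rule_format, OF al]])
  show "AE y in lborel. norm (lower * (indicator {0..l al} y * h (al, y))) <= norm (indicator {0..l al} y * (\<psi> al y * h (al, y)))"
  proof (rule AE_I2)
   fix y
   have "0 <= lower * (indicator {0..l al} y * h (al, y))" using nn[OF al, of y] lower_pos by (auto simp: indicator_def)
   then show "norm (lower * (indicator {0..l al} y * h (al, y))) <= norm (indicator {0..l al} y * (\<psi> al y * h (al, y)))"
    using pw[of y] by simp
  qed
 qed simp
 then show i2: "integrable lborel (%y. indicator {0..l al} y * h (al, y))" using lower_pos by simp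
 have "lower * (LINT y|lborel. indicator {0..l al} y * h (al, y)) = (LINT y|lborel. lower * (indicator {0..l al} y * h (al, y)))" by simp
 also have "... <= (LINT y|lborel. indicator {0..l al} y * (\<psi> al y * h (al, y)))"
  using i2 i al pw by (intro integral_mono) auto
 also have "... <= (\<Sum>al\<in>E. LINT y|lborel. indicator {0..l al} y * (\<psi> al y * h (al, y)))"
 proof (rule member_le_sum[OF al _ finite_E])
  fix be assume "be \<in> E - {al}"
  then show "0 <= (LINT y|lborel. indicator {0..l be} y * (\<psi> be y * h (be, y)))"
   using nn[of be] \<psi>_pos[of be] by (intro integral_nonneg_AE AE_I2) (auto simp: indicator_def less_imp_le)
 qed
 also have "... = (LINT x|NM. h x)" by (rule NM_integrable(2)[OF hm h, symmetric])
 finally show "lower * (LINT y|lborel. indicator {0..l al} y * h (al, y)) <= (LINT x|NM. h x)" .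
qed

lemma NM_L2_iff:
 assumes h: "h \<in> borel_measurable NM"
 shows "L2 NM h \<longleftrightarrow> (\<forall>al\<in>E. integrable lborel (%y. indicator {0..l al} y * (h (al, y))^2))"
proof
 assume "L2 NM h"
 then show "\<forall>al\<in>E. integrable lborel (%y. indicator {0..l al} y * (h (al, y))^2)"
  using NM_edge_le(1)[of "%x. (h x)^2"] by (simp add: L2_def)
next
 assume i: "\<forall>al\<in>E. integrable lborel (%y. indicator {0..l al} y * (h (al, y))^2)"
 have "integrable NM (%x. (h x)^2)"
 proof (subst NM_integrable(1))
  show "\<forall>al\<in>E. integrable lborel (%y. indicator {0..l al} y * (\<psi> al y * (h (al, y))^2))"
  proof
   fix al assume al: "al \<in> E"
   note [measurable] = NM_slice[OF h al]
   show "integrable lborel (%y. indicator {0..l al} y * (\<psi> al y * (h (al, y))^2))"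
   proof (rule Bochner_Integration.integrable_bound)
    show "integrable lborel (%y. upper * (indicator {0..l al} y * (h (al, y))^2))" using i al by simp
    show "AE y in lborel. norm (indicator {0..l al} y * (\<psi> al y * (h (al, y))^2)) <= norm (upper * (indicator {0..l al} y * (h (al, y))^2))"
    proof (rule AE_I2)
     fix y
     show "norm (indicator {0..l al} y * (\<psi> al y * (h (al, y))^2)) <= norm (upper * (indicator {0..l al} y * (h (al, y))^2))"
     proof (cases "y \<in> {0..l al}")
      case True
      have "\<bar>\<psi> al y\<bar> <= \<bar>upper\<bar>" using \<psi>_bounds[OF al True] \<psi>_pos[OF al True] by simp
      then show ?thesis using True by (simp add: abs_mult mult_right_mono)
     qed simp
    qed
   qed simp
  qed
 qed (use h in simp)
 then show "L2 NM h" using h by (simp add: L2_def)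
qed

lemma AE_NM_iff: "(AE x in NM. P x) ==> al \<in> E ==> AE y in lborel. y \<in> {0..l al} --> P (al, y)"
proof -
 assume P: "AE x in NM. P x" and al: "al \<in> E"
 interpret S: pair_sigma_finite "count_space E" "lborel :: real measure" by (rule NM_pair)
 have m: "(%(al, y). ennreal (indicator {0..l al} y * \<psi> al y)) \<in> borel_measurable (count_space E >< lborel)"
  using measurable_compose[OF weight_measurable measurable_ennreal] by (simp add: split_beta')
 from P have "AE z in count_space E >< lborel. 0 < (case z of (al, y) => ennreal (indicator {0..l al} y * \<psi> al y)) --> P z"
  unfolding NM_def AE_density[OF m] .
 from S.AE_pair[OF this] al have "AE y in lborel. 0 < ennreal (indicator {0..l al} y * \<psi> al y) --> P (al, y)"
  by (simp add: AE_count_space)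
 then show ?thesis by eventually_elim (use \<psi>_pos[OF al] in auto)
qed

lemma AE_NM_I:
 assumes "{x \<in> space NM. P x} \<in> sets NM" "\<And>al. al \<in> E ==> AE y in lborel. y \<in> {0..l al} --> P (al, y)"
 shows "AE x in NM. P x"
proof -
 interpret S: pair_sigma_finite "count_space E" "lborel :: real measure" by (rule NM_pair)
 have m: "(%(al, y). ennreal (indicator {0..l al} y * \<psi> al y)) \<in> borel_measurable (count_space E >< lborel)"
  using measurable_compose[OF weight_measurable measurable_ennreal] by (simp add: split_beta')
 have "AE z in count_space E >< lborel. 0 < (case z of (al, y) => ennreal (indicator {0..l al} y * \<psi> al y)) --> P z"
 proof (rule S.AE_pair_measure)
  have "{x \<in> space (count_space E >< lborel). P x} \<in> sets (count_space E >< (lborel :: real measure))" using assms(1) by (simp add: space_pair_measure)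
  then have [measurable]: "Measurable.pred (count_space E >< lborel) P" by (simp add: pred_def)
  note [measurable] = m
  show "{x \<in> space (count_space E >< lborel). 0 < (case x of (al, y) => ennreal (indicator {0..l al} y * \<psi> al y)) --> P x} \<in> sets (count_space E >< lborel)"
   by measurable
  show "AE x in count_space E. AE y in lborel. 0 < (case (x, y) of (al, y) => ennreal (indicator {0..l al} y * \<psi> al y)) --> P (x, y)"
   unfolding AE_count_space
  proof
   fix al assume "al \<in> E"
   from assms(2)[OF this] show "AE y in lborel. 0 < (case (al, y) of (al, y) => ennreal (indicator {0..l al} y * \<psi> al y)) --> P (al, y)"
    by eventually_elim (auto simp: indicator_def split: if_splits)
  qed
 qed
 then show ?thesis unfolding NM_def AE_density[OF m] .
qed

end

section \<open>The energy space\<close>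

context net_data
begin

text \<open>An element of \<open>V\<close> is represented by the function taking \<open>(True, al, y)\<close> to its value and
 \<open>(False, al, y)\<close> to its derivative at the point with arc length parameter \<open>y\<close> of the edge \<open>al\<close>.\<close>

definition endv :: "nat => bool => nat" where "endv al s = (if s then head G al else tail G al)"
definition endp :: "nat => bool => real" where "endp al s = (if s then l al else 0)"

definition Sp :: "(bool \<times> nat \<times> real => real) set" where
 "Sp = {w. (\<forall>al\<in>E. ac (l al) (%y. w (True, al, y)) (%y. w (False, al, y)) \<and>
   (%y. w (True, al, y)) \<in> BM \<and>
   integrable lborel (%y. indicator {0..l al} y * (w (False, al, y))^2)) \<and>
  (\<forall>al\<in>E. \<forall>be\<in>E. \<forall>s s'. endv al s = endv be s' --> w (True, al, endp al s) = w (True, be, endp be s'))}"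

lemma SpI:
 assumes "\<And>al. al \<in> E ==> ac (l al) (%y. w (True, al, y)) (%y. w (False, al, y))"
  "\<And>al. al \<in> E ==> (%y. w (True, al, y)) \<in> BM"
  "\<And>al. al \<in> E ==> integrable lborel (%y. indicator {0..l al} y * (w (False, al, y))^2)"
  "\<And>al be s s'. al \<in> E ==> be \<in> E ==> endv al s = endv be s' ==> w (True, al, endp al s) = w (True, be, endp be s')"
 shows "w \<in> Sp"
 unfolding Sp_def using assms by blast

lemma SpD:
 assumes "w \<in> Sp"
 shows "al \<in> E ==> ac (l al) (%y. w (True, al, y)) (%y. w (False, al, y))"
  "al \<in> E ==> (%y. w (True, al, y)) \<in> BM"
  "al \<in> E ==> integrable lborel (%y. indicator {0..l al} y * (w (False, al, y))^2)"
  "al \<in> E ==> be \<in> E ==> endv al s = endv be s' ==> w (True, al, endp al s) = w (True, be, endp be s')"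
 using assms unfolding Sp_def by blast+

lemma endp_range: "al \<in> E ==> endp al s \<in> {0..l al}"
 using l_pos[of al] by (auto simp: endp_def)

lemma Sp_L2:
 assumes w: "w \<in> Sp" shows "L2 NM (%x. w (True, x))" "L2 NM (%x. w (False, x))"
proof -
 have m: "(%x. w (True, x)) \<in> borel_measurable NM" "(%x. w (False, x)) \<in> borel_measurable NM"
  using SpD(2)[OF w] ac_borel[OF SpD(1)[OF w]] by (auto simp: NM_measurable_iff)
 show "L2 NM (%x. w (False, x))" using SpD(3)[OF w] by (subst NM_L2_iff[OF m(2)]) auto
 show "L2 NM (%x. w (True, x))"
 proof (subst NM_L2_iff[OF m(1)], rule ballI)
  fix al assume "al \<in> E"
  have "set_integrable lborel {0..l al} (%y. (w (True, al, y))^2)"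
   by (intro borel_integrable_atLeastAtMost' continuous_intros ac_continuous[OF SpD(1)[OF w \<open>al \<in> E\<close>]])
  then show "integrable lborel (%y. indicator {0..l al} y * (w (True, al, y))^2)" by (simp add: set_integrable_def)
 qed
qed

lemma \<mu>_measurable: "(%x. \<mu> (fst x)) \<in> borel_measurable NM"
 by (simp add: NM_measurable_iff)

lemma L2_\<mu>: assumes "L2 NM u" shows "L2 NM (%x. \<mu> (fst x) * u x)"
proof (rule L2_bound[OF assms, where C = upper])
 show "(%x. \<mu> (fst x) * u x) \<in> borel_measurable NM"
  using \<mu>_measurable L2_measurable[OF assms] by (rule borel_measurable_times)
 show "AE x in NM. \<bar>\<mu> (fst x) * u x\<bar> <= upper * \<bar>u x\<bar>"
 proof (rule AE_I2)
  fix x assume "x \<in> space NM"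
  then have "fst x \<in> E" by auto
  then have "\<bar>\<mu> (fst x)\<bar> <= upper" using \<mu>_bounds[of "fst x"] \<mu>_pos[of "fst x"] by simp
  then show "\<bar>\<mu> (fst x) * u x\<bar> <= upper * \<bar>u x\<bar>" by (simp add: abs_mult mult_right_mono)
 qed
qed

definition Bf :: "(bool \<times> nat \<times> real => real) => (bool \<times> nat \<times> real => real) => real" where
 "Bf w z = (LINT x|NM. w (True, x) * z (True, x))"
definition Df :: "(bool \<times> nat \<times> real => real) => (bool \<times> nat \<times> real => real) => real" where
 "Df w z = (LINT x|NM. \<mu> (fst x) * w (False, x) * z (False, x))"
definition Qf :: "(bool \<times> nat \<times> real => real) => (bool \<times> nat \<times> real => real) => real" where
 "Qf w z = Bf w z + Df w z"

abbreviation Qn where "Qn w \<equiv> Qf w w"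

section \<open>The energy form: sup bound, completeness and compactness\<close>

lemma Sp_integrable:
 assumes "w \<in> Sp" "z \<in> Sp"
 shows "integrable NM (%x. w (True, x) * z (True, x))" "integrable NM (%x. \<mu> (fst x) * w (False, x) * z (False, x))"
 using L2_mult[OF Sp_L2(1)[OF assms(1)] Sp_L2(1)[OF assms(2)]] L2_mult[OF L2_\<mu>[OF Sp_L2(2)[OF assms(1)]] Sp_L2(2)[OF assms(2)]] by auto

lemma Sp_zero: "(%x. 0) \<in> Sp"
 by (rule SpI) (auto simp: ac_const)

lemma Sp_comb: assumes u: "u \<in> Sp" and v: "v \<in> Sp" shows "(%x. a * u x + c * v x) \<in> Sp"
proof (rule SpI)
 fix al assume al: "al \<in> E"
 show ac: "ac (l al) (%y. a * u (True, al, y) + c * v (True, al, y)) (%y. a * u (False, al, y) + c * v (False, al, y))"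
  by (rule ac_comb[OF SpD(1)[OF u al] SpD(1)[OF v al]])
 show "(%y. a * u (True, al, y) + c * v (True, al, y)) \<in> BM"
  using SpD(2)[OF u al] SpD(2)[OF v al] by simp
 have "L2 NM (%x. a * u (False, x) + c * v (False, x))" by (intro L2_add L2_cmult Sp_L2 u v)
 then show "integrable lborel (%y. indicator {0..l al} y * (a * u (False, al, y) + c * v (False, al, y))^2)"
  using NM_L2_iff[of "%x. a * u (False, x) + c * v (False, x)"] al by (simp add: L2_def)
next
 fix al be s s' assume "al \<in> E" "be \<in> E" "endv al s = endv be s'"
 then show "a * u (True, al, endp al s) + c * v (True, al, endp al s) = a * u (True, be, endp be s') + c * v (True, be, endp be s')"
  using SpD(4)[OF u] SpD(4)[OF v] by metis
qed

lemma Bf_comb: "u \<in> Sp ==> v \<in> Sp ==> w \<in> Sp ==> Bf (%x. a * u x + c * v x) w = a * Bf u w + c * Bf v w"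
 unfolding Bf_def using Sp_integrable(1)[of u w] Sp_integrable(1)[of v w] by (simp add: algebra_simps)

lemma Df_comb: "u \<in> Sp ==> v \<in> Sp ==> w \<in> Sp ==> Df (%x. a * u x + c * v x) w = a * Df u w + c * Df v w"
proof -
 assume uvw: "u \<in> Sp" "v \<in> Sp" "w \<in> Sp"
 have "Df (%x. a * u x + c * v x) w = (LINT x|NM. a * (\<mu> (fst x) * u (False, x) * w (False, x)) + c * (\<mu> (fst x) * v (False, x) * w (False, x)))"
  unfolding Df_def by (intro Bochner_Integration.integral_cong refl) (simp add: algebra_simps)
 also have "... = a * Df u w + c * Df v w"
  unfolding Df_def using Sp_integrable(2)[of u w] Sp_integrable(2)[of v w] uvw by simp
 finally show ?thesis .
qed

lemma Df_nonneg: "0 <= Df u u"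
 unfolding Df_def
proof (intro integral_nonneg_AE AE_I2)
 fix x assume "x \<in> space NM"
 then have "0 < \<mu> (fst x)" using \<mu>_pos by auto
 then have "0 <= \<mu> (fst x) * (u (False, x) * u (False, x))" by (intro mult_nonneg_nonneg[of "\<mu> (fst x)"]) simp_all
 then show "0 <= \<mu> (fst x) * u (False, x) * u (False, x)" by (simp add: mult.assoc)
qed

lemma Bf_nonneg: "0 <= Bf u u" unfolding Bf_def by (simp add: integral_nonneg_AE)

lemma Df_lower: assumes u: "u \<in> Sp" shows "lower * (LINT x|NM. (u (False, x))^2) <= Df u u"
proof -
 have "lower * (LINT x|NM. (u (False, x))^2) = (LINT x|NM. lower * (u (False, x))^2)" by simp
 also have "... <= Df u u"
  unfolding Df_def
 proof (rule integral_mono)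
  show "integrable NM (%x. lower * (u (False, x))^2)" using Sp_L2[OF u] by (simp add: L2_def)
  show "integrable NM (%x. \<mu> (fst x) * u (False, x) * u (False, x))" by (rule Sp_integrable(2)[OF u u])
  fix x assume "x \<in> space NM"
  then show "lower * (u (False, x))^2 <= \<mu> (fst x) * u (False, x) * u (False, x)"
   using mult_right_mono[OF \<mu>_bounds(1), of "fst x" "(u (False, x))^2"] by (auto simp: power2_eq_square mult.assoc)
 qed
 finally show ?thesis .
qed

lemma Sp_edge_bounds:
 assumes w: "w \<in> Sp" and al: "al \<in> E"
 shows "(LINT y|lborel. indicator {0..l al} y * (w (True, al, y))^2) <= Bf w w / lower"
  and "(LINT y|lborel. indicator {0..l al} y * (w (False, al, y))^2) <= Df w w / lower^2"
proof -
 have "lower * (LINT y|lborel. indicator {0..l al} y * (w (True, al, y))^2) <= Bf w w"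
  using NM_edge_le(2)[OF L2_square[OF Sp_L2(1)[OF w]] _ al] by (simp add: Bf_def power2_eq_square)
 then show "(LINT y|lborel. indicator {0..l al} y * (w (True, al, y))^2) <= Bf w w / lower"
  using lower_pos by (simp add: field_simps)
 have "lower * (LINT y|lborel. indicator {0..l al} y * (w (False, al, y))^2) <= (LINT x|NM. (w (False, x))^2)"
  using NM_edge_le(2)[OF L2_square[OF Sp_L2(2)[OF w]] _ al] by simp
 then have "lower * (lower * (LINT y|lborel. indicator {0..l al} y * (w (False, al, y))^2)) <= lower * (LINT x|NM. (w (False, x))^2)"
  using lower_pos by (intro mult_left_mono) auto
 also have "... <= Df w w" by (rule Df_lower[OF w])
 finally show "(LINT y|lborel. indicator {0..l al} y * (w (False, al, y))^2) <= Df w w / lower^2"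
  using lower_pos by (simp add: field_simps power2_eq_square)
qed

lemma Sp_holder:
 assumes w: "w \<in> Sp" and al: "al \<in> E" and y: "y \<in> {0..l al}" "s \<in> {0..l al}"
 shows "(w (True, al, y) - w (True, al, s))^2 <= \<bar>y - s\<bar> * (Qf w w / lower^2)"
proof -
 have *: "(w (True, al, b) - w (True, al, a))^2 <= (b - a) * (Qf w w / lower^2)" if "0 <= a" "a <= b" "b <= l al" for a b
 proof -
  have "(w (True, al, b) - w (True, al, a))^2 <= (b - a) * (LINT y|lborel. indicator {0..l al} y * (w (False, al, y))^2)"
   by (rule ac_holder[OF SpD(1)[OF w al] SpD(3)[OF w al] that])
  also have "... <= (b - a) * (Qf w w / lower^2)"
   using Sp_edge_bounds(2)[OF w al] Bf_nonneg[of w] that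
   by (intro mult_left_mono) (auto simp: Qf_def add_divide_distrib intro: order_trans)
  finally show ?thesis .
 qed
 show ?thesis
  using *[of s y] *[of y s] y by (cases "s <= y") (auto simp: power2_commute)
qed

text \<open>By the Hoelder bound, \<open>w(y)^2 <= 2 * w(s)^2 + 2 * l al * Qf w w / lower^2\<close>
  for all \<open>s\<close> on the edge; averaging over \<open>s\<close> produces the summand, and
  the sum over all edges dominates each of them.\<close>

definition sup_const :: real where
 "sup_const = (\<Sum>al\<in>E. 2 / (l al * lower) + 2 * l al / lower^2)"

lemma sup_const_nonneg: "0 <= sup_const"
 unfolding sup_const_def using lower_pos l_pos by (intro sum_nonneg add_nonneg_nonneg divide_nonneg_pos) (auto simp: less_imp_le)

lemma Sp_sup_bound:
 assumes w: "w \<in> Sp" and al: "al \<in> E" and y: "y \<in> {0..l al}"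
 shows "(w (True, al, y))^2 <= sup_const * Qf w w"
proof -
 define q where "q = Qf w w / lower^2"
 have Q0: "0 <= Qf w w" using Bf_nonneg[of w] Df_nonneg[of w] by (simp add: Qf_def)
 have q0: "0 <= q" using Q0 by (simp add: q_def)
 have lp: "0 < l al" by (rule l_pos[OF al])
 have pw: "(w (True, al, y))^2 <= 2 * (w (True, al, s))^2 + 2 * (l al * q)" if s: "s \<in> {0..l al}" for s
 proof -
  have "(w (True, al, y))^2 = (w (True, al, s) + (w (True, al, y) - w (True, al, s)))^2" by simp
  also have "... <= 2 * (w (True, al, s))^2 + 2 * (w (True, al, y) - w (True, al, s))^2" by (rule square_sum_le)
  also have "(w (True, al, y) - w (True, al, s))^2 <= \<bar>y - s\<bar> * q" unfolding q_def by (rule Sp_holder[OF w al y s])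
  also have "\<bar>y - s\<bar> * q <= l al * q" using y s q0 by (intro mult_right_mono) auto
  finally show ?thesis by simp
 qed
 note i = NM_edge_le(1)[OF L2_square[OF Sp_L2(1)[OF w]] _ al, simplified]
 have ind: "integrable lborel (%s. indicator {0..l al} s * c)" "(LINT s|lborel. indicator {0..l al} s * c) = l al * c" for c :: real
  using lp by (auto intro!: integrable_real_indicator)
 have "l al * (w (True, al, y))^2 = (LINT s|lborel. indicator {0..l al} s * (w (True, al, y))^2)" by (rule ind(2)[symmetric])
 also have "... <= (LINT s|lborel. 2 * (indicator {0..l al} s * (w (True, al, s))^2) + indicator {0..l al} s * (2 * (l al * q)))"
 proof (rule integral_mono)
  show "integrable lborel (%s. 2 * (indicator {0..l al} s * (w (True, al, s))^2) + indicator {0..l al} s * (2 * (l al * q)))"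
   by (intro Bochner_Integration.integrable_add ind integrable_mult_right i)
  show "indicator {0..l al} s * (w (True, al, y))^2 <= 2 * (indicator {0..l al} s * (w (True, al, s))^2) + indicator {0..l al} s * (2 * (l al * q))" for s
   using pw[of s] by (auto simp: indicator_def)
 qed (rule ind)
 also have "... = 2 * (LINT s|lborel. indicator {0..l al} s * (w (True, al, s))^2) + l al * (2 * (l al * q))"
  by (subst Bochner_Integration.integral_add[OF integrable_mult_right[OF i] ind(1)]) (simp only: ind(2) integral_mult_right_zero)
 also have "... <= 2 * (Bf w w / lower) + l al * (2 * (l al * q))"
  using Sp_edge_bounds(1)[OF w al] by simp
 also have "... <= 2 * (Qf w w / lower) + l al * (2 * (l al * q))"
  using Df_nonneg[of w] lower_pos by (simp add: Qf_def divide_right_mono)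
 also have "... = l al * ((2 / (l al * lower) + 2 * l al / lower^2) * Qf w w)"
  using lp lower_pos by (simp add: q_def field_simps)
 finally have "(w (True, al, y))^2 <= (2 / (l al * lower) + 2 * l al / lower^2) * Qf w w"
  using lp by (simp only: mult_le_cancel_left_pos)
 also have "... <= sup_const * Qf w w"
 proof (rule mult_right_mono[OF _ Q0])
  show "2 / (l al * lower) + 2 * l al / lower^2 <= sup_const"
   unfolding sup_const_def
  proof (rule member_le_sum[OF al _ finite_E])
   fix be assume "be \<in> E - {al}"
   then show "0 <= 2 / (l be * lower) + 2 * l be / lower^2" using lower_pos l_pos[of be] by simp
  qed
 qed
 finally show ?thesis .
qed

lemma NM_bound:
 assumes "\<And>al y. al \<in> E ==> y \<in> {0..l al} ==> (h (al, y))^2 <= c" and L: "L2 NM h" and c: "0 <= c"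
 shows "(LINT x|NM. (h x)^2) <= c * measure NM (space NM)"
proof -
 interpret finite_measure NM by (rule finite_NM)
 have "(LINT x|NM. (h x)^2) <= (LINT x|NM. c)"
 proof (rule integral_mono_AE)
  show "AE x in NM. (h x)^2 <= c"
  proof (rule AE_NM_I)
   have "(%x. (h x)^2) \<in> borel_measurable NM" by (rule borel_measurable_integrable[OF L2_square[OF L]])
   then show "{x \<in> space NM. (h x)^2 <= c} \<in> sets NM" by (simp del: sets_NM space_NM)
   show "AE y in lborel. y \<in> {0..l al} --> (h (al, y))^2 <= c" if "al \<in> E" for al
    using assms(1)[OF that] by auto
  qed
 qed (use L in "auto simp: L2_def")
 then show ?thesis by (simp add: mult.commute)
qed

text \<open>A vanishing \<open>L^2\<close> norm makes the continuous value part zero at every point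
  of an edge, and the derivative part is then a derivative of the zero function.\<close>

lemma Sp_Bnull:
 assumes w: "w \<in> Sp" and z: "Bf w w = 0" shows "Qf w w = 0"
proof -
 have zero: "AE y in lborel. 0 < y & y < l al --> w (False, al, y) = 0" if al: "al \<in> E" for al
 proof -
  note i = NM_edge_le(1)[OF L2_square[OF Sp_L2(1)[OF w]] _ al, simplified]
  have "0 <= (LINT y|lborel. indicator {0..l al} y * (w (True, al, y))^2)" by (rule integral_nonneg_AE) simp
  moreover have "(LINT y|lborel. indicator {0..l al} y * (w (True, al, y))^2) <= 0"
   using Sp_edge_bounds(1)[OF w al] z by simp
  ultimately have "(LINT y|lborel. indicator {0..l al} y * (w (True, al, y))^2) = 0" by (intro antisym)
  then have "AE y in lborel. indicator {0..l al} y * (w (True, al, y))^2 = 0"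
   using i by (subst (asm) integral_nonneg_eq_0_iff_AE) auto
  then have "AE y in lborel. 0 < y & y < l al --> w (True, al, y) = 0" by eventually_elim auto
  then have w0: "w (True, al, y) = 0" if "y \<in> {0..l al}" for y
   using continuous_AE_eq[OF ac_continuous[OF SpD(1)[OF w al]] continuous_on_const _ l_pos[OF al] that] by simp
  have "ac (l al) (%y. 0) (%y. w (False, al, y))"
   by (rule ac_cong_AE[OF SpD(1)[OF w al] ac_borel[OF SpD(1)[OF w al]]]) (use w0 in auto)
  from ac_unique[OF this ac_const] show ?thesis .
 qed
 have "AE x in NM. w (False, x) = 0"
 proof (rule AE_NM_I)
  have "(%x. w (False, x)) \<in> borel_measurable NM" using Sp_L2[OF w] by (simp add: L2_def)
  then show "{x \<in> space NM. w (False, x) = 0} \<in> sets NM" by (simp del: sets_NM space_NM)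
  show "AE y in lborel. y \<in> {0..l al} --> w (False, al, y) = 0" if "al \<in> E" for al
   using zero[OF that] AE_lborel_singleton[of 0] AE_lborel_singleton[of "l al"] by eventually_elim auto
 qed
 then have "Df w w = 0" unfolding Df_def by (intro integral_eq_zero_AE) (auto elim!: eventually_mono)
 then show ?thesis using z by (simp add: Qf_def)
qed

lemma psd_B: "psd_form Sp Bf"
 by standard (auto simp: Sp_zero Sp_comb Bf_comb Bf_nonneg, simp add: Bf_def mult.commute)

lemma psd_Q: "psd_form Sp Qf"
proof
 show "Qf u v = Qf v u" for u v by (simp add: Qf_def Bf_def Df_def mult.commute mult.left_commute)
qed (auto simp: Sp_zero Sp_comb Bf_comb Df_comb Qf_def Bf_nonneg Df_nonneg algebra_simps)

text \<open>Derivatives converge in \<open>L^2\<close> and values uniformly by the sup bound;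
  passing to the limit in the integral representation identifies the limit of the derivatives as the
  derivative of the limit.\<close>

lemma Sp_complete:
 assumes s: "\<And>n. s n \<in> Sp"
  and Cy: "\<And>ep. ep > 0 ==> \<exists>N. \<forall>m\<ge>N. \<forall>n\<ge>N. Qn (%x. s m x - s n x) < ep"
 shows "\<exists>u\<in>Sp. (%n. Qn (%x. u x - s n x)) ~~> 0"
proof -
 interpret Q: psd_form Sp Qf by (rule psd_Q)
 have d_le: "(LINT x|NM. (w (False, x))^2) <= Qf w w / lower" if "w \<in> Sp" for w
  using Df_lower[OF that] Bf_nonneg[of w] lower_pos by (simp add: Qf_def field_simps)
 obtain D where D: "L2 NM D" "(%n. (LINT x|NM. (D x - s n (False, x))^2)) ~~> 0"
 proof -
  have "\<exists>N. \<forall>m\<ge>N. \<forall>n\<ge>N. (LINT x|NM. (s m (False, x) - s n (False, x))^2) < ep" if "ep > 0" for ep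
  proof -
   have "0 < ep * lower" using that lower_pos by simp
   from Cy[OF this] obtain N where N: "\<And>m n. m >= N ==> n >= N ==> Qn (%x. s m x - s n x) < ep * lower"
    by blast
   show ?thesis
   proof (intro exI allI impI)
    fix m n assume "m >= N" "n >= N"
    then have "Qn (%x. s m x - s n x) / lower < ep" using N lower_pos by (simp add: field_simps)
    then show "(LINT x|NM. (s m (False, x) - s n (False, x))^2) < ep" using d_le[OF Q.diff_in[OF s s], of m n] by linarith
   qed
  qed
  from L2_complete[OF Sp_L2(2)[OF s] this] show ?thesis using that by blast
 qed
 have sup: "(s m (True, al, y) - s n (True, al, y))^2 <= sup_const * Qn (%x. s m x - s n x)"
  if "al \<in> E" "y \<in> {0..l al}" for al y m n
  by (rule Sp_sup_bound[OF Q.diff_in[OF s s] that])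
 have conv: "convergent (%n. s n (True, al, y))" if "al \<in> E" "y \<in> {0..l al}" for al y
 proof -
  have "Cauchy (%n. s n (True, al, y))"
  proof (rule metric_CauchyI)
   fix r :: real assume r: "r > 0"
   define ep where "ep = r^2 / (sup_const + 1)"
   have "ep > 0" using r sup_const_nonneg by (simp add: ep_def)
   then obtain N where N: "\<And>m n. m >= N ==> n >= N ==> Qn (%x. s m x - s n x) < ep" using Cy by metis
   show "\<exists>M. \<forall>m\<ge>M. \<forall>n\<ge>M. dist (s m (True, al, y)) (s n (True, al, y)) < r"
   proof (intro exI allI impI)
    fix m n assume "m >= N" "n >= N"
    have "(s m (True, al, y) - s n (True, al, y))^2 <= sup_const * Qn (%x. s m x - s n x)" by (rule sup[OF that])
    also have "... <= sup_const * ep" using N[OF \<open>m >= N\<close> \<open>n >= N\<close>] sup_const_nonneg by (intro mult_left_mono) auto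
    also have "... < r^2" using r sup_const_nonneg by (simp add: ep_def field_simps)
    finally have "\<bar>s m (True, al, y) - s n (True, al, y)\<bar>^2 < r^2" by simp
    then have "\<bar>s m (True, al, y) - s n (True, al, y)\<bar> < r" by (rule power2_less_imp_less) (use r in simp)
    then show "dist (s m (True, al, y)) (s n (True, al, y)) < r" by (simp add: dist_real_def)
   qed
  qed
  then show ?thesis by (simp add: Cauchy_convergent_iff)
 qed
 \<comment> \<open>The value part is zero outside the edges, so that it is Borel on the whole
   line.\<close>
 define u where "u = (%(b, al, y). if b then (if al \<in> E & y \<in> {0..l al} then lim (%n. s n (True, al, y)) else 0) else D (al, y))"
 have uT: "(%n. s n (True, al, y)) ~~> u (True, al, y)" if "al \<in> E" "y \<in> {0..l al}" for al y
  using conv[OF that] that by (simp add: u_def convergent_LIMSEQ_iff)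
 have uF: "u (False, x) = D x" for x by (cases x) (simp add: u_def)
 have Dm: "(%y. D (al, y)) \<in> BM" if "al \<in> E" for al using NM_slice[of D al] D that by (simp add: L2_def)
 have D2: "integrable lborel (%y. indicator {0..l al} y * (D (al, y))^2)" if "al \<in> E" for al
  using NM_L2_iff[of D] D(1) that by (simp add: L2_def)
 have ac: "ac (l al) (%y. u (True, al, y)) (%y. u (False, al, y))" if al: "al \<in> E" for al
 proof (rule acI)
  show "(%y. u (False, al, y)) \<in> BM" using Dm[OF al] by (simp add: uF)
  show "integrable lborel (%y. indicator {0..l al} y * u (False, al, y))"
   unfolding uF by (rule integrable_of_square[OF Dm[OF al] D2[OF al]])
  fix y assume y: "y \<in> {0..l al}"
  have lim: "(%n. LINT r|lborel. indicator {0..y} r * s n (False, al, r)) ~~> (LINT r|lborel. indicator {0..y} r * D (al, r))"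
  proof -
   let ?f = "%n r. indicator {0..l al} r * s n (False, al, r)" and ?g = "%r. indicator {0..l al} r * D (al, r)"
   have sqi: "(indicator {0..l al} r * x)^2 = indicator {0..l al} r * x^2" for r x :: real
    by (simp add: indicator_def)
   have fL: "L2 lborel (?f n)" for n
    using ac_borel[OF SpD(1)[OF s al], of n] SpD(3)[OF s al, of n]
    by (simp add: L2_def sqi)
   have gL: "L2 lborel ?g"
    using Dm[OF al] D2[OF al] by (simp add: L2_def sqi)
   have iL: "L2 lborel (indicator {0..y} :: real => real)"
   proof -
    have "(%x. (indicator {0..y} x :: real)^2) = indicator {0..y}" by (auto simp: indicator_def)
    then show ?thesis using y by (simp add: L2_def integrable_real_indicator)
   qed
   have "(%n. (LINT r|lborel. (?g r - ?f n r)^2)) ~~> 0"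
   proof (rule tendsto_sandwich[OF _ _ tendsto_const])
    show "\<forall>\<^sub>F n in sequentially. (LINT r|lborel. (?g r - ?f n r)^2) <= (LINT x|NM. (D x - s n (False, x))^2) / lower"
    proof (intro always_eventually allI)
     fix n
     have "(%r. (?g r - ?f n r)^2) = (%r. indicator {0..l al} r * (D (al, r) - s n (False, al, r))^2)" by (auto simp: indicator_def)
     then show "(LINT r|lborel. (?g r - ?f n r)^2) <= (LINT x|NM. (D x - s n (False, x))^2) / lower"
      using NM_edge_le(2)[OF L2_square[OF L2_diff[OF D(1) Sp_L2(2)[OF s]]] _ al, of n] lower_pos by (simp add: field_simps)
    qed
    show "(%n. (LINT x|NM. (D x - s n (False, x))^2) / lower) ~~> 0" using tendsto_divide_zero[OF D(2)] by simp
   qed (simp add: integral_nonneg_AE)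
   from L2_tendsto_mult[OF fL gL iL this]
   have "(%n. LINT r|lborel. ?f n r * indicator {0..y} r) ~~> (LINT r|lborel. ?g r * indicator {0..y} r)" .
   moreover have "(%r. indicator {0..l al} r * h r * indicator {0..y} r) = (%r. indicator {0..y} r * h r)" for h :: "real => real"
    using y by (auto simp: indicator_def)
   ultimately show ?thesis by simp
  qed
  have "(%n. s n (True, al, 0) + (LINT r|lborel. indicator {0..y} r * s n (False, al, r))) ~~> u (True, al, 0) + (LINT r|lborel. indicator {0..y} r * D (al, r))"
   using l_pos[OF al] by (intro tendsto_add uT[OF al] lim) simp
  moreover have "s n (True, al, 0) + (LINT r|lborel. indicator {0..y} r * s n (False, al, r)) = s n (True, al, y)" for n
   using ac_eq[OF SpD(1)[OF s al] y, of n] by simp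
  ultimately show "u (True, al, y) = u (True, al, 0) + (LINT r|lborel. indicator {0..y} r * u (False, al, r))"
   unfolding uF using uT[OF al y] by (auto intro: LIMSEQ_unique)
 qed
 have uSp: "u \<in> Sp"
 proof (rule SpI[OF ac])
  fix al assume al: "al \<in> E"
  have "(%y. u (True, al, y)) = (%y. indicator {0..l al} y *\<^sub>R u (True, al, y))" by (auto simp: u_def indicator_def)
  then show "(%y. u (True, al, y)) \<in> BM"
   using borel_measurable_continuous_on_indicator[OF _ ac_continuous[OF ac[OF al]]] by simp
  show "integrable lborel (%y. indicator {0..l al} y * (u (False, al, y))^2)" unfolding uF by (rule D2[OF al])
 next
  fix al be b b' assume ab: "al \<in> E" "be \<in> E" "endv al b = endv be b'"
  have "s n (True, al, endp al b) = s n (True, be, endp be b')" for n by (rule SpD(4)[OF s ab])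
  then show "u (True, al, endp al b) = u (True, be, endp be b')"
   using uT[OF ab(1) endp_range[OF ab(1)], of b] uT[OF ab(2) endp_range[OF ab(2)], of b'] by (auto intro: LIMSEQ_unique)
 qed
 have Blim: "(%n. Bf (%x. u x - s n x) (%x. u x - s n x)) ~~> 0"
 proof (rule LIMSEQ_I)
  fix r :: real assume r: "r > 0"
  define m where "m = measure NM (space NM)"
  have m0: "0 <= m" by (simp add: m_def)
  define ep where "ep = r / ((sup_const + 1) * (m + 1))"
  have "ep > 0" using r sup_const_nonneg m0 by (simp add: ep_def)
  then obtain N where N: "\<And>m n. m >= N ==> n >= N ==> Qn (%x. s m x - s n x) < ep" using Cy by metis
  show "\<exists>no. \<forall>n\<ge>no. norm (Bf (%x. u x - s n x) (%x. u x - s n x) - 0) < r"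
  proof (intro exI allI impI)
   fix n assume n: "n >= N"
   have pw: "(u (True, al, y) - s n (True, al, y))^2 <= sup_const * ep" if "al \<in> E" "y \<in> {0..l al}" for al y
   proof (rule LIMSEQ_le_const2)
    show "(%m. (s m (True, al, y) - s n (True, al, y))^2) ~~> (u (True, al, y) - s n (True, al, y))^2"
     by (intro tendsto_intros uT that)
    show "\<exists>K. \<forall>m\<ge>K. (s m (True, al, y) - s n (True, al, y))^2 <= sup_const * ep"
    proof (intro exI allI impI)
     fix m assume "m >= N"
     then show "(s m (True, al, y) - s n (True, al, y))^2 <= sup_const * ep"
      using sup[OF that, of m n] mult_left_mono[OF less_imp_le[OF N[of m n]] sup_const_nonneg] n by linarith
    qed
   qed
   have "Bf (%x. u x - s n x) (%x. u x - s n x) = (LINT x|NM. (u (True, x) - s n (True, x))^2)"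
    by (simp add: Bf_def power2_eq_square)
   also have "... <= sup_const * ep * m" unfolding m_def
    by (rule NM_bound[OF pw L2_diff[OF Sp_L2(1)[OF uSp] Sp_L2(1)[OF s]]]) (use sup_const_nonneg \<open>ep > 0\<close> in auto)
   also have "... < r"
   proof -
    have "sup_const * m < (sup_const + 1) * (m + 1)" using sup_const_nonneg m0 by (simp add: algebra_simps)
    then have "r * (sup_const * m) < r * ((sup_const + 1) * (m + 1))" using r by (intro mult_strict_left_mono) auto
    then show ?thesis using sup_const_nonneg m0 by (simp add: ep_def divide_less_eq mult_ac)
   qed
   finally show "norm (Bf (%x. u x - s n x) (%x. u x - s n x) - 0) < r" using Bf_nonneg by simp
  qed
 qed
 have Dlim: "(%n. Df (%x. u x - s n x) (%x. u x - s n x)) ~~> 0"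
 proof (rule tendsto_sandwich[OF _ _ tendsto_const])
  show "\<forall>\<^sub>F n in sequentially. Df (%x. u x - s n x) (%x. u x - s n x) <= upper * (LINT x|NM. (D x - s n (False, x))^2)"
  proof (intro always_eventually allI)
   fix n
   have L: "integrable NM (%x. (u (False, x) - s n (False, x))^2)" using L2_diff[OF Sp_L2(2)[OF uSp] Sp_L2(2)[OF s]] by (simp add: L2_def)
   have "Df (%x. u x - s n x) (%x. u x - s n x) <= (LINT x|NM. upper * (u (False, x) - s n (False, x))^2)"
    unfolding Df_def
   proof (rule integral_mono[OF Sp_integrable(2)[OF Q.diff_in[OF uSp s] Q.diff_in[OF uSp s]]])
    show "integrable NM (%x. upper * (u (False, x) - s n (False, x))^2)" using L by simp
    fix x assume "x \<in> space NM"
    then show "\<mu> (fst x) * (u (False, x) - s n (False, x)) * (u (False, x) - s n (False, x)) <= upper * (u (False, x) - s n (False, x))^2"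
     using mult_right_mono[OF \<mu>_bounds(2), of "fst x" "(u (False, x) - s n (False, x))^2"] by (auto simp: power2_eq_square mult.assoc)
   qed
   then show "Df (%x. u x - s n x) (%x. u x - s n x) <= upper * (LINT x|NM. (D x - s n (False, x))^2)" by (simp add: uF)
  qed
  show "(%n. upper * (LINT x|NM. (D x - s n (False, x))^2)) ~~> 0" by (rule tendsto_mult_right_zero[OF D(2)])
 qed (simp add: Df_nonneg)
 have "(%n. Qn (%x. u x - s n x)) ~~> 0"
  unfolding Qf_def using tendsto_add[OF Blim Dlim] by simp
 then show ?thesis using uSp by blast
qed

text \<open>Arzela-Ascoli, with the sup bound for boundedness and the Hoelder bound for
  equicontinuity. The edges are laid out in the plane as segments
  \<open>{real al} x [0, l al]\<close>, any two of which are at least 1 apart.\<close>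

lemma Sp_compact:
 assumes s: "\<And>n. s n \<in> Sp" and C: "\<And>n. Qn (s n) <= C"
 shows "\<exists>r. strict_mono (r :: nat => nat) & (\<forall>ep>0. \<exists>N. \<forall>m\<ge>N. \<forall>n\<ge>N.
    Bf (%x. s (r m) x - s (r n) x) (%x. s (r m) x - s (r n) x) < ep)"
proof -
 interpret Q: psd_form Sp Qf by (rule psd_Q)
 have C0: "0 <= C" using Q.nonneg[OF s, of 0] C[of 0] by linarith
 define K where "K = (\<Union>al\<in>E. {real al} \<times> {0..l al})"
 define F where "F n z = s n (True, nat \<lfloor>fst z\<rfloor>, snd z)" for n and z :: "real \<times> real"
 have Fe: "F n (real al, y) = s n (True, al, y)" for n al y by (simp add: F_def)
 have "compact K" unfolding K_def by (intro compact_UN finite_E compact_Times) auto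
 moreover have "norm (F n z) <= sqrt (sup_const * C)" if "z \<in> K" for n z
 proof -
  obtain al y where z: "z = (real al, y)" "al \<in> E" "y \<in> {0..l al}" using \<open>z \<in> K\<close> by (auto simp: K_def)
  have "(F n z)^2 <= sup_const * Qn (s n)" unfolding z(1) Fe by (rule Sp_sup_bound[OF s z(2,3)])
  also have "... <= sup_const * C" by (rule mult_left_mono[OF C sup_const_nonneg])
  finally show ?thesis by (metis real_norm_def real_le_rsqrt power2_abs)
 qed
 moreover have "\<exists>d. 0 < d & (\<forall>n z'. z' \<in> K & norm (z - z') < d --> norm (F n z - F n z') < e)" if "z \<in> K" "0 < e" for z e
 proof -
  obtain al y where z: "z = (real al, y)" "al \<in> E" "y \<in> {0..l al}" using \<open>z \<in> K\<close> by (auto simp: K_def)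
  define q where "q = C / lower^2"
  have q0: "0 <= q" using C0 by (simp add: q_def)
  \<comment> \<open>Within distance 1/2 both points lie on the same segment;
    \<open>e^2 / (q + 1)\<close> is what the Hoelder exponent 1/2 requires.\<close>
  define d where "d = min (1/2) (e^2 / (q + 1))"
  have "0 < d" using that q0 by (simp add: d_def)
  moreover have "norm (F n z - F n z') < e" if z': "z' \<in> K" "norm (z - z') < d" for n z'
  proof -
   obtain be y' where b: "z' = (real be, y')" "be \<in> E" "y' \<in> {0..l be}" using z'(1) by (auto simp: K_def)
   have "norm (fst (z - z')) <= norm (z - z')" "norm (snd (z - z')) <= norm (z - z')" 
    using norm_fst_le[of "fst (z - z')" "snd (z - z')"] norm_snd_le[of "snd (z - z')" "fst (z - z')"] by (simp_all only: prod.collapse)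
   then have *: "\<bar>real al - real be\<bar> < d" "\<bar>y - y'\<bar> < d" using z'(2) by (auto simp: z(1) b(1))
   then have "\<bar>real al - real be\<bar> < 1/2" by (simp add: d_def)
   then have [simp]: "be = al" by linarith
   have "(F n z - F n z')^2 <= \<bar>y - y'\<bar> * (Qn (s n) / lower^2)"
    unfolding z(1) b(1) Fe using Sp_holder[OF s z(2,3), of y' n] b by simp
   also have "... <= \<bar>y - y'\<bar> * q" unfolding q_def using C[of n] lower_pos by (intro mult_left_mono divide_right_mono) auto
   also have "... <= e^2 / (q + 1) * q" using *(2) q0 by (intro mult_right_mono) (auto simp: d_def)
   also have "... < e^2" using q0 \<open>0 < e\<close> by (simp add: field_simps)
   finally have "\<bar>F n z - F n z'\<bar>^2 < e^2" by simp
   then have "\<bar>F n z - F n z'\<bar> < e" by (rule power2_less_imp_less) (use \<open>0 < e\<close> in simp)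
   then show ?thesis by simp
  qed
  ultimately show ?thesis by blast
 qed
 ultimately obtain g k where k: "strict_mono (k :: nat => nat)"
  and lim: "\<And>e. 0 < e ==> \<exists>N. \<forall>n z. n >= N & z \<in> K --> norm (F (k n) z - g z) < e"
  using Arzela_Ascoli[of K F "sqrt (sup_const * C)"] by metis
 have "\<exists>N. \<forall>m\<ge>N. \<forall>n\<ge>N. Bf (%x. s (k m) x - s (k n) x) (%x. s (k m) x - s (k n) x) < ep" if "ep > 0" for ep
 proof -
  define m0 where "m0 = measure NM (space NM)"
  have m0: "0 <= m0" by (simp add: m0_def)
  \<comment> \<open>Two approximations up to \<open>e\<close> differ by at most
    \<open>2 * e\<close>, so the integral is at most \<open>4 * e^2 * m0\<close>, which is below
    \<open>ep\<close>.\<close>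
  define e where "e = sqrt (ep / (8 * (m0 + 1)))"
  have e: "0 < e" "e^2 = ep / (8 * (m0 + 1))" using that m0 by (auto simp: e_def)
  from lim[OF e(1)] obtain N where N: "\<And>n z. n >= N ==> z \<in> K ==> \<bar>F (k n) z - g z\<bar> < e" by auto
  show ?thesis
  proof (intro exI allI impI)
   fix m n assume mn: "m >= N" "n >= N"
   have pw: "(s (k m) (True, al, y) - s (k n) (True, al, y))^2 <= 4 * e^2" if "al \<in> E" "y \<in> {0..l al}" for al y
   proof -
    have "(real al, y) \<in> K" using that by (auto simp: K_def)
    then have "\<bar>s (k m) (True, al, y) - s (k n) (True, al, y)\<bar> <= 2 * e"
     using N[OF mn(1)] N[OF mn(2)] unfolding Fe[symmetric] by fastforce
    from power_mono[OF this, of 2] show ?thesis by (simp add: power_mult_distrib)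
   qed
   have "Bf (%x. s (k m) x - s (k n) x) (%x. s (k m) x - s (k n) x) = (LINT x|NM. (s (k m) (True, x) - s (k n) (True, x))^2)"
    by (simp add: Bf_def power2_eq_square)
   also have "... <= 4 * e^2 * m0" unfolding m0_def
    by (rule NM_bound[OF pw L2_diff[OF Sp_L2(1)[OF s] Sp_L2(1)[OF s]]]) auto
   also have "... < ep" unfolding e(2) using that m0 by (simp add: field_simps add_pos_nonneg)
   finally show "Bf (%x. s (k m) x - s (k n) x) (%x. s (k m) x - s (k n) x) < ep" .
  qed
 qed
 then show ?thesis using k by blast
qed

sublocale spectral Sp Bf Qf
proof (intro spectral.intro psd_B psd_Q spectral_axioms.intro)
 show "Bf u u <= Qf u u" for u by (simp add: Qf_def Df_nonneg)
qed (use Sp_Bnull Sp_complete Sp_compact in blast)+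

end

section \<open>Functions on the network and their representatives\<close>

context net_data
begin

lemma arc_ends: "al \<in> E ==> arc G al (endp al s) = pos G (endv al s)"
 using l_pos[of al] by (auto simp: arc_def endp_def endv_def)

lemma arc_diff: "al \<in> E ==> arc G al y - pos G (tail G al) = (y / l al) *\<^sub>R (pos G (head G al) - pos G (tail G al))"
 using l_pos[of al] by (simp add: arc_def algebra_simps diff_divide_distrib)

lemma dist_arc: "al \<in> E ==> 0 <= y ==> dist (pos G (tail G al)) (arc G al y) = y"
proof -
 assume al: "al \<in> E" and y: "0 <= y"
 have "dist (pos G (tail G al)) (arc G al y) = norm (arc G al y - pos G (tail G al))" by (simp add: dist_norm norm_minus_commute)
 also have "... = (y / l al) * norm (pos G (head G al) - pos G (tail G al))"
  unfolding arc_diff[OF al] using y l_pos[OF al] by simp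
 also have "norm (pos G (head G al) - pos G (tail G al)) = l al" by (simp add: len_def dist_norm norm_minus_commute)
 finally show ?thesis using l_pos[OF al] by simp
qed

lemma edge_arc: "al \<in> E ==> edge G al = arc G al ` {0..l al}"
proof (intro set_eqI iffI)
 fix x assume al: "al \<in> E" and "x \<in> edge G al"
 then obtain u where u: "0 <= u" "u <= 1" "x = (1 - u) *\<^sub>R pos G (tail G al) + u *\<^sub>R pos G (head G al)"
  by (auto simp: edge_def closed_segment_def)
 have "x = arc G al (u * l al)" using l_pos[OF al] by (simp add: u(3) arc_def algebra_simps)
 then show "x \<in> arc G al ` {0..l al}" using u l_pos[OF al] by (auto simp: mult_left_le_one_le)
next
 fix x assume al: "al \<in> E" and "x \<in> arc G al ` {0..l al}"
 then obtain y where y: "y \<in> {0..l al}" "x = arc G al y" by blast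
 have "x = (1 - y / l al) *\<^sub>R pos G (tail G al) + (y / l al) *\<^sub>R pos G (head G al)"
  using l_pos[OF al] by (simp add: y(2) arc_def algebra_simps)
 then show "x \<in> edge G al" using y l_pos[OF al] unfolding edge_def closed_segment_def by (auto intro!: exI[of _ "y / l al"])
qed

lemma arc_inj: "al \<in> E ==> 0 <= y ==> 0 <= z ==> arc G al y = arc G al z ==> y = z"
 by (metis dist_arc)

lemma arc_in_points: "al \<in> E ==> y \<in> {0..l al} ==> arc G al y \<in> points G"
 unfolding points_def by (rule UN_I[of al]) (simp_all add: edge_arc)

lemma points_arc: "x \<in> points G ==> \<exists>al y. al \<in> E & y \<in> {0..l al} & x = arc G al y"
proof -
 assume "x \<in> points G"
 then obtain al where al: "al \<in> E" "x \<in> edge G al" unfolding points_def by blast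
 then obtain y where "y \<in> {0..l al}" "x = arc G al y" unfolding edge_arc[OF al(1)] by blast
 then show ?thesis using al(1) by blast
qed

lemma arc_eq:
 assumes "al \<in> E" "be \<in> E" "y \<in> {0..l al}" "z \<in> {0..l be}" "arc G al y = arc G be z"
 shows "al = be & y = z \<or> (\<exists>s s'. y = endp al s & z = endp be s' & endv al s = endv be s')"
proof (cases "al = be")
 case True then show ?thesis using arc_inj[of al y z] assms by auto
next
 case False
 have "arc G al y \<in> edge G al" unfolding edge_arc[OF assms(1)] using assms(3) by (rule imageI)
 moreover have "arc G al y \<in> edge G be" unfolding edge_arc[OF assms(2)] assms(5) using assms(4) by (rule imageI)
 ultimately have "arc G al y \<in> edge G al \<inter> edge G be" by blast
 then obtain i where i: "i \<in> {tail G al, head G al} \<inter> {tail G be, head G be}" "edge G al \<inter> edge G be = {pos G i}"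
  using edges_meet assms(1,2) False by blast
 then have p: "arc G al y = pos G i" using \<open>arc G al y \<in> edge G al \<inter> edge G be\<close> by blast
 have "\<exists>s. i = endv al s" "\<exists>s. i = endv be s" using i(1) by (auto simp: endv_def)
 then obtain s s' where s: "i = endv al s" "i = endv be s'" by blast
 have "arc G al y = arc G al (endp al s)" using arc_ends[OF assms(1), of s] p s by simp
 then have "y = endp al s" using arc_inj[OF assms(1)] assms(3) endp_range[OF assms(1)] by auto
 moreover have "arc G be z = arc G be (endp be s')" using arc_ends[OF assms(2), of s'] p s assms(5) by simp
 then have "z = endp be s'" using arc_inj[OF assms(2)] assms(4) endp_range[OF assms(2)] by auto
 ultimately show ?thesis using s by metis
qed

lemma arc_continuous: "continuous_on A (arc G al)"
 unfolding arc_def[abs_def] by (intro continuous_intros)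

text \<open>Agreement is required at every point of the closed edges and not almost everywhere,
  because continuity on the network and the terminal condition concern point values.\<close>

definition rep :: "('a => real) => (bool \<times> nat \<times> real => real) => bool" where
 "rep v w \<longleftrightarrow> w \<in> Sp & (\<forall>al\<in>E. \<forall>y\<in>{0..l al}. v (arc G al y) = w (True, al, y))"

lemma rep_Sp: "rep v w ==> w \<in> Sp" and rep_val: "rep v w ==> al \<in> E ==> y \<in> {0..l al} ==> v (arc G al y) = w (True, al, y)"
 by (auto simp: rep_def)

lemma rep_comb: "rep v w ==> rep v' w' ==> rep (%x. a * v x + c * v' x) (%x. a * w x + c * w' x)"
 by (auto simp: rep_def Sp_comb)

lemma rep_diff: "rep v w ==> rep v' w' ==> rep (%x. v x - v' x) (%x. w x - w' x)"
 using rep_comb[of v w v' w' 1 "-1"] by simp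

lemma rep_sum: "finite I ==> (\<And>k. k \<in> I ==> rep (v k) (w k)) ==> rep (%x. \<Sum>k\<in>I. a k * v k x) (%x. \<Sum>k\<in>I. a k * w k x)"
proof (induction I rule: finite_induct)
 case empty then show ?case by (simp add: rep_def Sp_zero)
next
 case (insert k I)
 then show ?case using rep_comb[of "v k" "w k" "%x. \<Sum>k\<in>I. a k * v k x" "%x. \<Sum>k\<in>I. a k * w k x" "a k" 1] by simp
qed

lemma rep_H1: assumes "rep v w" "al \<in> E"
 shows "H1_rep (l al) (on_edge G al v) (%y. w (True, al, y)) (%y. w (False, al, y))"
 using assms SpD(1,3)[OF rep_Sp[OF assms(1)] assms(2)] by (auto simp: H1_rep_def on_edge_def rep_def)

lemma rep_deriv: assumes "rep v w" "al \<in> E"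
 shows "AE y in lborel. 0 < y & y < l al --> edge_deriv G al v y = w (False, al, y)"
 unfolding edge_deriv_def by (rule weak_deriv_AE[OF rep_H1[OF assms] l_pos[OF assms(2)]])

text \<open>A point has several parameters only if it is a vertex, and there members of
  \<open>Sp\<close> agree; so the choice by \<open>SOME\<close> is immaterial.\<close>

lemma glue: assumes "w \<in> Sp" shows "\<exists>v. rep v w"
proof -
 define v where "v x = (let (al, y) = (SOME (al, y). al \<in> E & y \<in> {0..l al} & x = arc G al y) in w (True, al, y))" for x
 have "v (arc G al y) = w (True, al, y)" if a: "al \<in> E" "y \<in> {0..l al}" for al y
 proof -
  obtain be z where bz: "(SOME (be, z). be \<in> E & z \<in> {0..l be} & arc G al y = arc G be z) = (be, z)" by fastforce
  have "case (SOME (be, z). be \<in> E & z \<in> {0..l be} & arc G al y = arc G be z) of (be, z) => be \<in> E & z \<in> {0..l be} & arc G al y = arc G be z"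
   by (rule someI[of _ "(al, y)"]) (use a in simp)
  then have b: "be \<in> E" "z \<in> {0..l be}" "arc G al y = arc G be z" unfolding bz by auto
  have "v (arc G al y) = w (True, be, z)" unfolding v_def bz by simp
  also have "... = w (True, al, y)"
   using arc_eq[OF a(1) b(1) a(2) b(2,3)] SpD(4)[OF assms a(1) b(1)] by metis
  finally show ?thesis .
 qed
 then show ?thesis using assms unfolding rep_def by (intro exI[of _ v]) blast
qed

text \<open>On an edge the distance to the tail inverts the parametrisation, which makes
  \<open>v\<close> continuous there; finitely many closed edges are then glued.\<close>

lemma rep_V: assumes r: "rep v w" shows "v \<in> V_space G"
proof -
 have "continuous_on (edge G al) v" if al: "al \<in> E" for al
 proof -
  have c: "continuous_on (edge G al) (%x. w (True, al, dist (pos G (tail G al)) x))"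
  proof (rule continuous_on_compose2[OF ac_continuous[OF SpD(1)[OF rep_Sp[OF r] al]]])
   show "(%x. dist (pos G (tail G al)) x) ` edge G al \<subseteq> {0..l al}" using dist_arc[OF al] by (auto simp: edge_arc[OF al])
  qed (intro continuous_intros)
  show ?thesis
  proof (rule continuous_on_eq[OF c])
   fix x assume "x \<in> edge G al"
   then obtain y where "y \<in> {0..l al}" "x = arc G al y" by (auto simp: edge_arc[OF al])
   then show "w (True, al, dist (pos G (tail G al)) x) = v x" using dist_arc[OF al, of y] rep_val[OF r al, of y] by simp
  qed
 qed
 then have "continuous_on (points G) v"
  unfolding points_def by (intro continuous_on_closed_Union finite_E) (auto simp: edge_def)
 moreover have "sobolev 1 (l al) (on_edge G al v)" if "al \<in> E" for al
  using rep_H1[OF r that] sobolev_1[OF l_pos[OF that]] by blast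
 ultimately show ?thesis by (simp add: Hs_def Hb_def del: sobolev.simps One_nat_def)
qed

text \<open>A continuous \<open>v\<close> equals the absolutely continuous version at every point of
  a closed edge, so the values of different edges at a common vertex agree.\<close>

lemma V_rep: assumes "v \<in> V_space G" shows "\<exists>w. rep v w"
proof -
 have cont: "continuous_on (points G) v" and sob: "\<And>al. al \<in> E ==> sobolev 1 (l al) (on_edge G al v)"
  using assms by (auto simp: Hs_def Hb_def simp del: sobolev.simps One_nat_def)
 have "\<forall>al. \<exists>u d. al \<in> E --> H1_rep (l al) (on_edge G al v) u d"
  using sob sobolev_1 l_pos by blast
 then obtain u d where ud: "\<And>al. al \<in> E ==> H1_rep (l al) (on_edge G al v) (u al) (d al)" by metis
 have ec: "continuous_on {0..l al} (on_edge G al v)" if "al \<in> E" for al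
  unfolding on_edge_def[abs_def] by (rule continuous_on_compose2[OF cont arc_continuous]) (use arc_in_points[OF that] in auto)
 define w where "w = (%(b, al, y). if b then indicator {0..l al} y *\<^sub>R on_edge G al v y else d al y)"
 have wT: "w (True, al, y) = indicator {0..l al} y *\<^sub>R on_edge G al v y" and wF: "w (False, al, y) = d al y" for al y by (auto simp: w_def)
 have "w \<in> Sp"
 proof (rule SpI)
  fix al assume al: "al \<in> E"
  have h: "ac (l al) (u al) (d al)" "integrable lborel (%s. indicator {0..l al} s * (d al s)^2)"
   "AE y in lborel. 0 < y & y < l al --> on_edge G al v y = u al y" using ud[OF al] by (auto simp: H1_rep_def)
  have eq: "on_edge G al v y = u al y" if "y \<in> {0..l al}" for y
   by (rule continuous_AE_eq[OF ec[OF al] ac_continuous[OF h(1)] h(3) l_pos[OF al] that])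
  show "ac (l al) (%y. w (True, al, y)) (%y. w (False, al, y))"
   unfolding wF by (rule ac_cong_AE[OF h(1) ac_borel[OF h(1)]]) (use eq in "auto simp: wT")
  show "(%y. w (True, al, y)) \<in> BM"
   unfolding wT using ec[OF al] by (intro borel_measurable_continuous_on_indicator) auto
  show "integrable lborel (%y. indicator {0..l al} y * (w (False, al, y))^2)" unfolding wF by (rule h(2))
 next
  fix al be s s' assume a: "al \<in> E" "be \<in> E" "endv al s = endv be s'"
  then show "w (True, al, endp al s) = w (True, be, endp be s')"
   using endp_range[OF a(1), of s] endp_range[OF a(2), of s'] by (simp add: wT on_edge_def arc_ends)
 qed
 then show ?thesis by (intro exI[of _ w]) (auto simp: rep_def wT on_edge_def)
qed

section \<open>Norms of the network spaces in terms of representatives\<close>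

lemma net_integral_AE:
 assumes b: "\<And>al. al \<in> E ==> (%y. g (al, y)) \<in> BM"
  and ae: "\<And>al. al \<in> E ==> AE y in lborel. 0 < y & y < l al --> F al y = g (al, y)"
 shows "net_integral G F = (\<Sum>al\<in>E. LINT y|lborel. indicator {0..l al} y * g (al, y))"
 unfolding net_integral_def
proof (rule sum.cong[OF refl])
 fix al assume al: "al \<in> E"
 have "(LINT y|lebesgue_on {0<..<l al}. F al y) = (LINT y|lborel. indicator {0<..<l al} y * g (al, y))"
  by (rule integrable_lebesgue_on_AE(2)[OF _ b[OF al]]) (use ae[OF al] in auto)
 then show "(LINT y|lebesgue_on {0<..<l al}. F al y) = (LINT y|lborel. indicator {0..l al} y * g (al, y))"
  using integral_open_closed[OF b[OF al]] by simp
qed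

text \<open>The unweighted squared norm that occurs in \<open>Hb_norm\<close>; it is equivalent to
  that of \<open>NM\<close> because \<psi> lies between \<open>lower\<close> and
  \<open>upper\<close>.\<close>

definition esq :: "(nat \<times> real => real) => real" where
 "esq g = (\<Sum>al\<in>E. LINT y|lborel. indicator {0..l al} y * (g (al, y))^2)"

lemma esq_nonneg: "0 <= esq g"
 unfolding esq_def by (intro sum_nonneg integral_nonneg_AE) simp

lemma esq_bounds:
 assumes "L2 NM g" shows "lower * esq g <= (LINT x|NM. (g x)^2)" "(LINT x|NM. (g x)^2) <= upper * esq g"
proof -
 have m: "g \<in> borel_measurable NM" "(%x. (g x)^2) \<in> borel_measurable NM" using assms by (auto simp: L2_def)
 have i: "integrable NM (%x. (g x)^2)" by (rule L2_square[OF assms])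
 have e: "(LINT x|NM. (g x)^2) = (\<Sum>al\<in>E. LINT y|lborel. indicator {0..l al} y * (\<psi> al y * (g (al, y))^2))"
  by (rule NM_integrable(2)[OF m(2) i])
 have j: "integrable lborel (%y. indicator {0..l al} y * (g (al, y))^2)" "integrable lborel (%y. indicator {0..l al} y * (\<psi> al y * (g (al, y))^2))" if "al \<in> E" for al
  using NM_L2_iff[OF m(1)] assms NM_integrable(1)[OF m(2)] i that by auto
 have "lower * esq g = (\<Sum>al\<in>E. LINT y|lborel. lower * (indicator {0..l al} y * (g (al, y))^2))"
  by (simp add: esq_def sum_distrib_left)
 also have "... <= (LINT x|NM. (g x)^2)"
  unfolding e using j by (intro sum_mono integral_mono) (auto simp: indicator_def intro!: mult_right_mono \<psi>_bounds)
 finally show "lower * esq g <= (LINT x|NM. (g x)^2)" .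
 have "(LINT x|NM. (g x)^2) <= (\<Sum>al\<in>E. LINT y|lborel. upper * (indicator {0..l al} y * (g (al, y))^2))"
  unfolding e using j by (intro sum_mono integral_mono) (auto simp: indicator_def intro!: mult_right_mono \<psi>_bounds)
 then show "(LINT x|NM. (g x)^2) <= upper * esq g" by (simp add: esq_def sum_distrib_left)
qed

lemma Hb_norm_1:
 assumes r: "rep v w"
 shows "Hb_norm G 1 v = sqrt (esq (%x. w (True, x)) + esq (%x. w (False, x)))"
proof -
 note m = SpD(2)[OF rep_Sp[OF r]] ac_borel[OF SpD(1)[OF rep_Sp[OF r]]]
 have 0: "net_integral G (%al y. (on_edge G al v y)^2) = esq (%x. w (True, x))"
  unfolding esq_def by (rule net_integral_AE) (use m r in "auto simp: on_edge_def rep_def")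
 have 1: "net_integral G (%al y. (weak_deriv (l al) (on_edge G al v) y)^2) = esq (%x. w (False, x))"
  unfolding esq_def
 proof (rule net_integral_AE)
  fix al assume al: "al \<in> E"
  show "(%y. (w (False, al, y))^2) \<in> BM" using m(2)[OF al] by simp
  show "AE y in lborel. 0 < y & y < l al --> (weak_deriv (l al) (on_edge G al v) y)^2 = (w (False, al, y))^2"
   using rep_deriv[OF r al] unfolding edge_deriv_def by eventually_elim auto
 qed
 show ?thesis unfolding Hb_norm_def using 0 1 by simp
qed

lemma Qf_Hb_norm:
 assumes r: "rep v w"
 shows "Qf w w <= (upper^2 + upper) * (Hb_norm G 1 v)^2" "(Hb_norm G 1 v)^2 <= (1 / lower + 1 / lower^2) * Qf w w"
proof -
 note L = Sp_L2[OF rep_Sp[OF r]]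
 have H: "(Hb_norm G 1 v)^2 = esq (%x. w (True, x)) + esq (%x. w (False, x))"
  unfolding Hb_norm_1[OF r] by (simp add: esq_nonneg)
 have B: "Bf w w = (LINT x|NM. (w (True, x))^2)" by (simp add: Bf_def power2_eq_square)
 have "Df w w <= (LINT x|NM. upper * (w (False, x))^2)"
  unfolding Df_def
 proof (rule integral_mono[OF Sp_integrable(2)[OF rep_Sp[OF r] rep_Sp[OF r]]])
  show "integrable NM (%x. upper * (w (False, x))^2)" using L by (simp add: L2_def)
  fix x assume "x \<in> space NM"
  then show "\<mu> (fst x) * w (False, x) * w (False, x) <= upper * (w (False, x))^2"
   using mult_right_mono[OF \<mu>_bounds(2), of "fst x" "(w (False, x))^2"] by (auto simp: power2_eq_square mult.assoc)
 qed
 also have "... <= upper * (upper * esq (%x. w (False, x)))"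
  using esq_bounds(2)[OF L(2)] upper_ge_1 by simp
 finally have D: "Df w w <= upper^2 * esq (%x. w (False, x))" by (simp add: power2_eq_square)
 have B': "Bf w w <= upper * esq (%x. w (True, x))" unfolding B by (rule esq_bounds(2)[OF L(1)])
 have u: "0 <= upper" using upper_ge_1 by simp
 show "Qf w w <= (upper^2 + upper) * (Hb_norm G 1 v)^2"
  unfolding H Qf_def distrib_left distrib_right
  using B' D mult_nonneg_nonneg[OF u esq_nonneg] mult_nonneg_nonneg[OF zero_le_power2[of upper] esq_nonneg]
  by (smt (verit))
 have e1: "esq (%x. w (True, x)) <= Bf w w / lower" using esq_bounds(1)[OF L(1)] lower_pos by (simp add: B field_simps)
 have "esq (%x. w (False, x)) <= (LINT x|NM. (w (False, x))^2) / lower" using esq_bounds(1)[OF L(2)] lower_pos by (simp add: field_simps)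
 also have "... <= (Df w w / lower) / lower" using Df_lower[OF rep_Sp[OF r]] lower_pos by (intro divide_right_mono) (auto simp: field_simps)
 finally have e2: "esq (%x. w (False, x)) <= Df w w / lower^2" by (simp add: power2_eq_square)
 have "0 <= Bf w w / lower^2" "0 <= Df w w / lower" using Bf_nonneg Df_nonneg lower_pos by auto
 then show "(Hb_norm G 1 v)^2 <= (1 / lower + 1 / lower^2) * Qf w w"
  unfolding H Qf_def using e1 e2 by (simp add: distrib_right add_divide_distrib)
qed

lemma AE_NM_range: "AE x in NM. snd x \<in> {0..l (fst x)}"
proof (rule AE_NM_I)
 have "(%x. indicator {0..l (fst x)} (snd x) :: real) \<in> borel_measurable NM" by (simp add: NM_measurable_iff)
 then have "{x \<in> space NM. indicator {0..l (fst x)} (snd x) = (1::real)} \<in> sets NM" by (simp del: sets_NM space_NM)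
 moreover have "{x \<in> space NM. indicator {0..l (fst x)} (snd x) = (1::real)} = {x \<in> space NM. snd x \<in> {0..l (fst x)}}"
  by (auto simp: indicator_def)
 ultimately show "{x \<in> space NM. snd x \<in> {0..l (fst x)}} \<in> sets NM" by metis
qed simp

section \<open>Regularity\<close>

text \<open>The second derivative dictated by the equation
  \<open>\<psi> * w - (\<mu> * \<psi> * w')' = \<psi> * h\<close>, solved for
  \<open>w''\<close>.\<close>

definition d2 :: "(bool \<times> nat \<times> real => real) => (nat \<times> real => real) => nat \<times> real => real" where
 "d2 w h x = (w (True, x) - h x) / \<mu> (fst x) - \<psi>' (fst x) / \<psi> (fst x) (snd x) * w (False, x)"

lemma quot_measurable: "(%x. \<psi>' (fst x) / \<psi> (fst x) (snd x)) \<in> borel_measurable NM"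
 by (simp add: NM_measurable_iff)

lemma quot_bound: "al \<in> E ==> y \<in> {0..l al} ==> \<bar>\<psi>' al / \<psi> al y\<bar> <= upper / lower"
 using \<psi>'_upper[of al] \<psi>_bounds[of al y] lower_pos upper_ge_1 by (auto simp: abs_divide intro!: frac_le)

lemma L2_quot: assumes u: "L2 NM u" shows "L2 NM (%x. \<psi>' (fst x) / \<psi> (fst x) (snd x) * u x)"
  "(LINT x|NM. (\<psi>' (fst x) / \<psi> (fst x) (snd x) * u x)^2) <= (upper / lower)^2 * (LINT x|NM. (u x)^2)"
proof -
 have ae: "AE x in NM. \<bar>\<psi>' (fst x) / \<psi> (fst x) (snd x)\<bar> <= upper / lower"
  using AE_NM_range AE_space
 proof eventually_elim
  case (elim x) then show ?case using quot_bound[of "fst x" "snd x"] by (auto simp: mem_Times_iff)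
 qed
 show L: "L2 NM (%x. \<psi>' (fst x) / \<psi> (fst x) (snd x) * u x)"
 proof (rule L2_bound[OF u, where C = "upper / lower"])
  show "(%x. \<psi>' (fst x) / \<psi> (fst x) (snd x) * u x) \<in> borel_measurable NM"
   by (rule borel_measurable_times[OF quot_measurable L2_measurable[OF u]])
  show "AE x in NM. \<bar>\<psi>' (fst x) / \<psi> (fst x) (snd x) * u x\<bar> <= upper / lower * \<bar>u x\<bar>"
   using ae by eventually_elim (simp only: abs_mult mult_right_mono abs_ge_zero)
 qed
 have "(LINT x|NM. (\<psi>' (fst x) / \<psi> (fst x) (snd x) * u x)^2) <= (LINT x|NM. (upper / lower)^2 * (u x)^2)"
 proof (rule integral_mono_AE)
  show "AE x in NM. (\<psi>' (fst x) / \<psi> (fst x) (snd x) * u x)^2 <= (upper / lower)^2 * (u x)^2"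
   using ae
  proof eventually_elim
   case (elim x)
   have "\<bar>\<psi>' (fst x) / \<psi> (fst x) (snd x)\<bar>^2 <= (upper / lower)^2" by (rule power_mono[OF elim]) simp
   then show ?case unfolding power_mult_distrib by (intro mult_right_mono) (simp_all only: power2_abs zero_le_power2)
  qed
 qed (use L u in "auto simp: L2_def")
 then show "(LINT x|NM. (\<psi>' (fst x) / \<psi> (fst x) (snd x) * u x)^2) <= (upper / lower)^2 * (LINT x|NM. (u x)^2)" by simp
qed

lemma L2_div_\<mu>: assumes u: "L2 NM u" shows "L2 NM (%x. u x / \<mu> (fst x))"
  "(LINT x|NM. (u x / \<mu> (fst x))^2) <= (LINT x|NM. (u x)^2) / lower^2"
proof -
 have b: "\<bar>u x / \<mu> (fst x)\<bar> <= 1 / lower * \<bar>u x\<bar>" if "x \<in> space NM" for x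
 proof -
  have "fst x \<in> E" using that by auto
  then have "lower <= \<mu> (fst x)" by (rule \<mu>_bounds)
  then show ?thesis using lower_pos by (simp add: abs_divide frac_le)
 qed
 show L: "L2 NM (%x. u x / \<mu> (fst x))"
 proof (rule L2_bound[OF u, where C = "1 / lower"])
  show "(%x. u x / \<mu> (fst x)) \<in> borel_measurable NM"
   by (rule borel_measurable_divide[OF L2_measurable[OF u] \<mu>_measurable])
 qed (rule AE_I2, rule b)
 have "(LINT x|NM. (u x / \<mu> (fst x))^2) <= (LINT x|NM. (u x)^2 / lower^2)"
 proof (rule integral_mono)
  fix x assume "x \<in> space NM"
  from power_mono[OF b[OF this], of 2] show "(u x / \<mu> (fst x))^2 <= (u x)^2 / lower^2" by (simp add: power_divide)
 qed (use L u in "auto simp: L2_def")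
 then show "(LINT x|NM. (u x / \<mu> (fst x))^2) <= (LINT x|NM. (u x)^2) / lower^2" by simp
qed

lemma d2_L2: assumes "w \<in> Sp" "L2 NM h" shows "L2 NM (d2 w h)"
 unfolding d2_def[abs_def] by (intro L2_diff L2_div_\<mu> L2_quot Sp_L2[OF assms(1)] assms(2))

definition weak_eq :: "(bool \<times> nat \<times> real => real) => (nat \<times> real => real) => bool" where
 "weak_eq w h \<longleftrightarrow> w \<in> Sp & L2 NM h & (\<forall>ph\<in>Sp. Qf w ph = (LINT x|NM. h x * ph (True, x)))"

text \<open>Testing with \<open>w\<close> and expanding the square of \<open>h - w\<close> gives
  \<open>0 <= |h|^2 - 2 * Qf w w + Bf w w\<close>, and \<open>Bf <= Qf\<close> absorbs the last
  term. The second bound is read off from the formula for \<open>d2\<close>.\<close>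

lemma weak_eq_bounds:
 assumes "weak_eq w h"
 shows "Qf w w <= (LINT x|NM. (h x)^2)" "(LINT x|NM. (d2 w h x)^2) <= (8 / lower^2 + 2 * (upper / lower)^2 / lower) * (LINT x|NM. (h x)^2)"
proof -
 have w: "w \<in> Sp" and h: "L2 NM h" and eq: "Qf w w = (LINT x|NM. h x * w (True, x))" using assms by (auto simp: weak_eq_def)
 note L = Sp_L2[OF w]
 have B: "Bf w w = (LINT x|NM. (w (True, x))^2)" by (simp add: Bf_def power2_eq_square)
 have BQ: "Bf w w <= Qf w w" by (rule Q_ge[OF w])
 have "0 <= (LINT x|NM. (h x + (-1) * w (True, x))^2)" by (simp add: integral_nonneg_AE)
 also have "... = (LINT x|NM. (h x)^2) - 2 * Qf w w + Bf w w"
  unfolding L2_expand[OF h L(1)] B eq by simp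
 finally show Qh: "Qf w w <= (LINT x|NM. (h x)^2)" using BQ by linarith
 define I where "I = (LINT x|NM. (h x)^2)"
 have dl: "(LINT x|NM. (w (False, x))^2) <= I / lower"
  using Df_lower[OF w] Bf_nonneg[of w] Qh lower_pos by (simp add: Qf_def I_def field_simps)
 have "(LINT x|NM. (d2 w h x)^2) <= 2 * (LINT x|NM. ((w (True, x) - h x) / \<mu> (fst x))^2) + 2 * (LINT x|NM. (\<psi>' (fst x) / \<psi> (fst x) (snd x) * w (False, x))^2)"
  unfolding d2_def by (rule L2_integral_square_diff[OF L2_div_\<mu>(1)[OF L2_diff[OF L(1) h]] L2_quot(1)[OF L(2)]])
 also have "... <= 2 * ((LINT x|NM. (w (True, x) - h x)^2) / lower^2) + 2 * ((upper / lower)^2 * (LINT x|NM. (w (False, x))^2))"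
  using L2_div_\<mu>(2)[OF L2_diff[OF L(1) h]] L2_quot(2)[OF L(2)] by linarith
 also have "... <= 2 * ((4 * I) / lower^2) + 2 * ((upper / lower)^2 * (I / lower))"
 proof (intro add_mono mult_left_mono divide_right_mono dl)
  have "(LINT x|NM. (w (True, x) - h x)^2) <= 2 * (LINT x|NM. (w (True, x))^2) + 2 * (LINT x|NM. (h x)^2)" by (rule L2_integral_square_diff[OF L(1) h])
  then show "(LINT x|NM. (w (True, x) - h x)^2) <= 4 * I" using BQ Qh unfolding B I_def by linarith
 qed auto
 also have "... = (8 / lower^2 + 2 * (upper / lower)^2 / lower) * I" by (simp add: field_simps)
 finally show "(LINT x|NM. (d2 w h x)^2) <= (8 / lower^2 + 2 * (upper / lower)^2 / lower) * (LINT x|NM. (h x)^2)" by (simp add: I_def)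
qed

end

lemma L2_tm_iff: "v \<in> BM ==> L2 (tm a) v \<longleftrightarrow> integrable lborel (%y. indicator {0..a} y * (v y)^2)"
 unfolding L2_def by (simp add: integrable_tm)

lemma L2_tm_integrable: assumes "L2 (tm a) v" shows "integrable (tm a) v"
proof -
 interpret finite_measure "tm a" by (rule finite_measure_tm)
 have "L2 (tm a) (%x. 1)" by (simp add: L2_def)
 from L2_mult[OF assms this] show ?thesis by simp
qed

lemma ac_primitive:
 assumes "g \<in> BM" "integrable lborel (%s. indicator {0..l} s * g s)"
 shows "ac l (%y. LINT s|lborel. indicator {0..y} s * g s) g" "(LINT s|lborel. indicator {0..0} s * g s) = (0::real)"
proof -
 show z: "(LINT s|lborel. indicator {0..0} s * g s) = (0::real)"
 proof (rule integral_eq_zero_AE)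
  show "AE s in lborel. indicator {0..0} s * g s = 0"
   using AE_lborel_singleton[of "0::real"] by eventually_elim (simp add: indicator_def)
 qed
 show "ac l (%y. LINT s|lborel. indicator {0..y} s * g s) g"
  by (rule acI[OF assms]) (simp only: z add_0_left)
qed

context net_data
begin

lemma ac_\<psi>: "ac (l al) (\<psi> al) (%y. indicator {0..l al} y * \<psi>' al)"
 unfolding \<psi>_def[abs_def] by (rule ac_deriv) (auto intro!: derivative_eq_intros continuous_intros)

lemma ac_inverse_\<psi>:
 assumes "al \<in> E" shows "ac (l al) (%y. 1 / \<psi> al y) (%y. indicator {0..l al} y * (- \<psi>' al / (\<psi> al y)^2))"
proof (rule ac_deriv)
 have D: "(\<psi> al has_real_derivative \<psi>' al) (at y within {0..l al})" for y
  unfolding \<psi>_def[abs_def] by (auto intro!: derivative_eq_intros)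
 show "((%y. 1 / \<psi> al y) has_real_derivative - \<psi>' al / (\<psi> al y)^2) (at y within {0..l al})" if "y \<in> {0..l al}" for y
  using \<psi>_pos[OF assms that] by (auto intro!: derivative_eq_intros D simp: power2_eq_square)
 have c: "continuous_on {0..l al} (\<psi> al)" unfolding \<psi>_def[abs_def] by (intro continuous_intros)
 show "continuous_on {0..l al} (%y. - \<psi>' al / (\<psi> al y)^2)"
  using \<psi>_pos[OF assms] by (intro continuous_intros c) fastforce
qed

lemma NM_L2_edge: assumes "L2 NM h" "al \<in> E" shows "L2 (tm (l al)) (%y. h (al, y))"
proof -
 have m: "h \<in> borel_measurable NM" using assms by (simp add: L2_def)
 show ?thesis using NM_L2_iff[OF m] assms L2_tm_iff[OF NM_slice[OF m assms(2)]] by simp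
qed

lemma edge_L2_\<psi>: assumes al: "al \<in> E" and v: "L2 (tm (l al)) v" shows "L2 (tm (l al)) (%y. \<psi> al y * v y)"
proof (rule L2_bound[OF v, where C = upper])
 have "v \<in> BM" using v by (simp add: L2_def)
 then show "(%y. \<psi> al y * v y) \<in> borel_measurable (tm (l al))" by simp
 show "AE y in tm (l al). \<bar>\<psi> al y * v y\<bar> <= upper * \<bar>v y\<bar>"
  unfolding AE_tm
 proof (rule AE_I2, rule impI)
  fix y assume "0 <= y & y <= l al"
  then have "\<bar>\<psi> al y\<bar> <= upper" using \<psi>_bounds[OF al, of y] \<psi>_pos[OF al, of y] by simp
  then show "\<bar>\<psi> al y * v y\<bar> <= upper * \<bar>v y\<bar>" by (simp add: abs_mult mult_right_mono)
 qed
qed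

lemma NM_integral_single:
 assumes h: "integrable NM h" and al: "al \<in> E" and z: "\<And>be y. be \<in> E ==> be \<noteq> al ==> h (be, y) = 0"
 shows "integral\<^sup>L NM h = (LINT y|lborel. indicator {0..l al} y * (\<psi> al y * h (al, y)))"
proof -
 have "integral\<^sup>L NM h = (\<Sum>be\<in>E. LINT y|lborel. indicator {0..l be} y * (\<psi> be y * h (be, y)))"
  by (rule NM_integrable(2)[OF borel_measurable_integrable[OF h] h])
 also have "... = (\<Sum>be\<in>E. if be = al then (LINT y|lborel. indicator {0..l al} y * (\<psi> al y * h (al, y))) else 0)"
  by (rule sum.cong) (auto simp: z)
 also have "... = (LINT y|lborel. indicator {0..l al} y * (\<psi> al y * h (al, y)))" using al finite_E by simp
 finally show ?thesis .
qed

text \<open>Testing with functions supported on a single edge shows that \<open>\<mu> \<psi> w'\<close> differs by a constant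
 from a primitive of \<open>\<psi> (w - h)\<close>.\<close>

lemma regularity:
 assumes eq: "weak_eq w h" and al: "al \<in> E"
 shows "\<exists>D. H1_rep (l al) (%y. w (False, al, y)) D (%y. d2 w h (al, y))"
proof -
 have w: "w \<in> Sp" and h: "L2 NM h" using eq by (auto simp: weak_eq_def)
 define L where "L = l al"
 have L: "0 < L" unfolding L_def by (rule l_pos[OF al])
 have uh: "L2 (tm L) (%y. w (True, al, y) - h (al, y))"
  unfolding L_def by (intro L2_diff NM_L2_edge[OF Sp_L2(1)[OF w] al] NM_L2_edge[OF h al])
 have wd: "L2 (tm L) (%y. w (False, al, y))" unfolding L_def by (rule NM_L2_edge[OF Sp_L2(2)[OF w] al])
 define g where "g y = \<psi> al y * (w (True, al, y) - h (al, y))" for y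
 have gL: "L2 (tm L) g" unfolding g_def L_def by (rule edge_L2_\<psi>[OF al]) (use uh in "simp add: L_def")
 have gm[measurable]: "g \<in> BM" using gL by (simp add: L2_def)
 have gi: "integrable lborel (%s. indicator {0..L} s * g s)" using L2_tm_integrable[OF gL] by (simp add: integrable_tm)
 define P where "P y = (LINT s|lborel. indicator {0..y} s * g s)" for y
 have acP: "ac L P g" and P0: "P 0 = 0" unfolding P_def using ac_primitive[OF gm gi] by auto
 define PP where "PP y = indicator {0..L} y * P y" for y
 have PPm[measurable]: "PP \<in> BM" unfolding PP_def by (rule integrable_tm_continuous(2)[OF ac_continuous[OF acP]])
 have PPL: "L2 (tm L) PP"
 proof -
  have "integrable (tm L) (%y. indicator {0..L} y * (P y)^2)" by (intro integrable_tm_continuous continuous_intros ac_continuous[OF acP])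
  moreover have "(%y. indicator {0..L} y * (P y)^2) = (%y. (PP y)^2)" by (auto simp: PP_def indicator_def)
  ultimately show ?thesis by (simp add: L2_def)
 qed
 define R where "R y = \<mu> al * (\<psi> al y * w (False, al, y)) - PP y" for y
 have RL: "L2 (tm L) R" unfolding R_def by (intro L2_diff L2_cmult PPL) (use edge_L2_\<psi>[OF al, folded L_def, OF wd] in simp)
 have Rm[measurable]: "R \<in> BM" using RL by (simp add: L2_def)
 define c where "c = (LINT y|tm L. R y) / L"
 \<comment> \<open>Removing the mean makes the primitive \<Phi> vanish at both ends of the edge;
   continued by zero to the other edges it is an admissible test function.\<close>
 define \<delta> where "\<delta> y = R y - c" for y
 interpret fm: finite_measure "tm L" by (rule finite_measure_tm)
 have \<delta>L: "L2 (tm L) \<delta>" unfolding \<delta>_def by (intro L2_diff RL) (simp add: L2_def)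
 have \<delta>m[measurable]: "\<delta> \<in> BM" using \<delta>L by (simp add: L2_def)
 have \<delta>i: "integrable lborel (%s. indicator {0..L} s * \<delta> s)" using L2_tm_integrable[OF \<delta>L] by (simp add: integrable_tm)
 have cint: "(LINT y|tm L. c) = L * c" using L by (subst integral_tm) auto
 have \<delta>0: "(LINT y|tm L. \<delta> y) = 0"
  unfolding \<delta>_def using L2_tm_integrable[OF RL] cint L by (simp add: c_def)
 define \<Phi> where "\<Phi> y = (LINT s|lborel. indicator {0..y} s * \<delta> s)" for y
 have ac\<Phi>: "ac L \<Phi> \<delta>" and \<Phi>0: "\<Phi> 0 = 0" unfolding \<Phi>_def using ac_primitive[OF \<delta>m \<delta>i] by auto
 have \<Phi>L: "\<Phi> L = 0" using \<delta>0 by (simp add: \<Phi>_def integral_tm)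
 define ph where "ph = (%(b, be, y). if be = al then (if b then indicator {0..L} y * \<Phi> y else \<delta> y) else 0)"
 have ph_simps: "ph (True, al, y) = indicator {0..L} y * \<Phi> y" "ph (False, al, y) = \<delta> y" "be \<noteq> al ==> ph (b, be, y) = 0" for y b be
  by (simp_all add: ph_def)
 have ph: "ph \<in> Sp"
 proof (rule SpI)
  fix be assume "be \<in> E"
  show "ac (l be) (%y. ph (True, be, y)) (%y. ph (False, be, y))"
  proof (cases "be = al")
   case True
   show ?thesis unfolding True ph_simps L_def[symmetric] by (rule ac_cong_AE[OF ac\<Phi> \<delta>m]) auto
  qed (simp add: ph_simps(3) ac_const)
  show "(%y. ph (True, be, y)) \<in> BM"
  proof (cases "be = al")
   case True
   show ?thesis unfolding True ph_simps by (rule integrable_tm_continuous(2)[OF ac_continuous[OF ac\<Phi>]])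
  qed (simp add: ph_simps(3))
  show "integrable lborel (%y. indicator {0..l be} y * (ph (False, be, y))^2)"
  proof (cases "be = al")
   case True
   show ?thesis unfolding True ph_simps L_def[symmetric] using \<delta>L L2_tm_iff[OF \<delta>m] by simp
  qed (simp add: ph_simps(3))
 next
  fix be be' s s' assume "be \<in> E" "be' \<in> E"
  have "ph (True, be, endp be s) = 0" for be s
   using \<Phi>0 \<Phi>L by (cases "be = al") (auto simp: ph_simps endp_def L_def[symmetric])
  then show "ph (True, be, endp be s) = ph (True, be', endp be' s')" by simp
 qed
 have i1: "integrable NM (%x. w (True, x) * ph (True, x))" "integrable NM (%x. \<mu> (fst x) * w (False, x) * ph (False, x))" by (rule Sp_integrable[OF w ph])+
 have i2: "integrable NM (%x. h x * ph (True, x))" by (rule L2_mult[OF h Sp_L2(1)[OF ph]])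
 have "0 = Qf w ph - (LINT x|NM. h x * ph (True, x))" using eq ph by (simp add: weak_eq_def)
 also have "... = (LINT x|NM. (w (True, x) * ph (True, x) + \<mu> (fst x) * w (False, x) * ph (False, x)) - h x * ph (True, x))"
  unfolding Qf_def Bf_def Df_def using i1 i2 by simp
 also have "... = (LINT y|lborel. indicator {0..L} y * (\<psi> al y * ((w (True, al, y) * ph (True, al, y) + \<mu> al * w (False, al, y) * ph (False, al, y)) - h (al, y) * ph (True, al, y))))"
  unfolding L_def by (subst NM_integral_single[OF _ al]) (use i1 i2 in "auto simp: ph_simps(3)")
 also have "... = (LINT y|lborel. indicator {0..L} y * (g y * \<Phi> y) + indicator {0..L} y * ((R y + PP y) * \<delta> y))"
  by (intro Bochner_Integration.integral_cong refl) (simp add: ph_simps g_def R_def indicator_def algebra_simps)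
 also have "... = (LINT y|lborel. indicator {0..L} y * (g y * \<Phi> y)) + (LINT y|lborel. indicator {0..L} y * ((R y + PP y) * \<delta> y))"
 proof (rule Bochner_Integration.integral_add)
  show "integrable lborel (%y. indicator {0..L} y * (g y * \<Phi> y))" by (rule integrable_mult_continuous[OF gm gi ac_continuous[OF ac\<Phi>]])
  have "integrable (tm L) (%y. (R y + PP y) * \<delta> y)" by (intro L2_mult L2_add RL PPL \<delta>L)
  then show "integrable lborel (%y. indicator {0..L} y * ((R y + PP y) * \<delta> y))" by (subst (asm) integrable_tm) auto
 qed
 also have "(LINT y|lborel. indicator {0..L} y * (g y * \<Phi> y)) = - (LINT y|lborel. indicator {0..L} y * (P y * \<delta> y))"
  using ac_by_parts[OF acP ac\<Phi>] L \<Phi>0 \<Phi>L by simp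
 also have "(LINT y|lborel. indicator {0..L} y * (P y * \<delta> y)) = (LINT y|tm L. PP y * \<delta> y)"
  by (subst integral_tm, measurable) (intro Bochner_Integration.integral_cong refl, auto simp: PP_def indicator_def)
 also have "(LINT y|lborel. indicator {0..L} y * ((R y + PP y) * \<delta> y)) = (LINT y|tm L. (R y + PP y) * \<delta> y)"
  by (subst integral_tm) auto
 also have "(LINT y|tm L. (R y + PP y) * \<delta> y) = (LINT y|tm L. R y * \<delta> y) + (LINT y|tm L. PP y * \<delta> y)"
  using L2_mult[OF RL \<delta>L] L2_mult[OF PPL \<delta>L] by (simp add: distrib_right)
 finally have "(LINT y|tm L. R y * \<delta> y) = 0" by simp
 \<comment> \<open>As \<delta> is \<open>R\<close> minus a constant and has mean zero, orthogonality
   to \<open>R\<close> is orthogonality to \<delta> itself.\<close>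
 moreover have "(LINT y|tm L. (\<delta> y)^2) = (LINT y|tm L. R y * \<delta> y) - c * (LINT y|tm L. \<delta> y)"
 proof -
  have "(%y. (\<delta> y)^2) = (%y. R y * \<delta> y - c * \<delta> y)" by (auto simp: \<delta>_def power2_eq_square algebra_simps)
  then show ?thesis using L2_mult[OF RL \<delta>L] L2_tm_integrable[OF \<delta>L] by simp
 qed
 ultimately have "(LINT y|tm L. (\<delta> y)^2) = 0" using \<delta>0 by simp
 then have "AE y in tm L. (\<delta> y)^2 = 0"
  using L2_square[OF \<delta>L] by (subst (asm) integral_nonneg_eq_0_iff_AE) auto
 then have \<delta>AE: "AE y in lborel. 0 < y & y < L --> R y = c" unfolding AE_tm by eventually_elim (auto simp: \<delta>_def)
 \<comment> \<open>Solving \<open>\<mu> * \<psi> * w' = P + c\<close> for \<open>w'\<close> exhibits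
   an absolutely continuous version of the derivative.\<close>
 define D where "D y = ((1 / \<mu> al) * P y + 1 * (c / \<mu> al)) * (1 / \<psi> al y)" for y
 have acD0: "ac L D (%y. indicator {0..L} y * (((1 / \<mu> al) * g y + 1 * 0) * (1 / \<psi> al y) + ((1 / \<mu> al) * P y + 1 * (c / \<mu> al)) * (indicator {0..L} y * (- \<psi>' al / (\<psi> al y)^2))))"
  unfolding D_def by (rule ac_mult[OF ac_comb[OF acP ac_const] ac_inverse_\<psi>[OF al, folded L_def]])
 have \<mu>0: "0 < \<mu> al" by (rule \<mu>_pos[OF al])
 have wD: "w (False, al, y) = D y" if "0 < y" "y < L" "R y = c" for y
  using that \<psi>_pos[OF al, of y] \<mu>0 by (simp add: R_def D_def PP_def L_def field_simps)
 have AEwD: "AE y in lborel. 0 < y & y < L --> w (False, al, y) = D y" using \<delta>AE by eventually_elim (use wD in auto)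
 have acD: "ac L D (%y. d2 w h (al, y))"
 proof (rule ac_cong_AE[OF acD0])
  show "(%y. d2 w h (al, y)) \<in> BM" by (rule NM_slice[OF L2_measurable[OF d2_L2[OF w h]] al])
  show "AE s in lborel. 0 < s & s < L --> indicator {0..L} s * (((1 / \<mu> al) * g s + 1 * 0) * (1 / \<psi> al s) + ((1 / \<mu> al) * P s + 1 * (c / \<mu> al)) * (indicator {0..L} s * (- \<psi>' al / (\<psi> al s)^2))) = d2 w h (al, s)"
   using AEwD
  proof eventually_elim
   case (elim s)
   show ?case
   proof
    assume s: "0 < s & s < L"
    have \<psi>0: "\<psi> al s \<noteq> 0" using \<psi>_pos[OF al, of s] s by (simp add: L_def)
    have "d2 w h (al, s) = (w (True, al, s) - h (al, s)) / \<mu> al - \<psi>' al / \<psi> al s * D s" using elim s by (simp add: d2_def)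
    also have "(w (True, al, s) - h (al, s)) / \<mu> al = (1 / \<mu> al) * g s * (1 / \<psi> al s)" using \<psi>0 by (simp add: g_def)
    finally show "indicator {0..L} s * (((1 / \<mu> al) * g s + 1 * 0) * (1 / \<psi> al s) + ((1 / \<mu> al) * P s + 1 * (c / \<mu> al)) * (indicator {0..L} s * (- \<psi>' al / (\<psi> al s)^2))) = d2 w h (al, s)"
     using s \<psi>0 by (simp add: D_def power2_eq_square)
   qed
  qed
 qed simp
 have "integrable lborel (%y. indicator {0..L} y * (d2 w h (al, y))^2)"
  using NM_L2_iff[OF L2_measurable[OF d2_L2[OF w h]]] d2_L2[OF w h] al by (simp add: L_def)
 then have "H1_rep L (%y. w (False, al, y)) D (%y. d2 w h (al, y))" using acD AEwD by (simp add: H1_rep_def)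
 then show ?thesis unfolding L_def by blast
qed

lemma Hb_norm_2:
 assumes r: "rep v w" and eq: "weak_eq w h"
 shows "v \<in> Hs G 2" "Hb_norm G 2 v = sqrt (esq (%x. w (True, x)) + esq (%x. w (False, x)) + esq (d2 w h))"
  and "(Hb_norm G 2 v)^2 <= (1 / lower + 1 / lower^2 + (8 / lower^2 + 2 * (upper / lower)^2 / lower) / lower) * (LINT x|NM. (h x)^2)"
proof -
 have w: "w \<in> Sp" and h: "L2 NM h" using eq by (auto simp: weak_eq_def)
 obtain D where D: "\<And>al. al \<in> E ==> H1_rep (l al) (%y. w (False, al, y)) (D al) (%y. d2 w h (al, y))"
  using regularity[OF eq] by metis
 have s2: "sobolev 2 (l al) (on_edge G al v)"
  "AE y in lborel. 0 < y & y < l al --> weak_deriv (l al) (weak_deriv (l al) (on_edge G al v)) y = d2 w h (al, y)" if "al \<in> E" for al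
  by (rule sobolev_2[OF l_pos[OF that] rep_H1[OF r that] D[OF that]])+
 show "v \<in> Hs G 2" using rep_V[OF r] s2(1) by (auto simp: Hs_def Hb_def simp del: sobolev.simps)
 have m: "(%y. (d2 w h (al, y))^2) \<in> BM" if "al \<in> E" for al
  using NM_slice[OF L2_measurable[OF d2_L2[OF w h]] that] by simp
 have 2: "net_integral G (%al y. (weak_deriv (l al) (weak_deriv (l al) (on_edge G al v)) y)^2) = esq (d2 w h)"
  unfolding esq_def
 proof (rule net_integral_AE[OF m])
  fix al assume "al \<in> E"
  from s2(2)[OF this] show "AE y in lborel. 0 < y & y < l al --> (weak_deriv (l al) (weak_deriv (l al) (on_edge G al v)) y)^2 = (d2 w h (al, y))^2"
   by eventually_elim auto
 qed
 have "(Hb_norm G 1 v)^2 = (\<Sum>k\<le>1. net_integral G (%al y. ((weak_deriv (l al) ^^ k) (on_edge G al v) y)^2))"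
  unfolding Hb_norm_def by (intro real_sqrt_pow2 sum_nonneg) (auto simp: net_integral_def intro!: sum_nonneg integral_nonneg_AE)
 then have 01: "(\<Sum>k\<le>1. net_integral G (%al y. ((weak_deriv (l al) ^^ k) (on_edge G al v) y)^2)) = esq (%x. w (True, x)) + esq (%x. w (False, x))"
  unfolding Hb_norm_1[OF r] by (simp add: esq_nonneg)
 show N: "Hb_norm G 2 v = sqrt (esq (%x. w (True, x)) + esq (%x. w (False, x)) + esq (d2 w h))"
  unfolding Hb_norm_def using 01 2 by (simp add: numeral_2_eq_2)
 have "(Hb_norm G 2 v)^2 = (Hb_norm G 1 v)^2 + esq (d2 w h)"
  unfolding N Hb_norm_1[OF r] by (simp add: esq_nonneg)
 also have "... <= (1 / lower + 1 / lower^2) * (LINT x|NM. (h x)^2) + (8 / lower^2 + 2 * (upper / lower)^2 / lower) / lower * (LINT x|NM. (h x)^2)"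
 proof (rule add_mono)
  have "(1 / lower + 1 / lower^2) * Qf w w <= (1 / lower + 1 / lower^2) * (LINT x|NM. (h x)^2)"
   using weak_eq_bounds(1)[OF eq] lower_pos by (intro mult_left_mono) auto
  then show "(Hb_norm G 1 v)^2 <= (1 / lower + 1 / lower^2) * (LINT x|NM. (h x)^2)" using Qf_Hb_norm(2)[OF r] by linarith
  have "lower * esq (d2 w h) <= (8 / lower^2 + 2 * (upper / lower)^2 / lower) * (LINT x|NM. (h x)^2)"
   using esq_bounds(1)[OF d2_L2[OF w h]] weak_eq_bounds(2)[OF eq] by linarith
  then show "esq (d2 w h) <= (8 / lower^2 + 2 * (upper / lower)^2 / lower) / lower * (LINT x|NM. (h x)^2)"
   using lower_pos by (simp add: field_simps)
 qed
 finally show "(Hb_norm G 2 v)^2 <= (1 / lower + 1 / lower^2 + (8 / lower^2 + 2 * (upper / lower)^2 / lower) / lower) * (LINT x|NM. (h x)^2)"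
  by (simp only: distrib_right)
qed

lemma weak_eq_comb:
 assumes "weak_eq w h" "weak_eq w' h'" shows "weak_eq (%x. a * w x + c * w' x) (%x. a * h x + c * h' x)"
 unfolding weak_eq_def
proof (intro conjI ballI)
 have w: "w \<in> Sp" "w' \<in> Sp" and h: "L2 NM h" "L2 NM h'" using assms by (auto simp: weak_eq_def)
 show "(%x. a * w x + c * w' x) \<in> Sp" by (rule Sp_comb[OF w])
 show "L2 NM (%x. a * h x + c * h' x)" by (intro L2_add L2_cmult h)
 fix ph assume ph: "ph \<in> Sp"
 have "Qf (%x. a * w x + c * w' x) ph = a * Qf w ph + c * Qf w' ph" by (rule Q.comb_left[OF w ph])
 also have "... = a * (LINT x|NM. h x * ph (True, x)) + c * (LINT x|NM. h' x * ph (True, x))" using assms ph by (simp add: weak_eq_def)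
 also have "... = (LINT x|NM. a * (h x * ph (True, x)) + c * (h' x * ph (True, x)))"
  using L2_mult[OF h(1) Sp_L2(1)[OF ph]] L2_mult[OF h(2) Sp_L2(1)[OF ph]] by simp
 also have "... = (LINT x|NM. (a * h x + c * h' x) * ph (True, x))" by (simp add: algebra_simps)
 finally show "Qf (%x. a * w x + c * w' x) ph = (LINT x|NM. (a * h x + c * h' x) * ph (True, x))" .
qed

lemma weak_eq_ef: "weak_eq (ef k) (%x. ev k * ef k (True, x))"
 unfolding weak_eq_def using ef_in L2_cmult[OF Sp_L2(1)[OF ef_in]] by (auto simp: ef_Q Bf_def mult.assoc)

lemma weak_eq_sum: "weak_eq (%x. \<Sum>k<n. a k * ef k x) (%x. \<Sum>k<n. ev k * a k * ef k (True, x))"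
proof (induction n)
 case 0 show ?case by (auto simp: weak_eq_def Sp_zero L2_zero Q.zero_left)
next
 case (Suc n)
 from weak_eq_comb[OF Suc weak_eq_ef, of 1 "a n" n] show ?case by (simp add: mult_ac)
qed

lemma weak_eq_limit:
 assumes eq: "\<And>n. weak_eq (w n) (h n)" and w: "w' \<in> Sp" "(%n. Qn (%x. w' x - w n x)) ~~> 0"
  and h: "L2 NM h'" "(%n. (LINT x|NM. (h' x - h n x)^2)) ~~> 0"
 shows "weak_eq w' h'"
 unfolding weak_eq_def
proof (intro conjI ballI w h)
 fix ph assume ph: "ph \<in> Sp"
 have e: "w n \<in> Sp" "L2 NM (h n)" "Qf (w n) ph = (LINT x|NM. h n x * ph (True, x))" for n using eq[of n] ph by (auto simp: weak_eq_def)
 have "(%n. Qf (w n) ph) ~~> Qf w' ph" by (rule Q.tendsto_left[OF e(1) w(1) ph w(2)])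
 moreover have "(%n. Qf (w n) ph) ~~> (LINT x|NM. h' x * ph (True, x))"
  unfolding e(3) by (rule L2_tendsto_mult[OF e(2) h(1) Sp_L2(1)[OF ph] h(2)])
 ultimately show "Qf w' ph = (LINT x|NM. h' x * ph (True, x))" by (rule LIMSEQ_unique)
qed

section \<open>The test space\<close>

text \<open>All continuous representatives coincide on the closed edge, so the description by
  \<open>THE\<close> is unambiguous.\<close>

lemma vertex_val_eq:
 assumes r: "H1_rep (l al) (on_edge G al w) u d" and al: "al \<in> E"
 shows "vertex_val G al w i = u (if i = tail G al then 0 else l al)"
 unfolding vertex_val_def
proof (rule the_equality)
 have S: "{0<..<l al} \<in> sets borel" by simp
 have u: "continuous_on {0..l al} u" "AE y in lborel. 0 < y & y < l al --> on_edge G al w y = u y"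
  using r ac_continuous by (auto simp: H1_rep_def)
 then show "\<exists>ua. continuous_on {0..l al} ua & (AE y in lebesgue_on {0<..<l al}. on_edge G al w y = ua y) \<and>
  u (if i = tail G al then 0 else l al) = ua (if i = tail G al then 0 else l al)"
  unfolding AE_lebesgue_on[OF S] by (intro exI[of _ u]) auto
 fix c assume "\<exists>ua. continuous_on {0..l al} ua & (AE y in lebesgue_on {0<..<l al}. on_edge G al w y = ua y) \<and>
  c = ua (if i = tail G al then 0 else l al)"
 then obtain v where v: "continuous_on {0..l al} v" "AE y in lborel. y \<in> {0<..<l al} --> on_edge G al w y = v y"
  "c = v (if i = tail G al then 0 else l al)" unfolding AE_lebesgue_on[OF S] by blast
 have "AE y in lborel. 0 < y & y < l al --> v y = u y" using v(2) u(2) by eventually_elim auto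
 then have "v y = u y" if "y \<in> {0..l al}" for y by (rule continuous_AE_eq[OF v(1) u(1) _ l_pos[OF al] that])
 then show "c = u (if i = tail G al then 0 else l al)" using v(3) l_pos[OF al] by simp
qed

lemma vertex_val_endv:
 assumes "H1_rep (l al) (on_edge G al w) u d" "al \<in> E"
 shows "vertex_val G al w (endv al s) = u (endp al s)"
 unfolding vertex_val_eq[OF assms] using tail_neq_head[OF assms(2)] by (auto simp: endv_def endp_def)

lemma \<psi>_endp: "al \<in> E ==> \<psi> al (endp al s) = \<gamma> (endv al s) al"
 using \<psi>_ends by (auto simp: endv_def endp_def)

text \<open>The product rule is made part of the relation because \<open>edge_deriv\<close> is just
  some representative; restricting to the interior of edges leaves \<open>w\<close> free to jump at
  the vertices.\<close>

definition times_\<psi> :: "('a => real) => (bool \<times> nat \<times> real => real) => bool" where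
 "times_\<psi> w ph \<longleftrightarrow> (\<forall>al\<in>E. AE y in lborel. 0 < y & y < l al -->
  on_edge G al w y = \<psi> al y * ph (True, al, y) \<and>
  edge_deriv G al w y = \<psi> al y * ph (False, al, y) + \<psi>' al * ph (True, al, y))"

text \<open>Dividing by \<psi>, whose end values are the \<gamma>, turns the prescribed ratios of
  the traces of \<open>w\<close> into equality, that is, into continuity at the vertices. The
  derivative part is the quotient rule.\<close>

lemma W_imp_times_\<psi>:
 assumes w: "w \<in> W_space G \<gamma>" shows "\<exists>ph\<in>Sp. times_\<psi> w ph"
proof -
 have sob: "sobolev 1 (l al) (on_edge G al w)" if "al \<in> E" for al
  using w that by (auto simp: W_space_def Hb_def simp del: sobolev.simps One_nat_def)
 have "\<forall>al. \<exists>u d. al \<in> E --> H1_rep (l al) (on_edge G al w) u d" using sob sobolev_1 l_pos by blast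
 then obtain u d where ud: "\<And>al. al \<in> E ==> H1_rep (l al) (on_edge G al w) (u al) (d al)" by metis
 define ph where "ph = (%(b, al, y). if b then indicator {0..l al} y * (u al y * (1 / \<psi> al y))
  else indicator {0..l al} y * (d al y * (1 / \<psi> al y) + u al y * (indicator {0..l al} y * (- \<psi>' al / (\<psi> al y)^2))))"
 have phT: "ph (True, al, y) = indicator {0..l al} y * (u al y * (1 / \<psi> al y))" and
  phF: "ph (False, al, y) = indicator {0..l al} y * (d al y * (1 / \<psi> al y) + u al y * (indicator {0..l al} y * (- \<psi>' al / (\<psi> al y)^2)))" for al y
  by (simp_all add: ph_def)
 have "ph \<in> Sp"
 proof (rule SpI)
  fix al assume al: "al \<in> E"
  have h: "ac (l al) (u al) (d al)" "integrable lborel (%s. indicator {0..l al} s * (d al s)^2)" using ud[OF al] by (auto simp: H1_rep_def)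
  have acm: "ac (l al) (%y. u al y * (1 / \<psi> al y)) (%y. ph (False, al, y))" unfolding phF by (rule ac_mult[OF h(1) ac_inverse_\<psi>[OF al]])
  show ac: "ac (l al) (%y. ph (True, al, y)) (%y. ph (False, al, y))"
   by (rule ac_cong_AE[OF acm ac_borel[OF acm]]) (auto simp: phT)
  show "(%y. ph (True, al, y)) \<in> BM" unfolding phT by (rule integrable_tm_continuous(2)[OF ac_continuous[OF acm]])
  obtain B where B: "\<And>y. y \<in> {0..l al} ==> \<bar>u al y\<bar> <= B"
  proof -
   have "bounded (u al ` {0..l al})" by (intro compact_imp_bounded compact_continuous_image ac_continuous[OF h(1)]) simp
   then show ?thesis using that unfolding bounded_iff by (metis imageI real_norm_def)
  qed
  define C where "C = \<bar>B\<bar> * (upper / lower^2)"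
  have dL: "L2 (tm (l al)) (d al)" using h(2) L2_tm_iff[OF ac_borel[OF h(1)]] by simp
  interpret fm: finite_measure "tm (l al)" by (rule finite_measure_tm)
  have "L2 (tm (l al)) (%y. (1 / lower) * \<bar>d al y\<bar> + C)"
   using dL by (intro L2_add L2_cmult) (auto simp: L2_def)
  then have "L2 (tm (l al)) (%y. ph (False, al, y))"
  proof (rule L2_bound[where C = 1])
   show "(%y. ph (False, al, y)) \<in> borel_measurable (tm (l al))" using ac_borel[OF ac] by simp
   show "AE y in tm (l al). \<bar>ph (False, al, y)\<bar> <= 1 * \<bar>(1 / lower) * \<bar>d al y\<bar> + C\<bar>"
    unfolding AE_tm
   proof (rule AE_I2, rule impI)
    fix y assume "0 <= y & y <= l al"
    then have y: "y \<in> {0..l al}" by simp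
    note p = \<psi>_bounds(1)[OF al y] \<psi>_pos[OF al y]
    have "ph (False, al, y) = d al y * (1 / \<psi> al y) - u al y * (\<psi>' al / (\<psi> al y)^2)" using y by (simp add: phF)
    then have "\<bar>ph (False, al, y)\<bar> <= \<bar>d al y * (1 / \<psi> al y)\<bar> + \<bar>u al y * (\<psi>' al / (\<psi> al y)^2)\<bar>"
     by (simp only: abs_triangle_ineq4)
    also have "\<bar>d al y * (1 / \<psi> al y)\<bar> <= (1 / lower) * \<bar>d al y\<bar>"
     using p lower_pos by (simp add: abs_mult frac_le)
    also have "\<bar>u al y * (\<psi>' al / (\<psi> al y)^2)\<bar> <= C"
     unfolding C_def abs_mult
    proof (intro mult_mono)
     show "\<bar>u al y\<bar> <= \<bar>B\<bar>" using B[OF y] by simp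
     have "lower^2 <= (\<psi> al y)^2" using p lower_pos by (intro power_mono) auto
     then show "\<bar>\<psi>' al / (\<psi> al y)^2\<bar> <= upper / lower^2"
      using \<psi>'_upper[OF al] lower_pos upper_ge_1 by (auto simp: abs_divide intro!: frac_le)
    qed auto
    finally show "\<bar>ph (False, al, y)\<bar> <= 1 * \<bar>(1 / lower) * \<bar>d al y\<bar> + C\<bar>" by simp
   qed
  qed
  then show "integrable lborel (%y. indicator {0..l al} y * (ph (False, al, y))^2)" using L2_tm_iff[OF ac_borel[OF ac]] by simp
 next
  fix al be s s' assume a: "al \<in> E" "be \<in> E" "endv al s = endv be s'"
  have val: "ph (True, al, endp al s) = vertex_val G al w (endv al s) / \<gamma> (endv al s) al" if "al \<in> E" for al s
   using endp_range[OF that, of s] by (simp add: phT vertex_val_endv[OF ud[OF that] that] \<psi>_endp[OF that])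
  have v: "endv al s \<in> verts G" using ends_in_verts[OF a(1)] by (simp add: endv_def)
  have "al \<in> edges_at G (endv al s)" "be \<in> edges_at G (endv al s)"
   using edges_at_iff[OF v] a(1,2) by (auto simp: endv_def) (metis a(3) endv_def)+
  then have "vertex_val G al w (endv al s) / \<gamma> (endv al s) al = vertex_val G be w (endv al s) / \<gamma> (endv al s) be"
   using w v unfolding W_space_def by blast
  then show "ph (True, al, endp al s) = ph (True, be, endp be s')" using val[OF a(1), of s] val[OF a(2), of s'] a(3) by simp
 qed
 moreover have "times_\<psi> w ph"
  unfolding times_\<psi>_def
 proof
  fix al assume al: "al \<in> E"
  have "AE y in lborel. 0 < y & y < l al --> on_edge G al w y = u al y" using ud[OF al] by (simp add: H1_rep_def)
  moreover have "AE y in lborel. 0 < y & y < l al --> edge_deriv G al w y = d al y"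
   unfolding edge_deriv_def by (rule weak_deriv_AE[OF ud[OF al] l_pos[OF al]])
  ultimately show "AE y in lborel. 0 < y & y < l al --> on_edge G al w y = \<psi> al y * ph (True, al, y) \<and>
   edge_deriv G al w y = \<psi> al y * ph (False, al, y) + \<psi>' al * ph (True, al, y)"
  proof eventually_elim
   case (elim y)
   then show ?case using \<psi>_pos[OF al, of y] by (auto simp: phT phF field_simps power2_eq_square)
  qed
 qed
 ultimately show ?thesis by blast
qed

text \<open>A function on the network has one value at a vertex and cannot carry the different
  traces of the adjacent edges. Interior points determine their edge and parameter, and prescribing
  values there suffices up to null sets.\<close>

lemma interior_parameter: "\<exists>p. \<forall>al\<in>E. \<forall>y. 0 < y --> y < l al --> p (arc G al y) = (al, y)"
proof -
 define Q where "Q x z \<longleftrightarrow> fst z \<in> E & snd z \<in> {0..l (fst z)} & x = arc G (fst z) (snd z)" for x z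
 have "(SOME z. Q (arc G al y) z) = (al, y)" if al: "al \<in> E" and y: "0 < y" "y < l al" for al y
 proof (rule some_equality)
  show "Q (arc G al y) (al, y)" using al y by (simp add: Q_def)
  fix z assume "Q (arc G al y) z"
  moreover have "y \<noteq> endp al s" for s using y by (simp add: endp_def)
  moreover have "y \<in> {0..l al}" using y by simp
  ultimately show "z = (al, y)" using arc_eq[OF al, of "fst z" y "snd z"] unfolding Q_def by (metis prod.collapse)
 qed
 then show ?thesis by (intro exI[of _ "%x. SOME z. Q x z"]) blast
qed

text \<open>Traces are read from inside the edges, so it is enough to prescribe
  \<open>\<psi> * ph\<close> at interior points. This is what allows eigenfunctions to be tested
  against a given solution.\<close>

lemma times_\<psi>_exists:
 assumes ph: "ph \<in> Sp" shows "\<exists>w\<in>W_space G \<gamma>. times_\<psi> w ph"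
proof -
 obtain p where p: "\<And>al y. al \<in> E ==> 0 < y ==> y < l al ==> p (arc G al y) = (al, y)" using interior_parameter by blast
 define w where "w x = (let (al, y) = p x in \<psi> al y * ph (True, al, y))" for x
 have wv: "on_edge G al w y = \<psi> al y * ph (True, al, y)" if "al \<in> E" "0 < y" "y < l al" for al y
  using p[OF that] by (simp add: on_edge_def w_def)
 have ac1: "ac (l al) (%y. \<psi> al y * ph (True, al, y)) (%y. indicator {0..l al} y * (indicator {0..l al} y * \<psi>' al * ph (True, al, y) + \<psi> al y * ph (False, al, y)))" if "al \<in> E" for al
  by (rule ac_mult[OF ac_\<psi> SpD(1)[OF ph that]])
 have m: "(%y. \<psi> al y * ph (False, al, y) + \<psi>' al * ph (True, al, y)) \<in> BM" if "al \<in> E" for al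
  using ac_borel[OF SpD(1)[OF ph that]] SpD(2)[OF ph that] by simp
 have r: "H1_rep (l al) (on_edge G al w) (%y. \<psi> al y * ph (True, al, y)) (%y. \<psi> al y * ph (False, al, y) + \<psi>' al * ph (True, al, y))" if al: "al \<in> E" for al
  unfolding H1_rep_def
 proof (intro conjI)
  show "ac (l al) (%y. \<psi> al y * ph (True, al, y)) (%y. \<psi> al y * ph (False, al, y) + \<psi>' al * ph (True, al, y))"
   by (rule ac_cong_AE[OF ac1[OF al] m[OF al]]) auto
  have "L2 (tm (l al)) (%y. \<psi> al y * ph (False, al, y) + \<psi>' al * ph (True, al, y))"
   by (intro L2_add L2_cmult edge_L2_\<psi> NM_L2_edge[OF Sp_L2(1)[OF ph]] NM_L2_edge[OF Sp_L2(2)[OF ph]] al)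
  then show "integrable lborel (%s. indicator {0..l al} s * (\<psi> al s * ph (False, al, s) + \<psi>' al * ph (True, al, s))^2)"
   using L2_tm_iff[OF m[OF al]] by simp
  show "AE y in lborel. 0 < y & y < l al --> on_edge G al w y = \<psi> al y * ph (True, al, y)" using wv[OF al] by auto
 qed
 have "w \<in> W_space G \<gamma>"
  unfolding W_space_def
 proof (intro CollectI conjI ballI)
  show "w \<in> Hb G 1" unfolding Hb_def using r sobolev_1[OF l_pos] by (auto simp del: sobolev.simps One_nat_def)
  fix i al be assume i: "i \<in> verts G" "al \<in> edges_at G i" "be \<in> edges_at G i"
  have ab: "al \<in> E" "be \<in> E" using i by (auto simp: edges_at_def)
  obtain s s' where s: "i = endv al s" "i = endv be s'"
   using edges_at_iff[OF i(1)] i(2,3) by (metis endv_def)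
  have val: "vertex_val G al w (endv al s) / \<gamma> (endv al s) al = ph (True, al, endp al s)" if "al \<in> E" for al s
  proof -
   have "\<psi> al (endp al s) \<noteq> 0" using \<psi>_pos[OF that endp_range[OF that]] by (metis less_irrefl)
   then show ?thesis by (simp add: vertex_val_endv[OF r[OF that] that] \<psi>_endp[OF that, symmetric])
  qed
  show "vertex_val G al w i / \<gamma> i al = vertex_val G be w i / \<gamma> i be"
   using val[OF ab(1), of s] val[OF ab(2), of s'] SpD(4)[OF ph ab, of s s'] s by simp
 qed
 moreover have "times_\<psi> w ph"
  unfolding times_\<psi>_def
 proof
  fix al assume al: "al \<in> E"
  have "AE y in lborel. 0 < y & y < l al --> edge_deriv G al w y = \<psi> al y * ph (False, al, y) + \<psi>' al * ph (True, al, y)"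
   unfolding edge_deriv_def by (rule weak_deriv_AE[OF r[OF al] l_pos[OF al]])
  then show "AE y in lborel. 0 < y & y < l al --> on_edge G al w y = \<psi> al y * ph (True, al, y) \<and>
   edge_deriv G al w y = \<psi> al y * ph (False, al, y) + \<psi>' al * ph (True, al, y)"
   by eventually_elim (use wv[OF al] in auto)
 qed
 ultimately show ?thesis by blast
qed

end

section \<open>Space-time cylinders\<close>

lemma pair_tm: "pair_sigma_finite (tm a) (tm b)" and finite_pair_tm: "finite_measure (tm a >< tm b)"
 by (simp_all add: pair_sigma_finite_def finite_measure.axioms(1)[OF finite_measure_tm] finite_measure_pair_measure finite_measure_tm)

lemma sets_pair_tm[measurable_cong]: "sets (tm a >< tm b) = sets (borel :: (real \<times> real) measure)"
 by (subst borel_prod[symmetric]) (rule sets_pair_measure_cong; simp)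

lemma measurable_pair_tm[simp]: "borel_measurable (tm a >< tm b) = borel_measurable (borel :: (real \<times> real) measure)"
 by (rule measurable_cong_sets[OF sets_pair_tm refl])

lemma AE_pair_tm: "AE z in tm a >< tm b. fst z \<in> {0..a} & snd z \<in> {0..b}"
proof -
 interpret pair_sigma_finite "tm a" "tm b" by (rule pair_tm)
 show ?thesis
 proof (rule AE_pair_measure)
  have "{0..a} \<times> {0..b} \<in> sets (borel :: (real \<times> real) measure)" by (intro borel_closed closed_Times) auto
  moreover have "{0..a} \<times> {0..b} = {z. fst z \<in> {0..a} & snd z \<in> {0..b}}" by auto
  ultimately have "{z :: real \<times> real. fst z \<in> {0..a} & snd z \<in> {0..b}} \<in> sets borel" by metis
  then show "{z \<in> space (tm a >< tm b). fst z \<in> {0..a} & snd z \<in> {0..b}} \<in> sets (tm a >< tm b)"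
   unfolding sets_pair_tm by (simp only: space_pair_measure space_tm UNIV_Times_UNIV) simp
 qed (auto simp: AE_tm)
qed

lemma tm_pair: "tm a >< tm b = density lborel (%z. ennreal (indicator ({0..a} \<times> {0..b}) z))"
proof -
 have "tm a >< tm b = density (lborel >< lborel) (%(t, y). ennreal (indicator {0..a} t) * ennreal (indicator {0..b} y))"
  unfolding tm_def
  by (rule pair_measure_density) (auto intro: lborel.sigma_finite_measure_axioms finite_measure.axioms(1)[OF finite_measure_tm, unfolded tm_def])
 also have "... = density lborel (%z. ennreal (indicator ({0..a} \<times> {0..b}) z))"
  unfolding lborel_prod by (intro arg_cong2[where f = density] refl ext) (auto simp: indicator_def)
 finally show ?thesis .
qed

lemma AE_lborel_box: "AE z in lborel. z \<in> {0..l::real} \<times> {0..T::real} --> z \<in> {0<..<l} \<times> {0<..<T}"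
proof -
 have "AE z in lborel >< lborel. z \<in> {0..l} \<times> {0..T} --> z \<in> {0<..<l} \<times> {0<..<T}"
 proof (rule lborel_pair.AE_pair_measure)
  show "{z \<in> space (lborel >< lborel). z \<in> {0..l} \<times> {0..T} --> z \<in> {0<..<l} \<times> {0<..<T}} \<in> sets (lborel >< lborel)"
   by measurable
  show "AE x in lborel. AE y in lborel. (x, y) \<in> {0..l} \<times> {0..T} --> (x, y) \<in> {0<..<l} \<times> {0<..<T}"
   using AE_lborel_singleton[of 0] AE_lborel_singleton[of l]
  proof eventually_elim
   case (elim x)
   show ?case using AE_lborel_singleton[of 0] AE_lborel_singleton[of T] by eventually_elim (use elim in auto)
  qed
 qed
 then show ?thesis unfolding lborel_prod .
qed

lemma borel_swap:
 fixes g :: "real \<times> real => real"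
 assumes "g \<in> BM" shows "(%z. g (snd z, fst z)) \<in> BM"
proof -
 have "(%z :: real \<times> real. (snd z, fst z)) \<in> BM"
  by (intro borel_measurable_continuous_onI continuous_intros)
 from measurable_compose[OF this assms] show ?thesis .
qed

text \<open>Cylinders in the definitions have coordinates \<open>(y,t)\<close>, the product measures
  of the proof \<open>(t,y)\<close>; the swap and the boundary of measure zero are dealt with here
  once.\<close>

lemma cyl_integral:
 fixes g :: "real \<times> real => real"
 assumes g: "g \<in> BM"
  and ae: "AE z in lborel. z \<in> {0<..<l} \<times> {0<..<T} --> F z = g (snd z, fst z)"
 shows "integrable (lebesgue_on ({0<..<l} \<times> {0<..<T})) F \<longleftrightarrow> integrable (tm T >< tm l) g"
  "integral\<^sup>L (lebesgue_on ({0<..<l} \<times> {0<..<T})) F = integral\<^sup>L (tm T >< tm l) g"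
proof -
 let ?S = "{0<..<l} \<times> {0<..<T}"
 let ?h = "%z. indicator ({0..T} \<times> {0..l}) z *\<^sub>R g z"
 have S: "?S \<in> sets borel" by (intro borel_open open_Times) auto
 note sw = borel_swap[OF g]
 have B: "{0..T} \<times> {0..l} \<in> sets borel" by (intro borel_closed closed_Times) auto
 have eq: "AE z in lborel. indicator ?S z * g (snd z, fst z) = (case z of (y, t) => ?h (t, y))"
  using AE_lborel_box[of l T] by eventually_elim (auto simp: indicator_def)
 have hm: "?h \<in> BM" using g B by measurable
 have m: "(%z. indicator ?S z * g (snd z, fst z)) \<in> borel_measurable lborel" "(%(y, t). ?h (t, y)) \<in> borel_measurable lborel"
  using sw S borel_swap[OF hm] by (simp_all add: split_beta')
 note L = integrable_lebesgue_on_AE[OF S sw ae]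
 have hm': "?h \<in> borel_measurable (lborel >< lborel)" unfolding lborel_prod using hm by simp
 have "integrable lborel (%z. indicator ?S z * g (snd z, fst z)) \<longleftrightarrow> integrable (lborel >< lborel) (%(y, t). ?h (t, y))"
  unfolding lborel_prod by (rule integrable_cong_AE[OF m eq])
 also have "... \<longleftrightarrow> integrable lborel ?h"
  using lborel_pair.integrable_product_swap_iff[of ?h] by (simp only: lborel_prod)
 also have "... \<longleftrightarrow> integrable (tm T >< tm l) g"
  unfolding tm_pair by (rule integrable_density[symmetric]) (use g B in auto)
 finally show "integrable (lebesgue_on ?S) F \<longleftrightarrow> integrable (tm T >< tm l) g" using L(1) by simp
 have "(LINT z|lborel. indicator ?S z * g (snd z, fst z)) = integral\<^sup>L (lborel >< lborel) (%(y, t). ?h (t, y))"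
  unfolding lborel_prod by (rule integral_cong_AE[OF m eq])
 also have "... = (LINT z|lborel. ?h z)"
  using lborel_pair.integral_product_swap[OF hm'] by (simp add: lborel_prod)
 also have "... = integral\<^sup>L (tm T >< tm l) g"
  unfolding tm_pair by (rule integral_density[symmetric]) (use g B in auto)
 finally show "integral\<^sup>L (lebesgue_on ?S) F = integral\<^sup>L (tm T >< tm l) g" using L(2) by simp
qed

lemma L2_on_cyl:
 fixes g :: "real \<times> real => real"
 assumes g: "g \<in> BM"
  and ae: "AE z in lborel. z \<in> {0<..<l} \<times> {0<..<T} --> F z = g (snd z, fst z)"
 shows "L2_on ({0<..<l} \<times> {0<..<T}) F \<longleftrightarrow> L2 (tm T >< tm l) g"
proof -
 have S: "{0<..<l} \<times> {0<..<T} \<in> sets borel" by (intro borel_open open_Times) auto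
 note sw = borel_swap[OF g]
 have "(%z. (g z)^2) \<in> BM" using g by simp
 moreover have "AE z in lborel. z \<in> {0<..<l} \<times> {0<..<T} --> (F z)^2 = (g (snd z, fst z))^2" using ae by eventually_elim auto
 ultimately have "integrable (lebesgue_on ({0<..<l} \<times> {0<..<T})) (%z. (F z)^2) \<longleftrightarrow> integrable (tm T >< tm l) (%z. (g z)^2)"
  by (rule cyl_integral(1))
 then show ?thesis unfolding L2_on_def L2_def using measurable_lebesgue_on_AE[OF S sw ae] g by simp
qed

lemma continuous_L2_pair_tm:
 fixes g :: "real \<times> real => real"
 assumes "continuous_on UNIV g" shows "L2 (tm a >< tm b) g"
proof -
 interpret finite_measure "tm a >< tm b" by (rule finite_pair_tm)
 have "compact (({0..a} \<times> {0..b}) :: (real \<times> real) set)" by (intro compact_Times) auto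
 then have "bounded (g ` ({0..a} \<times> {0..b}))"
  by (intro compact_imp_bounded compact_continuous_image continuous_on_subset[OF assms]) auto
 then obtain C where C: "\<And>z. z \<in> {0..a} \<times> {0..b} ==> \<bar>g z\<bar> <= C" unfolding bounded_iff by (metis imageI real_norm_def)
 have "L2 (tm a >< tm b) (%z. 1)" by (simp add: L2_def)
 then show ?thesis
 proof (rule L2_bound[where C = C])
  show "g \<in> borel_measurable (tm a >< tm b)" using borel_measurable_continuous_onI[OF assms] by simp
  show "AE z in tm a >< tm b. \<bar>g z\<bar> <= C * \<bar>1\<bar>"
   using AE_pair_tm[of a b] by eventually_elim (use C in "auto simp: mem_Times_iff")
 qed
qed

lemma test_fun_time:
 fixes ph :: "real \<times> real => real"
 assumes t: "test_fun ({0<..<l} \<times> {0<..<T}) ph"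
 defines "pht \<equiv> %z. frechet_derivative ph (at z) (0, 1)"
 shows "continuous_on UNIV ph" "continuous_on UNIV pht"
  "\<And>y. ac T (%t. ph (y, t)) (%t. pht (y, t))" "\<And>y. ph (y, 0) = 0" "\<And>y. ph (y, T) = 0"
proof -
 have C: "Ck_fun k ph" for k using t by (simp add: test_fun_def)
 have D: "ph differentiable at z" for z using C[of "Suc 0"] unfolding Ck_fun.simps(2) by blast
 have B: "(0, 1) \<in> (Basis :: (real \<times> real) set)" by (simp add: Basis_prod_def)
 have "Ck_fun 0 (%z. frechet_derivative ph (at z) (0, 1))"
  using C[of "Suc 0"] B unfolding Ck_fun.simps(2) by blast
 then show c: "continuous_on UNIV pht" by (simp add: pht_def)
 show "continuous_on UNIV ph" using C[of 0] by simp
 obtain K where K: "K \<subseteq> {0<..<l} \<times> {0<..<T}" "\<And>z. z \<notin> K ==> ph z = 0" using t unfolding test_fun_def by blast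
 have "(y, 0) \<notin> K" "(y, T) \<notin> K" for y using K(1) by auto
 then show "ph (y, 0) = 0" "ph (y, T) = 0" for y by (auto intro: K(2))
 fix y
 have d: "((%t. ph (y, t)) has_real_derivative pht (y, t)) (at t within A)" for t A
 proof -
  have "(ph has_derivative frechet_derivative ph (at (y, t))) (at (y, t))" using D frechet_derivative_works by blast
  then have "((ph \<circ> (%t. (y, t))) has_derivative (frechet_derivative ph (at (y, t)) \<circ> (%h. (0, h)))) (at t)"
   by (intro diff_chain_at) (auto intro!: derivative_eq_intros)
  moreover have "frechet_derivative ph (at (y, t)) \<circ> (%h. (0, h)) = (%h. pht (y, t) * h)"
  proof
   fix h :: real
   have "linear (frechet_derivative ph (at (y, t)))" by (rule linear_frechet_derivative[OF D])
   from linear_scale[OF this, of h "(0, 1)"] show "(frechet_derivative ph (at (y, t)) \<circ> (%h. (0, h))) h = pht (y, t) * h"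
    by (simp add: pht_def mult.commute)
  qed
  ultimately have "((%t. ph (y, t)) has_real_derivative pht (y, t)) (at t)" by (simp add: has_field_derivative_def comp_def)
  then show ?thesis by (rule has_field_derivative_at_within)
 qed
 have cy: "continuous_on A (%t. pht (y, t))" for A by (rule continuous_on_compose2[OF c]) (auto intro!: continuous_intros)
 have "ac T (%t. ph (y, t)) (%t. indicator {0..T} t * pht (y, t))" by (rule ac_deriv[OF d cy])
 then show "ac T (%t. ph (y, t)) (%t. pht (y, t))"
  by (rule ac_cong_AE) (auto intro: borel_measurable_continuous_onI cy)
qed

context net_data
begin

lemma N_measurable:
 fixes h :: "real \<times> nat \<times> real => real"
 assumes h: "\<And>al. al \<in> E ==> (%(t, y). h (t, al, y)) \<in> BM"
 shows "h \<in> borel_measurable (tm T >< NM)"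
proof -
 let ?k = "%z. \<Sum>al\<in>E. indicator {al} (fst (snd z)) * (case (fst z, snd (snd z)) of (t, y) => h (t, al, y))"
 have "?k \<in> borel_measurable (tm T >< NM)"
 proof (intro borel_measurable_sum borel_measurable_times)
  fix al assume al: "al \<in> E"
  have "(%z. fst (snd z)) \<in> (tm T >< NM) \<rightarrow>\<^sub>M count_space E" by measurable
  then show "(%z. indicator {al} (fst (snd z)) :: real) \<in> borel_measurable (tm T >< NM)" by (rule measurable_compose) simp
  have "(%z. (fst z, snd (snd z))) \<in> (tm T >< NM) \<rightarrow>\<^sub>M borel >< borel" by measurable
  from measurable_compose[OF this, folded borel_prod, OF h[OF al, folded borel_prod]]
  show "(%z. case (fst z, snd (snd z)) of (t, y) => h (t, al, y)) \<in> borel_measurable (tm T >< NM)" .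
 qed
 moreover have "h z = ?k z" if "z \<in> space (tm T >< NM)" for z
 proof -
  obtain t be y where z: "z = (t, be, y)" by (cases z)
  have b: "be \<in> E" using that by (simp add: z space_pair_measure)
  have "?k z = (\<Sum>al\<in>E. if al = be then h (t, be, y) else 0)" by (rule sum.cong) (auto simp: z)
  then show ?thesis using b finite_E by (simp add: z)
 qed
 ultimately show ?thesis by (subst measurable_cong) auto
qed

lemma N_edge:
 assumes h: "h \<in> borel_measurable (tm T >< NM)" and al: "al \<in> E"
 shows "(%(t, y). h (t, al, y)) \<in> BM"
proof -
 have "(%z. (fst z, al, snd z)) \<in> borel >< borel \<rightarrow>\<^sub>M tm T >< (count_space E >< lborel)"
  using al by (intro measurable_Pair measurable_const) (auto simp: space_pair_measure)
 also have "... = borel >< borel \<rightarrow>\<^sub>M tm T >< NM" by (intro measurable_cong_sets sets_pair_measure_cong) auto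
 finally have "(%z. (fst z, al, snd z)) \<in> borel >< borel \<rightarrow>\<^sub>M tm T >< NM" .
 from measurable_compose[OF this h] show ?thesis by (simp add: borel_prod split_beta')
qed

lemma space_time_NM: "0 < T ==> space_time NM T"
 using sigma_finite_NM by (simp add: space_time_def space_time_axioms_def)

lemma edge_L2_N:
 assumes T: "0 < T" and h: "L2 (tm T >< NM) h" and al: "al \<in> E"
 shows "L2 (tm T >< tm (l al)) (%(t, y). h (t, al, y))"
  "(LINT z|(tm T >< tm (l al)). (case z of (t, y) => h (t, al, y))^2) <= (LINT z|(tm T >< NM). (h z)^2) / lower"
proof -
 interpret ST: space_time NM T by (rule space_time_NM[OF T])
 interpret P: pair_sigma_finite "tm T" "tm (l al)" by (rule pair_tm)
 let ?k = "%z. (case z of (t, y) => h (t, al, y))^2"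
 have hm: "h \<in> borel_measurable (tm T >< NM)" using h by (simp add: L2_def)
 have km: "(%(t, y). h (t, al, y)) \<in> borel_measurable (tm T >< tm (l al))" using N_edge[OF hm al] by simp
 then have km2: "?k \<in> borel_measurable (tm T >< tm (l al))" by (rule borel_measurable_power)
 have ae: "AE t in tm T. integrable (tm (l al)) (%y. (h (t, al, y))^2) & (LINT y|tm (l al). (h (t, al, y))^2) <= ST.sq h t / lower"
  using ST.slice_L2[OF h]
 proof eventually_elim
  case (elim t)
  have L: "L2 (tm (l al)) (%y. h (t, al, y))" by (rule NM_L2_edge[OF elim al])
  then have "(%y. h (t, al, y)) \<in> BM" by (simp add: L2_def)
  then have m: "(%y. (h (t, al, y))^2) \<in> BM" by simp
  have "lower * (LINT y|lborel. indicator {0..l al} y * (h (t, al, y))^2) <= ST.sq h t"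
   using NM_edge_le(2)[OF L2_square[OF elim] _ al] by (simp add: ST.sq_def)
  then show ?case using L lower_pos by (simp add: L2_def integral_tm[OF m] field_simps)
 qed
 have qi: "integrable (tm T) (%t. ST.sq h t / lower)" using ST.sq_integrable(1)[OF h] by simp
 have im: "(%t. (LINT y|tm (l al). ?k (t, y))) \<in> borel_measurable (tm T)" using P.M2.borel_measurable_lebesgue_integral[of "%t y. ?k (t, y)" "tm T"] km2 by (simp add: split_beta')
 have ki: "integrable (tm T >< tm (l al)) ?k"
 proof (rule P.Fubini_integrable[OF km2])
  show "integrable (tm T) (%t. (LINT y|tm (l al). norm (?k (t, y))))"
  proof (rule Bochner_Integration.integrable_bound[OF qi])
   show "AE t in tm T. norm (LINT y|tm (l al). norm (?k (t, y))) <= norm (ST.sq h t / lower)"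
    using ae by eventually_elim (simp add: ST.sq_nonneg abs_of_pos[OF lower_pos] integral_nonneg_AE)
  qed (use im in simp)
 qed (use ae in "auto elim!: eventually_mono")
 then show "L2 (tm T >< tm (l al)) (%(t, y). h (t, al, y))" using km by (simp add: L2_def)
 have "(LINT z|(tm T >< tm (l al)). ?k z) = (LINT t|tm T. (LINT y|tm (l al). ?k (t, y)))" using P.integral_fst'[OF ki] by simp
 also have "... <= (LINT t|tm T. ST.sq h t / lower)"
  using P.integrable_fst'[OF ki] qi ae by (intro integral_mono_AE) (auto elim!: eventually_mono)
 finally show "(LINT z|(tm T >< tm (l al)). ?k z) <= (LINT z|(tm T >< NM). (h z)^2) / lower"
  using ST.sq_integrable(2)[OF h] by simp
qed

lemma L2_N_edges:
 assumes T: "0 < T" and h: "\<And>al. al \<in> E ==> L2 (tm T >< tm (l al)) (%(t, y). h (t, al, y))"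
 shows "L2 (tm T >< NM) h"
proof -
 interpret ST: space_time NM T by (rule space_time_NM[OF T])
 have m: "h \<in> borel_measurable (tm T >< NM)" using h by (intro N_measurable) (simp add: L2_def)
 have mt: "(%x. h (t, x)) \<in> borel_measurable NM" for t using m by measurable
 have i: "integrable (tm T) (%t. (LINT y|tm (l al). (h (t, al, y))^2))" "AE t in tm T. integrable (tm (l al)) (%y. (h (t, al, y))^2)" if "al \<in> E" for al
 proof -
  interpret P: pair_sigma_finite "tm T" "tm (l al)" by (rule pair_tm)
  show "integrable (tm T) (%t. (LINT y|tm (l al). (h (t, al, y))^2))" "AE t in tm T. integrable (tm (l al)) (%y. (h (t, al, y))^2)"
   using P.integrable_fst'[OF L2_square[OF h[OF that]]] P.AE_integrable_fst'[OF L2_square[OF h[OF that]]] by simp_all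
 qed
 have ae: "AE t in tm T. \<forall>al\<in>E. integrable (tm (l al)) (%y. (h (t, al, y))^2)"
  using i(2) finite_E by (simp add: AE_finite_all)
 have sl: "AE t in tm T. L2 NM (%x. h (t, x)) & (LINT x|NM. (h (t, x))^2) <= upper * (\<Sum>al\<in>E. (LINT y|tm (l al). (h (t, al, y))^2))"
  using ae
 proof eventually_elim
  case (elim t)
  have mm: "(%y. (h (t, al, y))^2) \<in> BM" if "al \<in> E" for al using NM_slice[OF mt that] by simp
  have L: "L2 NM (%x. h (t, x))" using elim integrable_tm[OF mm] by (subst NM_L2_iff[OF mt]) blast
  then show ?case using esq_bounds(2)[OF L] integral_tm[OF mm] by (simp add: esq_def)
 qed
 have m2: "(%z. (h z)^2) \<in> borel_measurable (tm T >< NM)" using m by simp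
 have "integrable (tm T >< NM) (%z. (h z)^2)"
 proof (rule ST.N.Fubini_integrable[OF m2])
  show "integrable (tm T) (%t. (LINT x|NM. norm ((h (t, x))^2)))"
  proof (rule Bochner_Integration.integrable_bound)
   show "integrable (tm T) (%t. upper * (\<Sum>al\<in>E. (LINT y|tm (l al). (h (t, al, y))^2)))" using i(1) by simp
   show "AE t in tm T. norm (LINT x|NM. norm ((h (t, x))^2)) <= norm (upper * (\<Sum>al\<in>E. (LINT y|tm (l al). (h (t, al, y))^2)))"
    using sl by eventually_elim (auto simp: integral_nonneg_AE intro: order_trans[OF _ abs_ge_self])
  qed (use ST.M.borel_measurable_lebesgue_integral m in simp)
 qed (use sl in "auto simp: L2_def elim!: eventually_mono")
 then show ?thesis using m by (simp add: L2_def)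
qed

end

lemma AE_tm_open: "(AE t in lebesgue_on {0<..<T}. P t) \<longleftrightarrow> (AE t in tm T. P t)"
proof -
 have S: "{0<..<T} \<in> sets borel" by simp
 show ?thesis
  unfolding AE_tm AE_lebesgue_on[OF S]
 proof
  assume "AE t in lborel. t \<in> {0<..<T} --> P t"
  then show "AE t in lborel. 0 <= t & t <= T --> P t"
   using AE_lborel_singleton[of 0] AE_lborel_singleton[of T] by eventually_elim auto
 next
  assume "AE t in lborel. 0 <= t & t <= T --> P t"
  then show "AE t in lborel. t \<in> {0<..<T} --> P t" by eventually_elim auto
 qed
qed

lemma AE_lborel_swap: 
 assumes "AE z in lborel. P (z :: real \<times> real)" shows "AE t in lborel. AE y in lborel. P (y, t)"
proof -
 have "AE z in distr (lborel >< lborel) (lborel >< lborel) (%(x, y). (y, x)). P z"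
  unfolding lborel_pair.distr_pair_swap[symmetric] unfolding lborel_prod by (rule assms)
 then have "AE z in lborel >< lborel. P (case z of (x, y) => (y, x))" by (rule AE_distrD[rotated]) simp
 from lborel_pair.AE_pair[OF this] show ?thesis by simp
qed

section \<open>The Hamilton-Jacobi equation on the network\<close>

locale hj = net_data G \<mu> \<gamma>
 for G :: "'a::euclidean_space network" and \<mu> :: "nat => real" and \<gamma> :: "nat => nat => real" +
 fixes H :: "nat => 'a => real => real" and T :: real
 assumes T_pos: "0 < T" and ham: "hamiltonian G H"
begin

text \<open>Restricting the joint derivative to lines of constant \<open>y\<close> leaves the
  partial derivative \<open>Hp\<close>, whose bound gives the Lipschitz constant by the mean value
  inequality.\<close>

lemma ham_lipschitz: "\<exists>C\<ge>0. \<forall>al\<in>E. continuous_on ({0..l al} \<times> UNIV) (%(y, p). H al (arc G al y) p) \<and>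
 (\<forall>y\<in>{0..l al}. \<forall>p q. \<bar>H al (arc G al y) p - H al (arc G al y) q\<bar> <= C * \<bar>p - q\<bar>)"
proof -
 obtain C where C: "\<And>al. al \<in> E ==> \<exists>Hx Hp :: real \<times> real => real.
    (\<forall>y\<in>{0..l al}. \<forall>p.
     ((%(y,p). H al (arc G al y) p) has_derivative
       (%(dy,dp). Hx (y,p) * dy + Hp (y,p) * dp)) (at (y,p) within {0..l al} \<times> UNIV) \<and>
     \<bar>Hp (y,p)\<bar> <= C)"
  using ham unfolding hamiltonian_def by metis
 show ?thesis
 proof (intro exI[of _ "max C 0"] conjI ballI allI)
  fix al assume al: "al \<in> E"
  obtain Hx Hp :: "real \<times> real => real" where D: "\<And>y p. y \<in> {0..l al} ==> ((%(y,p). H al (arc G al y) p) has_derivative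
       (%(dy,dp). Hx (y,p) * dy + Hp (y,p) * dp)) (at (y,p) within {0..l al} \<times> UNIV)"
   and b: "\<And>y p. y \<in> {0..l al} ==> \<bar>Hp (y,p)\<bar> <= C"
   using C[OF al] by blast
  show "continuous_on ({0..l al} \<times> UNIV) (%(y, p). H al (arc G al y) p)"
   unfolding continuous_on_eq_continuous_within
  proof
   fix z assume "z \<in> {0..l al} \<times> (UNIV :: real set)"
   then show "continuous (at z within {0..l al} \<times> UNIV) (%(y, p). H al (arc G al y) p)"
    using has_derivative_continuous[OF D[of "fst z" "snd z"]] by (auto simp: mem_Times_iff)
  qed
  fix y p q assume y: "y \<in> {0..l al}"
  have d: "((%p. H al (arc G al y) p) has_field_derivative Hp (y, p)) (at p within UNIV)" for p
  proof -
   have "((%p. (y, p)) has_derivative (%h. (0, h))) (at p within UNIV)" by (auto intro!: derivative_eq_intros)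
   moreover have "((%(y,p). H al (arc G al y) p) has_derivative (%(dy,dp). Hx (y,p) * dy + Hp (y,p) * dp)) (at (y,p) within (%p. (y, p)) ` UNIV)"
    by (rule has_derivative_subset[OF D[OF y]]) (use y in auto)
   ultimately have "((%p. (%(y,p). H al (arc G al y) p) (y, p)) has_derivative (%h. (%(dy,dp). Hx (y,p) * dy + Hp (y,p) * dp) (0, h))) (at p within UNIV)"
    by (rule has_derivative_in_compose)
   then show ?thesis by (simp add: has_field_derivative_def)
  qed
  have "norm (H al (arc G al y) p - H al (arc G al y) q) <= max C 0 * norm (p - q)"
   by (rule field_differentiable_bound[OF _ d]) (use b[OF y] in "auto simp: le_max_iff_disj")
  then show "\<bar>H al (arc G al y) p - H al (arc G al y) q\<bar> <= max C 0 * \<bar>p - q\<bar>" by simp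
 qed simp
qed

definition LH :: real where
 "LH = (SOME C. C >= 0 & (\<forall>al\<in>E. continuous_on ({0..l al} \<times> UNIV) (%(y, p). H al (arc G al y) p) \<and>
 (\<forall>y\<in>{0..l al}. \<forall>p q. \<bar>H al (arc G al y) p - H al (arc G al y) q\<bar> <= C * \<bar>p - q\<bar>)))"

lemma LH: "0 <= LH" and H_continuous: "al \<in> E ==> continuous_on ({0..l al} \<times> UNIV) (%(y, p). H al (arc G al y) p)"
 and H_lipschitz: "al \<in> E ==> y \<in> {0..l al} ==> \<bar>H al (arc G al y) p - H al (arc G al y) q\<bar> <= LH * \<bar>p - q\<bar>"
 using someI_ex[OF ham_lipschitz, folded LH_def] by blast+

text \<open>The nonlinearity after the substitution \<open>w = \<psi> ph\<close>: the derivative of \<open>\<psi>\<close> produces a drift, and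
 \<open>- a\<close> compensates the zeroth order term of \<open>Qf\<close>.\<close>

definition FF :: "nat \<times> real => real => real => real" where
 "FF x a p = (if snd x \<in> {0..l (fst x)} then H (fst x) (arc G (fst x) (snd x)) p + \<mu> (fst x) * (\<psi>' (fst x) / \<psi> (fst x) (snd x)) * p - a else 0)"

text \<open>\<open>LH\<close> for the Hamiltonian, \<open>upper * (upper / lower)\<close> for the
  drift coefficient \<open>\<mu> * \<psi>' / \<psi>\<close>, and 1 for the term
  \<open>- a\<close>.\<close>

definition LF :: real where "LF = LH + upper * (upper / lower) + 1"

lemma LF: "0 <= LF"
 unfolding LF_def using LH upper_ge_1 lower_pos by (intro add_nonneg_nonneg mult_nonneg_nonneg divide_nonneg_nonneg) auto

lemma FF_lipschitz: assumes "x \<in> space NM" shows "\<bar>FF x a p - FF x a' p'\<bar> <= LF * (\<bar>a - a'\<bar> + \<bar>p - p'\<bar>)"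
proof (cases "snd x \<in> {0..l (fst x)}")
 case True
 obtain al y where x: "x = (al, y)" by (cases x)
 have al: "al \<in> E" and y: "y \<in> {0..l al}" using assms True by (auto simp: x)
 define q where "q = \<mu> al * (\<psi>' al / \<psi> al y)"
 have q: "\<bar>q\<bar> <= upper * (upper / lower)"
  unfolding q_def abs_mult using quot_bound[OF al y] \<mu>_bounds[OF al] lower_pos upper_ge_1 by (intro mult_mono) auto
 have "\<bar>FF x a p - FF x a' p'\<bar> = \<bar>(H al (arc G al y) p - H al (arc G al y) p') + q * (p - p') - (a - a')\<bar>"
 proof -
  have "FF x a p = H al (arc G al y) p + q * p - a" for a p using y by (simp add: FF_def x q_def)
  from this[of a p] this[of a' p'] show ?thesis by (simp only:) (simp add: algebra_simps)
 qed
 also have "... <= LH * \<bar>p - p'\<bar> + \<bar>q\<bar> * \<bar>p - p'\<bar> + \<bar>a - a'\<bar>"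
  using H_lipschitz[OF al y, of p p'] abs_mult[of q "p - p'"] by linarith
 also have "... <= LF * \<bar>p - p'\<bar> + 1 * \<bar>a - a'\<bar>"
  using mult_right_mono[OF q, of "\<bar>p - p'\<bar>"] by (simp add: LF_def algebra_simps)
 also have "... <= LF * \<bar>p - p'\<bar> + LF * \<bar>a - a'\<bar>"
 proof -
  have "0 <= upper * (upper / lower)" using q by linarith
  then have "1 <= LF" using LH by (simp add: LF_def)
  then show ?thesis by (intro add_mono mult_right_mono) auto
 qed
 finally show ?thesis by (simp add: algebra_simps)
qed (use LF in "auto simp: FF_def")

lemma FF_measurable: "(%(x, a, p). FF x a p) \<in> borel_measurable (NM >< (borel >< borel))"
proof -
 define J where "J al z = indicator ({0..l al} \<times> UNIV) z *\<^sub>R ((case z of (y, p) => H al (arc G al y) p) + \<mu> al * (\<psi>' al / \<psi> al (fst z)) * snd z)" for al and z :: "real \<times> real"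
 have J: "J al \<in> borel_measurable (borel >< borel)" if al: "al \<in> E" for al
 proof -
  have c: "continuous_on ({0..l al} \<times> UNIV) (%z::real \<times> real. \<psi> al (fst z))" unfolding \<psi>_def by (intro continuous_intros)
  have nz: "\<psi> al (fst z) \<noteq> 0" if "z \<in> {0..l al} \<times> (UNIV :: real set)" for z
   using \<psi>_pos[OF al, of "fst z"] that by auto
  have "{0..l al} \<times> UNIV \<in> sets (borel :: (real \<times> real) measure)" by (intro borel_closed closed_Times) auto
  then have "J al \<in> BM"
   unfolding J_def[abs_def]
   by (rule borel_measurable_continuous_on_indicator) (intro continuous_intros H_continuous al c ballI nz)
  then show ?thesis by (simp add: borel_prod)
 qed
 let ?k = "%z. \<Sum>al\<in>E. indicator {al} (fst (fst z)) * (J al (snd (fst z), snd (snd z)) - indicator {0..l al} (snd (fst z)) * fst (snd z))"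
 have "?k \<in> borel_measurable (NM >< (borel >< borel))"
 proof (intro borel_measurable_sum borel_measurable_times borel_measurable_diff)
  fix al assume al: "al \<in> E"
  have "(%z. fst (fst z)) \<in> (NM >< (borel >< borel)) \<rightarrow>\<^sub>M count_space E" by measurable
  then show "(%z. indicator {al} (fst (fst z)) :: real) \<in> borel_measurable (NM >< (borel >< borel))" by (rule measurable_compose) simp
  have "(%z. (snd (fst z), snd (snd z))) \<in> (NM >< (borel >< borel)) \<rightarrow>\<^sub>M borel >< borel" by measurable
  from measurable_compose[OF this J[OF al]]
  show "(%z. J al (snd (fst z), snd (snd z))) \<in> borel_measurable (NM >< (borel >< borel))" .
  show "(%z. indicator {0..l al} (snd (fst z)) :: real) \<in> borel_measurable (NM >< (borel >< borel))" by measurable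
  show "(%z. fst (snd z)) \<in> borel_measurable (NM >< (borel >< borel))" by measurable
 qed
 moreover have "(case z of (x, a, p) => FF x a p) = ?k z" if "z \<in> space (NM >< (borel >< borel))" for z
 proof -
  obtain be y a p where z: "z = ((be, y), a, p)" by (metis prod.exhaust)
  have b: "be \<in> E" using that by (simp add: z space_pair_measure)
  have "?k z = (\<Sum>al\<in>E. if al = be then J be (y, p) - indicator {0..l be} y * a else 0)" by (rule sum.cong) (auto simp: z)
  also have "... = J be (y, p) - indicator {0..l be} y * a" using b finite_E by simp
  also have "... = FF (be, y) a p" by (auto simp: J_def FF_def indicator_def)
  finally show ?thesis by (simp add: z)
 qed
 ultimately show ?thesis by (subst measurable_cong) auto
qed

lemma FF_0: "L2 NM (%x. FF x 0 0)"
proof -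
 have "(%x. (x, 0, 0)) \<in> NM \<rightarrow>\<^sub>M NM >< (borel >< borel)" by measurable
 from measurable_compose[OF this FF_measurable] have m: "(%x. FF x 0 0) \<in> borel_measurable NM" by simp
 show ?thesis
  unfolding NM_L2_iff[OF m]
 proof
  fix al assume al: "al \<in> E"
  have c: "continuous_on {0..l al} (%y. (H al (arc G al y) 0)^2)"
  proof -
   have "continuous_on {0..l al} (%y. (%(y, p). H al (arc G al y) p) (y, 0))"
    by (rule continuous_on_compose2[OF H_continuous[OF al]]) (auto intro!: continuous_intros)
   then show ?thesis by (auto intro!: continuous_intros)
  qed
  have "integrable lborel (%y. indicator {0..l al} y * (indicator {0..l al} y * (H al (arc G al y) 0)^2))"
   using integrable_tm_continuous[OF c] by (subst integrable_tm[symmetric]) auto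
  moreover have "(%y. indicator {0..l al} y * (indicator {0..l al} y * (H al (arc G al y) 0)^2)) = (%y. indicator {0..l al} y * (FF (al, y) 0 0)^2)"
   by (auto simp: FF_def indicator_def)
  ultimately show "integrable lborel (%y. indicator {0..l al} y * (FF (al, y) 0 0)^2)" by simp
 qed
qed

lemma FF_L2:
 assumes u: "L2 NM u" and p: "L2 NM p" shows "L2 NM (%x. FF x (u x) (p x))"
proof -
 have [measurable]: "u \<in> borel_measurable NM" "p \<in> borel_measurable NM" using u p by (auto simp: L2_def)
 have "(%x. (x, u x, p x)) \<in> NM \<rightarrow>\<^sub>M NM >< (borel >< borel)" by measurable
 from measurable_compose[OF this FF_measurable] have m: "(%x. FF x (u x) (p x)) \<in> borel_measurable NM" by simp
 have abs: "L2 NM (%x. \<bar>u x\<bar>)" if "L2 NM u" for u using that by (auto simp: L2_def)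
 have "L2 NM (%x. \<bar>FF x 0 0\<bar> + LF * (\<bar>u x\<bar> + \<bar>p x\<bar>))" by (intro L2_add L2_cmult abs u p FF_0)
 then show ?thesis
 proof (rule L2_bound[where C = 1, OF _ m])
  show "AE x in NM. \<bar>FF x (u x) (p x)\<bar> <= 1 * \<bar>\<bar>FF x 0 0\<bar> + LF * (\<bar>u x\<bar> + \<bar>p x\<bar>)\<bar>"
  proof (rule AE_I2)
   fix x assume "x \<in> space NM"
   from FF_lipschitz[OF this, of "u x" "p x" 0 0] show "\<bar>FF x (u x) (p x)\<bar> <= 1 * \<bar>\<bar>FF x 0 0\<bar> + LF * (\<bar>u x\<bar> + \<bar>p x\<bar>)\<bar>" by simp
  qed
 qed
qed

text \<open>The derivative bound is coercivity: \<open>lower\<close> times the squared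
  \<open>L^2\<close> norm of the derivative part is at most \<open>Qf\<close>, which is diagonal in
  the eigenbasis; hence the constant \<open>1 / lower\<close>.\<close>

sublocale F: fourier NM T "%k x. ef k (True, x)" "%k x. ef k (False, x)" ev "1 / lower"
proof (rule fourier.intro[OF space_time_NM[OF T_pos]], unfold_locales)
 show "L2 NM (%x. ef k (True, x))" "L2 NM (%x. ef k (False, x))" for k by (rule Sp_L2[OF ef_in])+
 show "(LINT x|NM. ef j (True, x) * ef k (True, x)) = 0" if "j \<noteq> k" for j k using ef_orth[OF that] by (simp add: Bf_def)
 show "(LINT x|NM. (ef k (True, x))^2) <= 1" for k using ef_norm[of k] by (auto simp: Bf_def power2_eq_square)
 show "1 <= ev k" for k by (rule ev_ge)
 show "0 <= 1 / lower" using lower_pos by simp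
 fix n m and a :: "nat => real"
 let ?s = "%x. \<Sum>k=n..<m. a k * ef k x"
 have s: "?s \<in> Sp" by (rule Q.sum_in) (rule ef_in)
 have "lower * (LINT x|NM. (?s (False, x))^2) <= Qf ?s ?s" using Df_lower[OF s] Bf_nonneg[of ?s] by (simp add: Qf_def)
 also have "... = (\<Sum>k=n..<m. ev k * (a k)^2 * Bf (ef k) (ef k))" by (rule ef_sum_QB) simp
 also have "... <= (\<Sum>k=n..<m. ev k * (a k)^2 * 1)"
  using ev_ge ef_norm by (intro sum_mono mult_left_mono mult_nonneg_nonneg) (auto intro: order_trans[of 0 1], metis le_numeral_extra(3,4) zero_le_one)
 finally show "(LINT x|NM. (\<Sum>k=n..<m. a k * ef k (False, x))^2) <= 1 / lower * (\<Sum>k=n..<m. ev k * (a k)^2)"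
  using lower_pos by (simp add: field_simps)
qed

lemma evolution_hj:
 assumes "L2 F.N f" "summable (%k. ev k * (\<tau> k)^2)"
 shows "evolution NM T (%k x. ef k (True, x)) (%k x. ef k (False, x)) ev (1 / lower) FF LF f \<tau>"
 by unfold_locales (use FF_measurable FF_lipschitz LF FF_0 assms in auto)

text \<open>Borel versions on the cylinders combine to one function on the product space, and Fubini
  turns equality almost everywhere into equality almost everywhere on almost every time
  slice.\<close>

lemma cyl_slices:
 assumes "L2_cyl G T f"
 shows "\<exists>h. L2 F.N h \<and>
  (\<forall>al\<in>E. AE z in lborel. z \<in> {0<..<l al} \<times> {0<..<T} --> on_edge G al (f (snd z)) (fst z) = h (snd z, al, fst z)) \<and>
  (AE t in tm T. L2 NM (%x. h (t, x)) & (\<forall>al\<in>E. AE y in lborel. 0 < y & y < l al --> on_edge G al (f t) y = h (t, al, y)))"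
proof -
 have S: "{0<..<l al} \<times> {0<..<T} \<in> sets borel" for al by (intro borel_open open_Times) auto
 have L: "L2_on ({0<..<l al} \<times> {0<..<T}) (%z. on_edge G al (f (snd z)) (fst z))" if "al \<in> E" for al
  using assms that by (simp add: L2_cyl_def cylinder_def split_beta')
 have "\<forall>al. \<exists>g. al \<in> E --> g \<in> BM & (AE z in lborel. z \<in> {0<..<l al} \<times> {0<..<T} --> on_edge G al (f (snd z)) (fst z) = (g z :: real))"
  using borel_version[OF S] L unfolding L2_on_def by blast
 from choice[OF this] obtain g where g: "\<And>al. al \<in> E ==> g al \<in> BM"
  and ae: "\<And>al. al \<in> E ==> AE z in lborel. z \<in> {0<..<l al} \<times> {0<..<T} --> on_edge G al (f (snd z)) (fst z) = (g al z :: real)"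
  by blast
 define h where "h = (%(t, al, y). g al (y, t))"
 have hs: "h (t, al, y) = g al (y, t)" for t al y by (simp add: h_def)
 have ae': "AE z in lborel. z \<in> {0<..<l al} \<times> {0<..<T} --> on_edge G al (f (snd z)) (fst z) = h (snd z, al, fst z)" if "al \<in> E" for al
  using ae[OF that] by (simp add: hs)
 have hL: "L2 F.N h"
 proof (rule L2_N_edges[OF T_pos])
  fix al assume al: "al \<in> E"
  have m: "(%(t, y). h (t, al, y)) \<in> BM" using borel_swap[OF g[OF al]] by (simp add: hs split_beta')
  show "L2 (tm T >< tm (l al)) (%(t, y). h (t, al, y))"
   by (rule L2_on_cyl[THEN iffD1, OF m _ L[OF al]]) (use ae'[OF al] in simp)
 qed
 have "AE t in tm T. \<forall>al\<in>E. AE y in lborel. 0 < y & y < l al --> on_edge G al (f t) y = h (t, al, y)"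
 proof (subst AE_finite_all[OF finite_E], intro ballI)
  fix al assume al: "al \<in> E"
  show "AE t in tm T. AE y in lborel. 0 < y & y < l al --> on_edge G al (f t) y = h (t, al, y)"
   unfolding AE_tm using AE_lborel_swap[OF ae'[OF al]] AE_lborel_singleton[of 0] AE_lborel_singleton[of T]
  proof eventually_elim
   case (elim t)
   show ?case
   proof
    assume t: "0 <= t & t <= T"
    show "AE y in lborel. 0 < y & y < l al --> on_edge G al (f t) y = h (t, al, y)"
     using elim(1) by eventually_elim (use elim(2,3) t in auto)
   qed
  qed
 qed
 then have "AE t in tm T. L2 NM (%x. h (t, x)) & (\<forall>al\<in>E. AE y in lborel. 0 < y & y < l al --> on_edge G al (f t) y = h (t, al, y))"
  using F.slice_L2[OF hL] by eventually_elim simp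
 then show ?thesis using hL ae' by blast
qed

section \<open>The weak formulation in the weighted space\<close>

lemma weak_form_rhs:
 assumes ph: "ph \<in> Sp" and w: "times_\<psi> w ph"
  and f: "L2 NM fh" "\<forall>al\<in>E. AE y in lborel. 0 < y & y < l al --> on_edge G al f y = fh (al, y)"
 shows "net_integral G (%al y. on_edge G al f y * on_edge G al w y) = (LINT x|NM. fh x * ph (True, x))"
proof -
 define k where "k x = fh x * ph (True, x)" for x
 have ki: "integrable NM k" unfolding k_def by (rule L2_mult[OF f(1) Sp_L2(1)[OF ph]])
 note km = borel_measurable_integrable[OF ki]
 have "net_integral G (%al y. on_edge G al f y * on_edge G al w y) = (\<Sum>al\<in>E. LINT y|lborel. indicator {0..l al} y * (%(al, y). \<psi> al y * k (al, y)) (al, y))"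
 proof (rule net_integral_AE)
  fix al assume al: "al \<in> E"
  show "(%y. (%(al, y). \<psi> al y * k (al, y)) (al, y)) \<in> BM" using NM_slice[OF km al] by simp
  show "AE y in lborel. 0 < y & y < l al --> on_edge G al f y * on_edge G al w y = (%(al, y). \<psi> al y * k (al, y)) (al, y)"
   using f(2)[rule_format, OF al] w[unfolded times_\<psi>_def, rule_format, OF al] by eventually_elim (auto simp: k_def)
 qed
 also have "... = integral\<^sup>L NM k" using NM_integrable(2)[OF km ki] by simp
 finally show ?thesis by (simp only: k_def[abs_def])
qed

text \<open>The derivative of \<open>w = \<psi> * ph\<close> splits the diffusion term into the
  symmetric part and a drift; the weight \<psi> is factored out of every term and absorbed into
  \<open>NM\<close>.\<close>

lemma weak_form:
 assumes U: "rep u U" and ph: "ph \<in> Sp" and w: "times_\<psi> w ph"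
  and P: "L2 NM P" "\<forall>al\<in>E. AE y in lborel. 0 < y & y < l al --> on_edge G al v' y = P (al, y)"
 shows "net_integral G (%al y. - on_edge G al v' y * on_edge G al w y + \<mu> al * edge_deriv G al u y * edge_deriv G al w y
   + H al (arc G al y) (edge_deriv G al u y) * on_edge G al w y)
  = Qf U ph + (LINT x|NM. (FF x (U (True, x)) (U (False, x)) - P x) * ph (True, x))"
proof -
 note US = rep_Sp[OF U]
 define k where "k x = (U (True, x) * ph (True, x) + \<mu> (fst x) * U (False, x) * ph (False, x)) + (FF x (U (True, x)) (U (False, x)) - P x) * ph (True, x)" for x
 have i1: "integrable NM (%x. (FF x (U (True, x)) (U (False, x)) - P x) * ph (True, x))"
  by (rule L2_mult[OF L2_diff[OF FF_L2[OF Sp_L2[OF US]] P(1)] Sp_L2(1)[OF ph]])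
 have ki: "integrable NM k" unfolding k_def using Sp_integrable[OF US ph] i1 by simp
 note km = borel_measurable_integrable[OF ki]
 have "net_integral G (%al y. - on_edge G al v' y * on_edge G al w y + \<mu> al * edge_deriv G al u y * edge_deriv G al w y
   + H al (arc G al y) (edge_deriv G al u y) * on_edge G al w y) = (\<Sum>al\<in>E. LINT y|lborel. indicator {0..l al} y * (%(al, y). \<psi> al y * k (al, y)) (al, y))"
 proof (rule net_integral_AE)
  fix al assume al: "al \<in> E"
  show "(%y. (%(al, y). \<psi> al y * k (al, y)) (al, y)) \<in> BM" using NM_slice[OF km al] by simp
  show "AE y in lborel. 0 < y & y < l al --> - on_edge G al v' y * on_edge G al w y + \<mu> al * edge_deriv G al u y * edge_deriv G al w y
   + H al (arc G al y) (edge_deriv G al u y) * on_edge G al w y = (%(al, y). \<psi> al y * k (al, y)) (al, y)"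
   using P(2)[rule_format, OF al] w[unfolded times_\<psi>_def, rule_format, OF al] rep_deriv[OF U al]
  proof eventually_elim
   case (elim y)
   show ?case
   proof
    assume y: "0 < y & y < l al"
    have "\<psi> al y \<noteq> 0" using \<psi>_pos[OF al, of y] y by simp
    then show "- on_edge G al v' y * on_edge G al w y + \<mu> al * edge_deriv G al u y * edge_deriv G al w y
     + H al (arc G al y) (edge_deriv G al u y) * on_edge G al w y = (%(al, y). \<psi> al y * k (al, y)) (al, y)"
     using elim y by (simp add: k_def FF_def field_simps)
   qed
  qed
 qed
 also have "... = integral\<^sup>L NM k" using NM_integrable(2)[OF km ki] by simp
 also have "... = Qf U ph + (LINT x|NM. (FF x (U (True, x)) (U (False, x)) - P x) * ph (True, x))"
  unfolding k_def[abs_def] Qf_def Bf_def Df_def using Sp_integrable[OF US ph] i1 by simp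
 finally show ?thesis .
qed

end

section \<open>Existence\<close>

lemma eventually_within_set: "eventually (%s. s \<in> S) (at t within S)"
 by (simp add: eventually_at_filter)

text \<open>Restricted to \<open>{..<n}\<close>, the tuple of the integers \<open>j k t\<close> lies
  in a finite function space and takes each value on a Borel set; any function of the tuple inherits
  both properties.\<close>

lemma finite_valued_measurable:
 fixes j :: "nat => real => int"
 assumes S: "S \<in> sets borel" and m: "\<And>k. k < n ==> j k \<in> borel \<rightarrow>\<^sub>M count_space UNIV"
  and b: "\<And>k t. k < n ==> t \<in> S ==> \<bar>j k t\<bar> <= B k"
 shows "finite ((%t. \<Psi> (\<lambda>k\<in>{..<n}. j k t)) ` S)" "{t \<in> S. \<Psi> (\<lambda>k\<in>{..<n}. j k t) = z} \<in> sets lebesgue"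
proof -
 define A where "A = PiE {..<n} (%k. {- B k..B k})"
 have A: "finite A" unfolding A_def by (intro finite_PiE) auto
 have in_A: "(\<lambda>k\<in>{..<n}. j k t) \<in> A" if "t \<in> S" for t
  using b[OF _ that] by (auto simp: A_def abs_le_iff minus_le_iff)
 show "finite ((%t. \<Psi> (\<lambda>k\<in>{..<n}. j k t)) ` S)"
  by (rule finite_subset[OF _ finite_imageI[OF A, of \<Psi>]]) (use in_A in auto)
 have eq: "{t \<in> S. \<Psi> (\<lambda>k\<in>{..<n}. j k t) = z} = (\<Union>a\<in>{a \<in> A. \<Psi> a = z}. S \<inter> (\<Inter>k\<in>{..<n}. {t. j k t = a k}) )"
 proof (intro set_eqI iffI)
  fix t assume "t \<in> {t \<in> S. \<Psi> (\<lambda>k\<in>{..<n}. j k t) = z}"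
  then show "t \<in> (\<Union>a\<in>{a \<in> A. \<Psi> a = z}. S \<inter> (\<Inter>k\<in>{..<n}. {t. j k t = a k}))"
   using in_A[of t] by (intro UN_I[of "\<lambda>k\<in>{..<n}. j k t"]) auto
 next
  fix t assume "t \<in> (\<Union>a\<in>{a \<in> A. \<Psi> a = z}. S \<inter> (\<Inter>k\<in>{..<n}. {t. j k t = a k}))"
  then obtain a where a: "a \<in> A" "\<Psi> a = z" "t \<in> S" "\<And>k. k < n ==> j k t = a k" by auto
  have "(\<lambda>k\<in>{..<n}. j k t) = a" using a(1,4) by (intro ext) (auto simp: A_def PiE_def extensional_def restrict_def)
  then show "t \<in> {t \<in> S. \<Psi> (\<lambda>k\<in>{..<n}. j k t) = z}" using a by simp
 qed
 have "S \<inter> (\<Inter>k\<in>{..<n}. {t. j k t = a k}) \<in> sets borel" for a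
 proof (cases "n = 0")
  case False
  have "{t. j k t = a k} \<in> sets borel" if "k < n" for k
   using measurable_sets[OF m[OF that], of "{a k}"] by (simp add: vimage_def)
  then show ?thesis using False S by (intro sets.Int sets.finite_INT) auto
 qed (use S in simp)
 then have "{t \<in> S. \<Psi> (\<lambda>k\<in>{..<n}. j k t) = z} \<in> sets borel"
  unfolding eq by (intro sets.finite_UN) (use A in simp_all)
 then show "{t \<in> S. \<Psi> (\<lambda>k\<in>{..<n}. j k t) = z} \<in> sets lebesgue" by simp
qed

context net_data
begin

lemma esq_borel:
 assumes k: "k \<in> borel_measurable (tm T >< NM)" shows "(%t. esq (%x. k (t, x))) \<in> BM"
 unfolding esq_def
proof (rule borel_measurable_sum)
 fix al assume "al \<in> E"
 from N_edge[OF k this] have [measurable]: "(%(t, y). k (t, al, y)) \<in> borel_measurable (borel >< borel)" by (simp add: borel_prod)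
 have "(%t. LINT y|lborel. indicator {0..l al} y * (case (t, y) of (t, y) => k (t, al, y))^2) \<in> BM" by measurable
 then show "(%t. LINT y|lborel. indicator {0..l al} y * (k (t, al, y))^2) \<in> BM" by simp
qed

lemma esq_cong:
 assumes "a \<in> borel_measurable NM" "b \<in> borel_measurable NM" "AE x in NM. a x = b x" shows "esq a = esq b"
 unfolding esq_def
proof (intro sum.cong refl integral_cong_AE)
 fix al assume al: "al \<in> E"
 note [measurable] = NM_slice[OF assms(1) al] NM_slice[OF assms(2) al]
 show "(%y. indicator {0..l al} y * (a (al, y))^2) \<in> borel_measurable lborel" "(%y. indicator {0..l al} y * (b (al, y))^2) \<in> borel_measurable lborel" by measurable
 show "AE y in lborel. indicator {0..l al} y * (a (al, y))^2 = indicator {0..l al} y * (b (al, y))^2"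
  using AE_NM_iff[OF assms(3) al] by eventually_elim (auto simp: indicator_def)
qed

end

context hj
begin

text \<open>A definite member of \<open>Sp\<close> at every time and not at almost every time, as
  \<open>C_time\<close> and the terminal condition speak of each \<open>t\<close>. When the series
  converges, the choice by \<open>SOME\<close> affects, on the edges, only the derivative part and
  this only on null sets.\<close>

definition jet :: "(nat => real => real) => real => bool \<times> nat \<times> real => real" where
 "jet c t = (SOME U. U \<in> Sp & (%n. Qn (%x. U x - (\<Sum>k<n. c k t * ef k x))) ~~> 0)"

context
 fixes \<tau> :: "nat => real" and g :: "real \<times> nat \<times> real => real" and c :: "nat => real => real"
 assumes m: "F.modes \<tau> g c" and g: "L2 F.N g" and \<tau>: "summable (%k. ev k * (\<tau> k)^2)"
begin

abbreviation bnd where "bnd \<equiv> F.bound \<tau> g"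

lemma mode_le: "t \<in> {0..T} ==> ev k * (c k t)^2 <= bnd k" and mode_nonneg: "0 <= ev k * (c k t)^2"
 and bnd_summable: "summable bnd"
 using F.modes_bounds(2)[OF m g] F.bound_summable[OF g \<tau>] ev_ge[of k] by auto

section \<open>Synthesis of the solution from its modes\<close>

lemma jet: assumes t: "t \<in> {0..T}"
 shows "jet c t \<in> Sp" "(%n. Qn (%x. jet c t x - (\<Sum>k<n. c k t * ef k x))) ~~> 0"
proof -
 have "summable (%k. ev k * (c k t)^2)"
  by (rule summable_comparison_test'[OF bnd_summable, of 0]) (use mode_le[OF t] mode_nonneg in simp)
 from ef_series[OF this] show "jet c t \<in> Sp" "(%n. Qn (%x. jet c t x - (\<Sum>k<n. c k t * ef k x))) ~~> 0"
  unfolding jet_def Bex_def by (rule someI2_ex; blast)+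
qed

lemma part_in: "(%x. \<Sum>k<n. a k * ef k x) \<in> Sp" by (rule Q.sum_in) (rule ef_in)

lemma part_Q_le: "Qn (%x. \<Sum>k<n. a k * ef k x) <= (\<Sum>k<n. ev k * (a k)^2)"
proof -
 have "ev k * (a k)^2 * Bf (ef k) (ef k) <= ev k * (a k)^2" for k
  using ef_norm[of k] ev_ge[of k] by auto
 then show ?thesis unfolding ef_sum_QB(1)[OF finite_lessThan] by (rule sum_mono)
qed

lemma jet_pointwise:
 assumes t: "t \<in> {0..T}" and al: "al \<in> E" and y: "y \<in> {0..l al}"
 shows "(%n. \<Sum>k<n. c k t * ef k (True, al, y)) ~~> jet c t (True, al, y)"
proof -
 define d where "d n = jet c t (True, al, y) - (\<Sum>k<n. c k t * ef k (True, al, y))" for n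
 have le: "(d n)^2 <= sup_const * Qn (%x. jet c t x - (\<Sum>k<n. c k t * ef k x))" for n
  unfolding d_def by (rule Sp_sup_bound[OF Q.diff_in[OF jet(1)[OF t] part_in] al y])
 have "(%n. (d n)^2) ~~> 0"
  by (rule tendsto_sandwich[OF _ _ tendsto_const tendsto_mult_right_zero[OF jet(2)[OF t], of sup_const]]) (use le in auto)
 from tendsto_real_sqrt[OF this] have "(%n. \<bar>d n\<bar>) ~~> 0" by simp
 then have "d ~~> 0" by (simp add: tendsto_rabs_zero_iff)
 from tendsto_diff[OF tendsto_const[of "jet c t (True, al, y)"] this] show ?thesis by (simp add: d_def)
qed

lemma part_bound:
 assumes t: "t \<in> {0..T}" shows "Qn (%x. \<Sum>k<n. c k t * ef k x) <= suminf bnd"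
proof -
 have "0 <= bnd k" for k using mode_le[OF t, of k] mode_nonneg[of k t] by linarith
 then have "(\<Sum>k<n. bnd k) <= suminf bnd" by (intro sum_le_suminf bnd_summable) auto
 moreover have "(\<Sum>k<n. ev k * (c k t)^2) <= (\<Sum>k<n. bnd k)" by (rule sum_mono) (rule mode_le[OF t])
 ultimately show ?thesis using part_Q_le[of "%k. c k t" n] by linarith
qed

text \<open>The Weierstrass test with majorant \<open>4 * bnd k\<close> makes \<open>Z\<close>
  continuous, with \<open>Z t = 0\<close>; since \<open>Qf\<close> is diagonal in the eigenbasis,
  \<open>Z\<close> dominates the squared energy distance.\<close>

lemma jet_continuous:
 assumes t: "t \<in> {0..T}"
 shows "((%s. Qn (%x. jet c s x - jet c t x)) \<longlongrightarrow> 0) (at t within {0..T})"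
proof -
 define Z where "Z s = (\<Sum>k. ev k * (c k s - c k t)^2)" for s
 have bd: "norm (ev k * (c k s - c k t)^2) <= 4 * bnd k" if "s \<in> {0..T}" for k s
 proof -
  have "ev k * (c k s - c k t)^2 <= ev k * (2 * (c k s)^2 + 2 * (c k t)^2)"
   using ev_ge[of k] by (intro mult_left_mono Submission.square_diff_le) auto
  then show ?thesis using mode_le[OF that, of k] mode_le[OF t, of k] ev_ge[of k] by (simp add: distrib_left abs_mult)
 qed
 have sm: "summable (%k. 4 * bnd k)" by (rule summable_mult[OF bnd_summable])
 have "continuous_on {0..T} Z"
  unfolding Z_def
 proof (rule uniform_limit_theorem[OF _ Weierstrass_m_test[OF bd sm]])
  show "\<forall>\<^sub>F n in sequentially. continuous_on {0..T} (%s. \<Sum>k<n. ev k * (c k s - c k t)^2)"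
   by (intro always_eventually allI continuous_intros ac_continuous[OF F.modesD(2)[OF m]])
 qed auto
 then have "(Z \<longlongrightarrow> Z t) (at t within {0..T})" using t by (simp add: continuous_on_def)
 then have Z: "(Z \<longlongrightarrow> 0) (at t within {0..T})" by (simp add: Z_def)
 have "Qn (%x. jet c s x - jet c t x) <= Z s" if s: "s \<in> {0..T}" for s
 proof (rule LIMSEQ_le_const2)
  let ?p = "%n x. \<Sum>k<n. (c k s - c k t) * ef k x"
  let ?d = "%s n x. jet c s x - (\<Sum>k<n. c k s * ef k x)"
  have d: "?d r n \<in> Sp" if "r \<in> {0..T}" for r n by (rule Q.diff_in[OF jet(1)[OF that] part_in])
  have "(%n. Qn (%x. (jet c s x - jet c t x) - ?p n x)) ~~> 0"
  proof (rule tendsto_sandwich[OF _ _ tendsto_const])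
   have e: "(%x. (jet c s x - jet c t x) - ?p n x) = (%x. ?d s n x - ?d t n x)" for n
    by (simp add: left_diff_distrib sum_subtractf algebra_simps)
   show "\<forall>\<^sub>F n in sequentially. Qn (%x. (jet c s x - jet c t x) - ?p n x) <= 2 * Qn (?d s n) + 2 * Qn (?d t n)"
    unfolding e by (intro always_eventually allI Q.square_diff_le d s t)
   show "(%n. 2 * Qn (?d s n) + 2 * Qn (?d t n)) ~~> 0"
    using tendsto_add[OF tendsto_mult_right_zero[OF jet(2)[OF s], of 2] tendsto_mult_right_zero[OF jet(2)[OF t], of 2]] by simp
  qed (auto intro!: always_eventually Q.nonneg Q.diff_in part_in jet s t)
  then show "(%n. Qn (?p n)) ~~> Qn (%x. jet c s x - jet c t x)"
   by (rule Q.tendsto_square[OF part_in Q.diff_in[OF jet(1)[OF s] jet(1)[OF t]]])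
  have "(\<Sum>k<n. ev k * (c k s - c k t)^2) <= Z s" for n
   unfolding Z_def using order_trans[OF zero_le_one ev_ge]
   by (intro sum_le_suminf summable_comparison_test'[OF sm, of 0] bd s) auto
  then show "\<exists>N. \<forall>n\<ge>N. Qn (?p n) <= Z s" using part_Q_le[of "%k. c k s - c k t"] by (meson order_trans)
 qed
 moreover have "0 <= Qn (%x. jet c s x - jet c t x)" if "s \<in> {0..T}" for s
  by (rule Q.nonneg[OF Q.diff_in[OF jet(1)[OF that] jet(1)[OF t]]])
 ultimately show ?thesis
  by (intro tendsto_sandwich[OF _ _ tendsto_const Z] eventually_mono[OF eventually_within_set]) blast+
qed

context
 fixes h v D :: "real \<times> nat \<times> real => real"
 assumes h: "F.tends (%k x. ef k (True, x)) (%k t. ev k * c k t) h"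
  and v: "F.tends (%k x. ef k (True, x)) c v" and D: "F.tends (%k x. ef k (False, x)) c D"
begin

text \<open>The partial sums converge in \<open>Qf\<close> to the jet, while their values,
  derivatives and eigenvalue-weighted sums converge in \<open>L^2\<close> to slices of
  \<open>v\<close>, \<open>D\<close> and \<open>h\<close>; uniqueness of limits identifies them.
  Each partial sum solves its elliptic equation, hence so does the jet.\<close>

lemma slices: "AE t in tm T. t \<in> {0..T} & weak_eq (jet c t) (%x. h (t, x)) \<and>
  (%n. (LINT x|NM. (h (t, x) - (\<Sum>k<n. ev k * c k t * ef k (True, x)))^2)) ~~> 0 \<and>
  (AE x in NM. jet c t (True, x) = v (t, x)) & (AE x in NM. jet c t (False, x) = D (t, x))"
proof -
 have lim: "AE t in tm T. L2 NM (%x. w (t, x)) & (%n. (LINT x|NM. (w (t, x) - (\<Sum>k<n. a k t * b k x))^2)) ~~> 0"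
  if "F.tends b a w" for b a w using that by (simp add: F.tends_def)
 have range: "AE t in tm T. t \<in> {0..T}" by (auto simp: AE_tm)
 show ?thesis
  using lim[OF h] lim[OF v] lim[OF D] range
 proof eventually_elim
  case (elim t)
  note t = elim(4) and J = jet[OF elim(4)]
  let ?d = "%n x. jet c t x - (\<Sum>k<n. c k t * ef k x)"
  have d: "?d n \<in> Sp" for n by (rule Q.diff_in[OF J(1) part_in])
  have "(%n. (LINT x|NM. (?d n (True, x))^2)) ~~> 0"
   using B_tendsto_of_Q[OF part_in J] by (simp add: Bf_def power2_eq_square)
  from L2_limit_unique[OF Sp_L2(1)[OF J(1)] _ Sp_L2(1)[OF part_in] this] elim(2)
  have 1: "AE x in NM. jet c t (True, x) = v (t, x)" by blast
  have "(%n. (LINT x|NM. (?d n (False, x))^2)) ~~> 0"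
  proof (rule tendsto_sandwich[OF _ _ tendsto_const tendsto_mult_right_zero[OF J(2), of "1 / lower"]])
   have "(LINT x|NM. (?d n (False, x))^2) <= 1 / lower * Qn (?d n)" for n
    using Df_lower[OF d[of n]] Bf_nonneg[of "?d n"] lower_pos by (simp add: Qf_def field_simps)
   then show "\<forall>\<^sub>F n in sequentially. (LINT x|NM. (?d n (False, x))^2) <= 1 / lower * Qn (?d n)" by simp
  qed (auto intro!: always_eventually integral_nonneg_AE)
  from L2_limit_unique[OF Sp_L2(2)[OF J(1)] _ Sp_L2(2)[OF part_in] this] elim(3)
  have 2: "AE x in NM. jet c t (False, x) = D (t, x)" by blast
  have "weak_eq (jet c t) (%x. h (t, x))"
   by (rule weak_eq_limit[OF weak_eq_sum J]) (use elim(1) in auto)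
  then show ?case using 1 2 t elim(1) by blast
 qed
qed

context
 fixes u :: "real => 'a => real"
 assumes u: "\<And>t. t \<in> {0..T} ==> rep (u t) (jet c t)"
begin

lemma C_time_u: "C_time T (V_space G) (Hb_norm G 1) u"
 unfolding C_time_def
proof (intro ballI conjI)
 fix t assume t: "t \<in> {0..T}"
 show "u t \<in> V_space G" by (rule rep_V[OF u[OF t]])
 let ?q = "%s. Qn (%x. jet c s x - jet c t x)"
 let ?K = "1 / lower + 1 / lower^2"
 have "Hb_norm G 1 (%x. u s x - u t x) <= sqrt (?K * ?q s)" if "s \<in> {0..T}" for s
  by (rule real_le_rsqrt[OF Qf_Hb_norm(2)[OF rep_diff[OF u[OF that] u[OF t]]]])
 moreover have "0 <= Hb_norm G 1 (%x. u s x - u t x)" if "s \<in> {0..T}" for s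
  unfolding Hb_norm_1[OF rep_diff[OF u[OF that] u[OF t]]] by (simp add: esq_nonneg)
 moreover have "((%s. sqrt (?K * ?q s)) \<longlongrightarrow> 0) (at t within {0..T})"
  using tendsto_real_sqrt[OF tendsto_mult_right_zero[OF jet_continuous[OF t], of ?K]] by simp
 ultimately show "((%s. Hb_norm G 1 (%x. u s x - u t x)) \<longlongrightarrow> 0) (at t within {0..T})"
  by (elim tendsto_sandwich[OF eventually_mono[OF eventually_within_set] eventually_mono[OF eventually_within_set] tendsto_const, rotated 2])
qed

abbreviation K2 where "K2 \<equiv> 1 / lower + 1 / lower^2 + (8 / lower^2 + 2 * (upper / lower)^2 / lower) / lower"

text \<open>Finitely valued approximations: truncate the series after \<open>n\<close> terms and
  round the coefficients down to multiples of \<open>1 / M n\<close>. The \<open>H^2\<close> norm is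
  controlled by the right-hand side of the elliptic equation, where the rounding error is a finite
  sum of squares and the truncation error tends to zero by \<open>slices\<close>.\<close>

lemma strongly_measurable_u: "strongly_measurable T (Hs G 2) (Hb_norm G 2) u"
proof -
 define ph where "ph k = (SOME v. rep v (ef k))" for k
 have ph: "rep (ph k) (ef k)" for k unfolding ph_def using glue[OF ef_in] by (rule someI_ex)
 \<comment> \<open>Large enough that the squared rounding errors, amplified by the eigenvalues, sum
   to at most \<open>1 / (real n + 1)\<close>.\<close>
 define M where "M n = (real n + 1) * (1 + (\<Sum>k<n. (ev k)^2))" for n
 have M1: "(\<Sum>k<n. (ev k)^2) / (M n)^2 <= 1 / (real n + 1)" and M0: "0 < M n" for n
 proof -
  define S where "S = (\<Sum>k<n. (ev k)^2)"
  have S: "0 <= S" unfolding S_def by (simp add: sum_nonneg)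
  show "0 < M n" using S by (simp add: M_def S_def[symmetric] add_pos_nonneg)
  have "S * (real n + 1) <= ((real n + 1) * (1 + S)) * ((real n + 1) * (1 + S))"
  proof -
   define b where "b = (real n + 1) * (1 + S)"
   have "1 * 1 <= b" unfolding b_def using S by (intro mult_mono) auto
   then have "b * 1 <= b * b" by (intro mult_left_mono) auto
   moreover have "S * (real n + 1) <= b" unfolding b_def by (simp add: algebra_simps)
   ultimately show ?thesis by (simp add: b_def)
  qed
  moreover have "M n = (real n + 1) * (1 + S)" by (simp only: M_def S_def)
  ultimately have "S * (real n + 1) <= (M n)^2" by (simp only: power2_eq_square)
  then have "S <= (M n)^2 / (real n + 1)" by (subst pos_le_divide_eq) auto
  moreover have "0 < (M n)^2" using \<open>0 < M n\<close> by simp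
  ultimately show "S / (M n)^2 <= 1 / (real n + 1)" by (subst pos_divide_le_eq) auto
 qed
 define j where "j n k t = \<lfloor>M n * c k t\<rfloor>" for n k t
 define q where "q n k t = of_int (j n k t) / M n" for n k t
 have q: "\<bar>q n k t - c k t\<bar> <= 1 / M n" for n k t
 proof -
  have "\<bar>of_int (j n k t) - M n * c k t\<bar> <= 1" unfolding j_def by linarith
  then show ?thesis using M0[of n] by (simp add: q_def field_simps abs_le_iff)
 qed
 define s where "s n t = (%x. \<Sum>k<n. q n k t * ph k x)" for n t
 have rs: "rep (s n t) (%x. \<Sum>k<n. q n k t * ef k x)" for n t unfolding s_def by (rule rep_sum) (auto simp: ph)
 have fin: "finite (s n ` {0<..<T})" "{t \<in> {0<..<T}. s n t = z} \<in> sets lebesgue" for n z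
 proof -
  have "\<exists>B. \<forall>t\<in>{0<..<T}. \<bar>j n k t\<bar> <= B" for k
  proof -
   have "bounded (c k ` {0..T})" by (intro compact_imp_bounded compact_continuous_image ac_continuous[OF F.modesD(2)[OF m]]) simp
   then obtain C where C: "\<And>t. t \<in> {0..T} ==> \<bar>c k t\<bar> <= C" unfolding bounded_iff by (metis imageI real_norm_def)
   have "\<bar>j n k t\<bar> <= \<lceil>M n * C\<rceil> + 1" if "t \<in> {0<..<T}" for t
   proof -
    have "\<bar>M n * c k t\<bar> <= M n * C" using C[of t] that M0[of n] by (simp add: abs_mult)
    then show ?thesis unfolding j_def by linarith
   qed
   then show ?thesis by blast
  qed
  then obtain B where B: "\<And>k t. t \<in> {0<..<T} ==> \<bar>j n k t\<bar> <= B k" by metis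
  have jm: "j n k \<in> borel \<rightarrow>\<^sub>M count_space UNIV" for k
   unfolding j_def[abs_def] using F.modesD(1)[OF m, of k] by measurable
  define \<Psi> where "\<Psi> a = (%x. \<Sum>k<n. of_int (a k) / M n * ph k x)" for a :: "nat => int"
  have e: "s n t = \<Psi> (\<lambda>k\<in>{..<n}. j n k t)" for t by (simp add: s_def \<Psi>_def q_def)
  show "finite (s n ` {0<..<T})" "{t \<in> {0<..<T}. s n t = z} \<in> sets lebesgue"
   unfolding e by (rule finite_valued_measurable[OF _ jm B]; simp)+
 qed
 have "AE t in tm T. (%n. Hb_norm G 2 (%x. s n t x - u t x)) ~~> 0"
  using slices
 proof eventually_elim
  case (elim t)
  define R where "R n = (LINT x|NM. (h (t, x) - (\<Sum>k<n. ev k * c k t * ef k (True, x)))^2)" for n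
  have hL: "L2 NM (%x. h (t, x))" using elim by (simp add: weak_eq_def)
  have le: "(Hb_norm G 2 (%x. s n t x - u t x))^2 <= K2 * (2 * (1 / (real n + 1)) + 2 * R n)" 
   and nn: "0 <= Hb_norm G 2 (%x. s n t x - u t x)" for n
  proof -
   let ?e = "%a x. \<Sum>k<n. a k * ef k (True, x)"
   have eL: "L2 NM (?e a)" for a by (intro L2_sum L2_cmult Sp_L2(1)[OF ef_in])
   have r: "rep (%x. s n t x - u t x) (%x. (\<Sum>k<n. q n k t * ef k x) - jet c t x)" by (rule rep_diff[OF rs u]) (use elim in simp)
   have w: "weak_eq (%x. (\<Sum>k<n. q n k t * ef k x) - jet c t x) (%x. ?e (%k. ev k * q n k t) x - h (t, x))"
    using weak_eq_comb[OF weak_eq_sum[of "%k. q n k t" n], of "jet c t" "%x. h (t, x)" 1 "-1"] elim by simp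
   show "0 <= Hb_norm G 2 (%x. s n t x - u t x)" unfolding Hb_norm_2(2)[OF r w] by (simp add: esq_nonneg)
   have "(LINT x|NM. (?e (%k. ev k * q n k t) x - h (t, x))^2)
    = (LINT x|NM. (?e (%k. ev k * (q n k t - c k t)) x - (h (t, x) - ?e (%k. ev k * c k t) x))^2)"
    by (simp add: right_diff_distrib left_diff_distrib sum_subtractf)
   also have "... <= 2 * (LINT x|NM. (?e (%k. ev k * (q n k t - c k t)) x)^2) + 2 * R n"
    unfolding R_def by (rule L2_integral_square_diff[OF eL L2_diff[OF hL eL]])
   also have "(LINT x|NM. (?e (%k. ev k * (q n k t - c k t)) x)^2) <= (\<Sum>k<n. (ev k * (q n k t - c k t))^2)"
    by (rule F.e_sum) simp
   also have "... <= (\<Sum>k<n. (ev k)^2 / (M n)^2)"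
   proof (rule sum_mono)
    fix k
    have "\<bar>q n k t - c k t\<bar>^2 <= (1 / M n)^2" by (rule power_mono[OF q]) simp
    from mult_left_mono[OF this, of "(ev k)^2"] show "(ev k * (q n k t - c k t))^2 <= (ev k)^2 / (M n)^2"
     by (simp add: power_mult_distrib power_divide)
   qed
   also have "... <= 1 / (real n + 1)" using M1[of n] by (simp add: sum_divide_distrib)
   finally have "(LINT x|NM. (?e (%k. ev k * q n k t) x - h (t, x))^2) <= 2 * (1 / (real n + 1)) + 2 * R n" by simp
   from mult_left_mono[OF this, of K2] Hb_norm_2(3)[OF r w] lower_pos upper_ge_1
   show "(Hb_norm G 2 (%x. s n t x - u t x))^2 <= K2 * (2 * (1 / (real n + 1)) + 2 * R n)" by fastforce
  qed
  have "(%n. 1 / (real n + 1)) ~~> 0" using LIMSEQ_inverse_real_of_nat by (simp add: inverse_eq_divide add.commute)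
  moreover have "R ~~> 0" using elim by (simp add: R_def[abs_def])
  ultimately have "(%n. K2 * (2 * (1 / (real n + 1)) + 2 * R n)) ~~> K2 * (2 * 0 + 2 * 0)" by (intro tendsto_intros)
  from tendsto_real_sqrt[OF this] have lim: "(%n. sqrt (K2 * (2 * (1 / (real n + 1)) + 2 * R n))) ~~> 0" by simp
  show ?case by (rule tendsto_sandwich[OF _ _ tendsto_const lim]) (use nn real_le_rsqrt[OF le] in auto)
 qed
 then show ?thesis
  unfolding strongly_measurable_def AE_tm_open
  using fin Hb_norm_2(1)[OF rs weak_eq_sum] by (intro exI[of _ s]) blast
qed

text \<open>\<open>Hb_norm\<close> of a slice involves representatives chosen separately for each
  \<open>t\<close>; its square is measurable in \<open>t\<close> because it agrees almost everywhere
  with \<open>e\<close>, which is built from the jointly measurable \<open>v\<close>,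
  \<open>D\<close> and \<open>d\<close>.\<close>

lemma L2_time_u: "L2_time T (Hs G 2) (Hb_norm G 2) u"
 unfolding L2_time_def
proof (intro conjI strongly_measurable_u)
 show "AE t in lebesgue_on {0<..<T}. u t \<in> Hs G 2"
  unfolding AE_tm_open using slices by eventually_elim (use Hb_norm_2(1)[OF u] in blast)
 have hL: "L2 F.N h" "L2 F.N v" "L2 F.N D" using h v D by (simp_all add: F.tends_def)
 define d where "d z = (v z - h z) / \<mu> (fst (snd z)) - \<psi>' (fst (snd z)) / \<psi> (fst (snd z)) (snd (snd z)) * D z" for z
 have dm: "d \<in> borel_measurable F.N"
 proof -
  have "(%z. \<mu> (fst (snd z))) \<in> borel_measurable F.N" "(%z. \<psi>' (fst (snd z)) / \<psi> (fst (snd z)) (snd (snd z))) \<in> borel_measurable F.N"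
   by (rule measurable_compose[OF measurable_snd \<mu>_measurable] measurable_compose[OF measurable_snd quot_measurable])+
  from borel_measurable_diff[OF borel_measurable_divide[OF borel_measurable_diff[OF hL(2,1)[THEN L2_measurable]] this(1)] borel_measurable_times[OF this(2) L2_measurable[OF hL(3)]]]
  show ?thesis by (simp only: d_def[abs_def])
 qed
 define e where "e t = esq (%x. v (t, x)) + esq (%x. D (t, x)) + esq (%x. d (t, x))" for t
 have em: "e \<in> BM"
  unfolding e_def[abs_def] using esq_borel[OF L2_measurable[OF hL(2)]] esq_borel[OF L2_measurable[OF hL(3)]] esq_borel[OF dm]
  by (intro borel_measurable_add)
 have slm: "(%x. k (t, x)) \<in> borel_measurable NM" if "k \<in> borel_measurable F.N" for k :: "real \<times> nat \<times> real => real" and t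
  using that by measurable
 have ae: "AE t in tm T. (Hb_norm G 2 (u t))^2 = e t & norm ((Hb_norm G 2 (u t))^2) <= norm (K2 * F.sq h t)"
  using slices
 proof eventually_elim
  case (elim t)
  then have r: "rep (u t) (jet c t)" and w: "weak_eq (jet c t) (%x. h (t, x))" and J: "jet c t \<in> Sp"
   and 1: "AE x in NM. jet c t (True, x) = v (t, x)" and 2: "AE x in NM. jet c t (False, x) = D (t, x)"
   using u jet by auto
  have hh: "L2 NM (%x. h (t, x))" using w by (simp add: weak_eq_def)
  have "esq (%x. jet c t (True, x)) = esq (%x. v (t, x))"
   by (rule esq_cong[OF L2_measurable[OF Sp_L2(1)[OF J]] slm[OF L2_measurable[OF hL(2)]] 1])
  moreover have "esq (%x. jet c t (False, x)) = esq (%x. D (t, x))"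
   by (rule esq_cong[OF L2_measurable[OF Sp_L2(2)[OF J]] slm[OF L2_measurable[OF hL(3)]] 2])
  moreover have "esq (d2 (jet c t) (%x. h (t, x))) = esq (%x. d (t, x))"
   by (rule esq_cong[OF L2_measurable[OF d2_L2[OF J hh]] slm[OF dm]]) (use 1 2 in "eventually_elim, simp add: d_def d2_def")
  ultimately have "(Hb_norm G 2 (u t))^2 = e t" unfolding Hb_norm_2(2)[OF r w] by (simp add: e_def esq_nonneg)
  moreover have "norm ((Hb_norm G 2 (u t))^2) <= norm (K2 * F.sq h t)"
   using order_trans[OF Hb_norm_2(3)[OF r w] abs_ge_self] by (simp only: F.sq_def real_norm_def abs_power2)
  ultimately show ?case ..
 qed
 have S: "{0<..<T} \<in> sets borel" by simp
 have aeS: "AE t in lborel. t \<in> {0<..<T} --> (Hb_norm G 2 (u t))^2 = e t"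
  using ae unfolding AE_tm_open[symmetric] AE_lebesgue_on[OF S] by eventually_elim auto
 have sqm: "(%t. K2 * F.sq h t) \<in> BM" using F.sq_borel[OF hL(1)] by simp
 have "integrable (tm T) (%t. K2 * F.sq h t)" using F.sq_integrable(1)[OF hL(1)] by simp
 then have i: "integrable (lebesgue_on {0<..<T}) (%t. K2 * F.sq h t)"
  unfolding integrable_tm[OF sqm] integrable_open_closed[OF sqm, symmetric] by (subst integrable_lebesgue_on_AE(1)[OF S sqm]) auto
 show "integrable (lebesgue_on {0<..<T}) (%t. (Hb_norm G 2 (u t))^2)"
  by (rule Bochner_Integration.integrable_bound[OF i measurable_lebesgue_on_AE[OF S em aeS]])
   (use ae in "auto simp: AE_tm_open elim: eventually_mono")
qed

end
end
end
end

context hj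
begin

section \<open>The time derivative and the weak equation for the constructed function\<close>

lemma part_integral:
 assumes "L2 NM q" shows "(LINT x|NM. (\<Sum>k<n. a k * ef k (True, x)) * q x) = (\<Sum>k<n. a k * (LINT x|NM. ef k (True, x) * q x))"
proof -
 have "(LINT x|NM. (\<Sum>k<n. a k * ef k (True, x)) * q x) = (LINT x|NM. (\<Sum>k<n. a k * (ef k (True, x) * q x)))"
  by (simp add: sum_distrib_right mult.assoc)
 then show ?thesis using L2_mult[OF Sp_L2(1)[OF ef_in] assms] by simp
qed

text \<open>For a single mode the identity is integration by parts in \<open>t\<close> at fixed
  \<open>y\<close>. In the limit the left side converges by dominated convergence, as the jets are
  pointwise limits of uniformly bounded sums, and the right side by convergence in
  \<open>L^2\<close>.\<close>

lemma time_deriv: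
 assumes m: "F.modes \<tau> g c" and g: "L2 F.N g" and \<tau>: "summable (%k. ev k * (\<tau> k)^2)"
  and u: "\<And>t. t \<in> {0..T} ==> rep (u t) (jet c t)"
  and P: "F.tends (%k x. ef k (True, x)) (%k t. ev k * c k t - F.coef g k t) P"
 shows "\<exists>v'. has_time_deriv G T u v' & (\<forall>t. \<forall>al\<in>E. \<forall>y. 0 < y --> y < l al --> on_edge G al (v' t) y = P (t, al, y))"
proof -
 obtain pr where pr: "\<And>al y. al \<in> E ==> 0 < y ==> y < l al ==> pr (arc G al y) = (al, y)" using interior_parameter by blast
 define v' where "v' t x = P (t, pr x)" for t x
 have v': "on_edge G al (v' t) y = P (t, al, y)" if "al \<in> E" "0 < y" "y < l al" for t al y
  using pr[OF that] by (simp add: on_edge_def v'_def)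
 have "has_weak_deriv (cylinder G T al) (0, 1) (%(y,t). on_edge G al (u t) y) (%(y,t). on_edge G al (v' t) y)" if al: "al \<in> E" for al
 proof -
  define L where "L = l al"
  interpret Q: space_time "tm L" T by (rule space_time.intro) (simp_all add: space_time_axioms_def T_pos finite_measure.axioms(1)[OF finite_measure_tm])
  interpret fQ: finite_measure "tm T >< tm L" by (rule finite_pair_tm)
  define e where "e k y = ef k (True, al, y)" for k y
  define p where "p k t = ev k * c k t - F.coef g k t" for k t
  have eL: "L2 (tm L) (e k)" for k unfolding e_def L_def by (rule NM_L2_edge[OF Sp_L2(1)[OF ef_in] al])
  note cL = F.modes_bounds(1)[OF m g] and pL = F.modes_bounds(4)[OF m g, folded p_def]
  define s where "s n = (%(t, y). \<Sum>k<n. c k t * e k y)" for n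
  define q where "q n = (%(t, y). \<Sum>k<n. p k t * e k y)" for n
  define g1 where "g1 = (%(t, y). indicator ({0..T} \<times> {0..L}) (t, y) * jet c t (True, al, y))"
  have sL: "L2 Q.N (s n)" for n
  proof -
   have "L2 Q.N (%z. \<Sum>k<n. case z of (t, y) => c k t * e k y)" by (intro L2_sum Q.tensor_L2 eL cL)
   then show ?thesis by (simp add: s_def split_beta')
  qed
  have qL: "L2 Q.N (q n)" for n
  proof -
   have "L2 Q.N (%z. \<Sum>k<n. case z of (t, y) => p k t * e k y)" by (intro L2_sum Q.tensor_L2 eL pL)
   then show ?thesis by (simp add: q_def split_beta')
  qed
  have slim: "(%n. s n z) ~~> g1 z" if "z \<in> {0..T} \<times> {0..L}" for z
   using jet_pointwise[OF m g \<tau> _ al, of "fst z" "snd z"] that by (auto simp: s_def g1_def e_def L_def)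
  have B: "{0..T} \<times> {0..L} \<in> sets borel" by (intro borel_closed closed_Times) auto
  have g1m: "g1 \<in> BM"
  proof (rule borel_measurable_LIMSEQ_real)
   show "(%n. indicator ({0..T} \<times> {0..L}) z * s n z) ~~> g1 z" for z
   proof (cases "z \<in> {0..T} \<times> {0..L}")
    case True then show ?thesis using slim[OF True] by simp
   next
    case False then show ?thesis by (cases z) (simp add: g1_def)
   qed
   show "(%z. indicator ({0..T} \<times> {0..L}) z * s n z) \<in> BM" for n
    using L2_measurable[OF sL] B by simp
  qed
  \<comment> \<open>A bound for all partial sums at once: the sup bound applied to the total energy
    \<open>suminf (F.bound \<tau> g)\<close>.\<close>
  define C where "C = sqrt (sup_const * suminf (F.bound \<tau> g))"
  have sC: "\<bar>s n z\<bar> <= C" if z: "z \<in> {0..T} \<times> {0..L}" for n z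
  proof -
   let ?w = "%x. \<Sum>k<n. c k (fst z) * ef k x"
   have "(?w (True, al, snd z))^2 <= sup_const * Qf ?w ?w"
    by (rule Sp_sup_bound[OF Q.sum_in[OF ef_in] al]) (use z in "auto simp: L_def")
   also have "... <= sup_const * suminf (F.bound \<tau> g)"
    by (intro mult_left_mono part_bound[OF m g \<tau>] sup_const_nonneg) (use z in auto)
   finally have "(s n z)^2 <= sup_const * suminf (F.bound \<tau> g)" by (simp add: s_def e_def split_beta')
   from real_sqrt_le_mono[OF this] show ?thesis by (simp add: C_def)
  qed
  have gC: "\<bar>g1 z\<bar> <= C" if "z \<in> {0..T} \<times> {0..L}" for z
   by (rule LIMSEQ_le_const2[OF tendsto_rabs[OF slim[OF that]]]) (use sC[OF that] in auto)
  have ae: "AE z in Q.N. z \<in> {0..T} \<times> {0..L}" using AE_pair_tm[of T L] by eventually_elim (simp add: mem_Times_iff)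
  have g1L: "L2 Q.N g1"
  proof (rule L2_bound[where g = "%z. 1" and C = C])
   show "AE z in Q.N. \<bar>g1 z\<bar> <= C * \<bar>1\<bar>" using ae by eventually_elim (use gC in simp)
  qed (use g1m in "simp_all add: L2_def")
  have PL: "L2 F.N P" and Plim: "(%n. (LINT z|F.N. (P z - (\<Sum>k<n. case z of (t, x) => (ev k * c k t - F.coef g k t) * ef k (True, x)))^2)) ~~> 0"
   using P by (simp_all add: F.tends_def)
  define Pa where "Pa = (%(t, y). P (t, al, y))"
  have PaL: "L2 Q.N Pa" unfolding Pa_def L_def by (rule edge_L2_N(1)[OF T_pos PL al])
  have Palim: "(%n. (LINT z|Q.N. (Pa z - q n z)^2)) ~~> 0"
  proof (rule tendsto_sandwich[OF _ _ tendsto_const tendsto_mult_right_zero[OF Plim, of "1 / lower"]])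
   have LL: "L2 F.N (%z. P z - (\<Sum>k<n. case z of (t, x) => (ev k * c k t - F.coef g k t) * ef k (True, x)))" for n
    by (intro L2_diff PL L2_sum F.tensor_L2 Sp_L2(1)[OF ef_in] F.modes_bounds(4)[OF m g])
   have "(LINT z|Q.N. (Pa z - q n z)^2) <= 1 / lower * (LINT z|F.N. (P z - (\<Sum>k<n. case z of (t, x) => (ev k * c k t - F.coef g k t) * ef k (True, x)))^2)" for n
    using edge_L2_N(2)[OF T_pos LL al, of n] by (simp add: Pa_def q_def p_def e_def L_def split_beta')
   then show "\<forall>\<^sub>F n in sequentially. (LINT z|Q.N. (Pa z - q n z)^2) <= 1 / lower * (LINT z|F.N. (P z - (\<Sum>k<n. case z of (t, x) => (ev k * c k t - F.coef g k t) * ef k (True, x)))^2)" by simp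
  qed (auto intro!: always_eventually integral_nonneg_AE)
  have cyl: "cylinder G T al = {0<..<L} \<times> {0<..<T}" by (simp add: cylinder_def L_def)
  have Fu: "(case z of (y, t) => on_edge G al (u t) y) = g1 (snd z, fst z)" if "z \<in> {0<..<L} \<times> {0<..<T}" for z
   using rep_val[OF u al, of "snd z" "fst z"] that by (auto simp: g1_def on_edge_def L_def)
  have Fv: "(case z of (y, t) => on_edge G al (v' t) y) = Pa (snd z, fst z)" if "z \<in> {0<..<L} \<times> {0<..<T}" for z
   using v'[OF al, of "fst z" "snd z"] that by (auto simp: Pa_def L_def)
  have Pm: "Pa \<in> BM" using PaL by (simp add: L2_def)
  show ?thesis
   unfolding has_weak_deriv_def cyl
  proof (intro conjI allI impI)
   show "L2_on ({0<..<L} \<times> {0<..<T}) (%(y, t). on_edge G al (u t) y)"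
    by (rule L2_on_cyl[THEN iffD2, OF g1m _ g1L]) (use Fu in auto)
   show "L2_on ({0<..<L} \<times> {0<..<T}) (%(y, t). on_edge G al (v' t) y)"
    by (rule L2_on_cyl[THEN iffD2, OF Pm _ PaL]) (use Fv in auto)
   fix ph :: "real \<times> real => real" assume ph: "test_fun ({0<..<L} \<times> {0<..<T}) ph"
   define pht where "pht z = frechet_derivative ph (at z) (0, 1)" for z
   note tf = test_fun_time[OF ph, folded pht_def]
   define \<Phi> where "\<Phi> z = ph (snd z, fst z)" for z
   define \<Phi>t where "\<Phi>t z = pht (snd z, fst z)" for z
   have \<Phi>c: "continuous_on UNIV \<Phi>" "continuous_on UNIV \<Phi>t"
    unfolding \<Phi>_def \<Phi>t_def by (rule continuous_on_compose2[OF tf(1)] continuous_on_compose2[OF tf(2)]; (intro continuous_intros)?; simp)+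
   note \<Phi>L = continuous_L2_pair_tm[OF \<Phi>c(1), of T L] continuous_L2_pair_tm[OF \<Phi>c(2), of T L]
   have "(LINT z|lebesgue_on ({0<..<L} \<times> {0<..<T}). (case z of (y, t) => on_edge G al (u t) y) * frechet_derivative ph (at z) (0, 1)) = (LINT z|Q.N. g1 z * \<Phi>t z)"
   proof (rule cyl_integral(2))
    show "(%z. g1 z * \<Phi>t z) \<in> BM" using g1m borel_measurable_continuous_onI[OF \<Phi>c(2)] by simp
   qed (use Fu in "auto simp: \<Phi>t_def pht_def")
   moreover have "(LINT z|lebesgue_on ({0<..<L} \<times> {0<..<T}). (case z of (y, t) => on_edge G al (v' t) y) * ph z) = (LINT z|Q.N. Pa z * \<Phi> z)"
   proof (rule cyl_integral(2))
    show "(%z. Pa z * \<Phi> z) \<in> BM" using Pm borel_measurable_continuous_onI[OF \<Phi>c(1)] by simp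
   qed (use Fv in "auto simp: \<Phi>_def")
   moreover have "(LINT z|Q.N. g1 z * \<Phi>t z) = - (LINT z|Q.N. Pa z * \<Phi> z)"
   proof (rule LIMSEQ_unique)
    have w: "integrable Q.N (%z. C * \<bar>\<Phi>t z\<bar>)"
    proof -
     have "L2 Q.N (%z. 1)" by (simp add: L2_def)
     from L2_mult[OF \<Phi>L(2) this] show ?thesis by simp
    qed
    show "(%n. (LINT z|Q.N. s n z * \<Phi>t z)) ~~> (LINT z|Q.N. g1 z * \<Phi>t z)"
    proof (rule integral_dominated_convergence[OF _ _ w])
     show "AE z in Q.N. (%n. s n z * \<Phi>t z) ~~> g1 z * \<Phi>t z"
      using ae by eventually_elim (intro tendsto_mult slim tendsto_const)
     show "AE z in Q.N. norm (s n z * \<Phi>t z) <= C * \<bar>\<Phi>t z\<bar>" for n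
      using ae by eventually_elim (use sC in "auto simp: abs_mult intro!: mult_right_mono")
    qed (use g1m L2_measurable[OF sL] L2_measurable[OF \<Phi>L(2)] in auto)
    have k: "(LINT z|Q.N. (case z of (t, y) => c k t * e k y) * \<Phi>t z) = - (LINT z|Q.N. (case z of (t, y) => p k t * e k y) * \<Phi> z)" for k
    proof -
     have i1: "integrable Q.N (%(t, y). c k t * e k y * \<Phi>t (t, y))"
      using L2_mult[OF Q.tensor_L2[OF eL cL] \<Phi>L(2)] by (simp add: split_beta')
     have i2: "integrable Q.N (%(t, y). p k t * e k y * \<Phi> (t, y))"
      using L2_mult[OF Q.tensor_L2[OF eL pL] \<Phi>L(1)] by (simp add: split_beta')
     have inner: "(LINT t|tm T. c k t * e k y * \<Phi>t (t, y)) = - (LINT t|tm T. p k t * e k y * \<Phi> (t, y))" for y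
     proof -
      have [measurable]: "c k \<in> BM" "p k \<in> BM" using cL[of k] pL[of k] by (simp_all add: L2_def)
      have [measurable]: "(%t. pht (y, t)) \<in> BM" "(%t. ph (y, t)) \<in> BM"
       by (intro borel_measurable_continuous_onI continuous_on_compose2[OF tf(2)] continuous_on_compose2[OF tf(1)] continuous_intros; simp)+
      have "(LINT t|tm T. c k t * e k y * \<Phi>t (t, y)) = e k y * (LINT t|tm T. c k t * pht (y, t))"
       by (subst Bochner_Integration.integral_mult_right_zero[symmetric]) (simp add: \<Phi>t_def mult_ac)
      also have "(LINT t|tm T. c k t * pht (y, t)) = - (LINT t|lborel. indicator {0..T} t * (indicator {0..T} t * p k t * ph (y, t)))"
       using ac_by_parts[OF F.modesD(2)[OF m, of k] tf(3)[of y]] T_pos tf(4,5)[of y] by (subst integral_tm) (auto simp: p_def)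
      also have "... = - (LINT t|tm T. p k t * ph (y, t))"
       by (subst integral_tm) (auto intro!: Bochner_Integration.integral_cong simp: indicator_def)
      also have "e k y * (- (LINT t|tm T. p k t * ph (y, t))) = - (LINT t|tm T. p k t * e k y * \<Phi> (t, y))"
       by (simp add: Bochner_Integration.integral_mult_right_zero[symmetric] \<Phi>_def mult_ac del: Bochner_Integration.integral_mult_right_zero)
      finally show ?thesis .
     qed
     have "(LINT z|Q.N. (case z of (t, y) => c k t * e k y * \<Phi>t (t, y))) = - (LINT z|Q.N. (case z of (t, y) => p k t * e k y * \<Phi> (t, y)))"
      unfolding Q.N.integral_snd[OF i1, symmetric] Q.N.integral_snd[OF i2, symmetric] inner by simp
     then show ?thesis by (simp add: split_beta')
    qed
    have "(LINT z|Q.N. s n z * \<Phi>t z) = - (LINT z|Q.N. q n z * \<Phi> z)" for n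
    proof -
     have "(LINT z|Q.N. s n z * \<Phi>t z) = (LINT z|Q.N. (\<Sum>k<n. (case z of (t, y) => c k t * e k y) * \<Phi>t z))"
      by (simp add: s_def split_beta' sum_distrib_right)
     also have "... = (\<Sum>k<n. (LINT z|Q.N. (case z of (t, y) => c k t * e k y) * \<Phi>t z))"
      by (rule Bochner_Integration.integral_sum) (rule L2_mult[OF Q.tensor_L2[OF eL cL] \<Phi>L(2)])
     also have "... = - (\<Sum>k<n. (LINT z|Q.N. (case z of (t, y) => p k t * e k y) * \<Phi> z))"
      unfolding k by (rule sum_negf)
     also have "(\<Sum>k<n. (LINT z|Q.N. (case z of (t, y) => p k t * e k y) * \<Phi> z)) = (LINT z|Q.N. (\<Sum>k<n. (case z of (t, y) => p k t * e k y) * \<Phi> z))"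
      by (rule Bochner_Integration.integral_sum[symmetric]) (rule L2_mult[OF Q.tensor_L2[OF eL pL] \<Phi>L(1)])
     also have "... = (LINT z|Q.N. q n z * \<Phi> z)"
      by (simp add: q_def split_beta' sum_distrib_right)
     finally show ?thesis .
    qed
    then show "(%n. (LINT z|Q.N. s n z * \<Phi>t z)) ~~> - (LINT z|Q.N. Pa z * \<Phi> z)"
     using tendsto_minus[OF L2_tendsto_mult[OF qL PaL \<Phi>L(1) Palim]] by simp
   qed
   ultimately show "(LINT z|lebesgue_on ({0<..<L} \<times> {0<..<T}). (case z of (y, t) => on_edge G al (u t) y) * frechet_derivative ph (at z) (0, 1)) =
    - (LINT z|lebesgue_on ({0<..<L} \<times> {0<..<T}). (case z of (y, t) => on_edge G al (v' t) y) * ph z)" by simp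
  qed
 qed
 then have "has_time_deriv G T u v'" by (simp add: has_time_deriv_def)
 then show ?thesis using v' by blast
qed

text \<open>The fixed point gives a source \<open>g\<close> that equals the right-hand side at the
  solution. The series \<open>h\<close> of the elliptic part and \<open>P\<close> of the time
  derivative differ, mode by mode, by the coefficients of \<open>g\<close>; testing with
  \<open>ph\<close> turns this into the weak equation.\<close>

theorem existence:
 assumes vT: "vT \<in> V_space G" and f: "L2_cyl G T f"
 shows "\<exists>u. weak_solution G \<mu> \<gamma> H T f vT u"
proof -
 obtain fh where fh: "L2 F.N fh"
  and fs: "AE t in tm T. L2 NM (%x. fh (t, x)) & (\<forall>al\<in>E. AE y in lborel. 0 < y & y < l al --> on_edge G al (f t) y = fh (t, al, y))"
  using cyl_slices[OF f] by blast
 obtain wT where wT: "rep vT wT" using V_rep[OF vT] by blast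
 define \<tau> where "\<tau> k = Bf wT (ef k)" for k
 have \<tau>: "summable (%k. ev k * (\<tau> k)^2)" unfolding \<tau>_def by (rule sums_summable[OF parseval(2)[OF rep_Sp[OF wT]]])
 interpret V: evolution NM T "%k x. ef k (True, x)" "%k x. ef k (False, x)" ev "1 / lower" FF LF fh \<tau> by (rule evolution_hj[OF fh \<tau>])
 obtain g c v D where g: "L2 F.N g" and m: "F.modes \<tau> g c" and v: "F.tends (%k x. ef k (True, x)) c v"
  and D: "F.tends (%k x. ef k (False, x)) c D" and grhs: "AE z in F.N. g z = V.rhs v D z"
  using V.fixed_point by blast
 obtain h where h: "F.tends (%k x. ef k (True, x)) (%k t. ev k * c k t) h" using F.modes_tends(3)[OF m g \<tau>] by blast
 obtain P where P: "F.tends (%k x. ef k (True, x)) (%k t. ev k * c k t - F.coef g k t) P" using F.modes_tends(4)[OF m g \<tau>] by blast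
 define u where "u t = (SOME v. rep v (jet c t))" for t
 have u: "rep (u t) (jet c t)" if "t \<in> {0..T}" for t unfolding u_def using glue[OF jet(1)[OF m g \<tau> that]] by (rule someI_ex)
 have T: "T \<in> {0..T}" using T_pos by simp
 \<comment> \<open>The jet at \<open>T\<close> and the representative of \<open>vT\<close> have the
   same Fourier sums, hence energy distance zero, and the sup bound gives equality at every
   point.\<close>
 have "u T x = vT x" if xp: "x \<in> points G" for x
 proof -
  obtain al y where x: "al \<in> E" "y \<in> {0..l al}" "x = arc G al y" using points_arc[OF xp] by blast
  let ?s = "%n x. \<Sum>k<n. \<tau> k * ef k x"
  have s: "?s n \<in> Sp" for n by (rule Q.sum_in) (rule ef_in)
  have 1: "(%n. Qn (%x. jet c T x - ?s n x)) ~~> 0"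
   using jet(2)[OF m g \<tau> T] by (simp add: F.modesD(3)[OF m])
  have 2: "(%n. Qn (%x. wT x - ?s n x)) ~~> 0"
   using parseval(1)[OF rep_Sp[OF wT]] by (simp add: \<tau>_def)
  note J = jet(1)[OF m g \<tau> T] and W = rep_Sp[OF wT]
  have "Qn (%x. jet c T x - wT x) <= 2 * Qn (%x. jet c T x - ?s n x) + 2 * Qn (%x. wT x - ?s n x)" for n
   using Q.square_diff_le[OF Q.diff_in[OF J s[of n]] Q.diff_in[OF W s[of n]]] by simp
  moreover have "(%n. 2 * Qn (%x. jet c T x - ?s n x) + 2 * Qn (%x. wT x - ?s n x)) ~~> 2 * 0 + 2 * 0"
   by (intro tendsto_intros 1 2)
  ultimately have "Qn (%x. jet c T x - wT x) <= 2 * 0 + 2 * 0" by (intro LIMSEQ_le_const) auto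
  moreover have "(jet c T (True, al, y) - wT (True, al, y))^2 <= sup_const * Qn (%x. jet c T x - wT x)"
   by (rule Sp_sup_bound[OF Q.diff_in[OF J W] x(1,2)])
  ultimately have "(jet c T (True, al, y) - wT (True, al, y))^2 <= 0" using sup_const_nonneg by (smt (verit) mult_nonneg_nonpos)
  then show ?thesis using rep_val[OF u[OF T] x(1,2)] rep_val[OF wT x(1,2)] by (simp add: x(3))
 qed
 moreover obtain v' where v': "has_time_deriv G T u v'" "\<And>t al y. al \<in> E ==> 0 < y ==> y < l al ==> on_edge G al (v' t) y = P (t, al, y)"
  using time_deriv[OF m g \<tau> u P] by blast
 moreover have "AE t in lebesgue_on {0<..<T}.
   net_integral G (%al y. - on_edge G al (v' t) y * on_edge G al w y + \<mu> al * edge_deriv G al (u t) y * edge_deriv G al w y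
    + H al (arc G al y) (edge_deriv G al (u t) y) * on_edge G al w y) = net_integral G (%al y. on_edge G al (f t) y * on_edge G al w y)"
  if w: "w \<in> W_space G \<gamma>" for w
 proof -
  obtain ph where ph: "ph \<in> Sp" "times_\<psi> w ph" using W_imp_times_\<psi>[OF w] by blast
  note phL = Sp_L2(1)[OF ph(1)]
  have lim: "AE t in tm T. L2 NM (%x. w (t, x)) & (%n. (LINT x|NM. (w (t, x) - (\<Sum>k<n. a k t * b k x))^2)) ~~> 0"
   if "F.tends b a w" for b a w using that by (simp add: F.tends_def)
  have gs: "AE t in tm T. AE x in NM. g (t, x) = V.rhs v D (t, x)" using F.N.AE_pair[OF grhs] .
  show ?thesis
   unfolding AE_tm_open using slices[OF m g \<tau> h v D] lim[OF P] gs F.slice_L2[OF g] fs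
  proof eventually_elim
   case (elim t)
   then have r: "rep (u t) (jet c t)" and t: "t \<in> {0..T}" using u by auto
   have J: "jet c t \<in> Sp" by (rule jet(1)[OF m g \<tau> t])
   have weq: "weak_eq (jet c t) (%x. h (t, x))" using elim by blast
   have hL: "L2 NM (%x. h (t, x))" using weq by (simp add: weak_eq_def)
   have PL: "L2 NM (%x. P (t, x))" and gL: "L2 NM (%x. g (t, x))" and fL: "L2 NM (%x. fh (t, x))" using elim by auto
   define k where "k x = FF x (jet c t (True, x)) (jet c t (False, x))" for x
   have kL: "L2 NM k" unfolding k_def by (rule FF_L2[OF Sp_L2[OF J]])
   have "AE x in NM. jet c t (True, x) = v (t, x)" "AE x in NM. jet c t (False, x) = D (t, x)" "AE x in NM. g (t, x) = V.rhs v D (t, x)" using elim by blast+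
   then have "AE x in NM. g (t, x) * ph (True, x) = fh (t, x) * ph (True, x) - k x * ph (True, x)"
    by eventually_elim (simp add: V.rhs_def k_def left_diff_distrib)
   then have "(LINT x|NM. g (t, x) * ph (True, x)) = (LINT x|NM. fh (t, x) * ph (True, x) - k x * ph (True, x))"
    using L2_measurable[OF gL] L2_measurable[OF fL] L2_measurable[OF kL] L2_measurable[OF phL]
    by (intro integral_cong_AE borel_measurable_times borel_measurable_diff) auto
   then have G: "(LINT x|NM. g (t, x) * ph (True, x)) = (LINT x|NM. fh (t, x) * ph (True, x)) - (LINT x|NM. k x * ph (True, x))"
    using L2_mult[OF fL phL] L2_mult[OF kL phL] by simp
   let ?b = "%k. (LINT x|NM. ef k (True, x) * ph (True, x))"
   have eL: "L2 NM (%x. \<Sum>k<n. a k * ef k (True, x))" for n a by (intro L2_sum L2_cmult Sp_L2(1)[OF ef_in])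
   have 1: "(%n. \<Sum>k<n. ev k * c k t * ?b k) ~~> (LINT x|NM. h (t, x) * ph (True, x))"
    unfolding part_integral[OF phL, symmetric] by (rule L2_tendsto_mult[OF eL hL phL]) (use elim in blast)
   have 2: "(%n. \<Sum>k<n. (ev k * c k t - F.coef g k t) * ?b k) ~~> (LINT x|NM. P (t, x) * ph (True, x))"
    unfolding part_integral[OF phL, symmetric] by (rule L2_tendsto_mult[OF eL PL phL]) (use elim in blast)
   have "(%n. (LINT x|NM. (ph (True, x) - (\<Sum>k<n. Bf ph (ef k) * ef k (True, x)))^2)) ~~> 0"
    using B_tendsto_of_Q[OF part_in[OF m g \<tau>] ph(1) parseval(1)[OF ph(1)]] by (simp add: Bf_def power2_eq_square)
   from L2_tendsto_mult[OF eL phL gL this]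
   have 3: "(%n. \<Sum>k<n. Bf ph (ef k) * (LINT x|NM. ef k (True, x) * g (t, x))) ~~> (LINT x|NM. ph (True, x) * g (t, x))"
    unfolding part_integral[OF gL] .
   have "(%n. (\<Sum>k<n. ev k * c k t * ?b k) - (\<Sum>k<n. (ev k * c k t - F.coef g k t) * ?b k)) = (%n. \<Sum>k<n. Bf ph (ef k) * (LINT x|NM. ef k (True, x) * g (t, x)))"
    unfolding sum_subtractf[symmetric] by (simp add: F.coef_def Bf_def algebra_simps)
   from LIMSEQ_unique[OF tendsto_diff[OF 1 2, unfolded this] 3]
   have X: "(LINT x|NM. h (t, x) * ph (True, x)) - (LINT x|NM. P (t, x) * ph (True, x)) = (LINT x|NM. g (t, x) * ph (True, x))" by (simp add: mult.commute)
   have "Qf (jet c t) ph + (LINT x|NM. (k x - P (t, x)) * ph (True, x)) = (LINT x|NM. h (t, x) * ph (True, x)) + ((LINT x|NM. k x * ph (True, x)) - (LINT x|NM. P (t, x) * ph (True, x)))"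
    using weq ph(1) L2_mult[OF kL phL] L2_mult[OF PL phL] by (simp add: weak_eq_def left_diff_distrib)
   then have "Qf (jet c t) ph + (LINT x|NM. (k x - P (t, x)) * ph (True, x)) = (LINT x|NM. fh (t, x) * ph (True, x))" using X G by simp
   moreover have "\<forall>al\<in>E. AE y in lborel. 0 < y & y < l al --> on_edge G al (v' t) y = P (t, al, y)" using v'(2) by auto
   moreover have "\<forall>al\<in>E. AE y in lborel. 0 < y & y < l al --> on_edge G al (f t) y = fh (t, al, y)" using elim by blast
   ultimately show ?case
    using weak_form[OF r ph PL] weak_form_rhs[OF ph fL] by (simp add: k_def)
  qed
 qed
 ultimately show ?thesis
  unfolding weak_solution_def using L2_time_u[OF m g \<tau> h v D u] C_time_u[OF m g \<tau> h v D u] by blast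
qed

end

section \<open>Uniqueness\<close>

lemma frechet_derivative_prod:
 fixes ph \<eta> :: "real => real"
 assumes "\<And>y. (ph has_real_derivative ph' y) (at y)" "\<And>t. (\<eta> has_real_derivative \<eta>' t) (at t)"
 shows "frechet_derivative (%(y, t). ph y * \<eta> t) (at (y, t)) (0, 1) = ph y * \<eta>' t"
proof -
 have 1: "((%z. ph (fst z)) has_derivative (%h. ph' y * fst h)) (at (y, t))"
  by (rule has_derivative_compose[OF has_derivative_fst[OF has_derivative_ident], unfolded fst_conv]) (use assms(1) in "simp add: has_field_derivative_def")
 have 2: "((%z. \<eta> (snd z)) has_derivative (%h. \<eta>' t * snd h)) (at (y, t))"
  by (rule has_derivative_compose[OF has_derivative_snd[OF has_derivative_ident], unfolded snd_conv]) (use assms(2) in "simp add: has_field_derivative_def")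
 from fun_cong[OF frechet_derivative_at[OF has_derivative_mult[OF 1 2]], of "(0, 1)"] show ?thesis by (simp add: split_beta')
qed

context hj
begin

text \<open>Testing the equation with products of functions of \<open>y\<close> and \<open>t\<close> shows that the Fourier coefficients
 of a function are absolutely continuous in time.\<close>

lemma coef_weak_deriv:
 assumes U: "L2 F.N U" and P: "L2 F.N P"
  and wd: "\<And>al. al \<in> E ==> has_weak_deriv ({0<..<l al} \<times> {0<..<T}) (0, 1) (u al) (p al)"
  and ae: "\<And>al. al \<in> E ==> AE z in lborel. z \<in> {0<..<l al} \<times> {0<..<T} --> u al z = U (snd z, al, fst z)"
   "\<And>al. al \<in> E ==> AE z in lborel. z \<in> {0<..<l al} \<times> {0<..<T} --> p al z = P (snd z, al, fst z)"
 shows "has_weak_deriv {0<..<T} 1 (F.coef U k) (F.coef P k)"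
 unfolding has_weak_deriv_def
proof (intro conjI allI impI)
 have S: "{0<..<T} \<in> sets borel" by simp
 have L: "L2_on {0<..<T} (F.coef q k)" if "L2 F.N q" for q
 proof -
  have m: "F.coef q k \<in> BM" "(%t. (F.coef q k t)^2) \<in> BM" using F.coef_borel[OF that, of k] by simp_all
  then show ?thesis using F.coef_square_integrable[OF that, of k]
   by (subst L2_on_AE[OF S m(1)]) (auto simp: integrable_open_closed[OF m(2)] integrable_tm[OF m(2)])
 qed
 show "L2_on {0<..<T} (F.coef U k)" "L2_on {0<..<T} (F.coef P k)" by (rule L[OF U] L[OF P])+
 fix \<eta> :: "real => real" assume \<eta>: "test_fun {0<..<T} \<eta>"
 obtain \<eta>' where d: "\<And>t. (\<eta> has_real_derivative \<eta>' t) (at t)" "continuous_on UNIV \<eta>'" "continuous_on UNIV \<eta>" "\<And>t. frechet_derivative \<eta> (at t) 1 = \<eta>' t"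
  using test_fun_continuous[OF \<eta>] by metis
 note \<eta>m[measurable] = borel_measurable_continuous_onI[OF d(2)] borel_measurable_continuous_onI[OF d(3)]
 \<comment> \<open>The time integral of the weak identity as a function of position; product test
   functions and the fundamental lemma in \<open>y\<close> show that it vanishes almost everywhere
   on each edge.\<close>
 define a where "a x = (LINT t|tm T. U (t, x) * \<eta>' t + P (t, x) * \<eta> t)" for x
 have a0: "AE y in lborel. 0 < y & y < l al --> a (al, y) = 0" if al: "al \<in> E" for al
 proof -
  define L where "L = l al"
  interpret Q: pair_sigma_finite "tm T" "tm L" by (rule pair_tm)
  have UL: "L2 (tm T >< tm L) (%(t, y). U (t, al, y))" and PL: "L2 (tm T >< tm L) (%(t, y). P (t, al, y))"
   unfolding L_def by (rule edge_L2_N(1)[OF T_pos _ al]; fact)+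
  have cL: "L2 (tm T >< tm L) (%z. ph (snd z) * \<eta>' (fst z))" "L2 (tm T >< tm L) (%z. ph (snd z) * \<eta> (fst z))" if "continuous_on UNIV ph" for ph
   by (intro continuous_L2_pair_tm continuous_intros continuous_on_compose2[OF d(2)] continuous_on_compose2[OF d(3)] continuous_on_compose2[OF that]; simp)+
  have i: "integrable (tm T >< tm L) (%z. (case z of (t, y) => U (t, al, y)) * (ph (snd z) * \<eta>' (fst z)))"
    "integrable (tm T >< tm L) (%z. (case z of (t, y) => P (t, al, y)) * (ph (snd z) * \<eta> (fst z)))" if "continuous_on UNIV ph" for ph
   by (rule L2_mult[OF UL cL(1)[OF that]] L2_mult[OF PL cL(2)[OF that]])+
  have i2: "integrable (tm T >< tm L) (%(t, y). (U (t, al, y) * \<eta>' t + P (t, al, y) * \<eta> t) * ph y)" if "continuous_on UNIV ph" for ph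
   using Bochner_Integration.integrable_add[OF i[OF that]] by (simp add: split_beta' algebra_simps)
  have im: "integrable (tm L) (%y. a (al, y))"
   using Q.integrable_snd[OF i2[of "%y. 1"]] by (simp add: a_def)
  then have am: "(%y. a (al, y)) \<in> BM" by (auto dest: borel_measurable_integrable)
  have "AE y in lborel. 0 < y & y < L --> a (al, y) = 0"
  proof (rule fundamental_lemma[OF am])
   show "integrable lborel (%y. indicator {0..L} y * a (al, y))" using im by (simp add: integrable_tm[OF am])
   fix ph :: "real => real" assume ph: "test_fun {0<..<L} ph"
   obtain ph' where e: "\<And>y. (ph has_real_derivative ph' y) (at y)" "continuous_on UNIV ph" using test_fun_continuous[OF ph] by metis
   note phm[measurable] = borel_measurable_continuous_onI[OF e(2)]
   have fm: "(%z. ph (snd z) * \<eta>' (fst z)) \<in> BM" "(%z. ph (snd z) * \<eta> (fst z)) \<in> BM"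
    using L2_measurable[OF cL(1)[OF e(2)]] L2_measurable[OF cL(2)[OF e(2)]] by simp_all
   let ?\<Phi> = "%(y, t). ph y * \<eta> t"
   have "(LINT z|lebesgue_on ({0<..<L} \<times> {0<..<T}). u al z * frechet_derivative ?\<Phi> (at z) (0, 1)) = - (LINT z|lebesgue_on ({0<..<L} \<times> {0<..<T}). p al z * ?\<Phi> z)"
    using wd[OF al] test_fun_prod[OF ph \<eta>] unfolding has_weak_deriv_def L_def by blast
   moreover have "(LINT z|lebesgue_on ({0<..<L} \<times> {0<..<T}). u al z * frechet_derivative ?\<Phi> (at z) (0, 1)) = (LINT z|(tm T >< tm L). (case z of (t, y) => U (t, al, y)) * (ph (snd z) * \<eta>' (fst z)))"
   proof (rule cyl_integral(2))
    show "(%z. (case z of (t, y) => U (t, al, y)) * (ph (snd z) * \<eta>' (fst z))) \<in> BM" by (rule borel_measurable_times) (use L2_measurable[OF UL] fm(1) in simp_all)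
    show "AE z in lborel. z \<in> {0<..<L} \<times> {0<..<T} --> u al z * frechet_derivative ?\<Phi> (at z) (0, 1) = (case (snd z, fst z) of (t, y) => U (t, al, y)) * (ph (snd (snd z, fst z)) * \<eta>' (fst (snd z, fst z)))"
     using ae(1)[OF al] unfolding L_def
    proof eventually_elim
     case (elim z)
     then show ?case using frechet_derivative_prod[OF e(1) d(1), of "fst z" "snd z"] by (cases z) simp
    qed
   qed
   moreover have "(LINT z|lebesgue_on ({0<..<L} \<times> {0<..<T}). p al z * ?\<Phi> z) = (LINT z|(tm T >< tm L). (case z of (t, y) => P (t, al, y)) * (ph (snd z) * \<eta> (fst z)))"
   proof (rule cyl_integral(2))
    show "(%z. (case z of (t, y) => P (t, al, y)) * (ph (snd z) * \<eta> (fst z))) \<in> BM" by (rule borel_measurable_times) (use L2_measurable[OF PL] fm(2) in simp_all)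
    show "AE z in lborel. z \<in> {0<..<L} \<times> {0<..<T} --> p al z * ?\<Phi> z = (case (snd z, fst z) of (t, y) => P (t, al, y)) * (ph (snd (snd z, fst z)) * \<eta> (fst (snd z, fst z)))"
     using ae(2)[OF al] unfolding L_def by eventually_elim (auto simp: split_beta')
   qed
   ultimately have "0 = (LINT z|(tm T >< tm L). (case z of (t, y) => (U (t, al, y) * \<eta>' t + P (t, al, y) * \<eta> t) * ph y))"
    using Bochner_Integration.integral_add[OF i[OF e(2)]] by (simp add: split_beta' algebra_simps)
   also have "... = (LINT y|tm L. a (al, y) * ph y)" unfolding Q.integral_snd[OF i2[OF e(2)], symmetric] by (simp add: a_def)
   also have "... = (LINT y|lborel. indicator {0..L} y * (a (al, y) * ph y))" by (rule integral_tm) (use am in measurable)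
   finally show "(LINT y|lborel. indicator {0..L} y * a (al, y) * ph y) = 0" by (simp add: mult.assoc)
  qed
  then show ?thesis by (simp add: L_def)
 qed
 have e: "L2 NM (%x. ef k (True, x))" by (rule Sp_L2(1)[OF ef_in])
 interpret fT: finite_measure "tm T" by (rule finite_measure_tm)
 have \<eta>L: "L2 (tm T) \<eta>'" "L2 (tm T) \<eta>" by (intro F.continuous_L2_tm continuous_on_subset[OF d(2)] continuous_on_subset[OF d(3)] \<eta>m; simp)+
 have i: "integrable F.N (%(t, x). (U (t, x) * \<eta>' t + P (t, x) * \<eta> t) * ef k (True, x))"
  using Bochner_Integration.integrable_add[OF L2_mult[OF U F.tensor_L2[OF e \<eta>L(1)]] L2_mult[OF P F.tensor_L2[OF e \<eta>L(2)]]]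
  by (simp add: split_beta' algebra_simps)
 have "(LINT x|NM. a x * ef k (True, x)) = 0"
 proof -
  have ai: "integrable NM (%x. a x * ef k (True, x))" using F.N.integrable_snd[OF i] by (simp add: a_def)
  have "(LINT x|NM. a x * ef k (True, x)) = (\<Sum>al\<in>E. LINT y|lborel. indicator {0..l al} y * (\<psi> al y * (a (al, y) * ef k (True, al, y))))"
   by (rule NM_integrable(2)[OF borel_measurable_integrable[OF ai] ai])
  also have "... = 0"
  proof (intro sum.neutral ballI integral_eq_zero_AE)
   fix al assume al: "al \<in> E"
   show "AE y in lborel. indicator {0..l al} y * (\<psi> al y * (a (al, y) * ef k (True, al, y))) = 0"
    using a0[OF al] AE_lborel_singleton[of 0] AE_lborel_singleton[of "l al"] by eventually_elim (auto simp: indicator_def)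
  qed
  finally show ?thesis .
 qed
 then have "0 = (LINT x|NM. (LINT t|tm T. (U (t, x) * \<eta>' t + P (t, x) * \<eta> t) * ef k (True, x)))" by (simp add: a_def)
 also have "... = (LINT t|tm T. (LINT x|NM. (U (t, x) * \<eta>' t + P (t, x) * \<eta> t) * ef k (True, x)))"
  unfolding F.N.integral_snd[OF i] F.N.integral_fst[OF i] ..
 also have "... = (LINT t|tm T. F.coef U k t * \<eta>' t + F.coef P k t * \<eta> t)"
 proof (rule integral_cong_AE)
  show "AE t in tm T. (LINT x|NM. (U (t, x) * \<eta>' t + P (t, x) * \<eta> t) * ef k (True, x)) = F.coef U k t * \<eta>' t + F.coef P k t * \<eta> t"
   using F.slice_L2[OF U] F.slice_L2[OF P]
  proof eventually_elim
   case (elim t)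
   have "(LINT x|NM. (U (t, x) * \<eta>' t + P (t, x) * \<eta> t) * ef k (True, x)) = (LINT x|NM. \<eta>' t * (U (t, x) * ef k (True, x)) + \<eta> t * (P (t, x) * ef k (True, x)))"
    by (simp add: algebra_simps)
   also have "... = \<eta>' t * F.coef U k t + \<eta> t * F.coef P k t"
    using L2_mult[OF elim(1) e] L2_mult[OF elim(2) e] by (simp add: F.coef_def)
   finally show ?case by (simp add: mult.commute)
  qed
  show "(%t. (LINT x|NM. (U (t, x) * \<eta>' t + P (t, x) * \<eta> t) * ef k (True, x))) \<in> borel_measurable (tm T)"
   using borel_measurable_integrable[OF F.N.integrable_fst[OF i]] by simp
 qed (use F.coef_borel[OF U, of k] F.coef_borel[OF P, of k] in simp)
 also have "... = (LINT t|tm T. F.coef U k t * \<eta>' t) + (LINT t|tm T. F.coef P k t * \<eta> t)"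
 proof -
  have "L2 (tm T) (F.coef q k)" if "L2 F.N q" for q using F.coef_square_integrable[OF that] F.coef_borel[OF that] by (simp add: L2_def)
  from L2_mult[OF this[OF U] \<eta>L(1)] L2_mult[OF this[OF P] \<eta>L(2)] show ?thesis by simp
 qed
 finally have "(LINT t|tm T. F.coef U k t * \<eta>' t) = - (LINT t|tm T. F.coef P k t * \<eta> t)" by simp
 moreover have "(LINT t|lebesgue_on {0<..<T}. b t) = integral\<^sup>L (tm T) b" if "b \<in> BM" for b :: "real => real"
  unfolding integral_tm[OF that] integral_open_closed[OF that, symmetric] by (rule integrable_lebesgue_on_AE(2)[OF S that]) simp
 ultimately show "(LINT t|lebesgue_on {0<..<T}. F.coef U k t * frechet_derivative \<eta> (at t) 1) = - (LINT t|lebesgue_on {0<..<T}. F.coef P k t * \<eta> t)"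
  unfolding d(4) using F.coef_borel[OF U, of k] F.coef_borel[OF P, of k] by simp
qed

text \<open>The Fourier coefficients of a solution have a weak derivative in time and hence an
  absolutely continuous version; continuity in \<open>V\<close> makes the coefficients themselves
  continuous, so they are that version. Testing with \<open>ef k\<close> yields the mode equation
  for almost every \<open>t\<close>.\<close>

lemma solution_modes:
 assumes ws: "weak_solution G \<mu> \<gamma> H T f vT u"
  and fh: "AE t in tm T. L2 NM (%x. fh (t, x)) & (\<forall>al\<in>E. AE y in lborel. 0 < y & y < l al --> on_edge G al (f t) y = fh (t, al, y))"
 shows "\<exists>U p. (\<forall>t\<in>{0..T}. rep (u t) (U t) & ((%s. Qn (%x. U s x - U t x)) \<longlongrightarrow> 0) (at t within {0..T})) \<and>
  (\<forall>k. ac T (%t. Bf (U t) (ef k)) (p k) & (AE t in tm T. p k t = Qf (U t) (ef k) +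
   (LINT x|NM. FF x (U t (True, x)) (U t (False, x)) * ef k (True, x)) - (LINT x|NM. fh (t, x) * ef k (True, x))))"
proof -
 have C: "C_time T (V_space G) (Hb_norm G 1) u" using ws by (simp add: weak_solution_def)
 obtain v' where td: "has_time_deriv G T u v'" and eq: "\<And>w. w \<in> W_space G \<gamma> ==> AE t in lebesgue_on {0<..<T}.
   net_integral G (%al y. - on_edge G al (v' t) y * on_edge G al w y + \<mu> al * edge_deriv G al (u t) y * edge_deriv G al w y
    + H al (arc G al y) (edge_deriv G al (u t) y) * on_edge G al w y) = net_integral G (%al y. on_edge G al (f t) y * on_edge G al w y)"
  using ws unfolding weak_solution_def by blast
 have "\<forall>t. \<exists>U. t \<in> {0..T} --> rep (u t) U" using C V_rep unfolding C_time_def by blast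
 from choice[OF this] obtain U where U: "\<And>t. t \<in> {0..T} ==> rep (u t) (U t)" by blast
 have cont: "((%s. Qn (%x. U s x - U t x)) \<longlongrightarrow> 0) (at t within {0..T})" if t: "t \<in> {0..T}" for t
 proof (rule tendsto_sandwich[OF eventually_mono[OF eventually_within_set] eventually_mono[OF eventually_within_set] tendsto_const])
  show "((%s. (upper^2 + upper) * (Hb_norm G 1 (%x. u s x - u t x))^2) \<longlongrightarrow> 0) (at t within {0..T})"
  proof (rule tendsto_mult_right_zero)
   have "((%s. Hb_norm G 1 (%x. u s x - u t x)) \<longlongrightarrow> 0) (at t within {0..T})" using C t unfolding C_time_def by blast
   from tendsto_power[OF this, of 2] show "((%s. (Hb_norm G 1 (%x. u s x - u t x))^2) \<longlongrightarrow> 0) (at t within {0..T})" by simp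
  qed
  fix s assume s: "s \<in> {0..T}"
  note r = rep_diff[OF U[OF s] U[OF t]]
  show "Qn (%x. U s x - U t x) <= (upper^2 + upper) * (Hb_norm G 1 (%x. u s x - u t x))^2" by (rule Qf_Hb_norm(1)[OF r])
  show "0 <= Qn (%x. U s x - U t x)" by (rule Q.nonneg[OF rep_Sp[OF r]])
 qed
 have wd: "has_weak_deriv ({0<..<l al} \<times> {0<..<T}) (0, 1) (%z. on_edge G al (u (snd z)) (fst z)) (%z. on_edge G al (v' (snd z)) (fst z))" if "al \<in> E" for al
  using td that by (simp add: has_time_deriv_def cylinder_def split_beta')
 have "L2_cyl G T u" "L2_cyl G T v'" using td by (auto simp: has_time_deriv_def L2_cyl_def has_weak_deriv_def)
 then obtain Uh P where Uh: "L2 F.N Uh"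
   "\<And>al. al \<in> E ==> AE z in lborel. z \<in> {0<..<l al} \<times> {0<..<T} --> on_edge G al (u (snd z)) (fst z) = Uh (snd z, al, fst z)"
   "AE t in tm T. L2 NM (%x. Uh (t, x)) & (\<forall>al\<in>E. AE y in lborel. 0 < y & y < l al --> on_edge G al (u t) y = Uh (t, al, y))"
  and P: "L2 F.N P"
   "\<And>al. al \<in> E ==> AE z in lborel. z \<in> {0<..<l al} \<times> {0<..<T} --> on_edge G al (v' (snd z)) (fst z) = P (snd z, al, fst z)"
   "AE t in tm T. L2 NM (%x. P (t, x)) & (\<forall>al\<in>E. AE y in lborel. 0 < y & y < l al --> on_edge G al (v' t) y = P (t, al, y))"
  using cyl_slices by meson
 have range: "AE t in tm T. t \<in> {0..T}" by (auto simp: AE_tm)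
 have "ac T (%t. Bf (U t) (ef k)) (F.coef P k)" for k
 proof -
  obtain b d where b: "H1_rep T (F.coef Uh k) b d" and dP: "AE t in lborel. 0 < t & t < T --> F.coef P k t = d t"
   using weak_deriv_H1_rep[OF coef_weak_deriv[OF Uh(1) P(1) wd Uh(2) P(2)] T_pos] by blast
  have b': "ac T b d" "AE t in lborel. 0 < t & t < T --> F.coef Uh k t = b t" using b by (auto simp: H1_rep_def)
  have cU: "AE t in tm T. F.coef Uh k t = Bf (U t) (ef k)"
   using Uh(3) range
  proof eventually_elim
   case (elim t)
   note r = U[OF elim(2)]
   have m: "(%x. Uh (t, x) * ef k (True, x)) \<in> borel_measurable NM" "(%x. U t (True, x) * ef k (True, x)) \<in> borel_measurable NM"
    by (rule borel_measurable_times[OF L2_measurable[OF elim(1)[THEN conjunct1]] L2_measurable[OF Sp_L2(1)[OF ef_in]]]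
      borel_measurable_times[OF L2_measurable[OF Sp_L2(1)[OF rep_Sp[OF r]]] L2_measurable[OF Sp_L2(1)[OF ef_in]]])+
   have "integrable NM (%x. Uh (t, x) * ef k (True, x))" "integrable NM (%x. U t (True, x) * ef k (True, x))"
    using elim L2_mult[OF _ Sp_L2(1)[OF ef_in]] Sp_L2(1)[OF rep_Sp[OF r]] by blast+
   note E = NM_integrable(2)[OF m(1) this(1)] NM_integrable(2)[OF m(2) this(2)]
   have "(LINT y|lborel. indicator {0..l al} y * (\<psi> al y * (Uh (t, al, y) * ef k (True, al, y)))) = (LINT y|lborel. indicator {0..l al} y * (\<psi> al y * (U t (True, al, y) * ef k (True, al, y))))"
    if al: "al \<in> E" for al
   proof (rule integral_cong_AE)
    show "AE y in lborel. indicator {0..l al} y * (\<psi> al y * (Uh (t, al, y) * ef k (True, al, y))) = indicator {0..l al} y * (\<psi> al y * (U t (True, al, y) * ef k (True, al, y)))"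
     using elim(1)[THEN conjunct2, rule_format, OF al] AE_lborel_singleton[of 0] AE_lborel_singleton[of "l al"]
     by eventually_elim (use rep_val[OF r al] in "auto simp: indicator_def on_edge_def")
   qed (use NM_slice[OF m(1) al] NM_slice[OF m(2) al] in simp_all)
   then show ?case unfolding F.coef_def Bf_def E by (rule sum.cong[OF refl])
  qed
  have c: "continuous_on {0..T} (%t. Bf (U t) (ef k))"
   unfolding continuous_on_def
  proof
   fix t assume t: "t \<in> {0..T}"
   have "((%s. Bf (U s) (ef k) - Bf (U t) (ef k)) \<longlongrightarrow> 0) (at t within {0..T})"
   proof (rule tendsto_rabs_zero_cancel, rule tendsto_sandwich[OF always_eventually eventually_mono[OF eventually_within_set] tendsto_const], intro allI abs_ge_zero)
    show "((%s. sqrt (Qn (%x. U s x - U t x))) \<longlongrightarrow> 0) (at t within {0..T})"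
     using tendsto_real_sqrt[OF cont[OF t]] by simp
    fix s assume s: "s \<in> {0..T}"
    note d = B.diff_in[OF rep_Sp[OF U[OF s]] rep_Sp[OF U[OF t]]]
    have "(Bf (%x. U s x - U t x) (ef k))^2 <= Bf (%x. U s x - U t x) (%x. U s x - U t x) * Bf (ef k) (ef k)" by (rule B.Cauchy_Schwarz[OF d ef_in])
    also have "... <= Qn (%x. U s x - U t x)" using ef_norm[of k] Q_ge[OF d] Q.nonneg[OF d] by auto
    finally have "(Bf (U s) (ef k) - Bf (U t) (ef k))^2 <= Qn (%x. U s x - U t x)"
     by (simp add: B.diff_left[OF rep_Sp[OF U[OF s]] rep_Sp[OF U[OF t]] ef_in])
    from real_sqrt_le_mono[OF this] show "\<bar>Bf (U s) (ef k) - Bf (U t) (ef k)\<bar> <= sqrt (Qn (%x. U s x - U t x))" by simp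
   qed
   from tendsto_add[OF this tendsto_const[of "Bf (U t) (ef k)"]] show "((%s. Bf (U s) (ef k)) \<longlongrightarrow> Bf (U t) (ef k)) (at t within {0..T})" by simp
  qed
  have "b t = Bf (U t) (ef k)" if t: "t \<in> {0..T}" for t
  proof (rule continuous_AE_eq[OF ac_continuous[OF b'(1)] c _ T_pos t])
   show "AE t in lborel. 0 < t & t < T --> b t = Bf (U t) (ef k)" using b'(2) cU unfolding AE_tm by eventually_elim auto
  qed
  then show ?thesis by (intro ac_cong_AE[OF b'(1) F.coef_borel[OF P(1)]]) (use dP in "auto elim: eventually_mono")
 qed
 moreover have "AE t in tm T. F.coef P k t = Qf (U t) (ef k) + (LINT x|NM. FF x (U t (True, x)) (U t (False, x)) * ef k (True, x)) - (LINT x|NM. fh (t, x) * ef k (True, x))" for k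
 proof -
  \<comment> \<open>The exceptional null set of times depends on the test function; only one is
    needed for each \<open>k\<close>, hence countably many.\<close>
  obtain w where w: "w \<in> W_space G \<gamma>" "times_\<psi> w (ef k)" using times_\<psi>_exists[OF ef_in] by blast
  show ?thesis
   using eq[OF w(1), unfolded AE_tm_open] P(3) fh range
  proof eventually_elim
   case (elim t)
   note r = U[OF elim(4)]
   have PL: "L2 NM (%x. P (t, x))" and fL: "L2 NM (%x. fh (t, x))" using elim by auto
   note FL = FF_L2[OF Sp_L2[OF rep_Sp[OF r]]] and e = Sp_L2(1)[OF ef_in, of k]
   have "Qf (U t) (ef k) + (LINT x|NM. (FF x (U t (True, x)) (U t (False, x)) - P (t, x)) * ef k (True, x)) = (LINT x|NM. fh (t, x) * ef k (True, x))"
    using elim(1) weak_form[OF r ef_in w(2) PL elim(2)[THEN conjunct2]] weak_form_rhs[OF ef_in w(2) fL elim(3)[THEN conjunct2]] by simp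
   then show ?case using L2_mult[OF FL e] L2_mult[OF PL e] by (simp add: F.coef_def left_diff_distrib)
  qed
 qed
 ultimately show ?thesis using U cont by (intro exI[of _ U] exI[of _ "F.coef P"]) blast
qed

lemma FF_difference:
 assumes U: "U1 \<in> Sp" "U2 \<in> Sp"
 defines "q \<equiv> %x. FF x (U1 (True, x)) (U1 (False, x)) - FF x (U2 (True, x)) (U2 (False, x))"
 shows "L2 NM q" "(LINT x|NM. (q x)^2) <= 2 * LF^2 * (1 + 1 / lower) * Qn (%x. U1 x - U2 x)"
proof -
 define z where "z x = U1 x - U2 x" for x
 have z: "z \<in> Sp" unfolding z_def by (rule Q.diff_in[OF U])
 note zL = Sp_L2[OF z]
 show qL: "L2 NM q" unfolding q_def by (intro L2_diff FF_L2 Sp_L2 U)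
 have "(LINT x|NM. (q x)^2) <= (LINT x|NM. 2 * LF^2 * ((z (True, x))^2 + (z (False, x))^2))"
 proof (rule integral_mono[OF L2_square[OF qL]])
  show "integrable NM (%x. 2 * LF^2 * ((z (True, x))^2 + (z (False, x))^2))" using zL[THEN L2_square] by simp
  fix x assume "x \<in> space NM"
  then have "\<bar>q x\<bar> <= LF * (\<bar>z (True, x)\<bar> + \<bar>z (False, x)\<bar>)" unfolding q_def z_def by (rule FF_lipschitz)
  then have "(q x)^2 <= (LF * (\<bar>z (True, x)\<bar> + \<bar>z (False, x)\<bar>))^2" by (metis abs_ge_zero power2_abs power_mono)
  also have "... <= LF^2 * (2 * \<bar>z (True, x)\<bar>^2 + 2 * \<bar>z (False, x)\<bar>^2)"
   unfolding power_mult_distrib by (intro mult_left_mono square_sum_le) simp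
  finally show "(q x)^2 <= 2 * LF^2 * ((z (True, x))^2 + (z (False, x))^2)" by (simp add: algebra_simps)
 qed
 also have "... = 2 * LF^2 * (Bf z z + (LINT x|NM. (z (False, x))^2))"
  using zL[THEN L2_square] by (simp add: Bf_def power2_eq_square)
 also have "... <= 2 * LF^2 * ((1 + 1 / lower) * Qf z z)"
 proof (rule mult_left_mono)
  have "(LINT x|NM. (z (False, x))^2) <= Df z z / lower" using Df_lower[OF z] lower_pos by (simp add: field_simps)
  also have "... <= Qf z z / lower" using Bf_nonneg[of z] lower_pos by (intro divide_right_mono) (auto simp: Qf_def)
  finally show "Bf z z + (LINT x|NM. (z (False, x))^2) <= (1 + 1 / lower) * Qf z z" using Q_ge[OF z] by (simp add: distrib_right)
 qed simp
 finally show "(LINT x|NM. (q x)^2) <= 2 * LF^2 * (1 + 1 / lower) * Qn (%x. U1 x - U2 x)"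
  by (simp add: z_def[abs_def] mult.assoc)
qed

text \<open>Iteration with the weight \<open>exp (2 * K * (T - t))\<close>: starting from a bound
  \<open>M\<close> of \<open>y\<close>, each application of the inequality gains a factor
  1/2.\<close>

lemma gronwall:
 assumes c: "continuous_on {0..T} y" and nn: "\<And>t. t \<in> {0..T} ==> 0 <= y t" and K: "0 < K"
  and le: "\<And>t. t \<in> {0..T} ==> y t <= K * tint T (%s. indicator {0..T} s * y s) t" and t: "t \<in> {0..T}"
 shows "y t = 0"
proof -
 \<comment> \<open>An instance with zero data, from which only the integral estimate for
   exponentials is taken.\<close>
 interpret V: evolution NM T "%k x. ef k (True, x)" "%k x. ef k (False, x)" ev "1 / lower" FF LF "%z. 0" "%k. 0"
  by (rule evolution_hj) (simp_all add: L2_zero)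
 interpret fT: finite_measure "tm T" by (rule finite_measure_tm)
 have "bounded (y ` {0..T})" by (intro compact_imp_bounded compact_continuous_image c) simp
 then obtain M where M: "\<And>t. t \<in> {0..T} ==> \<bar>y t\<bar> <= M" unfolding bounded_iff by (metis imageI real_norm_def)
 have M0: "0 <= M" using M[OF t] by linarith
 have bd: "y t <= M * (1 / 2) ^ n * exp (2 * K * (T - t))" if "t \<in> {0..T}" for n t
  using that
 proof (induction n arbitrary: t)
  case 0
  have "M * 1 <= M * exp (2 * K * (T - t))" using 0 K M0 by (intro mult_left_mono) auto
  then show ?case using M[OF 0] by simp
 next
  case (Suc n)
  define A where "A = M * (1 / 2) ^ n"
  have A: "0 <= A" using M0 by (simp add: A_def)
  have "tint T (%s. indicator {0..T} s * y s) t <= tint T (%s. A * exp (2 * K * (T - s))) t"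
  proof (rule tint_mono)
   show "integrable (tm T) (%s. indicator {0..T} s * y s)" by (rule integrable_tm_continuous[OF c])
   have "L2 (tm T) (%s. A * exp (2 * K * (T - s)))" by (intro F.continuous_L2_tm continuous_intros) simp
   then show "integrable (tm T) (%s. A * exp (2 * K * (T - s)))" by (rule L2_tm_integrable)
   show "AE s in tm T. indicator {0..T} s * y s <= A * exp (2 * K * (T - s))" using Suc.IH by (auto simp: AE_tm A_def)
  qed (use Suc.prems in simp)
  also have "... <= A * (exp (2 * K * (T - t)) / (2 * K))"
   unfolding tint_cmult using V.tint_exp_le[of t "2 * K"] Suc.prems K A by (intro mult_left_mono) auto
  finally have "K * tint T (%s. indicator {0..T} s * y s) t <= K * (A * (exp (2 * K * (T - t)) / (2 * K)))" using K by (intro mult_left_mono) auto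
  then show ?case using le[OF Suc.prems] K by (simp add: A_def)
 qed
 have "(%n. M * (1 / 2) ^ n * exp (2 * K * (T - t))) ~~> M * 0 * exp (2 * K * (T - t))" by (intro tendsto_intros LIMSEQ_realpow_zero) auto
 from LIMSEQ_le_const[OF this, of "y t"] bd[OF t] have "y t <= 0" by simp
 then show ?thesis using nn[OF t] by simp
qed

text \<open>In the energy identity for the modes of the difference \<open>z\<close> the terminal
  values vanish and the sources are coefficients of the difference of the nonlinearities. Bessel's
  inequality and the Lipschitz bound control these by \<open>Qn (z s)\<close>, Parseval sums the
  modes, and Gronwall's lemma applies.\<close>

theorem uniqueness:
 assumes f: "L2_cyl G T f" and w1: "weak_solution G \<mu> \<gamma> H T f vT u1" and w2: "weak_solution G \<mu> \<gamma> H T f vT u2"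
  and t: "t \<in> {0..T}" and x: "x \<in> points G"
 shows "u1 t x = u2 t x"
proof -
 obtain fh where fs: "AE t in tm T. L2 NM (%x. fh (t, x)) & (\<forall>al\<in>E. AE y in lborel. 0 < y & y < l al --> on_edge G al (f t) y = fh (t, al, y))"
  using cyl_slices[OF f] by blast
 obtain U1 p1 where r1: "\<And>t. t \<in> {0..T} ==> rep (u1 t) (U1 t)"
  and c1: "\<And>t. t \<in> {0..T} ==> ((%s. Qn (%x. U1 s x - U1 t x)) \<longlongrightarrow> 0) (at t within {0..T})"
  and a1: "\<And>k. ac T (%t. Bf (U1 t) (ef k)) (p1 k)"
  and e1: "\<And>k. AE t in tm T. p1 k t = Qf (U1 t) (ef k) + (LINT x|NM. FF x (U1 t (True, x)) (U1 t (False, x)) * ef k (True, x)) - (LINT x|NM. fh (t, x) * ef k (True, x))"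
  using solution_modes[OF w1 fs] by blast
 obtain U2 p2 where r2: "\<And>t. t \<in> {0..T} ==> rep (u2 t) (U2 t)"
  and c2: "\<And>t. t \<in> {0..T} ==> ((%s. Qn (%x. U2 s x - U2 t x)) \<longlongrightarrow> 0) (at t within {0..T})"
  and a2: "\<And>k. ac T (%t. Bf (U2 t) (ef k)) (p2 k)"
  and e2: "\<And>k. AE t in tm T. p2 k t = Qf (U2 t) (ef k) + (LINT x|NM. FF x (U2 t (True, x)) (U2 t (False, x)) * ef k (True, x)) - (LINT x|NM. fh (t, x) * ef k (True, x))"
  using solution_modes[OF w2 fs] by blast
 define z where "z t x = U1 t x - U2 t x" for t x
 have S: "U1 t \<in> Sp" "U2 t \<in> Sp" if "t \<in> {0..T}" for t using rep_Sp r1[OF that] r2[OF that] by blast+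
 have zS: "z t \<in> Sp" if "t \<in> {0..T}" for t unfolding z_def by (rule Q.diff_in[OF S[OF that]])
 define y where "y t = Qn (z t)" for t
 have y0: "0 <= y t" if "t \<in> {0..T}" for t unfolding y_def by (rule Q.nonneg[OF zS[OF that]])
 have yc: "continuous_on {0..T} y"
  unfolding continuous_on_sequentially
 proof (intro allI ballI impI, elim conjE)
  fix s t assume t: "t \<in> {0..T}" and s: "\<forall>n. s n \<in> {0..T}" "s ~~> t"
  have lim: "(%n. Qn (%x. U t x - U (s n) x)) ~~> 0"
   if U: "\<And>t. t \<in> {0..T} ==> U t \<in> Sp" and c: "((%s. Qn (%x. U s x - U t x)) \<longlongrightarrow> 0) (at t within {0..T})" for U
  proof -
   define \<delta> where "\<delta> s = Qn (%x. U s x - U t x)" for s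
   have "continuous (at t within {0..T}) \<delta>"
    using c Q.zero_left[OF Q.zero] by (simp add: continuous_within \<delta>_def[abs_def])
   from continuous_within_tendsto_compose'[OF this _ s(2)] s(1) have "(%n. \<delta> (s n)) ~~> 0" using Q.zero_left[OF Q.zero] by (simp add: \<delta>_def)
   moreover have "\<delta> (s n) = Qn (%x. U t x - U (s n) x)" for n
    using s(1) Q.expand_diff[OF U[OF t] U[of "s n"]] Q.expand_diff[OF U[of "s n"] U[OF t]] Q.sym[OF U[OF t] U[of "s n"]] by (simp add: \<delta>_def)
   ultimately show ?thesis by simp
  qed
  have s': "s n \<in> {0..T}" for n using s(1) by blast
  have "(%n. Qn (%x. z t x - z (s n) x)) ~~> 0"
  proof (rule tendsto_sandwich[OF _ _ tendsto_const])
   show "(%n. 2 * Qn (%x. U1 t x - U1 (s n) x) + 2 * Qn (%x. U2 t x - U2 (s n) x)) ~~> 0"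
    using tendsto_add[OF tendsto_mult_right_zero[OF lim[OF S(1) c1[OF t]], of 2] tendsto_mult_right_zero[OF lim[OF S(2) c2[OF t]], of 2]] by simp
   have "Qn (%x. z t x - z (s n) x) <= 2 * Qn (%x. U1 t x - U1 (s n) x) + 2 * Qn (%x. U2 t x - U2 (s n) x)" for n
   proof -
    have "(%x. z t x - z (s n) x) = (%x. (U1 t x - U1 (s n) x) - (U2 t x - U2 (s n) x))" by (simp add: z_def algebra_simps)
    then show ?thesis using Q.square_diff_le[OF Q.diff_in[OF S(1)[OF t] S(1)[OF s'[of n]]] Q.diff_in[OF S(2)[OF t] S(2)[OF s'[of n]]]] by simp
   qed
   then show "\<forall>\<^sub>F n in sequentially. Qn (%x. z t x - z (s n) x) <= 2 * Qn (%x. U1 t x - U1 (s n) x) + 2 * Qn (%x. U2 t x - U2 (s n) x)" by simp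
   show "\<forall>\<^sub>F n in sequentially. 0 <= Qn (%x. z t x - z (s n) x)"
    by (intro always_eventually allI Q.nonneg Q.diff_in zS t s')
  qed
  from Q.tendsto_square[OF zS[OF s'] zS[OF t] this] show "(y \<circ> s) ~~> y t" by (simp add: y_def comp_def)
 qed
 define c where "c k t = Bf (z t) (ef k)" for k t
 define q where "q k t = 1 * p1 k t + (-1) * p2 k t" for k t
 have ac: "ac T (c k) (q k)" for k
 proof (rule ac_cong_AE)
  show a: "ac T (%t. 1 * Bf (U1 t) (ef k) + (-1) * Bf (U2 t) (ef k)) (q k)" unfolding q_def by (rule ac_comb[OF a1 a2])
  show "q k \<in> BM" by (rule ac_borel[OF a])
  show "1 * Bf (U1 t) (ef k) + (-1) * Bf (U2 t) (ef k) = c k t" if "t \<in> {0..T}" for t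
   unfolding c_def z_def by (simp add: B.diff_left[OF S[OF that] ef_in])
 qed simp
 \<comment> \<open>Almost everywhere minus the coefficient of the difference of the nonlinearities,
   written so that \<open>q k t = ev k * c k t - h k t\<close> on \<open>[0,T]\<close>, the form
   required by \<open>mode_energy\<close>.\<close>
 define h where "h k t = ev k * (indicator {0..T} t * c k t) - q k t" for k t
 have hm[measurable]: "h k \<in> BM" for k
  unfolding h_def[abs_def] using integrable_tm_continuous(2)[OF ac_continuous[OF ac]] ac_borel[OF ac] by simp
 define K where "K = 2 * LF^2 * (1 + 1 / lower) + 1"
 have K: "0 < K" using lower_pos by (simp add: K_def add_nonneg_pos)
 have bes: "AE t in tm T. t \<in> {0..T} & (\<forall>n. (\<Sum>k<n. (h k t)^2) <= K * y t)"
 proof -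
  have "AE t in tm T. \<forall>k. p1 k t = Qf (U1 t) (ef k) + (LINT x|NM. FF x (U1 t (True, x)) (U1 t (False, x)) * ef k (True, x)) - (LINT x|NM. fh (t, x) * ef k (True, x))"
   "AE t in tm T. \<forall>k. p2 k t = Qf (U2 t) (ef k) + (LINT x|NM. FF x (U2 t (True, x)) (U2 t (False, x)) * ef k (True, x)) - (LINT x|NM. fh (t, x) * ef k (True, x))"
   unfolding AE_all_countable using e1 e2 by blast+
  moreover have "AE t in tm T. t \<in> {0..T}" by (auto simp: AE_tm)
  ultimately show ?thesis
  proof eventually_elim
   case (elim t)
   note t = elim(3)
   define d where "d x = FF x (U1 t (True, x)) (U1 t (False, x)) - FF x (U2 t (True, x)) (U2 t (False, x))" for x
   note dL = FF_difference(1)[OF S[OF t], folded d_def] and db = FF_difference(2)[OF S[OF t], folded d_def z_def]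
   have "h k t = - (LINT x|NM. d x * ef k (True, x))" for k
   proof -
    have "Qf (U1 t) (ef k) - Qf (U2 t) (ef k) = Qf (z t) (ef k)" unfolding z_def by (rule Q.diff_left[OF S[OF t] ef_in, symmetric])
    also have "... = ev k * c k t" unfolding c_def using Q.sym[OF zS[OF t] ef_in] B.sym[OF zS[OF t] ef_in] ef_Q[OF zS[OF t]] by simp
    finally have "q k t - ev k * c k t = (LINT x|NM. FF x (U1 t (True, x)) (U1 t (False, x)) * ef k (True, x)) - (LINT x|NM. FF x (U2 t (True, x)) (U2 t (False, x)) * ef k (True, x))"
     using elim(1,2) by (simp add: q_def)
    also have "... = (LINT x|NM. d x * ef k (True, x))"
     unfolding d_def left_diff_distrib
     by (rule Bochner_Integration.integral_diff[symmetric]) (intro L2_mult FF_L2 Sp_L2 S[OF t] ef_in)+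
    finally show ?thesis using t by (simp add: h_def)
   qed
   then have "(\<Sum>k<n. (h k t)^2) <= (LINT x|NM. (d x)^2)" for n using F.bessel[OF dL, of n] by simp
   moreover have "(LINT x|NM. (d x)^2) <= K * y t"
    using db y0[OF t] by (simp add: K_def y_def distrib_right)
   ultimately show ?case using t order_trans by blast
  qed
 qed
 have hK: "AE t in tm T. (h k t)^2 <= K * (indicator {0..T} t * y t)" for k
  using bes
 proof eventually_elim
  case (elim t)
  have "(h k t)^2 <= (\<Sum>j<Suc k. (h j t)^2)" by (simp add: sum_nonneg)
  also have "... <= K * y t" using elim by blast
  finally show ?case using elim by simp
 qed
 have iy: "integrable (tm T) (%t. K * (indicator {0..T} t * y t))" using integrable_tm_continuous(1)[OF yc] by simp
 have hi: "integrable (tm T) (%t. (h k t)^2)" for k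
  by (rule Bochner_Integration.integrable_bound[OF iy]) (use hK[of k] in "auto elim!: eventually_mono intro: order_trans[OF _ abs_ge_self]")
 have zT: "c k T = 0" for k
 proof -
  have T: "T \<in> {0..T}" using T_pos by simp
  have "AE x in NM. z T (True, x) * ef k (True, x) = 0"
   using AE_NM_range AE_space
  proof eventually_elim
   case (elim x)
   have al: "fst x \<in> E" "snd x \<in> {0..l (fst x)}" using elim by auto
   have "u1 T (arc G (fst x) (snd x)) = u2 T (arc G (fst x) (snd x))"
    using w1 w2 arc_in_points[OF al] by (simp add: weak_solution_def)
   then show ?case using rep_val[OF r1[OF T] al] rep_val[OF r2[OF T] al] by (simp add: z_def)
  qed
  then show ?thesis unfolding c_def Bf_def by (rule integral_eq_zero_AE)
 qed
 have "y t <= K * tint T (%s. indicator {0..T} s * y s) t" if t: "t \<in> {0..T}" for t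
 proof -
  have t0: "0 <= t" "t <= T" using t by auto
  have le: "ev k * (c k t)^2 <= tint T (%s. (h k s)^2) t" for k
  proof -
   have "AE s in lborel. 0 < s & s < T --> q k s = ev k * c k s - h k s" by (auto simp: h_def)
   from mode_energy(2)[OF ac hm hi this t0]
   have "ev k * (c k t)^2 + (tint T (%s. (q k s)^2) t + (ev k)^2 * tint T (%s. indicator {0..T} s * (c k s)^2) t) = tint T (%s. (h k s)^2) t" by (simp add: zT)
   moreover have "0 <= tint T (%s. (q k s)^2) t" "0 <= (ev k)^2 * tint T (%s. indicator {0..T} s * (c k s)^2) t"
    using t0 by (auto intro!: tint_nonneg mult_nonneg_nonneg)
   ultimately show ?thesis by linarith
  qed
  have "(\<Sum>k<n. ev k * (c k t)^2) <= K * tint T (%s. indicator {0..T} s * y s) t" for n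
  proof -
   have "(\<Sum>k<n. ev k * (c k t)^2) <= tint T (%s. \<Sum>k<n. (h k s)^2) t"
    unfolding tint_sum[OF hi t0(1)] by (rule sum_mono) (rule le)
   also have "... <= tint T (%s. K * (indicator {0..T} s * y s)) t"
   proof (rule tint_mono[OF _ iy])
    show "AE s in tm T. (\<Sum>k<n. (h k s)^2) <= K * (indicator {0..T} s * y s)" using bes by eventually_elim simp
   qed (use hi t0 in auto)
   finally show ?thesis by (simp only: tint_cmult)
  qed
  then show ?thesis
   using parseval(2)[OF zS[OF t]] unfolding sums_def y_def c_def by (intro LIMSEQ_le_const2) auto
 qed
 from gronwall[OF yc y0 K this t] have "Qn (z t) = 0" by (simp add: y_def)
 moreover obtain al r where xr: "al \<in> E" "r \<in> {0..l al}" "x = arc G al r" using points_arc[OF x] by blast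
 ultimately have "(z t (True, al, r))^2 <= 0" using Sp_sup_bound[OF zS[OF t] xr(1,2)] by simp
 then show ?thesis using rep_val[OF r1[OF t] xr(1,2)] rep_val[OF r2[OF t] xr(1,2)] by (simp add: z_def xr(3))
qed

end

theorem theorem4p2:
  fixes G :: "'a::euclidean_space network"
    and \<mu> :: "nat \<Rightarrow> real"
    and \<gamma> :: "nat \<Rightarrow> nat \<Rightarrow> real"
    and H :: "nat \<Rightarrow> 'a \<Rightarrow> real \<Rightarrow> real"
    and T :: real
    and f :: "real \<Rightarrow> 'a \<Rightarrow> real"
    and vT :: "'a \<Rightarrow> real"
  assumes "is_network G"
    and "T > 0"
    and "\<And>\<alpha>. \<alpha> \<in> edges G \<Longrightarrow> \<mu> \<alpha> > 0"
    and "\<And>i \<alpha>. i \<in> verts G \<Longrightarrow> \<alpha> \<in> edges_at G i \<Longrightarrow> \<gamma> i \<alpha> > 0"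
    and "\<And>i. i \<in> verts G \<Longrightarrow> (\<Sum>\<alpha>\<in>edges_at G i. \<gamma> i \<alpha> * \<mu> \<alpha>) = 1"
    and "hamiltonian G H"
    and "vT \<in> V_space G"
    and "L2_cyl G T f"
  shows "\<exists>v. weak_solution G \<mu> \<gamma> H T f vT v \<and>
           (\<forall>u. weak_solution G \<mu> \<gamma> H T f vT u \<longrightarrow>
              (\<forall>t\<in>{0..T}. \<forall>x\<in>points G. u t x = v t x))"
proof -
  interpret hj G \<mu> \<gamma> H T
    using assms(1-4,6) by (simp add: hj_def net_data_def hj_axioms_def)
  show ?thesis
    using existence[OF assms(7,8)] uniqueness[OF assms(8)] by blast
qed

end
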